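(* Let $\Omega\subset\mathbb{R}^d$ be a bounded $C^{1,1}$-domain and $s_\star\in(0,1)$. (1) There exist a continuous (linear) trace operator $\operatorname{Tr}: V^s(\Omega\,|\,\mathbb{R}^d)\to\mathcal{T}^s(\Omega^c)$ and a constant $C=C(d,\Omega,s_\star)>0$ such that for all $s\in(s_\star,1)$ and all $u\in V^s(\Omega\,|\,\mathbb{R}^d)$ $$\|\operatorname{Tr}u\|_{\mathcal{T}^s(\Omega^c)}\le C\,\|u\|_{V^s(\Omega\,|\,\mathbb{R}^d)}.$$ (2) There exist a continuous (linear) extension operator $\operatorname{Ext}:\mathcal{T}^s(\Omega^c)\to V^s(\Omega\,|\,\mathbb{R}^d)$ and a constant $C=C(d,\Omega)>0$ such that for all $s\in(0,1)$ and all $g\in\mathcal{T}^s(\Omega^c)$ $$\|\operatorname{Ext}g\|_{V^s(\Omega\,|\,\mathbb{R}^d)}\le C\,\|g\|_{\mathcal{T}^s(\Omega^c)}.$$ (3) $\operatorname{Tr}$ is the left inverse of $\operatorname{Ext}$, i.e. $\operatorname{Tr}\circ\operatorname{Ext}=\mathrm{id}$.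
   Context: Fix $d\in\mathbb{N}$, $d\ge2$. A domain is an open connected set; $\Omega^c=\mathbb{R}^d\setminus\Omega$; $d_x:=\inf\{|x-z| : z\in\partial\Omega\}$. All functions are Borel measurable and are identified if equal a.e. The trace operator on $V^s(\Omega\,|\,\mathbb{R}^d)$ is the restriction to the complement, $\operatorname{Tr}u=u|_{\Omega^c}$. The constants do not depend on $s$ (in the indicated ranges). For $s\in(0,1)$ let $\kappa_{d,s}=\dfrac{2^{2s}s\,\Gamma(\frac{d+2s}{2})}{\pi^{d/2}\Gamma(1-s)}$. For $u,v:\mathbb{R}^d\to\mathbb{R}$ put $$[u,v]_{V^s(\Omega|\mathbb{R}^d)}=\frac{\kappa_{d,s}}{2}\iint_{(\mathbb{R}^d\times\mathbb{R}^d)\setminus(\Omega^c\times\Omega^c)}\frac{(u(x)-u(y))(v(x)-v(y))}{|x-y|^{d+2s}}\,dx\,dy .$$ $V^s(\Omega\,|\,\mathbb{R}^d)$ is the space of measurable $u:\mathbb{R}^d\to\mathbb{R}$ with $[u,u]_{V^s(\Omega|\mathbb{R}^d)}<\infty$, with norm $\|u\|_{V^s(\Omega|\mathbb{R}^d)}=(\|u\|_{L^2(\Omega)}^2+[u,u]_{V^s(\Omega|\mathbb{R}^d)})^{1/2}$. For $s\in(0,1)$ put $\tau_s(x)=\dfrac{1-s}{d_x^s(1+d_x)^{d+s}}$ and $$k_s(x,y)=\frac{(1-s)^2}{d_x^s(1+d_x)^s\,d_y^s(1+d_y)^s\,(|x-y|+d_xd_y+d_x+d_y)^d},\qquad x,y\in\mathbb{R}^d\setminus\overline\Omega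 .$$ $\mathcal{T}^s(\Omega^c)$ is the space of measurable $g:\Omega^c\to\mathbb{R}$ with finite norm $$\|g\|_{\mathcal{T}^s(\Omega^c)}=\Big(\int_{\Omega^c}g(x)^2\tau_s(x)\,dx+\int_{\Omega^c}\int_{\Omega^c}(g(x)-g(y))^2k_s(x,y)\,dx\,dy\Big)^{1/2}.$$ *)

theory Defs
  imports "HOL-Analysis.Analysis"
begin

section \<open>Bounded \<open>C\<^sup>1\<^sup>,\<^sup>1\<close> domains\<close>

definition C11_function :: "('a::euclidean_space \<Rightarrow> real) \<Rightarrow> bool" where
  "C11_function \<gamma> \<longleftrightarrow> (\<exists>G L. (\<forall>x. GDERIV \<gamma> x :> G x) \<and> L-lipschitz_on UNIV G)"

text \<open>
  Near each boundary point the set is the strict supergraph, in the direction of a unit vector \<open>e\<close>,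
  of a \<open>C\<^sup>1\<^sup>,\<^sup>1\<close> function on the hyperplane orthogonal to \<open>e\<close>. The function is represented by one
  on the whole space that is only evaluated at the orthogonal projection \<open>x - (x \<bullet> e) e\<close>; since a
  \<open>C\<^sup>1\<^sup>,\<^sup>1\<close> function on the hyperplane can be extended constantly along \<open>e\<close>, this is no restriction.
\<close>

definition C11_domain :: "'a::euclidean_space set \<Rightarrow> bool" where
  "C11_domain \<Omega> \<longleftrightarrow>
     open \<Omega> \<and> connected \<Omega> \<and> \<Omega> \<noteq> {} \<and>
     (\<forall>z\<in>frontier \<Omega>. \<exists>r>0. \<exists>e \<gamma>. norm e = 1 \<and> C11_function \<gamma> \<and>
        \<Omega> \<inter> ball z r = {x \<in> ball z r. \<gamma> (x - (x \<bullet> e) *\<^sub>R e) < x \<bullet> e})"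

section \<open>Function spaces\<close>

text \<open>
  Norms take values in \<open>[0, \<infinity>]\<close>, so that no finiteness is hidden in a default value. Elements of the
  spaces are functions, not classes: almost everywhere equality is kept explicit. A function on
  \<open>- \<Omega>\<close> is a function on the whole space whose values on \<open>\<Omega>\<close> are irrelevant.
\<close>

definition esqrt :: "ennreal \<Rightarrow> ennreal" where
  "esqrt t = (if t = \<infinity> then \<infinity> else ennreal (sqrt (enn2real t)))"

definition ae_eq_on :: "'a::euclidean_space set \<Rightarrow> ('a \<Rightarrow> real) \<Rightarrow> ('a \<Rightarrow> real) \<Rightarrow> bool" where
  "ae_eq_on A f g \<longleftrightarrow> (AE x\<in>A in lborel. f x = g x)"

definition kappa :: "nat \<Rightarrow> real \<Rightarrow> real" where
  "kappa d s = 2 powr (2 * s) * s * Gamma ((real d + 2 * s) / 2)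
                 / (pi powr (real d / 2) * Gamma (1 - s))"

text \<open>\<open>V_energy s \<Omega> u\<close> is the value \<open>[u, u]\<close> of the quadratic form.\<close>

definition V_energy :: "real \<Rightarrow> (real^'n) set \<Rightarrow> (real^'n \<Rightarrow> real) \<Rightarrow> ennreal" where
  "V_energy s \<Omega> u = ennreal (kappa CARD('n) s / 2) *
     (\<integral>\<^sup>+p\<in>UNIV \<times> UNIV - (- \<Omega>) \<times> (- \<Omega>).
        ennreal ((u (fst p) - u (snd p))\<^sup>2 / norm (fst p - snd p) powr (real CARD('n) + 2 * s))
      \<partial>(lborel \<Otimes>\<^sub>M lborel))"

definition V_space :: "real \<Rightarrow> (real^'n) set \<Rightarrow> (real^'n \<Rightarrow> real) set" where
  "V_space s \<Omega> = {u \<in> borel_measurable borel. V_energy s \<Omega> u < \<infinity>}"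

definition V_norm :: "real \<Rightarrow> (real^'n) set \<Rightarrow> (real^'n \<Rightarrow> real) \<Rightarrow> ennreal" where
  "V_norm s \<Omega> u = esqrt ((\<integral>\<^sup>+x\<in>\<Omega>. ennreal ((u x)\<^sup>2) \<partial>lborel) + V_energy s \<Omega> u)"

definition bdist :: "'a::euclidean_space set \<Rightarrow> 'a \<Rightarrow> real" where
  "bdist \<Omega> x = infdist x (frontier \<Omega>)"

text \<open>
  The weights are meant for points outside the closure of \<open>\<Omega>\<close>. On the boundary, which is a null set
  for the domains considered, division by zero makes them \<open>0\<close>.
\<close>

definition tau_weight :: "real \<Rightarrow> (real^'n) set \<Rightarrow> real^'n \<Rightarrow> real" where
  "tau_weight s \<Omega> x =
     (1 - s) / (bdist \<Omega> x powr s * (1 + bdist \<Omega> x) powr (real CARD('n) + s))"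

definition k_kernel :: "real \<Rightarrow> (real^'n) set \<Rightarrow> real^'n \<Rightarrow> real^'n \<Rightarrow> real" where
  "k_kernel s \<Omega> x y =
     (1 - s)\<^sup>2 /
       (bdist \<Omega> x powr s * (1 + bdist \<Omega> x) powr s *
        (bdist \<Omega> y powr s * (1 + bdist \<Omega> y) powr s) *
        (norm (x - y) + bdist \<Omega> x * bdist \<Omega> y + bdist \<Omega> x + bdist \<Omega> y) ^ CARD('n))"

definition T_norm :: "real \<Rightarrow> (real^'n) set \<Rightarrow> (real^'n \<Rightarrow> real) \<Rightarrow> ennreal" where
  "T_norm s \<Omega> g = esqrt
     ((\<integral>\<^sup>+x\<in>- \<Omega>. ennreal ((g x)\<^sup>2 * tau_weight s \<Omega> x) \<partial>lborel) +
      (\<integral>\<^sup>+x\<in>- \<Omega>. (\<integral>\<^sup>+y\<in>- \<Omega>. ennreal ((g x - g y)\<^sup>2 * k_kernel s \<Omega> x y) \<partial>lborel) \<partial>lborel))"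

definition T_space :: "real \<Rightarrow> (real^'n) set \<Rightarrow> (real^'n \<Rightarrow> real) set" where
  "T_space s \<Omega> = {g \<in> borel_measurable (restrict_space borel (- \<Omega>)). T_norm s \<Omega> g < \<infinity>}"

section \<open>Operators\<close>

definition Tr :: "(real^'n) set \<Rightarrow> (real^'n \<Rightarrow> real) \<Rightarrow> (real^'n \<Rightarrow> real)" where
  "Tr \<Omega> u = restrict u (- \<Omega>)"

text \<open>
  \<open>F\<close> induces a continuous linear operator from the normed space \<open>(X, N)\<close> of functions on \<open>A\<close>, modulo
  almost everywhere equality on \<open>A\<close>, to the normed space \<open>(Y, M)\<close> of functions on \<open>B\<close>, modulo almost
  everywhere equality on \<open>B\<close>.
\<close>

definition continuous_linear_operator ::
  "'a::euclidean_space set \<Rightarrow> ('a \<Rightarrow> real) set \<Rightarrow> (('a \<Rightarrow> real) \<Rightarrow> ennreal) \<Rightarrow>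
   'a set \<Rightarrow> ('a \<Rightarrow> real) set \<Rightarrow> (('a \<Rightarrow> real) \<Rightarrow> ennreal) \<Rightarrow>
   (('a \<Rightarrow> real) \<Rightarrow> ('a \<Rightarrow> real)) \<Rightarrow> bool" where
  "continuous_linear_operator A X N B Y M F \<longleftrightarrow>
     (\<forall>u\<in>X. F u \<in> Y) \<and>
     (\<forall>u\<in>X. \<forall>v\<in>X. ae_eq_on A u v \<longrightarrow> ae_eq_on B (F u) (F v)) \<and>
     (\<forall>u\<in>X. \<forall>v\<in>X. ae_eq_on B (F (\<lambda>x. u x + v x)) (\<lambda>x. F u x + F v x)) \<and>
     (\<forall>c. \<forall>u\<in>X. ae_eq_on B (F (\<lambda>x. c * u x)) (\<lambda>x. c * F u x)) \<and>
     (\<forall>u\<in>X. \<forall>\<epsilon>>0. \<exists>\<delta>>0. \<forall>v\<in>X.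
        N (\<lambda>x. v x - u x) < ennreal \<delta> \<longrightarrow> M (\<lambda>x. F v x - F u x) < ennreal \<epsilon>)"

end

theory Submission
  imports Defs
begin

text \<open>
Throughout, \<open>\<delta>\<close> is the distance to the boundary and \<open>d\<close> the dimension. Near each boundary point the
domain is \<open>{h > 0}\<close> for a Lipschitz height function \<open>h\<close> that grows with unit speed in a fixed
direction, and \<open>\<bar>h\<bar>\<close> is comparable with \<open>\<delta>\<close>. By compactness the Lipschitz constants and the radii of
the charts can be chosen uniformly; the locale \<open>lipschitz_domain\<close> fixes them. Averaging over
translations in the direction of growth turns integrals of functions of \<open>h\<close> over a ball into
one-dimensional integrals (\<open>layer_upper\<close>, \<open>layer_lower\<close>). The factors \<open>1 - s\<close> in the weights are
compensated by the integrals of \<open>\<delta>\<^sup>-\<^sup>s\<close> and \<open>\<delta>\<^sup>1\<^sup>-\<^sup>2\<^sup>s\<close> over the boundary layer, and \<open>\<kappa>\<close> is comparable with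
\<open>1 - s\<close> (\<open>kappa_bounds\<close>). This makes the constants uniform as \<open>s\<close> tends to one.

Extension. At a point \<open>x\<close> of the domain the extension of \<open>g\<close> is the average of \<open>g\<close> over the exterior
points at distance of order \<open>\<delta> x\<close>, with the weight \<open>\<delta>\<^sup>1\<^sup>-\<^sup>2\<^sup>s\<close> and a Lipschitz cutoff. By Jensen's
inequality every increment of the extension is controlled by averages of increments of \<open>g\<close>
(\<open>avg_const_exists\<close>). Fubini's theorem then reduces the energy estimate to a pointwise one: the
Gagliardo kernel, integrated over the interior variables against the averaging kernel \<open>mker\<close>, is
bounded by the kernel of the trace space. Pairs with one exterior point, pairs of interior points
that are separated compared with \<open>\<delta>\<close>, and pairs that are close compared with \<open>\<delta>\<close> are treated by
\<open>mker_exterior_kernel\<close>, \<open>mker_interior_far_kernel\<close> and \<open>mker_interior_near_kernel\<close>. All three follow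
from the bound \<open>mker_tail\<close> for one averaging kernel.

Trace. In a chart let \<open>t = - h x > 0\<close> be the depth of an exterior point. The quantity
\<open>oscillation u x \<rho>\<close> compares \<open>u x\<close> with the values of \<open>u\<close> on a cone of size \<open>\<rho>\<close> over \<open>x\<close> that lies in
the domain, and \<open>scale_energy s u j\<close> collects it at the scales \<open>\<rho> = 2\<^sup>j t\<close>. Two exterior points see a
common part of the domain at the scale \<open>r = \<bar>x - y\<bar> + t\<^sub>x + t\<^sub>y\<close>; choosing for each of them the dyadic
scale next to \<open>r\<close> bounds the trace energy by the sum of all scale energies (\<open>near_pair_energy\<close>), and
the top scale controls the weighted square integral (\<open>near_trace_mass\<close>). It remains to sum the scale
energies. For \<open>j = 0\<close> the distance from \<open>x\<close> to the cone is of order \<open>t\<close>, and the energy is controlled by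
\<open>[u, u]\<close>. Passing from \<open>j\<close> to \<open>j + 1\<close> gains the factor \<open>2\<^sup>-\<^sup>s\<close> from the weight and costs increments of
\<open>u\<close> between interior points. These are estimated by a Poincare inequality on convex sets with the
factor \<open>1 - s\<close> (\<open>fractional_poincare\<close>), and the layers that see a given interior point contribute
\<open>(1 - s) 2\<^sup>-\<^sup>j\<^sup>(\<^sup>1\<^sup>-\<^sup>s\<^sup>)\<close>, which is summable over \<open>j\<close> uniformly in \<open>s\<close> (\<open>cross_energy_le\<close>). The recursion
contracts uniformly for \<open>s\<close> bounded away from zero (\<open>scale_energy_sum\<close>); this is the role of the
lower bound on \<open>s\<close> for traces in the charts.
\<close>

text \<open>Nonnegative integrals without an explicit measure are with respect to Lebesgue measure.\<close>

abbreviation lebesgue_nn_integral :: "('a::euclidean_space \<Rightarrow> ennreal) \<Rightarrow> ennreal" (binder "\<integral>\<^sup>+" 10) where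
  "lebesgue_nn_integral f \<equiv> nn_integral lborel f"

section \<open>Integrals of radial functions and of functions of a chart height\<close>

lemma ennreal_cancel_le:
  assumes "c > 0" "k \<ge> 0"
  shows "ennreal c * x \<le> y * ennreal (c * k) \<Longrightarrow> x \<le> ennreal k * y"
   and "y * ennreal (c * k) \<le> ennreal c * x \<Longrightarrow> ennreal k * y \<le> x"
proof -
  have "y * ennreal (c * k) = ennreal c * (ennreal k * y)"
   using assms by (subst ennreal_mult) (simp_all add: mult.left_commute mult.commute)
  moreover have "ennreal c * a \<le> ennreal c * b \<longleftrightarrow> a \<le> b" for a b
   using assms by (subst ennreal_mult_le_mult_iff) auto
  ultimately show "ennreal c * x \<le> y * ennreal (c * k) \<Longrightarrow> x \<le> ennreal k * y"
   and "y * ennreal (c * k) \<le> ennreal c * x \<Longrightarrow> ennreal k * y \<le> x" by auto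
qed

lemma nn_integral_lborel_translate:
  fixes f :: "'a::euclidean_space \<Rightarrow> ennreal"
  assumes [measurable]: "f \<in> borel_measurable borel"
  shows "(\<integral>\<^sup>+x. f (x + a)) = (\<integral>\<^sup>+x. f x)"
proof -
  have "(\<integral>\<^sup>+x. f x) = (\<integral>\<^sup>+x. f x \<partial>(distr lborel borel (\<lambda>x. a + 1 *\<^sub>R x)))"
   by (subst lborel_affine[of 1 a]) (simp_all add: density_1)
  also have "\<dots> = (\<integral>\<^sup>+x. f (x + a))"
   by (subst nn_integral_distr) (simp_all add: add.commute)
  finally show ?thesis ..
qed

lemma nn_integral_lborel_dilate:
  fixes f :: "'a::euclidean_space \<Rightarrow> ennreal"
  assumes [measurable]: "f \<in> borel_measurable borel" and c: "c > 0"
  shows "(\<integral>\<^sup>+x. f x) = ennreal (c ^ DIM('a)) * (\<integral>\<^sup>+w. f (a + c *\<^sub>R w))"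
proof -
  have "(\<integral>\<^sup>+x. f x) =
    (\<integral>\<^sup>+x. f x \<partial>(density (distr lborel borel (\<lambda>x. a + c *\<^sub>R x)) (\<lambda>_. \<bar>c\<bar>^DIM('a))))"
   using c by (subst lborel_affine[of c a]) simp_all
  also have "\<dots> = (\<integral>\<^sup>+x. ennreal (c ^ DIM('a)) * f x \<partial>(distr lborel borel (\<lambda>x. a + c *\<^sub>R x)))"
   using c by (subst nn_integral_density) simp_all
  also have "\<dots> = ennreal (c ^ DIM('a)) * (\<integral>\<^sup>+w. f (a + c *\<^sub>R w))"
   by (subst nn_integral_distr) (simp_all add: nn_integral_cmult)
  finally show ?thesis .
qed

lemma nn_integral_swap:
  fixes f :: "'a::euclidean_space \<Rightarrow> 'b::euclidean_space \<Rightarrow> ennreal"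
  assumes "case_prod f \<in> borel_measurable (borel \<Otimes>\<^sub>M borel)"
  shows "(\<integral>\<^sup>+x. (\<integral>\<^sup>+y. f x y)) = (\<integral>\<^sup>+y. (\<integral>\<^sup>+x. f x y))"
proof -
  have "case_prod f \<in> borel_measurable (lborel \<Otimes>\<^sub>M lborel)"
   using assms by (subst measurable_cong_sets[OF sets_pair_measure_cong[OF sets_lborel sets_lborel] refl])
  from lborel_pair.Fubini'[OF this] show ?thesis by simp
qed

lemma nn_integral_powr_near:
  fixes a r :: real
  assumes "a > 0" "r \<ge> 0"
  shows "(\<integral>\<^sup>+t. ennreal (t powr (a - 1)) * indicator {0..r} t) = ennreal (r powr a / a)"
proof -
  have "((\<lambda>t. t powr (a - 1)) has_integral (r powr (a - 1 + 1) / (a - 1 + 1))) {0..r}"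
   using assms by (intro has_integral_powr_from_0) auto
  from nn_integral_has_integral_lebesgue[OF _ this]
  have "(\<integral>\<^sup>+t. ennreal (indicator {0..r} t * t powr (a - 1))) = ennreal (r powr a / a)"
   by (simp add: nn_integral_completion)
  then show ?thesis by (simp add: indicator_mult_ennreal mult.commute)
qed

lemma nn_integral_powr_far:
  fixes a r :: real
  assumes "a > 0" "r > 0"
  shows "(\<integral>\<^sup>+t. ennreal (t powr (- a - 1)) * indicator {r..} t) = ennreal (r powr (- a) / a)"
proof -
  have "((\<lambda>t. t powr (- a - 1)) has_integral - (r powr (- a - 1 + 1)) / (- a - 1 + 1)) {r..}"
   using assms by (intro has_integral_powr_to_inf) auto
  from nn_integral_has_integral_lebesgue[OF _ this]
  have "(\<integral>\<^sup>+t. ennreal (indicator {r..} t * t powr (- a - 1))) = ennreal (r powr (- a) / a)"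
   by (simp add: nn_integral_completion)
  then show ?thesis by (simp add: indicator_mult_ennreal mult.commute)
qed

text \<open>Both sides are integrals of \<open>f\<close> with respect to measures on the line, which agree on the
intervals \<open>{..t}\<close> by the volume of balls.\<close>

lemma nn_integral_radial:
  fixes f :: "real \<Rightarrow> ennreal" and a :: "'a::euclidean_space"
  assumes [measurable]: "f \<in> borel_measurable borel"
  shows "(\<integral>\<^sup>+x. f (dist x a)) =
   ennreal (unit_ball_vol (DIM('a)) * DIM('a)) *
    (\<integral>\<^sup>+t. f t * ennreal (t powr (real DIM('a) - 1)) * indicator {0..} t)"
proof -
  let ?w = "unit_ball_vol (DIM('a))" and ?d = "real DIM('a)"
  have d: "?d > 0" by simp
  define q where "q t = ennreal (?w * ?d) * (ennreal (t powr (?d - 1)) * indicator {0..} t)" for t :: real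
  have [measurable]: "q \<in> borel_measurable borel"
   unfolding q_def by measurable
  have ball: "emeasure (distr lborel borel (\<lambda>x::'a. dist x a)) {..t} = ennreal (?w * max 0 t ^ DIM('a))"
   for t
  proof -
   have "emeasure (distr lborel borel (\<lambda>x::'a. dist x a)) {..t} = emeasure lborel {x. dist x a \<le> t}"
    by (subst emeasure_distr) (auto simp: vimage_def)
   also have "{x. dist x a \<le> t} = cball a t" by (auto simp: dist_commute)
   finally show ?thesis
    by (cases "t \<ge> 0") (simp_all add: emeasure_cball max_def)
  qed
  have dens: "emeasure (density lborel q) {..t} = ennreal (?w * max 0 t ^ DIM('a))" for t
  proof -
   have "emeasure (density lborel q) {..t} = (\<integral>\<^sup>+s. q s * indicator {..t} s)"
    by (subst emeasure_density) simp_all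
   also have "\<dots> = (\<integral>\<^sup>+s. ennreal (?w * ?d) * (ennreal (s powr (?d - 1)) * indicator {0..t} s))"
    by (intro nn_integral_cong) (auto simp: q_def indicator_def)
   also have "\<dots> = ennreal (?w * ?d) * (\<integral>\<^sup>+s. ennreal (s powr (?d - 1)) * indicator {0..t} s)"
    by (rule nn_integral_cmult) measurable
   also have "\<dots> = ennreal (?w * max 0 t ^ DIM('a))"
   proof (cases "t \<ge> 0")
    case True
    show ?thesis
     unfolding nn_integral_powr_near[OF d True] using True d
     by (cases "t = 0") (simp_all add: ennreal_mult'[symmetric] powr_realpow)
   qed simp
   finally show ?thesis .
  qed
  have "distr lborel borel (\<lambda>x::'a. dist x a) = density lborel q"
  proof (rule measure_eqI_generator_eq[where E="range (\<lambda>t::real. {..t})" and \<Omega>=UNIV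
     and A="\<lambda>n. {..real n}"])
   show "Int_stable (range (\<lambda>t::real. {..t}))"
    by (auto simp: Int_stable_def)
   show "sets (distr lborel borel (\<lambda>x::'a. dist x a)) = sigma_sets UNIV (range (\<lambda>t::real. {..t}))"
    by (simp add: borel_eq_atMost)
   show "sets (density lborel q) = sigma_sets UNIV (range (\<lambda>t::real. {..t}))"
    by (simp add: borel_eq_atMost)
   show "(\<Union>i. {..real i}) = UNIV"
    using real_arch_simple by auto
  qed (auto simp: ball dens)
  then have "(\<integral>\<^sup>+t. f t \<partial>distr lborel borel (\<lambda>x::'a. dist x a)) = (\<integral>\<^sup>+t. f t \<partial>density lborel q)"
   by simp
  then have "(\<integral>\<^sup>+x. f (dist x a)) = (\<integral>\<^sup>+t. q t * f t)"
   by (simp add: nn_integral_distr nn_integral_density)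
  also have "\<dots> = (\<integral>\<^sup>+t. ennreal (?w * ?d) * (f t * ennreal (t powr (?d - 1)) * indicator {0..} t))"
   by (intro nn_integral_cong) (auto simp: q_def mult_ac)
  also have "\<dots> = ennreal (?w * ?d) * (\<integral>\<^sup>+t. f t * ennreal (t powr (?d - 1)) * indicator {0..} t)"
   by (rule nn_integral_cmult) measurable
  finally show ?thesis .
qed

definition sphere_area :: "'a::euclidean_space itself \<Rightarrow> real" where
  "sphere_area _ = unit_ball_vol (DIM('a)) * DIM('a)"

lemma sphere_area_pos: "sphere_area TYPE('a::euclidean_space) > 0"
  by (simp add: sphere_area_def)

lemma nn_integral_dist_powr_near:
  fixes y :: "'a::euclidean_space" and a r :: real
  assumes "a > 0" "r \<ge> 0"
  shows "(\<integral>\<^sup>+x. ennreal (dist x y powr (a - real DIM('a))) * indicator {..r} (dist x y)) =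
   ennreal (sphere_area TYPE('a) * (r powr a / a))"
proof -
  have "(\<integral>\<^sup>+x. ennreal (dist x y powr (a - real DIM('a))) * indicator {..r} (dist x y)) =
   ennreal (unit_ball_vol (DIM('a)) * DIM('a)) * (\<integral>\<^sup>+t. ennreal (t powr (a - real DIM('a))) * indicator {..r} t *
    ennreal (t powr (real DIM('a) - 1)) * indicator {0..} t)"
   by (rule nn_integral_radial) measurable
  also have "(\<integral>\<^sup>+t. ennreal (t powr (a - real DIM('a))) * indicator {..r} t *
    ennreal (t powr (real DIM('a) - 1)) * indicator {0..} t)
   = (\<integral>\<^sup>+t. ennreal (t powr (a - 1)) * indicator {0..r} t)"
   by (intro nn_integral_cong)
    (auto simp: indicator_def ennreal_mult[symmetric] powr_add[symmetric])
  also have "\<dots> = ennreal (r powr a / a)" by (rule nn_integral_powr_near[OF assms])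
  finally show ?thesis
   by (simp add: sphere_area_def ennreal_mult'[symmetric])
qed

lemma nn_integral_dist_powr_far:
  fixes y :: "'a::euclidean_space" and a r :: real
  assumes "a > 0" "r > 0"
  shows "(\<integral>\<^sup>+x. ennreal (dist x y powr (- a - real DIM('a))) * indicator {r..} (dist x y)) =
   ennreal (sphere_area TYPE('a) * (r powr (- a) / a))"
proof -
  have "(\<integral>\<^sup>+x. ennreal (dist x y powr (- a - real DIM('a))) * indicator {r..} (dist x y)) =
   ennreal (unit_ball_vol (DIM('a)) * DIM('a)) * (\<integral>\<^sup>+t. ennreal (t powr (- a - real DIM('a))) * indicator {r..} t *
    ennreal (t powr (real DIM('a) - 1)) * indicator {0..} t)"
   by (rule nn_integral_radial) measurable
  also have "(\<integral>\<^sup>+t. ennreal (t powr (- a - real DIM('a))) * indicator {r..} t *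
    ennreal (t powr (real DIM('a) - 1)) * indicator {0..} t)
   = (\<integral>\<^sup>+t. ennreal (t powr (- a - 1)) * indicator {r..} t)"
   using assms by (intro nn_integral_cong)
    (auto simp: indicator_def ennreal_mult[symmetric] powr_add[symmetric])
  also have "\<dots> = ennreal (r powr (- a) / a)" by (rule nn_integral_powr_far[OF assms])
  finally show ?thesis
   by (simp add: sphere_area_def ennreal_mult'[symmetric])
qed

text \<open>A height function grows with unit speed along \<open>e\<close>. Averaging over the translations by \<open>\<tau> *\<^sub>R e\<close> with
\<open>\<bar>\<tau>\<bar> \<le> r\<close> turns the integral of \<open>f (h x)\<close> over a ball into an integral of \<open>f\<close> over the line; this avoids
coordinates that flatten the level sets of \<open>h\<close>.\<close>

definition height_function :: "real \<Rightarrow> 'a::euclidean_space \<Rightarrow> ('a \<Rightarrow> real) \<Rightarrow> bool" where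
  "height_function M e h \<longleftrightarrow> norm e = 1 \<and> M-lipschitz_on UNIV h \<and> (\<forall>x t. h (x + t *\<^sub>R e) = h x + t)"

lemma height_functionD:
  assumes "height_function M e h"
  shows "norm e = 1" "\<And>x y. \<bar>h x - h y\<bar> \<le> M * dist x y" "\<And>x t. h (x + t *\<^sub>R e) = h x + t"
   "h \<in> borel_measurable borel" "continuous_on UNIV h"
proof -
  have L: "M-lipschitz_on UNIV h" using assms by (simp add: height_function_def)
  show "\<bar>h x - h y\<bar> \<le> M * dist x y" for x y
   using lipschitz_onD[OF L, of x y] by (simp add: dist_real_def)
  show "continuous_on UNIV h" by (rule lipschitz_on_continuous_on[OF L])
  then show "h \<in> borel_measurable borel" by (rule borel_measurable_continuous_onI)
qed (use assms in \<open>auto simp: height_function_def\<close>)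

lemma indicator_cball_eq: "indicator (cball z r) x = indicator {..r} (dist z x)"
  by (simp add: indicator_def)

lemma layer_translate:
  fixes f :: "real \<Rightarrow> ennreal" and z e :: "'a::euclidean_space"
  assumes h: "height_function M e h" and [measurable]: "f \<in> borel_measurable borel"
  shows "(\<integral>\<^sup>+x. f (h x) * indicator (cball z r) x) =
   (\<integral>\<^sup>+x. f (h x + t) * indicator (cball z r) (x + t *\<^sub>R e))"
proof -
  note [measurable] = height_functionD(4)[OF h]
  show ?thesis
   using nn_integral_lborel_translate[of "\<lambda>x. f (h x) * indicator {..r} (dist z x)" "t *\<^sub>R e"]
   unfolding height_functionD(3)[OF h] indicator_cball_eq by simp
qed

lemma layer_upper:
  fixes f :: "real \<Rightarrow> ennreal" and z e :: "'a::euclidean_space"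
  assumes h: "height_function M e h" and [measurable]: "f \<in> borel_measurable borel" and r: "r > 0"
  shows "(\<integral>\<^sup>+x. f (h x) * indicator (cball z r) x) \<le>
   ennreal (unit_ball_vol (DIM('a)) * 2 ^ DIM('a) * r powr (real DIM('a) - 1)) * (\<integral>\<^sup>+t. f t)"
proof -
  note [measurable] = height_functionD(4)[OF h]
  have ne: "norm e = 1" by (rule height_functionD(1)[OF h])
  let ?I = "\<integral>\<^sup>+x. f (h x) * indicator (cball z r) x"
  have tr: "?I * indicator {-r..r} t = (\<integral>\<^sup>+x. f (h x + t) * indicator (cball z r) (x + t *\<^sub>R e) * indicator {-r..r} t)" for t
   by (subst layer_translate[OF h assms(2), of z r t], unfold indicator_cball_eq,
     rule nn_integral_multc[symmetric]) measurable
  have "ennreal (2 * r) * ?I = (\<integral>\<^sup>+t. ?I * indicator {-r..r} t)"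
   using r by (subst nn_integral_cmult_indicator) (simp_all add: mult.commute)
  also have "\<dots> = (\<integral>\<^sup>+t. (\<integral>\<^sup>+x. f (h x + t) * indicator (cball z r) (x + t *\<^sub>R e) * indicator {-r..r} t))"
   by (intro nn_integral_cong tr )
  also have "\<dots> \<le> (\<integral>\<^sup>+t. (\<integral>\<^sup>+x. f (h x + t) * indicator (cball z (2 * r)) x))"
  proof (intro nn_integral_mono)
   fix t :: real and x :: 'a
   have "x \<in> cball z (2 * r)" if "x + t *\<^sub>R e \<in> cball z r" "\<bar>t\<bar> \<le> r"
   proof -
    have "dist z x \<le> dist z (x + t *\<^sub>R e) + dist (x + t *\<^sub>R e) x" by (rule dist_triangle)
    also have "dist (x + t *\<^sub>R e) x = \<bar>t\<bar>" by (simp add: dist_norm ne)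
    finally show ?thesis using that by simp
   qed
   then show "f (h x + t) * indicator (cball z r) (x + t *\<^sub>R e) * indicator {-r..r} t
     \<le> f (h x + t) * indicator (cball z (2 * r)) x"
    by (auto simp: indicator_def abs_le_iff)
  qed
  also have "\<dots> = (\<integral>\<^sup>+x. (\<integral>\<^sup>+t. f (h x + t) * indicator (cball z (2 * r)) x))"
   unfolding indicator_cball_eq by (rule nn_integral_swap) measurable
  also have "\<dots> = (\<integral>\<^sup>+x. (\<integral>\<^sup>+t. f t) * indicator (cball z (2 * r)) x)"
   using nn_integral_lborel_translate[of f]
   by (intro nn_integral_cong) (simp add: nn_integral_multc add.commute[of "h _"])
  also have "\<dots> = (\<integral>\<^sup>+t. f t) * ennreal (unit_ball_vol (DIM('a)) * (2 * r) ^ DIM('a))"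
   using r by (simp add: nn_integral_cmult_indicator emeasure_cball)
  finally have "ennreal (2 * r) * ?I \<le> (\<integral>\<^sup>+t. f t) * ennreal (unit_ball_vol (DIM('a)) * (2 * r) ^ DIM('a))" .
  moreover have "unit_ball_vol (DIM('a)) * (2 * r) ^ DIM('a) =
    (2 * r) * (unit_ball_vol (DIM('a)) * 2 ^ DIM('a) * r powr (real DIM('a) - 1) / 2)"
   using r by (simp add: powr_diff powr_realpow power_mult_distrib)
  ultimately have "?I \<le> ennreal (unit_ball_vol (DIM('a)) * 2 ^ DIM('a) * r powr (real DIM('a) - 1) / 2) * (\<integral>\<^sup>+t. f t)"
   using r by (intro ennreal_cancel_le(1)[of "2 * r"]) (simp_all only:, simp_all)
  also have "\<dots> \<le> ennreal (unit_ball_vol (DIM('a)) * 2 ^ DIM('a) * r powr (real DIM('a) - 1)) * (\<integral>\<^sup>+t. f t)"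
   by (intro mult_right_mono ennreal_leI) auto
  finally show ?thesis .
qed

text \<open>The Lipschitz bound keeps \<open>\<bar>h\<bar> \<le> r/4\<close> on the smaller ball of radius \<open>r / (4 * M)\<close>; all translations
that bring the height into \<open>[-r/4, r/4]\<close> therefore stay inside the ball of radius \<open>r\<close>.\<close>

lemma layer_lower:
  fixes f :: "real \<Rightarrow> ennreal" and z e :: "'a::euclidean_space"
  assumes h: "height_function M e h" and [measurable]: "f \<in> borel_measurable borel" and r: "r > 0"
   and M: "M \<ge> 1" and z: "h z = 0"
  shows "ennreal (unit_ball_vol (DIM('a)) / (4 * M) ^ DIM('a) * r powr (real DIM('a) - 1)) *
    (\<integral>\<^sup>+t. f t * indicator {-r/4..r/4} t)
   \<le> (\<integral>\<^sup>+x. f (h x) * indicator (cball z r) x)"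
proof -
  note [measurable] = height_functionD(4)[OF h]
  have ne: "norm e = 1" by (rule height_functionD(1)[OF h])
  let ?I = "\<integral>\<^sup>+x. f (h x) * indicator (cball z r) x"
  let ?J = "\<integral>\<^sup>+t. f t * indicator {-r/4..r/4} t"
  have tr: "?I * indicator {-r/2..r/2} t = (\<integral>\<^sup>+x. f (h x + t) * indicator (cball z r) (x + t *\<^sub>R e) * indicator {-r/2..r/2} t)" for t
   by (subst layer_translate[OF h assms(2), of z r t], unfold indicator_cball_eq,
     rule nn_integral_multc[symmetric]) measurable
  have "?J * ennreal (unit_ball_vol (DIM('a)) * (r / (4 * M)) ^ DIM('a))
    = (\<integral>\<^sup>+x. ?J * indicator (cball z (r / (4 * M))) x)"
   using r M by (simp add: nn_integral_cmult_indicator emeasure_cball)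
  also have "\<dots> = (\<integral>\<^sup>+x. (\<integral>\<^sup>+t. f (h x + t) * indicator {-r/4..r/4} (h x + t) * indicator (cball z (r / (4 * M))) x))"
   using nn_integral_lborel_translate[of "\<lambda>t. f t * indicator {-r/4..r/4} t"]
   by (intro nn_integral_cong) (simp add: nn_integral_multc add.commute[of "h _"])
  also have "\<dots> \<le> (\<integral>\<^sup>+x. (\<integral>\<^sup>+t. f (h x + t) * indicator (cball z r) (x + t *\<^sub>R e) * indicator {-r/2..r/2} t))"
  proof (intro nn_integral_mono)
   fix t :: real and x :: 'a
   have "x + t *\<^sub>R e \<in> cball z r \<and> t \<in> {-r/2..r/2}"
    if a: "h x + t \<in> {-r/4..r/4}" and b: "x \<in> cball z (r / (4 * M))"
   proof -
    have "\<bar>h x\<bar> \<le> M * dist x z" using height_functionD(2)[OF h, of x z] z by simp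
    also have "\<dots> \<le> M * (r / (4 * M))" using M b by (intro mult_left_mono) (auto simp: dist_commute)
    also have "\<dots> = r / 4" using M by simp
    finally have hx: "\<bar>h x\<bar> \<le> r / 4" .
    with a have t: "\<bar>t\<bar> \<le> r / 2" by auto
    have "r / (4 * M) \<le> r / 4" using r M by (intro divide_left_mono) auto
    then have "dist z x \<le> r / 4" using b by simp
    moreover have "dist z (x + t *\<^sub>R e) \<le> dist z x + dist x (x + t *\<^sub>R e)" by (rule dist_triangle)
    moreover have "dist x (x + t *\<^sub>R e) = \<bar>t\<bar>" by (simp add: dist_norm ne)
    ultimately show ?thesis using t r by auto
   qed
   then show "f (h x + t) * indicator {-r/4..r/4} (h x + t) * indicator (cball z (r / (4 * M))) x
     \<le> f (h x + t) * indicator (cball z r) (x + t *\<^sub>R e) * indicator {-r/2..r/2} t"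
    by (auto simp: indicator_def)
  qed
  also have "\<dots> = (\<integral>\<^sup>+t. (\<integral>\<^sup>+x. f (h x + t) * indicator (cball z r) (x + t *\<^sub>R e) * indicator {-r/2..r/2} t))"
   unfolding indicator_cball_eq by (rule nn_integral_swap) measurable
  also have "\<dots> = (\<integral>\<^sup>+t. ?I * indicator {-r/2..r/2} t)"
   by (intro nn_integral_cong tr[symmetric])
  also have "\<dots> = ennreal r * ?I"
   using r by (subst nn_integral_cmult_indicator) (simp_all add: mult.commute)
  finally have "?J * ennreal (unit_ball_vol (DIM('a)) * (r / (4 * M)) ^ DIM('a)) \<le> ennreal r * ?I" .
  moreover have "unit_ball_vol (DIM('a)) * (r / (4 * M)) ^ DIM('a) =
    r * (unit_ball_vol (DIM('a)) / (4 * M) ^ DIM('a) * r powr (real DIM('a) - 1))"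
   using r by (simp add: powr_diff powr_realpow power_mult_distrib power_divide)
  ultimately show ?thesis
   using r M by (intro ennreal_cancel_le(2)[of r]) (simp_all only:, simp_all)
qed

section \<open>Lipschitz charts and the distance to the boundary\<close>

lemma ennreal_mult_assoc3:
  "0 \<le> a \<Longrightarrow> 0 \<le> b \<Longrightarrow> 0 \<le> c \<Longrightarrow> ennreal a * (ennreal b * ennreal c) = ennreal (a * (b * c))"
  by (simp add: ennreal_mult)

lemma powr_divide_eq:
  fixes x m a :: real
  shows "(x / m) powr a = m powr (- a) * x powr a"
  by (simp only: powr_divide powr_minus) (simp add: divide_inverse mult.commute)

lemma DIM_ge_1: "1 \<le> real DIM('a::euclidean_space)"
  using DIM_positive[where 'a='a] by linarith

lemma norm_projection_le:
  fixes v e :: "'a::euclidean_space"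
  assumes "norm e = 1"
  shows "norm (v - (v \<bullet> e) *\<^sub>R e) \<le> norm v"
proof -
  have "e \<bullet> e = 1" using assms by (simp add: norm_eq_1)
  then have "(norm (v - (v \<bullet> e) *\<^sub>R e))\<^sup>2 = (norm v)\<^sup>2 - (v \<bullet> e)\<^sup>2"
   unfolding power2_norm_eq_inner
   by (simp add: inner_diff_left inner_diff_right inner_commute power2_eq_square)
  also have "\<dots> \<le> (norm v)\<^sup>2" by simp
  finally show ?thesis by (rule power2_le_imp_le) simp
qed

text \<open>The gradient is Lipschitz, hence bounded on balls.\<close>

lemma C11_function_lipschitz_cball:
  fixes \<gamma> :: "'a::euclidean_space \<Rightarrow> real"
  assumes "C11_function \<gamma>"
  shows "\<exists>B\<ge>0. B-lipschitz_on (cball p r) \<gamma>"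
proof (cases "r \<ge> 0")
  case True
  from assms obtain G L where G: "\<And>x. GDERIV \<gamma> x :> G x" and L: "L-lipschitz_on UNIV G"
   by (auto simp: C11_function_def)
  have L0: "L \<ge> 0" by (rule lipschitz_on_nonneg[OF L])
  define B where "B = norm (G p) + L * r"
  have B0: "B \<ge> 0" using True L0 by (simp add: B_def)
  have "B-lipschitz_on (cball p r) \<gamma>"
  proof (rule bounded_derivative_imp_lipschitz)
   show "(\<gamma> has_derivative (\<lambda>h. h \<bullet> G x)) (at x within cball p r)" if "x \<in> cball p r" for x
    using G[of x] by (auto simp: gderiv_def intro: has_derivative_at_withinI)
   show "convex (cball p r)" by simp
   show "onorm (\<lambda>h. h \<bullet> G x) \<le> B" if "x \<in> cball p r" for x
   proof (rule onorm_le)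
    fix v :: 'a
    have "dist (G x) (G p) \<le> L * dist x p" by (rule lipschitz_onD[OF L]) auto
    also have "\<dots> \<le> L * r" using that L0 by (intro mult_left_mono) (auto simp: dist_commute)
    finally have "norm (G x) \<le> B"
     using norm_triangle_ineq2[of "G x" "G p"] by (simp add: B_def dist_norm)
    then have "norm v * norm (G x) \<le> norm v * B" by (intro mult_left_mono) auto
    then show "norm (v \<bullet> G x) \<le> B * norm v"
     using Cauchy_Schwarz_ineq2[of v "G x"] by (simp add: mult.commute)
   qed
  qed (rule B0)
  with B0 show ?thesis by blast
next
  case False
  then show ?thesis by (intro exI[of _ 0]) (auto simp: lipschitz_on_def)
qed

text \<open>
  A \<open>C\<^sup>1\<^sup>,\<^sup>1\<close> function is Lipschitz only on bounded sets; composing it with the nearest point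
  projection onto a ball makes the height function globally Lipschitz without changing it nearby.
\<close>

lemma C11_domain_height_function:
  fixes \<Omega> :: "'a::euclidean_space set"
  assumes "C11_domain \<Omega>" "z \<in> frontier \<Omega>"
  shows "\<exists>r>0. \<exists>M\<ge>1. \<exists>e h. height_function M e h \<and> (\<forall>x\<in>ball z r. x \<in> \<Omega> \<longleftrightarrow> 0 < h x)"
proof -
  from assms obtain r e \<gamma> where r: "r > 0" and e: "norm e = 1" and \<gamma>: "C11_function \<gamma>"
   and eq: "\<Omega> \<inter> ball z r = {x \<in> ball z r. \<gamma> (x - (x \<bullet> e) *\<^sub>R e) < x \<bullet> e}"
   unfolding C11_domain_def by blast
  have ee: "e \<bullet> e = 1" using e by (simp add: norm_eq_1)
  let ?\<pi> = "\<lambda>x. x - (x \<bullet> e) *\<^sub>R e"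
  let ?S = "cball (?\<pi> z) r"
  obtain B where B: "B \<ge> 0" "B-lipschitz_on ?S \<gamma>"
   using C11_function_lipschitz_cball[OF \<gamma>] by blast
  define h where "h x = x \<bullet> e - \<gamma> (closest_point ?S (?\<pi> x))" for x
  have S: "convex ?S" "closed ?S" "?S \<noteq> {}" using r by auto
  have "(1 + B)-lipschitz_on UNIV h"
  proof (rule lipschitz_onI)
   fix x y :: 'a
   have \<pi>: "?\<pi> x - ?\<pi> y = ?\<pi> (x - y)" by (simp add: inner_diff algebra_simps)
   have "\<bar>\<gamma> (closest_point ?S (?\<pi> x)) - \<gamma> (closest_point ?S (?\<pi> y))\<bar>
     \<le> B * dist (closest_point ?S (?\<pi> x)) (closest_point ?S (?\<pi> y))"
    using lipschitz_onD[OF B(2) closest_point_in_set[OF S(2,3), of "?\<pi> x"] closest_point_in_set[OF S(2,3), of "?\<pi> y"]]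
    by (simp only: dist_real_def)
   also have "\<dots> \<le> B * dist (?\<pi> x) (?\<pi> y)"
    by (intro mult_left_mono closest_point_lipschitz S B)
   also have "\<dots> \<le> B * dist x y"
    using B(1) norm_projection_le[OF e, of "x - y"] unfolding dist_norm \<pi>
    by (intro mult_left_mono)
   finally have 1: "\<bar>\<gamma> (closest_point ?S (?\<pi> x)) - \<gamma> (closest_point ?S (?\<pi> y))\<bar> \<le> B * dist x y" .
   have "\<bar>x \<bullet> e - y \<bullet> e\<bar> \<le> dist x y"
    using Cauchy_Schwarz_ineq2[of "x - y" e] e by (simp add: inner_diff dist_norm)
   with 1 show "dist (h x) (h y) \<le> (1 + B) * dist x y"
    unfolding h_def dist_real_def by (simp add: algebra_simps)
  qed (use B in simp)
  moreover have "h (x + t *\<^sub>R e) = h x + t" for x t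
   by (simp add: h_def inner_add ee algebra_simps)
  moreover have "x \<in> \<Omega> \<longleftrightarrow> 0 < h x" if x: "x \<in> ball z r" for x
  proof -
   have \<pi>: "?\<pi> z - ?\<pi> x = ?\<pi> (z - x)" by (simp add: inner_diff algebra_simps)
   have "norm (z - x) < r" using x by (simp add: dist_norm)
   then have "?\<pi> x \<in> ?S"
    using norm_projection_le[OF e, of "z - x"] unfolding mem_cball dist_norm \<pi> by linarith
   then have "closest_point ?S (?\<pi> x) = ?\<pi> x" by (rule closest_point_self)
   moreover have "x \<in> \<Omega> \<longleftrightarrow> \<gamma> (?\<pi> x) < x \<bullet> e" using x eq by blast
   ultimately show ?thesis by (simp add: h_def)
  qed
  ultimately show ?thesis using e r B(1)
   by (intro exI[of _ r] conjI exI[of _ "1 + B"] exI[of _ e] exI[of _ h])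
    (auto simp: height_function_def)
qed

lemma height_function_mono: "height_function M e h \<Longrightarrow> M \<le> M' \<Longrightarrow> height_function M' e h"
  unfolding height_function_def by (meson lipschitz_on_mono order_refl)

locale lipschitz_domain =
  fixes \<Omega> :: "'a::euclidean_space set" and M R D :: real
  assumes open_dom: "open \<Omega>" and dom_nonempty: "\<Omega> \<noteq> {}"
   and diam: "\<And>x y. x \<in> closure \<Omega> \<Longrightarrow> y \<in> closure \<Omega> \<Longrightarrow> dist x y \<le> D" and D1: "D \<ge> 1"
   and M1: "M \<ge> 1" and R0: "0 < R" and R1: "R \<le> 1"
   and charts: "\<And>z. z \<in> frontier \<Omega> \<Longrightarrow>
    \<exists>e h. height_function M e h \<and> (\<forall>x\<in>ball z R. x \<in> \<Omega> \<longleftrightarrow> 0 < h x)"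

text \<open>Compactness of the boundary makes the Lipschitz constant and the radius of the charts uniform.\<close>

lemma C11_domain_lipschitz_domain:
  fixes \<Omega> :: "'a::euclidean_space set"
  assumes C: "C11_domain \<Omega>" and b: "bounded \<Omega>"
  shows "\<exists>M R D. lipschitz_domain \<Omega> M R D"
proof -
  have cpt: "compact (frontier \<Omega>)" by (rule compact_frontier_bounded[OF b])
  from C11_domain_height_function[OF C] obtain r M e h where
   rM: "\<And>z. z \<in> frontier \<Omega> \<Longrightarrow> r z > 0 \<and> M z \<ge> 1 \<and> height_function (M z) (e z) (h z) \<and>
    (\<forall>x\<in>ball z (r z). x \<in> \<Omega> \<longleftrightarrow> 0 < h z x)"
   by metis
  obtain F where F: "F \<subseteq> frontier \<Omega>" "finite F" "frontier \<Omega> \<subseteq> (\<Union>z\<in>F. ball z (r z / 2))"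
  proof -
   have "frontier \<Omega> \<subseteq> (\<Union>z\<in>frontier \<Omega>. ball z (r z / 2))" using rM by force
   from compactE_image[OF cpt _ this] show thesis using that by auto
  qed
  define Rm where "Rm = Min (insert 1 ((\<lambda>z. r z / 2) ` F))"
  define Mm where "Mm = Max (insert 1 (M ` F))"
  have Rm: "0 < Rm" "Rm \<le> 1" using F rM by (auto simp: Rm_def)
  have RmF: "Rm \<le> r z / 2" if "z \<in> F" for z
   unfolding Rm_def by (rule Min_le) (use F that in auto)
  have Mm: "Mm \<ge> 1" using F by (auto simp: Mm_def)
  have MmF: "M z \<le> Mm" if "z \<in> F" for z
   unfolding Mm_def by (rule Max_ge) (use F that in auto)
  have "bounded (closure \<Omega>)" using b by (rule bounded_closure)
  then obtain D where D: "\<And>x y. x \<in> closure \<Omega> \<Longrightarrow> y \<in> closure \<Omega> \<Longrightarrow> dist x y \<le> D"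
   by (metis bounded_two_points)
  have "lipschitz_domain \<Omega> Mm Rm (max 1 D)"
  proof
   show "open \<Omega>" "\<Omega> \<noteq> {}" using C by (auto simp: C11_domain_def)
   show "dist x y \<le> max 1 D" if "x \<in> closure \<Omega>" "y \<in> closure \<Omega>" for x y
    using D[OF that] by simp
   show "\<exists>e h. height_function Mm e h \<and> (\<forall>x\<in>ball z Rm. x \<in> \<Omega> \<longleftrightarrow> 0 < h x)"
    if z: "z \<in> frontier \<Omega>" for z
   proof -
    from z F(3) obtain w where w: "w \<in> F" "dist w z < r w / 2" by auto
    have "ball z Rm \<subseteq> ball w (r w)"
    proof
     fix x assume "x \<in> ball z Rm"
     then have "dist z x < r w / 2" using RmF[OF w(1)] by simp
     then show "x \<in> ball w (r w)"
      using dist_triangle[of w x z] w(2) by simp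
    qed
    moreover have "height_function Mm (e w) (h w)"
     using rM[of w] w F(1) MmF[of w] height_function_mono by blast
    moreover have "\<forall>x\<in>ball w (r w). x \<in> \<Omega> \<longleftrightarrow> 0 < h w x" using rM[of w] w F(1) by blast
    ultimately show ?thesis by blast
   qed
  qed (use Rm Mm in auto)
  then show ?thesis by blast
qed

lemma nn_integral_abs_powr_near:
  fixes a r :: real
  assumes "a > 0" "r \<ge> 0"
  shows "(\<integral>\<^sup>+t. ennreal (\<bar>t\<bar> powr (a - 1)) * indicator {-r..r} t) = ennreal (2 * (r powr a / a))"
proof -
  have "(\<integral>\<^sup>+t. ennreal (\<bar>t\<bar> powr (a - 1)) * indicator {-r..r} t)
   = (\<integral>\<^sup>+(t::real). ennreal (dist t 0 powr (a - real DIM(real))) * indicator {..r} (dist t 0))"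
   by (intro nn_integral_cong) (auto simp: indicator_def)
  also have "\<dots> = ennreal (sphere_area TYPE(real) * (r powr a / a))"
   by (rule nn_integral_dist_powr_near[OF assms])
  finally show ?thesis by (simp add: sphere_area_def unit_ball_vol_1)
qed

lemma nn_integral_neg_powr_near:
  fixes a r :: real
  assumes "a > 0" "r \<ge> 0"
  shows "(\<integral>\<^sup>+t. ennreal (\<bar>t\<bar> powr (a - 1)) * indicator {-r..0} t) = ennreal (r powr a / a)"
proof -
  have "(\<integral>\<^sup>+t. ennreal (\<bar>t\<bar> powr (a - 1)) * indicator {-r..0} t)
   = (\<integral>\<^sup>+t. ennreal (t powr (a - 1)) * indicator {0..r} t)"
   by (subst nn_integral_real_affine[where c="-1" and t=0])
    (auto intro!: nn_integral_cong simp: indicator_def)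
  also have "\<dots> = ennreal (r powr a / a)" by (rule nn_integral_powr_near[OF assms])
  finally show ?thesis .
qed

lemma powr_le_of_ge:
  fixes a x p q :: real
  assumes "0 < a" "a \<le> 1" "a \<le> x" "0 \<le> p" "p \<le> q"
  shows "a powr q \<le> x powr p"
proof -
  have "a powr q \<le> a powr p" using assms by (intro powr_mono') auto
  also have "\<dots> \<le> x powr p" using assms by (intro powr_mono2) auto
  finally show ?thesis .
qed

context lipschitz_domain
begin

abbreviation "\<delta> \<equiv> bdist \<Omega>"

lemma compact_frontier_dom: "compact (frontier \<Omega>)"
proof (rule compact_frontier_bounded)
  show "bounded \<Omega>"
   using diam closure_subset[of \<Omega>] unfolding bounded_two_points by blast
qed

lemma frontier_nonempty: "frontier \<Omega> \<noteq> {}"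
proof
  assume "frontier \<Omega> = {}"
  then have "\<Omega> = UNIV" using dom_nonempty by (simp add: frontier_eq_empty)
  then show False
   using diam not_bounded_UNIV unfolding bounded_two_points by (metis UNIV_I closure_UNIV)
qed

lemma frontier_not_dom: "p \<in> frontier \<Omega> \<Longrightarrow> p \<notin> \<Omega>"
  using open_dom by (auto simp: frontier_def interior_open)

lemma frontier_closure: "p \<in> frontier \<Omega> \<Longrightarrow> p \<in> closure \<Omega>"
  by (auto simp: frontier_def)

lemma bdist_nonneg [simp]: "\<delta> x \<ge> 0"
  by (simp add: bdist_def infdist_nonneg)

lemma bdist_lipschitz: "\<bar>\<delta> x - \<delta> y\<bar> \<le> dist x y"
  by (simp add: bdist_def infdist_triangle_abs)

lemma bdist_measurable [measurable]: "\<delta> \<in> borel_measurable borel"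
  unfolding bdist_def by (intro borel_measurable_continuous_onI continuous_intros)

lemma dom_measurable [measurable]: "\<Omega> \<in> sets borel"
  using open_dom by simp

lemma bdist_attained: "\<exists>p\<in>frontier \<Omega>. dist x p = \<delta> x"
proof -
  have "closed (frontier \<Omega>)" by simp
  from infdist_attains_inf[OF this frontier_nonempty, of x] obtain p
   where "p \<in> frontier \<Omega>" "infdist x (frontier \<Omega>) = dist x p" by blast
  then show ?thesis by (auto simp: bdist_def)
qed

lemma bdist_le: "p \<in> frontier \<Omega> \<Longrightarrow> \<delta> x \<le> dist x p"
  by (simp add: bdist_def infdist_le)

lemma bdist_eq_0_iff: "\<delta> x = 0 \<longleftrightarrow> x \<in> frontier \<Omega>"
  using in_closed_iff_infdist_zero[of "frontier \<Omega>" x] frontier_nonempty by (simp add: bdist_def)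

lemma bdist_pos: "x \<in> \<Omega> \<Longrightarrow> \<delta> x > 0"
  using bdist_eq_0_iff[of x] frontier_not_dom[of x] bdist_nonneg[of x] by linarith

lemma bdist_le_D: "x \<in> \<Omega> \<Longrightarrow> \<delta> x \<le> D"
  using bdist_attained[of x] diam[of x] frontier_closure closure_subset[of \<Omega>] by force

lemma crossing:
  assumes "x \<in> \<Omega>" "y \<notin> \<Omega>"
  shows "\<delta> x \<le> dist x y" "\<delta> y \<le> dist x y"
proof -
  have "closed_segment x y \<inter> frontier \<Omega> \<noteq> {}"
   using assms by (intro connected_Int_frontier) auto
  then obtain p where p: "p \<in> closed_segment x y" "p \<in> frontier \<Omega>" by blast
  show "\<delta> x \<le> dist x y" "\<delta> y \<le> dist x y"
   using bdist_le[OF p(2), of x] bdist_le[OF p(2), of y] dist_in_closed_segment[OF p(1)]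
   by (auto simp: dist_commute)
qed

text \<open>Moving from \<open>x\<close> by \<open>- h x\<close> along the direction of growth leads to the zero level of \<open>h\<close>, whence
\<open>\<delta> \<le> \<bar>h\<bar>\<close>; conversely \<open>h\<close> vanishes on the boundary inside the chart and is \<open>M\<close>-Lipschitz. The radius
\<open>R / (4 * M)\<close> keeps both the displaced points and the nearest boundary points inside the chart.\<close>

lemma chart_obtain:
  assumes z: "z \<in> frontier \<Omega>"
  obtains e h where "height_function M e h" "\<And>x. x \<in> ball z R \<Longrightarrow> x \<in> \<Omega> \<longleftrightarrow> 0 < h x" "h z = 0"
   "\<And>x. x \<in> cball z (R / (4 * M)) \<Longrightarrow> \<delta> x \<le> \<bar>h x\<bar>" "\<And>x. x \<in> cball z (R / (4 * M)) \<Longrightarrow> \<bar>h x\<bar> \<le> M * \<delta> x"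
proof -
  from charts[OF z] obtain e h where h: "height_function M e h"
   and iff: "\<And>x. x \<in> ball z R \<Longrightarrow> x \<in> \<Omega> \<longleftrightarrow> 0 < h x" by blast
  note hD = height_functionD[OF h]
  have fr0: "h p = 0" if p: "p \<in> frontier \<Omega>" "p \<in> ball z R" for p
  proof -
   have "\<not> 0 < h p" using iff[OF p(2)] frontier_not_dom[OF p(1)] by simp
   moreover have "\<not> h p < 0"
   proof
    assume "h p < 0"
    moreover have "open (ball z R \<inter> {x. h x < 0})"
     using hD(5) by (intro open_Int open_Collect_less continuous_intros) auto
    moreover have "p \<in> (ball z R \<inter> {x. h x < 0}) \<inter> closure \<Omega>"
     using \<open>h p < 0\<close> p frontier_closure[OF p(1)] by simp
    ultimately have "(ball z R \<inter> {x. h x < 0}) \<inter> \<Omega> \<noteq> {}"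
     using open_Int_closure_eq_empty[of "ball z R \<inter> {x. h x < 0}" \<Omega>] by blast
    then show False using iff by fastforce
   qed
   ultimately show ?thesis by simp
  qed
  have fr1: "p \<in> frontier \<Omega>" if p: "h p = 0" "p \<in> ball z R" for p
  proof -
   have "p \<in> closure \<Omega>"
   proof (unfold closure_approachable, intro allI impI)
    fix \<epsilon> :: real assume "\<epsilon> > 0"
    define t where "t = min (\<epsilon> / 2) ((R - dist z p) / 2)"
    have t: "t > 0" "t < \<epsilon>" "t < R - dist z p" using \<open>\<epsilon> > 0\<close> p(2) by (auto simp: t_def min_def)
    have "dist (p + t *\<^sub>R e) p = t" using t hD(1) by (simp add: dist_norm)
    moreover have "dist z (p + t *\<^sub>R e) \<le> dist z p + dist (p + t *\<^sub>R e) p"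
     using dist_triangle2[of z "p + t *\<^sub>R e" p] by (simp only: dist_commute)
    then have "p + t *\<^sub>R e \<in> ball z R"
     using t \<open>dist (p + t *\<^sub>R e) p = t\<close> unfolding mem_ball by linarith
    then have "p + t *\<^sub>R e \<in> \<Omega>" using iff hD(3)[of p t] p t by simp
    ultimately show "\<exists>y\<in>\<Omega>. dist y p < \<epsilon>" using t by (intro bexI[of _ "p + t *\<^sub>R e"]) auto
   qed
   moreover have "p \<notin> interior \<Omega>" using iff[OF p(2)] p(1) open_dom by (simp add: interior_open)
   ultimately show ?thesis by (simp add: frontier_def)
  qed
  have zR: "z \<in> ball z R" using R0 by simp
  have h0: "h z = 0" by (rule fr0[OF z zR])
  have r4: "R / (4 * M) \<le> R / 4" using R0 M1 by (intro divide_left_mono) auto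
  have up: "\<delta> x \<le> \<bar>h x\<bar>" if x: "x \<in> cball z (R / (4 * M))" for x
  proof -
   have "\<bar>h x\<bar> \<le> M * dist x z" using hD(2)[of x z] h0 by simp
   also have "\<dots> \<le> M * (R / (4 * M))" using M1 x by (intro mult_left_mono) (auto simp: dist_commute)
   also have "\<dots> = R / 4" using M1 by simp
   finally have hx: "\<bar>h x\<bar> \<le> R / 4" .
   let ?p = "x + (- h x) *\<^sub>R e"
   have d: "dist x ?p = \<bar>h x\<bar>" using hD(1) by (simp add: dist_norm)
   have "dist z ?p \<le> dist z x + \<bar>h x\<bar>" using dist_triangle[of z ?p x] unfolding d .
   then have "?p \<in> ball z R" using hx x r4 R0 unfolding mem_ball mem_cball by linarith
   then have "?p \<in> frontier \<Omega>" by (intro fr1) (subst hD(3), simp)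
   from bdist_le[OF this, of x] show ?thesis unfolding d .
  qed
  have low: "\<bar>h x\<bar> \<le> M * \<delta> x" if x: "x \<in> cball z (R / (4 * M))" for x
  proof -
   obtain p where p: "p \<in> frontier \<Omega>" "dist x p = \<delta> x" using bdist_attained by blast
   have "dist x p \<le> dist z x" using p bdist_le[OF z, of x] by (simp add: dist_commute)
   then have "p \<in> ball z R" using dist_triangle[of z p x] x r4 R0 by simp
   then have "h p = 0" using p fr0 by blast
   then show ?thesis using hD(2)[of x p] p by simp
  qed
  from that[OF h iff h0 up low] show thesis .
qed

lemma frontier_cover:
  assumes "\<rho> > 0"
  obtains F where "finite F" "F \<subseteq> frontier \<Omega>" "frontier \<Omega> \<subseteq> (\<Union>z\<in>F. ball z \<rho>)"
proof -
  have "frontier \<Omega> \<subseteq> (\<Union>z\<in>frontier \<Omega>. ball z \<rho>)" using assms by auto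
  from compactE_image[OF compact_frontier_dom _ this] obtain C
   where "C \<subseteq> frontier \<Omega>" "finite C" "frontier \<Omega> \<subseteq> (\<Union>z\<in>C. ball z \<rho>)" by auto
  then show thesis by (intro that)
qed

lemma frontier_null: "frontier \<Omega> \<in> null_sets lborel"
proof -
  have r: "R / (4 * M) > 0" using R0 M1 by simp
  obtain F where F: "finite F" "F \<subseteq> frontier \<Omega>" "frontier \<Omega> \<subseteq> (\<Union>z\<in>F. ball z (R / (4 * M)))"
   using frontier_cover[OF r] by blast
  have "frontier \<Omega> \<inter> cball z (R / (4 * M)) \<in> null_sets lborel" if "z \<in> F" for z
  proof -
   have z: "z \<in> frontier \<Omega>" using that F by blast
   obtain e h where h: "height_function M e h"
    and low: "\<And>x. x \<in> cball z (R / (4 * M)) \<Longrightarrow> \<bar>h x\<bar> \<le> M * \<delta> x"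
    using chart_obtain[OF z] by metis
   let ?A = "frontier \<Omega> \<inter> cball z (R / (4 * M))"
   have Am: "?A \<in> sets lborel" by simp
   have "emeasure lborel ?A = (\<integral>\<^sup>+x. indicator ?A x)"
    by (rule nn_integral_indicator[OF Am, symmetric])
   also have "\<dots> \<le> (\<integral>\<^sup>+x. indicator {0} (h x) * indicator (cball z (R / (4 * M))) x)"
   proof (intro nn_integral_mono)
    fix x
    have "h x = 0" if "x \<in> ?A"
    proof -
     have "\<delta> x = 0" using that bdist_eq_0_iff[of x] by simp
     then show ?thesis using low[of x] that by simp
    qed
    then show "indicator ?A x \<le> (indicator {0} (h x) * indicator (cball z (R / (4 * M))) x :: ennreal)"
     by (simp add: indicator_def)
   qed
   also have "\<dots> \<le> ennreal (unit_ball_vol (DIM('a)) * 2 ^ DIM('a) * (R / (4 * M)) powr (real DIM('a) - 1)) * (\<integral>\<^sup>+(t::real). indicator {0} t)"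
    by (rule layer_upper[OF h _ r]) simp
   also have "(\<integral>\<^sup>+(t::real). indicator {0} t) = 0" by simp
   finally have "emeasure lborel ?A \<le> 0" unfolding mult_zero_right .
   with Am show ?thesis by (intro null_setsI) simp_all
  qed
  then have null: "(\<Union>z\<in>F. frontier \<Omega> \<inter> cball z (R / (4 * M))) \<in> null_sets lborel"
   using F(1) by (intro null_sets.finite_UN) auto
  have "frontier \<Omega> \<subseteq> (\<Union>z\<in>F. frontier \<Omega> \<inter> cball z (R / (4 * M)))"
   using F(3) ball_subset_cball by blast
  then show ?thesis by (intro null_sets_subset[OF null]) simp_all
qed

lemma AE_bdist_pos: "AE x in lborel. \<delta> x > 0"
proof (rule AE_I'[OF frontier_null])
  show "{x \<in> space lborel. \<not> 0 < \<delta> x} \<subseteq> frontier \<Omega>"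
   using bdist_nonneg bdist_eq_0_iff by (smt (verit, best) mem_Collect_eq subsetI)
qed

lemma chart_bdist_powr_integral:
  fixes s r :: real
  assumes z: "z \<in> frontier \<Omega>" and r: "0 < r" "r \<le> R / (4 * M)" and s: "0 < s" "s < 1"
  shows "(\<integral>\<^sup>+x. ennreal (\<delta> x powr (- s)) * indicator (cball z r) x) \<le>
   ennreal (unit_ball_vol (DIM('a)) * 2 ^ DIM('a) * 2 * M ^ 2 * (r powr (real DIM('a) - s) / (1 - s)))"
proof -
  obtain e h where h: "height_function M e h" and h0: "h z = 0"
   and up: "\<And>x. x \<in> cball z (R / (4 * M)) \<Longrightarrow> \<delta> x \<le> \<bar>h x\<bar>"
   and low: "\<And>x. x \<in> cball z (R / (4 * M)) \<Longrightarrow> \<bar>h x\<bar> \<le> M * \<delta> x"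
   using chart_obtain[OF z] by metis
  let ?f = "\<lambda>t. ennreal M * (ennreal (\<bar>t\<bar> powr ((1 - s) - 1)) * indicator {-(M*r)..M*r} t)"
  have "(\<integral>\<^sup>+x. ennreal (\<delta> x powr (- s)) * indicator (cball z r) x)
   \<le> (\<integral>\<^sup>+x. ?f (h x) * indicator (cball z r) x)"
  proof (intro nn_integral_mono)
   fix x
   have "ennreal (\<delta> x powr (- s)) \<le> ?f (h x)" if x: "x \<in> cball z r"
   proof -
    have x': "x \<in> cball z (R / (4 * M))" using x r by simp
    have "\<bar>h x\<bar> \<le> M * dist x z" using height_functionD(2)[OF h, of x z] h0 by simp
    also have "\<dots> \<le> M * r" using M1 x by (intro mult_left_mono) (auto simp: dist_commute)
    finally have hx: "\<bar>h x\<bar> \<le> M * r" .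
    have "\<delta> x powr (- s) \<le> M * \<bar>h x\<bar> powr (- s)"
    proof (cases "\<delta> x = 0")
     case False
     then have pos: "\<delta> x > 0" using bdist_nonneg[of x] by linarith
     then have hp: "\<bar>h x\<bar> > 0" using up[OF x'] by linarith
     have "\<bar>h x\<bar> / M \<le> \<delta> x" using low[OF x'] M1 by (simp add: field_simps)
     then have "\<delta> x powr (- s) \<le> (\<bar>h x\<bar> / M) powr (- s)"
      using hp M1 s by (intro powr_mono2') auto
     also have "\<dots> = M powr s * \<bar>h x\<bar> powr (- s)"
      using M1 by (subst powr_divide_eq) simp_all
     also have "\<dots> \<le> M powr 1 * \<bar>h x\<bar> powr (- s)"
      using M1 s by (intro mult_right_mono powr_mono) auto
     finally show ?thesis using M1 by simp
    qed (use M1 in simp)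
    then have "ennreal (\<delta> x powr (- s)) \<le> ennreal M * ennreal (\<bar>h x\<bar> powr ((1 - s) - 1))"
     using M1 by (subst ennreal_mult[symmetric]) (auto intro!: ennreal_leI)
    then show ?thesis using hx by (simp add: indicator_def abs_le_iff)
   qed
   then show "ennreal (\<delta> x powr (- s)) * indicator (cball z r) x \<le> ?f (h x) * indicator (cball z r) x"
    by (auto simp: indicator_def)
  qed
  also have "\<dots> \<le> ennreal (unit_ball_vol (DIM('a)) * 2 ^ DIM('a) * r powr (real DIM('a) - 1)) * (\<integral>\<^sup>+t. ?f t)"
   by (rule layer_upper[OF h _ r(1)]) measurable
  also have "(\<integral>\<^sup>+t. ?f t) = ennreal M * ennreal (2 * ((M * r) powr (1 - s) / (1 - s)))"
   using s r M1 nn_integral_abs_powr_near[of "1 - s" "M * r"]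
   by (subst nn_integral_cmult) simp_all
  also have "ennreal (unit_ball_vol (DIM('a)) * 2 ^ DIM('a) * r powr (real DIM('a) - 1)) * \<dots> =
   ennreal (unit_ball_vol (DIM('a)) * 2 ^ DIM('a) * r powr (real DIM('a) - 1) * (M * (2 * ((M * r) powr (1 - s) / (1 - s)))))"
   by (rule ennreal_mult_assoc3) (use M1 s in auto)
  also have "\<dots> \<le> ennreal (unit_ball_vol (DIM('a)) * 2 ^ DIM('a) * 2 * M ^ 2 * (r powr (real DIM('a) - s) / (1 - s)))"
  proof (rule ennreal_leI)
   have "M powr (1 - s) \<le> M powr 1" using M1 s by (intro powr_mono) auto
   then have Mp: "M powr (1 - s) \<le> M" using M1 by simp
   have rr: "r powr (real DIM('a) - 1) * r powr (1 - s) = r powr (real DIM('a) - s)"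
    using r by (simp add: powr_add[symmetric])
   have "unit_ball_vol (DIM('a)) * 2 ^ DIM('a) * r powr (real DIM('a) - 1) * (M * (2 * ((M * r) powr (1 - s) / (1 - s))))
    = unit_ball_vol (DIM('a)) * 2 ^ DIM('a) * 2 * M * M powr (1 - s) * (r powr (real DIM('a) - s) / (1 - s))"
    unfolding rr[symmetric] using M1 r by (simp add: powr_mult)
   also have "\<dots> \<le> unit_ball_vol (DIM('a)) * 2 ^ DIM('a) * 2 * M * M * (r powr (real DIM('a) - s) / (1 - s))"
    using Mp M1 s by (intro mult_right_mono mult_left_mono) auto
   finally show "unit_ball_vol (DIM('a)) * 2 ^ DIM('a) * r powr (real DIM('a) - 1) * (M * (2 * ((M * r) powr (1 - s) / (1 - s))))
    \<le> unit_ball_vol (DIM('a)) * 2 ^ DIM('a) * 2 * M ^ 2 * (r powr (real DIM('a) - s) / (1 - s))"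
    by (simp add: power2_eq_square mult.assoc)
  qed
  finally show ?thesis .
qed

text \<open>The layer of width \<open>t\<close> around the boundary has volume of order \<open>t\<close>; hence \<open>\<delta>\<^sup>-\<^sup>s\<close> is
  integrable, with the constant \<open>1 / (1 - s)\<close> of the one-dimensional integral.\<close>

lemma bdist_powr_integral:
  "\<exists>C>0. \<forall>(s::real) z (r::real). 0 < s \<longrightarrow> s < 1 \<longrightarrow> z \<in> frontier \<Omega> \<longrightarrow> 0 < r \<longrightarrow> r \<le> 8 * D \<longrightarrow>
   (\<integral>\<^sup>+x. ennreal (\<delta> x powr (- s)) * indicator (cball z r) x) \<le>
    ennreal (C * (r powr (real DIM('a) - s) / (1 - s)))"
proof -
  let ?w = "unit_ball_vol (DIM('a))"
  define \<rho> where "\<rho> = R / (4 * M)"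
  have "R / (4 * M) \<le> 1 / 1" using R0 R1 M1 by (intro frac_le) auto
  then have \<rho>: "0 < \<rho>" "\<rho> \<le> 1" using R0 M1 by (auto simp: \<rho>_def)
  obtain F where F: "finite F" "F \<subseteq> frontier \<Omega>" "frontier \<Omega> \<subseteq> (\<Union>z\<in>F. ball z (\<rho>/2))"
   using frontier_cover[of "\<rho>/2"] \<rho> by auto
  define C1 where "C1 = ?w * 2 ^ DIM('a) * 2 * M ^ 2"
  define K where "K = real (card F) * C1 + (2 / \<rho>) * (?w * (8 * D) ^ DIM('a))"
  have C1: "C1 > 0" using M1 by (simp add: C1_def)
  have K: "K \<ge> 0" using C1 \<rho> D1 by (simp add: K_def)
  have big: "(\<integral>\<^sup>+x. ennreal (\<delta> x powr (- s)) * indicator (cball z (8 * D)) x) \<le> ennreal (K / (1 - s))"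
   if s: "0 < s" "s < 1" for s :: real and z
  proof -
   have "ennreal (\<delta> x powr (- s)) * indicator (cball z (8 * D)) x \<le>
    (\<Sum>w\<in>F. ennreal (\<delta> x powr (- s)) * indicator (cball w \<rho>) x) + ennreal (2 / \<rho>) * indicator (cball z (8 * D)) x" for x
   proof (cases "\<delta> x < \<rho> / 2")
    case True
    obtain p where p: "p \<in> frontier \<Omega>" "dist x p = \<delta> x" using bdist_attained by blast
    then obtain w where w: "w \<in> F" "dist w p < \<rho> / 2" using F(3) by auto
    then have "x \<in> cball w \<rho>" using dist_triangle[of w x p] p True by (simp add: dist_commute)
    then have "ennreal (\<delta> x powr (- s)) * indicator (cball z (8 * D)) x \<le> ennreal (\<delta> x powr (- s)) * indicator (cball w \<rho>) x"
     by (auto simp: indicator_def)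
    also have "\<dots> \<le> (\<Sum>w\<in>F. ennreal (\<delta> x powr (- s)) * indicator (cball w \<rho>) x)"
     using w F(1) by (intro member_le_sum) auto
    finally show ?thesis by (simp add: add_increasing2)
   next
    case False
    then have "\<delta> x powr (- s) \<le> (\<rho> / 2) powr (- s)" using \<rho> s by (intro powr_mono2') auto
    also have "\<dots> = (2 / \<rho>) powr s" using \<rho> by (simp only: powr_minus inverse_powr[symmetric] inverse_divide)
    also have "\<dots> \<le> (2 / \<rho>) powr 1" using \<rho> s by (intro powr_mono) auto
    finally have "ennreal (\<delta> x powr (- s)) * indicator (cball z (8 * D)) x \<le> ennreal (2 / \<rho>) * indicator (cball z (8 * D)) x"
     using \<rho> by (intro mult_right_mono ennreal_leI) auto
    then show ?thesis by (simp add: add_increasing)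
   qed
   then have "(\<integral>\<^sup>+x. ennreal (\<delta> x powr (- s)) * indicator (cball z (8 * D)) x) \<le>
    (\<integral>\<^sup>+x. (\<Sum>w\<in>F. ennreal (\<delta> x powr (- s)) * indicator (cball w \<rho>) x) + ennreal (2 / \<rho>) * indicator (cball z (8 * D)) x)"
    by (intro nn_integral_mono)
   also have "\<dots> = (\<Sum>w\<in>F. \<integral>\<^sup>+x. ennreal (\<delta> x powr (- s)) * indicator (cball w \<rho>) x) +
     ennreal (2 / \<rho>) * ennreal (?w * (8 * D) ^ DIM('a))"
   proof (subst nn_integral_add)
    show "(\<integral>\<^sup>+x. (\<Sum>w\<in>F. ennreal (\<delta> x powr (- s)) * indicator (cball w \<rho>) x)) +
      (\<integral>\<^sup>+x. ennreal (2 / \<rho>) * indicator (cball z (8 * D)) x) =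
     (\<Sum>w\<in>F. \<integral>\<^sup>+x. ennreal (\<delta> x powr (- s)) * indicator (cball w \<rho>) x) +
      ennreal (2 / \<rho>) * ennreal (?w * (8 * D) ^ DIM('a))"
    proof (intro arg_cong2[where f="(+)"])
     show "(\<integral>\<^sup>+x. (\<Sum>w\<in>F. ennreal (\<delta> x powr (- s)) * indicator (cball w \<rho>) x)) =
      (\<Sum>w\<in>F. \<integral>\<^sup>+x. ennreal (\<delta> x powr (- s)) * indicator (cball w \<rho>) x)"
      unfolding indicator_cball_eq by (rule nn_integral_sum) measurable
     have "(\<integral>\<^sup>+x. ennreal (2 / \<rho>) * indicator (cball z (8 * D)) x) = ennreal (2 / \<rho>) * emeasure lborel (cball z (8 * D))"
      by (rule nn_integral_cmult_indicator) simp
     also have "emeasure lborel (cball z (8 * D)) = ennreal (?w * (8 * D) ^ DIM('a))"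
      using D1 by (intro emeasure_cball) simp
     finally show "(\<integral>\<^sup>+x. ennreal (2 / \<rho>) * indicator (cball z (8 * D)) x) =
      ennreal (2 / \<rho>) * ennreal (?w * (8 * D) ^ DIM('a))" .
    qed
   qed (unfold indicator_cball_eq, measurable)
   also have "\<dots> \<le> (\<Sum>w\<in>F. ennreal (C1 / (1 - s))) + ennreal (2 / \<rho>) * ennreal (?w * (8 * D) ^ DIM('a))"
   proof (intro add_right_mono sum_mono)
    fix w assume "w \<in> F"
    then have "(\<integral>\<^sup>+x. ennreal (\<delta> x powr (- s)) * indicator (cball w \<rho>) x)
     \<le> ennreal (C1 * (\<rho> powr (real DIM('a) - s) / (1 - s)))"
     unfolding C1_def using F(2) \<rho> s by (intro chart_bdist_powr_integral) (auto simp: \<rho>_def)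
    also have "\<dots> \<le> ennreal (C1 / (1 - s))"
    proof (rule ennreal_leI)
     have "\<rho> powr (real DIM('a) - s) \<le> 1" using \<rho> s less_le_trans[OF s(2) DIM_ge_1[where 'a='a]]
      by (intro powr_le1) auto
     then have "C1 * (\<rho> powr (real DIM('a) - s) / (1 - s)) \<le> C1 * (1 / (1 - s))"
      using s C1 by (intro mult_left_mono divide_right_mono) auto
     then show "C1 * (\<rho> powr (real DIM('a) - s) / (1 - s)) \<le> C1 / (1 - s)" by simp
    qed
    finally show "(\<integral>\<^sup>+x. ennreal (\<delta> x powr (- s)) * indicator (cball w \<rho>) x) \<le> ennreal (C1 / (1 - s))" .
   qed
   also have "\<dots> = ennreal (real (card F) * (C1 / (1 - s)) + (2 / \<rho>) * (?w * (8 * D) ^ DIM('a)))"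
   proof -
    have p: "0 \<le> real (card F) * (C1 / (1 - s))" "0 \<le> 2 / \<rho>" "0 \<le> ?w * (8 * D) ^ DIM('a)"
     using C1 \<rho> D1 s by auto
    have "(\<Sum>w\<in>F. ennreal (C1 / (1 - s))) = ennreal (\<Sum>w\<in>F. C1 / (1 - s))"
     using C1 s by (intro sum_ennreal) simp
    also have "(\<Sum>w\<in>F. C1 / (1 - s)) = real (card F) * (C1 / (1 - s))" by (rule sum_constant)
    finally show ?thesis
     using ennreal_plus[OF p(1) mult_nonneg_nonneg[OF p(2,3)]] ennreal_mult[OF p(2,3)] by (simp only:)
   qed
   also have "\<dots> \<le> ennreal (K / (1 - s))"
   proof (rule ennreal_leI)
    have "(2 / \<rho>) * (?w * (8 * D) ^ DIM('a)) \<le> (2 / \<rho>) * (?w * (8 * D) ^ DIM('a)) / (1 - s)"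
    proof -
     have "x \<le> x / (1 - s)" if "x \<ge> 0" for x
      using s that mult_left_le[of "1 - s" x] by (subst le_divide_eq) auto
     moreover have "(2 / \<rho>) * (?w * (8 * D) ^ DIM('a)) \<ge> 0" using \<rho> D1 by simp
     ultimately show ?thesis by blast
    qed
    then show "real (card F) * (C1 / (1 - s)) + (2 / \<rho>) * (?w * (8 * D) ^ DIM('a)) \<le> K / (1 - s)"
     by (simp add: K_def add_divide_distrib)
   qed
   finally show ?thesis .
  qed
  define C where "C = C1 + K / \<rho> ^ DIM('a)"
  have "C > 0" using C1 K \<rho> by (simp add: C_def add_pos_nonneg)
  moreover have "(\<integral>\<^sup>+x. ennreal (\<delta> x powr (- s)) * indicator (cball z r) x) \<le>
    ennreal (C * (r powr (real DIM('a) - s) / (1 - s)))"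
   if s: "0 < s" "s < 1" and z: "z \<in> frontier \<Omega>" and r: "0 < r" "r \<le> 8 * D" for s r :: real and z
  proof (cases "r \<le> \<rho>")
   case True
   then have "(\<integral>\<^sup>+x. ennreal (\<delta> x powr (- s)) * indicator (cball z r) x) \<le> ennreal (C1 * (r powr (real DIM('a) - s) / (1 - s)))"
    unfolding C1_def using z r s by (intro chart_bdist_powr_integral) (auto simp: \<rho>_def)
   also have "\<dots> \<le> ennreal (C * (r powr (real DIM('a) - s) / (1 - s)))"
    using s K \<rho> by (intro ennreal_leI mult_right_mono) (auto simp: C_def)
   finally show ?thesis .
  next
   case False
   have "(\<integral>\<^sup>+x. ennreal (\<delta> x powr (- s)) * indicator (cball z r) x) \<le>
    (\<integral>\<^sup>+x. ennreal (\<delta> x powr (- s)) * indicator (cball z (8 * D)) x)"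
    using r by (intro nn_integral_mono) (auto simp: indicator_def)
   also have "\<dots> \<le> ennreal (K / (1 - s))" by (rule big[OF s])
   also have "\<dots> \<le> ennreal (C * (r powr (real DIM('a) - s) / (1 - s)))"
   proof (rule ennreal_leI)
    have "\<rho> powr real DIM('a) \<le> r powr (real DIM('a) - s)"
     using \<rho> False s less_le_trans[OF s(2) DIM_ge_1[where 'a='a]]
     by (intro powr_le_of_ge) auto
    then have "\<rho> ^ DIM('a) \<le> r powr (real DIM('a) - s)" using \<rho> by (simp add: powr_realpow)
    then have "K / \<rho> ^ DIM('a) * \<rho> ^ DIM('a) \<le> C * r powr (real DIM('a) - s)"
     using K \<rho> C1 by (intro mult_mono) (auto simp: C_def)
    then have "K \<le> C * r powr (real DIM('a) - s)" using \<rho> by simp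
    then show "K / (1 - s) \<le> C * (r powr (real DIM('a) - s) / (1 - s))"
     using s by (simp add: divide_right_mono)
   qed
   finally show ?thesis .
  qed
  ultimately show ?thesis by blast
qed

text \<open>Below the graph the heights fill a whole interval next to zero, and \<open>\<delta>\<close> is comparable with
the height; the comparison works for both signs of the exponent \<open>1 - 2 s\<close>.\<close>

lemma exterior_mass_lower:
  "\<exists>c>0. \<forall>(s::real) z (r::real). 0 < s \<longrightarrow> s < 1 \<longrightarrow> z \<in> frontier \<Omega> \<longrightarrow> 0 < r \<longrightarrow> r \<le> D \<longrightarrow>
   ennreal (c * (r powr (real DIM('a) + 1 - 2 * s) / (1 - s))) \<le>
   (\<integral>\<^sup>+x. ennreal (\<delta> x powr (1 - 2 * s)) * indicator (cball z r - \<Omega>) x)"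
proof -
  let ?w = "unit_ball_vol (DIM('a))"
  define \<rho> where "\<rho> = R / (4 * M)"
  have "R / (4 * M) \<le> 1 / 1" using R0 R1 M1 by (intro frac_le) auto
  then have \<rho>: "0 < \<rho>" "\<rho> \<le> 1" using R0 M1 by (auto simp: \<rho>_def)
  define c1 where "c1 = ?w / (4 * M) ^ DIM('a) / M / 32"
  have c1: "c1 > 0" using M1 by (simp add: c1_def)
  have small: "ennreal (c1 * (r powr (real DIM('a) + 1 - 2 * s) / (1 - s))) \<le>
   (\<integral>\<^sup>+x. ennreal (\<delta> x powr (1 - 2 * s)) * indicator (cball z r - \<Omega>) x)"
   if s: "0 < s" "s < 1" and z: "z \<in> frontier \<Omega>" and r: "0 < r" "r \<le> \<rho>" for s r :: real and z
  proof -
   obtain e h where h: "height_function M e h" and h0: "h z = 0"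
    and iff: "\<And>x. x \<in> ball z R \<Longrightarrow> x \<in> \<Omega> \<longleftrightarrow> 0 < h x"
    and up: "\<And>x. x \<in> cball z (R / (4 * M)) \<Longrightarrow> \<delta> x \<le> \<bar>h x\<bar>"
    and low: "\<And>x. x \<in> cball z (R / (4 * M)) \<Longrightarrow> \<bar>h x\<bar> \<le> M * \<delta> x"
    using chart_obtain[OF z] by metis
   have r4: "R / (4 * M) \<le> R / 4" using R0 M1 by (intro divide_left_mono) auto
   let ?f = "\<lambda>t. ennreal (1 / M) * (ennreal (\<bar>t\<bar> powr ((2 - 2 * s) - 1)) * indicator {..0} t)"
   have "c1 * (r powr (real DIM('a) + 1 - 2 * s) / (1 - s)) \<le>
     ?w / (4 * M) ^ DIM('a) * r powr (real DIM('a) - 1) * (1 / M * ((r / 4) powr (2 - 2 * s) / (2 - 2 * s)))"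
   proof -
    have "(1 / 4) powr 2 \<le> (1 / 4) powr (2 - 2 * s)" using s by (intro powr_mono') auto
    then have q: "1 / 16 \<le> (1 / 4) powr (2 - 2 * s)" by (simp add: powr_numeral power2_eq_square)
    have rr: "r powr (real DIM('a) + 1 - 2 * s) = r powr (real DIM('a) - 1) * r powr (2 - 2 * s)"
     using r by (subst powr_add[symmetric]) (simp add: algebra_simps)
    have r4p: "(r / 4) powr (2 - 2 * s) = r powr (2 - 2 * s) * (1 / 4) powr (2 - 2 * s)"
     using r powr_mult[of r "1/4" "2 - 2 * s"] by simp
    have e1: "c1 * (r powr (real DIM('a) + 1 - 2 * s) / (1 - s)) =
      (?w / (4 * M) ^ DIM('a) * r powr (real DIM('a) - 1) * (1 / M) * (r powr (2 - 2 * s) / (2 - 2 * s))) * (1 / 16)"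
     unfolding rr c1_def using s M1 by (simp add: divide_simps)
    have e2: "?w / (4 * M) ^ DIM('a) * r powr (real DIM('a) - 1) * (1 / M * ((r / 4) powr (2 - 2 * s) / (2 - 2 * s)))
     = (?w / (4 * M) ^ DIM('a) * r powr (real DIM('a) - 1) * (1 / M) * (r powr (2 - 2 * s) / (2 - 2 * s))) * (1 / 4) powr (2 - 2 * s)"
     unfolding r4p by simp
    show ?thesis unfolding e1 e2 using q s M1 by (intro mult_left_mono) auto
   qed
   then have "ennreal (c1 * (r powr (real DIM('a) + 1 - 2 * s) / (1 - s))) \<le>
    ennreal (?w / (4 * M) ^ DIM('a) * r powr (real DIM('a) - 1) * (1 / M * ((r / 4) powr (2 - 2 * s) / (2 - 2 * s))))"
    by (rule ennreal_leI)
   also have "\<dots> = ennreal (?w / (4 * M) ^ DIM('a) * r powr (real DIM('a) - 1)) *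
     (ennreal (1 / M) * ennreal ((r / 4) powr (2 - 2 * s) / (2 - 2 * s)))"
    by (rule ennreal_mult_assoc3[symmetric]) (use M1 s in auto)
   also have "ennreal (1 / M) * ennreal ((r / 4) powr (2 - 2 * s) / (2 - 2 * s)) =
    (\<integral>\<^sup>+t. ennreal (1 / M) * (ennreal (\<bar>t\<bar> powr ((2 - 2 * s) - 1)) * indicator {-(r/4)..0} t))"
    using s r nn_integral_neg_powr_near[of "2 - 2 * s" "r / 4"] by (subst nn_integral_cmult) simp_all
   also have "\<dots> \<le> (\<integral>\<^sup>+t. ?f t * indicator {-r/4..r/4} t)"
    using r by (intro nn_integral_mono) (auto simp: indicator_def)
   also have "ennreal (?w / (4 * M) ^ DIM('a) * r powr (real DIM('a) - 1)) * (\<integral>\<^sup>+t. ?f t * indicator {-r/4..r/4} t)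
     \<le> (\<integral>\<^sup>+x. ?f (h x) * indicator (cball z r) x)"
    by (rule layer_lower[OF h _ r(1) M1 h0]) measurable
   also have "\<dots> \<le> (\<integral>\<^sup>+x. ennreal (\<delta> x powr (1 - 2 * s)) * indicator (cball z r - \<Omega>) x)"
   proof (intro nn_integral_mono)
    fix x
    have "ennreal (1 / M) * ennreal (\<bar>h x\<bar> powr ((2 - 2 * s) - 1)) \<le> ennreal (\<delta> x powr (1 - 2 * s)) \<and> x \<notin> \<Omega>"
     if x: "x \<in> cball z r" and hx: "h x \<le> 0"
    proof
     have x': "x \<in> cball z (R / (4 * M))" using x r by (simp add: \<rho>_def)
     then have "x \<in> ball z R" using r4 R0 by simp
     then show "x \<notin> \<Omega>" using iff hx by force
     have "1 / M * \<bar>h x\<bar> powr (1 - 2 * s) \<le> \<delta> x powr (1 - 2 * s)"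
     proof (cases "h x = 0")
      case False
      then have hp: "\<bar>h x\<bar> > 0" by simp
      have lo: "\<bar>h x\<bar> / M \<le> \<delta> x" using low[OF x'] M1 by (simp add: field_simps)
      have pos: "\<delta> x > 0" using lo hp M1 by (smt (verit) divide_pos_pos)
      show ?thesis
      proof (cases "1 - 2 * s \<ge> 0")
       case True
       have "1 / M * \<bar>h x\<bar> powr (1 - 2 * s) = M powr (-1) * \<bar>h x\<bar> powr (1 - 2 * s)"
        using M1 by (simp add: powr_minus divide_inverse)
       also have "\<dots> \<le> M powr (- (1 - 2 * s)) * \<bar>h x\<bar> powr (1 - 2 * s)"
        using M1 s by (intro mult_right_mono powr_mono) auto
       also have "\<dots> = (\<bar>h x\<bar> / M) powr (1 - 2 * s)"
        using M1 by (subst powr_divide_eq) simp_all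
       also have "\<dots> \<le> \<delta> x powr (1 - 2 * s)" using lo True M1 by (intro powr_mono2) auto
       finally show ?thesis .
      next
       case False
       have "1 / M * \<bar>h x\<bar> powr (1 - 2 * s) \<le> 1 * \<bar>h x\<bar> powr (1 - 2 * s)"
        using M1 by (intro mult_right_mono) auto
       also have "\<dots> \<le> \<delta> x powr (1 - 2 * s)"
        using False up[OF x'] pos by (simp, intro powr_mono2') auto
       finally show ?thesis .
      qed
     qed simp
     then show "ennreal (1 / M) * ennreal (\<bar>h x\<bar> powr ((2 - 2 * s) - 1)) \<le> ennreal (\<delta> x powr (1 - 2 * s))"
      using M1 by (subst ennreal_mult[symmetric]) (auto intro!: ennreal_leI)
    qed
    then show "?f (h x) * indicator (cball z r) x \<le> ennreal (\<delta> x powr (1 - 2 * s)) * indicator (cball z r - \<Omega>) x"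
     by (auto simp: indicator_def)
   qed
   finally show ?thesis by (simp add: mult_left_mono)
  qed
  define c where "c = c1 * (\<rho> / D) powr (real DIM('a) + 1)"
  have \<rho>D: "0 < \<rho> / D" "\<rho> / D \<le> 1" using \<rho> D1 by auto
  have c: "c > 0" using c1 \<rho> D1 by (simp add: c_def)
  have "ennreal (c * (r powr (real DIM('a) + 1 - 2 * s) / (1 - s))) \<le>
   (\<integral>\<^sup>+x. ennreal (\<delta> x powr (1 - 2 * s)) * indicator (cball z r - \<Omega>) x)"
   if s: "0 < s" "s < 1" and z: "z \<in> frontier \<Omega>" and r: "0 < r" "r \<le> D" for s r :: real and z
  proof -
   let ?r = "r * (\<rho> / D)"
   have r': "0 < ?r" "?r \<le> \<rho>" "?r \<le> r"
    using r \<rho> D1 \<rho>D by (auto simp: field_simps mult_left_le mult_right_le_one_le)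
   have "(\<rho> / D) powr (real DIM('a) + 1) \<le> (\<rho> / D) powr (real DIM('a) + 1 - 2 * s)"
    using s \<rho>D by (intro powr_mono') auto
   then have "c1 * (\<rho> / D) powr (real DIM('a) + 1) * (r powr (real DIM('a) + 1 - 2 * s) / (1 - s)) \<le>
    c1 * (\<rho> / D) powr (real DIM('a) + 1 - 2 * s) * (r powr (real DIM('a) + 1 - 2 * s) / (1 - s))"
    using c1 s by (intro mult_right_mono mult_left_mono) auto
   also have "\<dots> = c1 * (?r powr (real DIM('a) + 1 - 2 * s) / (1 - s))"
    using powr_mult[of r "\<rho> / D" "real DIM('a) + 1 - 2 * s"] r \<rho>D by (simp add: mult_ac)
   finally have "ennreal (c * (r powr (real DIM('a) + 1 - 2 * s) / (1 - s))) \<le> ennreal (c1 * (?r powr (real DIM('a) + 1 - 2 * s) / (1 - s)))"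
    unfolding c_def by (rule ennreal_leI)
   also have "\<dots> \<le> (\<integral>\<^sup>+x. ennreal (\<delta> x powr (1 - 2 * s)) * indicator (cball z ?r - \<Omega>) x)"
    by (rule small[OF s z r'(1,2)])
   also have "\<dots> \<le> (\<integral>\<^sup>+x. ennreal (\<delta> x powr (1 - 2 * s)) * indicator (cball z r - \<Omega>) x)"
    using r' by (intro nn_integral_mono) (auto simp: indicator_def)
   finally show ?thesis .
  qed
  with c show ?thesis by blast
qed

end

section \<open>Kernel estimates for the extension\<close>

text \<open>The weights of the trace space, on an arbitrary Euclidean space.\<close>

definition tau_density :: "real \<Rightarrow> 'a::euclidean_space set \<Rightarrow> 'a \<Rightarrow> real" where
  "tau_density s \<Omega> x = (1 - s) / (bdist \<Omega> x powr s * (1 + bdist \<Omega> x) powr (real DIM('a) + s))"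

definition trace_kernel :: "real \<Rightarrow> 'a::euclidean_space set \<Rightarrow> 'a \<Rightarrow> 'a \<Rightarrow> real" where
  "trace_kernel s \<Omega> x y = (1 - s)\<^sup>2 /
    (bdist \<Omega> x powr s * (1 + bdist \<Omega> x) powr s * (bdist \<Omega> y powr s * (1 + bdist \<Omega> y) powr s) *
     (dist x y + bdist \<Omega> x * bdist \<Omega> y + bdist \<Omega> x + bdist \<Omega> y) ^ DIM('a))"

lemma powr_neg_antimono:
  fixes a b c :: real
  assumes "0 < a" "a \<le> b" "0 \<le> c"
  shows "b powr (- c) \<le> a powr (- c)"
  using assms by (intro powr_mono2') auto

lemma powr_neg_le_scaled:
  fixes k a b c q :: real
  assumes "0 < a" "a \<le> k * b" "1 \<le> k" "0 \<le> c" "c \<le> q"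
  shows "b powr (- c) \<le> k powr q * a powr (- c)"
proof -
  have b: "0 < b" using assms by (smt (verit) zero_less_mult_pos)
  have "(k * b) powr (- c) \<le> a powr (- c)" using assms by (intro powr_neg_antimono) auto
  moreover have "(k * b) powr (- c) = k powr (- c) * b powr (- c)" using assms b by (simp add: powr_mult)
  moreover have "k powr q * k powr (- c) \<ge> 1"
   using assms by (simp add: powr_add[symmetric] ge_one_powr_ge_zero)
  ultimately have "b powr (- c) * 1 \<le> k powr q * a powr (- c)"
  proof -
   have "b powr (- c) * 1 \<le> b powr (- c) * (k powr q * k powr (- c))"
    using \<open>k powr q * k powr (- c) \<ge> 1\<close> by (intro mult_left_mono) auto
   also have "\<dots> = k powr q * (k * b) powr (- c)"
    using \<open>(k * b) powr (- c) = k powr (- c) * b powr (- c)\<close> by simp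
   also have "\<dots> \<le> k powr q * a powr (- c)"
    using \<open>(k * b) powr (- c) \<le> a powr (- c)\<close> by (intro mult_left_mono) auto
   finally show ?thesis .
  qed
  then show ?thesis by simp
qed

context lipschitz_domain
begin

text \<open>Up to constants, the normalized weight with which the value at \<open>y\<close> enters the average that defines
the extension at \<open>x\<close>.\<close>

definition mker :: "real \<Rightarrow> 'a \<Rightarrow> 'a \<Rightarrow> real" where
  "mker s x y = (if x \<in> \<Omega> \<and> y \<notin> \<Omega> \<and> dist x y \<le> 4 * \<delta> x
   then (1 - s) * \<delta> y powr (1 - 2 * s) * \<delta> x powr (2 * s - 1 - real DIM('a)) else 0)"

lemma mker_nonneg: "s < 1 \<Longrightarrow> 0 \<le> mker s x y"
  by (simp add: mker_def)

lemma mker_measurable [measurable]: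
  assumes [measurable]: "f \<in> borel_measurable N" "g \<in> borel_measurable N"
  shows "(\<lambda>x. mker s (f x) (g x)) \<in> borel_measurable N"
  unfolding mker_def by measurable

lemma mker_nonzeroD:
  assumes "mker s x y \<noteq> 0"
  shows "x \<in> \<Omega>" "y \<notin> \<Omega>" "dist x y \<le> 4 * \<delta> x" "\<delta> x \<le> dist x y" "\<delta> y \<le> dist x y" "0 < \<delta> x"
   "dist x y \<le> 4 * D"
proof -
  show xy: "x \<in> \<Omega>" "y \<notin> \<Omega>" "dist x y \<le> 4 * \<delta> x"
   using assms by (auto simp: mker_def split: if_splits)
  show "\<delta> x \<le> dist x y" "\<delta> y \<le> dist x y" by (rule crossing[OF xy(1,2)])+
  show "0 < \<delta> x" by (rule bdist_pos[OF xy(1)])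
  show "dist x y \<le> 4 * D" using xy(3) bdist_le_D[OF xy(1)] by linarith
qed

text \<open>On the support \<open>\<delta> y \<le> dist x y\<close>, so the last factor is at most one; for small \<open>s\<close> it provides
the decay that the other power lacks.\<close>

lemma mker_le:
  assumes s: "0 < s" "s < 1" and y: "0 < \<delta> y"
  shows "mker s x y \<le> 4 powr (real DIM('a) + 1) * (1 - s) * \<delta> y powr (- s) *
   (dist x y powr (s - real DIM('a)) * (\<delta> y / dist x y) powr (1 - s))"
proof (cases "mker s x y = 0")
  case False
  note D = mker_nonzeroD[OF False]
  have \<rho>: "0 < dist x y" using D(5) y by linarith
  have "\<delta> x powr (- (real DIM('a) + 1 - 2 * s)) \<le> 4 powr (real DIM('a) + 1) * dist x y powr (- (real DIM('a) + 1 - 2 * s))"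
   using D \<rho> s DIM_ge_1[where 'a='a] by (intro powr_neg_le_scaled) linarith+
  then have 1: "\<delta> x powr (2 * s - 1 - real DIM('a)) \<le> 4 powr (real DIM('a) + 1) * dist x y powr (2 * s - 1 - real DIM('a))"
   by (simp add: algebra_simps)
  have "mker s x y = (1 - s) * \<delta> y powr (1 - 2 * s) * \<delta> x powr (2 * s - 1 - real DIM('a))"
   using False by (simp add: mker_def split: if_splits)
  also have "\<dots> \<le> (1 - s) * \<delta> y powr (1 - 2 * s) * (4 powr (real DIM('a) + 1) * dist x y powr (2 * s - 1 - real DIM('a)))"
   using 1 s by (intro mult_left_mono) auto
  also have "\<dots> = 4 powr (real DIM('a) + 1) * (1 - s) * \<delta> y powr (- s) *
   (dist x y powr (s - real DIM('a)) * (\<delta> y / dist x y) powr (1 - s))"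
  proof -
   have "\<delta> y powr (1 - 2 * s) = \<delta> y powr (- s) * \<delta> y powr (1 - s)"
    by (subst powr_add[symmetric]) simp
   moreover have "dist x y powr (2 * s - 1 - real DIM('a)) = dist x y powr (s - real DIM('a)) * dist x y powr (- (1 - s))"
    by (subst powr_add[symmetric]) (simp add: algebra_simps)
   moreover have "(\<delta> y / dist x y) powr (1 - s) = \<delta> y powr (1 - s) * dist x y powr (- (1 - s))"
    by (subst powr_divide_eq) simp
   ultimately show ?thesis by (simp only: mult_ac)
  qed
  finally show ?thesis .
qed (use s in simp)

text \<open>For \<open>s \<ge> 1/4\<close> the power \<open>dist x y\<^sup>s\<^sup>-\<^sup>d\<close> is integrated over the ball. For smaller \<open>s\<close> the constant \<open>1/s\<close>
of that integral would not be uniform; there the factor \<open>(\<delta> y / dist x y)\<^sup>1\<^sup>-\<^sup>s\<close> makes the integral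
converge at the scale \<open>\<delta> y\<close>, which is at most \<open>r\<close> unless the integral vanishes.\<close>

lemma mker_ball:
  "\<exists>C>0. \<forall>s y r. 0 < s \<longrightarrow> s < 1 \<longrightarrow> 0 < \<delta> y \<longrightarrow> 0 < r \<longrightarrow>
   (\<integral>\<^sup>+x. ennreal (mker s x y) * indicator {..r} (dist x y)) \<le>
    ennreal (C * ((1 - s) * \<delta> y powr (- s) * r powr s))"
proof -
  let ?S = "sphere_area TYPE('a)"
  have S: "?S > 0" by (rule sphere_area_pos)
  define C where "C = 4 powr (real DIM('a) + 1) * (4 * ?S)"
  have "(\<integral>\<^sup>+x. ennreal (mker s x y) * indicator {..r} (dist x y)) \<le>
    ennreal (C * ((1 - s) * \<delta> y powr (- s) * r powr s))"
   if s: "0 < s" "s < 1" and y: "0 < \<delta> y" and r: "0 < r" for s y r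
  proof -
   define A where "A = 4 powr (real DIM('a) + 1) * (1 - s) * \<delta> y powr (- s)"
   have A: "A \<ge> 0" using s by (simp add: A_def)
   have "(\<integral>\<^sup>+x. ennreal (mker s x y) * indicator {..r} (dist x y)) \<le> ennreal A * ennreal (4 * ?S * r powr s)"
   proof (cases "s \<ge> 1 / 4")
    case True
    have "(\<integral>\<^sup>+x. ennreal (mker s x y) * indicator {..r} (dist x y)) \<le>
     (\<integral>\<^sup>+x. ennreal A * (ennreal (dist x y powr (s - real DIM('a))) * indicator {..r} (dist x y)))"
    proof (intro nn_integral_mono)
     fix x
     have "mker s x y \<le> A * dist x y powr (s - real DIM('a))"
     proof (cases "mker s x y = 0")
      case False
      note D = mker_nonzeroD[OF False]
      have "(\<delta> y / dist x y) powr (1 - s) \<le> 1"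
       using D y s by (intro powr_le1) (auto simp: divide_le_eq_1)
      then have "A * (dist x y powr (s - real DIM('a)) * (\<delta> y / dist x y) powr (1 - s)) \<le> A * (dist x y powr (s - real DIM('a)) * 1)"
       using A by (intro mult_left_mono) auto
      then show ?thesis using mker_le[OF s y, of x] unfolding A_def[symmetric] by simp
     qed (use A in simp)
     then show "ennreal (mker s x y) * indicator {..r} (dist x y) \<le>
      ennreal A * (ennreal (dist x y powr (s - real DIM('a))) * indicator {..r} (dist x y))"
      using A by (auto simp: indicator_def ennreal_mult[symmetric] intro!: ennreal_leI)
    qed
    also have "\<dots> = ennreal A * ennreal (?S * (r powr s / s))"
     using nn_integral_dist_powr_near[OF s(1), of r y] r by (subst nn_integral_cmult) auto
    also have "\<dots> \<le> ennreal A * ennreal (4 * ?S * r powr s)"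
    proof (intro mult_left_mono ennreal_leI)
     have "r powr s / s \<le> 4 * r powr s" using True s mult_right_mono[of 1 "4 * s" "r powr s"] by (simp add: field_simps)
     then show "?S * (r powr s / s) \<le> 4 * ?S * r powr s" using S mult_left_mono[of _ _ ?S] by fastforce
    qed simp
    finally show ?thesis .
   next
    case False
    then have s4: "s < 1 / 4" by simp
    define a where "a = 3 / 4 - s"
    have a: "a > 1 / 2" using s4 by (simp add: a_def)
    show ?thesis
    proof (cases "\<delta> y \<le> r")
     case True
     have "(\<integral>\<^sup>+x. ennreal (mker s x y) * indicator {..r} (dist x y)) \<le>
      (\<integral>\<^sup>+x. ennreal (A * \<delta> y powr (3/4)) * (ennreal (dist x y powr (- a - real DIM('a))) * indicator {\<delta> y..} (dist x y)))"
     proof (intro nn_integral_mono)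
      fix x
      have "mker s x y \<le> A * \<delta> y powr (3/4) * dist x y powr (- a - real DIM('a))" "\<delta> y \<le> dist x y" if "mker s x y \<noteq> 0"
      proof -
       note D = mker_nonzeroD[OF that]
       show "\<delta> y \<le> dist x y" by (rule D(5))
       have "(\<delta> y / dist x y) powr (1 - s) \<le> (\<delta> y / dist x y) powr (3/4)"
        using D y s s4 by (intro powr_mono') (auto simp: divide_le_eq_1)
       then have "A * (dist x y powr (s - real DIM('a)) * (\<delta> y / dist x y) powr (1 - s)) \<le>
         A * (dist x y powr (s - real DIM('a)) * (\<delta> y / dist x y) powr (3/4))"
        using A by (intro mult_left_mono) auto
       moreover have "(\<delta> y / dist x y) powr (3/4) = \<delta> y powr (3/4) * dist x y powr (- (3/4))"
        by (subst powr_divide_eq) simp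
       moreover have "dist x y powr (- a - real DIM('a)) = dist x y powr (s - real DIM('a)) * dist x y powr (- (3/4))"
        by (subst powr_add[symmetric]) (simp add: a_def algebra_simps)
       ultimately show "mker s x y \<le> A * \<delta> y powr (3/4) * dist x y powr (- a - real DIM('a))"
        using mker_le[OF s y, of x] by (simp add: A_def mult_ac)
      qed
      then show "ennreal (mker s x y) * indicator {..r} (dist x y) \<le>
       ennreal (A * \<delta> y powr (3/4)) * (ennreal (dist x y powr (- a - real DIM('a))) * indicator {\<delta> y..} (dist x y))"
       using A by (cases "mker s x y = 0")
        (auto simp: indicator_def ennreal_mult[symmetric] intro!: ennreal_leI)
     qed
     also have "\<dots> = ennreal (A * \<delta> y powr (3/4)) * ennreal (?S * (\<delta> y powr (- a) / a))"
      using nn_integral_dist_powr_far[of a "\<delta> y" y] a y by (subst nn_integral_cmult) auto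
     also have "\<dots> = ennreal A * ennreal (\<delta> y powr (3/4) * (?S * (\<delta> y powr (- a) / a)))"
      using A S a by (simp add: ennreal_mult[symmetric] mult.assoc)
     also have "\<dots> \<le> ennreal A * ennreal (4 * ?S * r powr s)"
     proof (intro mult_left_mono ennreal_leI)
      have "\<delta> y powr (3/4) * (?S * (\<delta> y powr (- a) / a)) = ?S * (1 / a) * (\<delta> y powr (3/4) * \<delta> y powr (- a))"
       by simp
      also have "\<delta> y powr (3/4) * \<delta> y powr (- a) = \<delta> y powr s"
       by (subst powr_add[symmetric]) (simp add: a_def)
      also have "?S * (1 / a) * \<delta> y powr s \<le> ?S * 4 * r powr s"
       using S a True y s by (intro mult_mono mult_left_mono powr_mono2) (auto simp: divide_le_eq)
      finally show "\<delta> y powr (3/4) * (?S * (\<delta> y powr (- a) / a)) \<le> 4 * ?S * r powr s" by simp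
     qed simp
     finally show ?thesis .
    next
     case False
     have z: "ennreal (mker s x y) * indicator {..r} (dist x y) = 0" for x
      using mker_nonzeroD(5)[of s x y] False by (cases "mker s x y = 0") (auto simp: indicator_def)
     show ?thesis by (simp only: z nn_integral_const mult_zero_left) simp
    qed
   qed
   also have "\<dots> = ennreal (C * ((1 - s) * \<delta> y powr (- s) * r powr s))"
    using A S by (simp add: ennreal_mult[symmetric] A_def C_def mult_ac)
   finally show ?thesis .
  qed
  moreover have "C > 0" using S by (simp add: C_def)
  ultimately show ?thesis by blast
qed

text \<open>Layer cake: \<open>(r + \<rho>)\<^sup>-\<^sup>b\<close> is a superposition of indicators of balls, and \<open>mker_ball\<close> applies to each.\<close>

lemma mker_tail:
  "\<exists>C>0. \<forall>s y r b. 0 < s \<longrightarrow> s < 1 \<longrightarrow> 0 < \<delta> y \<longrightarrow> 0 < r \<longrightarrow> real DIM('a) + s \<le> b \<longrightarrow> b \<le> real DIM('a) + 2 \<longrightarrow>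
   (\<integral>\<^sup>+x. ennreal (mker s x y) * ennreal ((r + dist x y) powr (- b))) \<le>
    ennreal (C * ((1 - s) * \<delta> y powr (- s) * r powr (s - b)))"
proof -
  obtain C0 where C0: "C0 > 0" and ball: "\<And>s y r. 0 < s \<Longrightarrow> s < 1 \<Longrightarrow> 0 < \<delta> y \<Longrightarrow> 0 < r \<Longrightarrow>
   (\<integral>\<^sup>+x. ennreal (mker s x y) * indicator {..r} (dist x y)) \<le>
    ennreal (C0 * ((1 - s) * \<delta> y powr (- s) * r powr s))"
   using mker_ball by blast
  have "(\<integral>\<^sup>+x. ennreal (mker s x y) * ennreal ((r + dist x y) powr (- b))) \<le>
    ennreal (3 * C0 * ((1 - s) * \<delta> y powr (- s) * r powr (s - b)))"
   if s: "0 < s" "s < 1" and y: "0 < \<delta> y" and r: "0 < r" and b: "real DIM('a) + s \<le> b" "b \<le> real DIM('a) + 2" for s y r b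
  proof -
   have d1: "real DIM('a) \<ge> 1" by (rule DIM_ge_1)
   have b0: "b > 0" "b - s \<ge> real DIM('a)" using b s d1 by linarith+
   define B where "B = C0 * ((1 - s) * \<delta> y powr (- s))"
   have B: "B \<ge> 0" using C0 s by (simp add: B_def)
   have cake: "ennreal ((r + dist x y) powr (- b)) =
    (\<integral>\<^sup>+t. ennreal b * (ennreal (t powr (- b - 1)) * indicator {r + dist x y..} t))" for x
   proof -
    have rp: "r + dist x y > 0" using r zero_le_dist[of x y] by linarith
    show ?thesis
     using nn_integral_powr_far[OF b0(1) rp] b0
     by (subst nn_integral_cmult) (auto simp: ennreal_mult[symmetric])
   qed
   have "(\<integral>\<^sup>+x. ennreal (mker s x y) * ennreal ((r + dist x y) powr (- b))) =
    (\<integral>\<^sup>+x. (\<integral>\<^sup>+t. ennreal (mker s x y) * (ennreal b * (ennreal (t powr (- b - 1)) * indicator {0..} (t - (r + dist x y))))))"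
    unfolding cake
    by (intro nn_integral_cong, subst nn_integral_cmult[symmetric])
     (auto intro!: nn_integral_cong simp: indicator_def)
   also have "\<dots> = (\<integral>\<^sup>+t. (\<integral>\<^sup>+x. ennreal (mker s x y) * (ennreal b * (ennreal (t powr (- b - 1)) * indicator {0..} (t - (r + dist x y))))))"
    by (rule nn_integral_swap) measurable
   also have "\<dots> \<le> (\<integral>\<^sup>+t. ennreal (b * B) * (ennreal (t powr (- (b - s) - 1)) * indicator {r..} t))"
   proof (intro nn_integral_mono)
    fix t :: real
    show "(\<integral>\<^sup>+x. ennreal (mker s x y) * (ennreal b * (ennreal (t powr (- b - 1)) * indicator {0..} (t - (r + dist x y)))))
     \<le> ennreal (b * B) * (ennreal (t powr (- (b - s) - 1)) * indicator {r..} t)"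
    proof (cases "t \<ge> r")
     case True
     then have t: "t > 0" using r by simp
     have "(\<integral>\<^sup>+x. ennreal (mker s x y) * (ennreal b * (ennreal (t powr (- b - 1)) * indicator {0..} (t - (r + dist x y)))))
      \<le> (\<integral>\<^sup>+x. (ennreal b * ennreal (t powr (- b - 1))) * (ennreal (mker s x y) * indicator {..t} (dist x y)))"
      using r by (intro nn_integral_mono) (auto simp: indicator_def mult_ac)
     also have "\<dots> = (ennreal b * ennreal (t powr (- b - 1))) * (\<integral>\<^sup>+x. ennreal (mker s x y) * indicator {..t} (dist x y))"
      by (rule nn_integral_cmult) measurable
     also have "\<dots> \<le> (ennreal b * ennreal (t powr (- b - 1))) * ennreal (C0 * ((1 - s) * \<delta> y powr (- s) * t powr s))"
      by (intro mult_left_mono ball s y t) simp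
     also have "\<dots> = ennreal (b * t powr (- b - 1) * (B * t powr s))"
     proof -
      have e: "C0 * ((1 - s) * \<delta> y powr (- s) * t powr s) = B * t powr s" by (simp add: B_def)
      show ?thesis unfolding e using b0 B by (simp add: ennreal_mult)
     qed
     also have "b * t powr (- b - 1) * (B * t powr s) = b * B * t powr (- (b - s) - 1)"
     proof -
      have "t powr (- (b - s) - 1) = t powr (- b - 1) * t powr s" by (subst powr_add[symmetric]) (simp add: algebra_simps)
      then show ?thesis by simp
     qed
     finally show ?thesis using True b0 B by (simp add: ennreal_mult)
    next
     case False
     have "indicator {0..} (t - (r + dist x y)) = (0::ennreal)" for x
      using False zero_le_dist[of x y] unfolding indicator_def by (simp del: zero_le_dist)
     then show ?thesis by simp
    qed
   qed
   also have "\<dots> = ennreal (b * B) * ennreal (r powr (- (b - s)) / (b - s))"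
    using nn_integral_powr_far[of "b - s" r] b0 r d1 by (subst nn_integral_cmult) auto
   also have "\<dots> = ennreal (b / (b - s) * (B * r powr (s - b)))"
    using b0 B d1 by (simp add: ennreal_mult[symmetric])
   also have "\<dots> \<le> ennreal (3 * (B * r powr (s - b)))"
   proof (intro ennreal_leI mult_right_mono)
    have "1 \<le> b - s" using d1 b0(2) by (rule order_trans)
    then have "b \<le> 3 * (b - s)" using s by (simp add: algebra_simps)
    then show "b / (b - s) \<le> 3" using b0 d1 by (subst divide_le_eq) auto
   qed (use B in auto)
   finally show ?thesis by (simp add: B_def mult_ac)
  qed
  moreover have "3 * C0 > 0" using C0 by simp
  ultimately show ?thesis by blast
qed

lemma trace_kernel_nonneg: "s < 1 \<Longrightarrow> 0 \<le> trace_kernel s \<Omega> x y"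
  unfolding trace_kernel_def by (intro divide_nonneg_nonneg mult_nonneg_nonneg zero_le_power add_nonneg_nonneg) auto

lemma trace_kernel_measurable [measurable]:
  assumes [measurable]: "f \<in> borel_measurable N" "g \<in> borel_measurable N"
  shows "(\<lambda>x. trace_kernel s \<Omega> (f x) (g x)) \<in> borel_measurable N"
  unfolding trace_kernel_def by measurable

text \<open>The product of the distances in the trace kernel is at most \<open>4 * D * r\<close>, and the factors \<open>1 + \<delta>\<close> are
at most \<open>1 + 4 * D\<close> and \<open>1 + r\<close>; this gives the form in which the kernel comes out of the integrals below.\<close>

lemma trace_kernel_lower:
  assumes s: "0 < s" "s < 1" and y: "0 < \<delta> y" and y': "0 < \<delta> y'" "\<delta> y' \<le> 4 * D"
  defines "r \<equiv> dist y y' + \<delta> y + \<delta> y'"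
  shows "(1 - s)\<^sup>2 * (\<delta> y powr (- s) * \<delta> y' powr (- s) * (r powr (- real DIM('a)) * (1 + r) powr (- s)))
   \<le> (1 + 4 * D) powr (real DIM('a) + 1) * trace_kernel s \<Omega> y y'"
proof -
  let ?P = "dist y y' + \<delta> y * \<delta> y' + \<delta> y + \<delta> y'"
  let ?K = "1 + 4 * D"
  have r: "r > 0" "\<delta> y \<le> r" unfolding r_def using y y' zero_le_dist[of y y'] by linarith+
  have K: "?K \<ge> 1" using D1 by simp
  have "\<delta> y * \<delta> y' \<le> \<delta> y * (4 * D)" using y y' by (intro mult_left_mono) auto
  also have "\<dots> \<le> r * (4 * D)" using r D1 by (intro mult_right_mono) auto
  finally have P: "?P \<le> ?K * r" by (simp add: r_def algebra_simps)
  have P0: "?P > 0" using y y' zero_le_dist[of y y'] by (simp add: add_pos_pos add_nonneg_pos)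
  have 1: "r powr (- real DIM('a)) \<le> ?K powr real DIM('a) * ?P powr (- real DIM('a))"
   using P P0 K by (intro powr_neg_le_scaled) auto
  have 2: "(1 + r) powr (- s) \<le> (1 + \<delta> y) powr (- s)"
   using r y s by (intro powr_neg_antimono) auto
  have 3: "1 \<le> ?K powr 1 * (1 + \<delta> y') powr (- s)"
  proof -
   have "1 powr (- s) \<le> ?K powr 1 * (1 + \<delta> y') powr (- s)"
    using y' K s D1 by (intro powr_neg_le_scaled) auto
   then show ?thesis by simp
  qed
  have tk: "trace_kernel s \<Omega> y y' = (1 - s)\<^sup>2 * (\<delta> y powr (- s) * \<delta> y' powr (- s) *
    ((1 + \<delta> y) powr (- s) * (1 + \<delta> y') powr (- s) * ?P powr (- real DIM('a))))"
   unfolding trace_kernel_def using P0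
   by (simp add: powr_minus powr_realpow divide_inverse mult_ac)
  have "r powr (- real DIM('a)) * (1 + r) powr (- s) * 1 \<le>
   (?K powr real DIM('a) * ?P powr (- real DIM('a))) * (1 + \<delta> y) powr (- s) * (?K powr 1 * (1 + \<delta> y') powr (- s))"
   by (intro mult_mono 1 2 3) auto
  also have "\<dots> = ?K powr (real DIM('a) + 1) * ((1 + \<delta> y) powr (- s) * (1 + \<delta> y') powr (- s) * ?P powr (- real DIM('a)))"
   using K by (simp add: powr_add mult_ac)
  finally have "(1 - s)\<^sup>2 * (\<delta> y powr (- s) * \<delta> y' powr (- s) * (r powr (- real DIM('a)) * (1 + r) powr (- s)))
   \<le> (1 - s)\<^sup>2 * (\<delta> y powr (- s) * \<delta> y' powr (- s) * (?K powr (real DIM('a) + 1) * ((1 + \<delta> y) powr (- s) * (1 + \<delta> y') powr (- s) * ?P powr (- real DIM('a)))))"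
   by (intro mult_left_mono) auto
  then show ?thesis unfolding tk by (simp only: mult_ac)
qed

text \<open>An interior point \<open>x\<close> satisfies \<open>\<delta> y \<le> dist x y\<close> for every exterior \<open>y\<close>, so on the support
\<open>dist x y\<close> dominates \<open>r + dist x y'\<close> with \<open>r = dist y y' + \<delta> y + \<delta> y'\<close>. For small \<open>r\<close> the tail bound
applies; for large \<open>r\<close> the kernel is of order \<open>r\<^sup>-\<^sup>d\<^sup>-\<^sup>2\<^sup>s\<close> on the whole support, which has bounded size.\<close>

lemma mker_exterior_kernel:
  "\<exists>C>0. \<forall>s y y'. 0 < s \<longrightarrow> s < 1 \<longrightarrow> y \<notin> \<Omega> \<longrightarrow> 0 < \<delta> y \<longrightarrow> 0 < \<delta> y' \<longrightarrow>
   ennreal (1 - s) * (\<integral>\<^sup>+x. ennreal (mker s x y') * ennreal (dist x y powr (- (real DIM('a) + 2 * s))))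
    \<le> ennreal (C * trace_kernel s \<Omega> y y')"
proof -
  obtain C1 where C1: "C1 > 0" and ball: "\<And>s y r. 0 < s \<Longrightarrow> s < 1 \<Longrightarrow> 0 < \<delta> y \<Longrightarrow> 0 < r \<Longrightarrow>
   (\<integral>\<^sup>+x. ennreal (mker s x y) * indicator {..r} (dist x y)) \<le>
    ennreal (C1 * ((1 - s) * \<delta> y powr (- s) * r powr s))"
   using mker_ball by blast
  obtain C2 where C2: "C2 > 0" and tail: "\<And>s y r b. 0 < s \<Longrightarrow> s < 1 \<Longrightarrow> 0 < \<delta> y \<Longrightarrow> 0 < r \<Longrightarrow>
   real DIM('a) + s \<le> b \<Longrightarrow> b \<le> real DIM('a) + 2 \<Longrightarrow>
   (\<integral>\<^sup>+x. ennreal (mker s x y) * ennreal ((r + dist x y) powr (- b))) \<le>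
    ennreal (C2 * ((1 - s) * \<delta> y powr (- s) * r powr (s - b)))"
   using mker_tail by blast
  define E where "E = 14 powr (real DIM('a) + 2)"
  have E: "E > 0" by (simp add: E_def)
  define C where "C = E * (2 * C2 + 8 * D * C1) * (1 + 4 * D) powr (real DIM('a) + 1)"
  have C: "C > 0" using E C1 C2 D1 by (simp add: C_def add_pos_pos)
  have "ennreal (1 - s) * (\<integral>\<^sup>+x. ennreal (mker s x y') * ennreal (dist x y powr (- (real DIM('a) + 2 * s))))
    \<le> ennreal (C * trace_kernel s \<Omega> y y')"
   if s: "0 < s" "s < 1" and y: "y \<notin> \<Omega>" "0 < \<delta> y" and y': "0 < \<delta> y'" for s y y'
  proof -
   define r where "r = dist y y' + \<delta> y + \<delta> y'"
   let ?b = "real DIM('a) + 2 * s"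
   let ?I = "\<integral>\<^sup>+x. ennreal (mker s x y') * ennreal (dist x y powr (- ?b))"
   have r: "r > 0" "\<delta> y \<le> r" unfolding r_def using y y' zero_le_dist[of y y'] by linarith+
   show ?thesis
   proof (cases "\<delta> y' \<le> 4 * D")
    case True
    have pt: "ennreal (mker s x y') * ennreal (dist x y powr (- ?b)) \<le>
      ennreal E * (ennreal (mker s x y') * ennreal ((r + dist x y') powr (- ?b)))" for x
    proof (cases "mker s x y' = 0")
     case False
     note Dx = mker_nonzeroD[OF False]
     have c: "\<delta> x \<le> dist x y" "\<delta> y \<le> dist x y" by (rule crossing[OF Dx(1) y(1)])+
     have "dist y y' \<le> dist x y + dist x y'" by (rule dist_triangle3)
     then have "r + dist x y' \<le> 14 * dist x y" unfolding r_def using c Dx by linarith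
     then have "dist x y powr (- ?b) \<le> E * (r + dist x y') powr (- ?b)"
      unfolding E_def using r s zero_le_dist[of x y'] by (intro powr_neg_le_scaled) linarith+
     then have "mker s x y' * dist x y powr (- ?b) \<le> mker s x y' * (E * (r + dist x y') powr (- ?b))"
      using mker_nonneg[OF s(2)] by (intro mult_left_mono)
     then have "mker s x y' * dist x y powr (- ?b) \<le> E * (mker s x y' * (r + dist x y') powr (- ?b))"
      by (simp only: mult_ac)
     then show ?thesis
      using E mker_nonneg[OF s(2), of x y'] by (simp add: ennreal_mult[symmetric] ennreal_leI)
    qed simp
    have bd1: "?I \<le> ennreal (E * (C2 * ((1 - s) * \<delta> y' powr (- s) * r powr (s - ?b))))"
    proof -
     have "?I \<le> (\<integral>\<^sup>+x. ennreal E * (ennreal (mker s x y') * ennreal ((r + dist x y') powr (- ?b))))"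
      by (intro nn_integral_mono pt)
     also have "\<dots> = ennreal E * (\<integral>\<^sup>+x. ennreal (mker s x y') * ennreal ((r + dist x y') powr (- ?b)))"
      by (rule nn_integral_cmult) measurable
     also have "\<dots> \<le> ennreal E * ennreal (C2 * ((1 - s) * \<delta> y' powr (- s) * r powr (s - ?b)))"
      using s r y' by (intro mult_left_mono tail) auto
     finally show ?thesis using E by (simp add: ennreal_mult'[symmetric])
    qed
    have bd2: "?I \<le> ennreal (E * (r powr (- ?b) * (C1 * ((1 - s) * \<delta> y' powr (- s) * (4 * D)))))"
    proof -
     have "?I \<le> (\<integral>\<^sup>+x. ennreal (E * r powr (- ?b)) * (ennreal (mker s x y') * indicator {..4 * D} (dist x y')))"
     proof (intro nn_integral_mono)
      fix x
      show "ennreal (mker s x y') * ennreal (dist x y powr (- ?b)) \<le>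
       ennreal (E * r powr (- ?b)) * (ennreal (mker s x y') * indicator {..4 * D} (dist x y'))"
      proof (cases "mker s x y' = 0")
       case False
       have "(r + dist x y') powr (- ?b) \<le> r powr (- ?b)"
        using r s by (intro powr_neg_antimono) auto
       then have "ennreal E * (ennreal (mker s x y') * ennreal ((r + dist x y') powr (- ?b)))
        \<le> ennreal E * (ennreal (mker s x y') * ennreal (r powr (- ?b)))"
        by (intro mult_left_mono ennreal_leI) auto
       with pt[of x] show ?thesis
        using mker_nonzeroD(7)[OF False] E by (simp add: indicator_def ennreal_mult mult_ac)
      qed simp
     qed
     also have "\<dots> = ennreal (E * r powr (- ?b)) * (\<integral>\<^sup>+x. ennreal (mker s x y') * indicator {..4 * D} (dist x y'))"
      by (rule nn_integral_cmult) measurable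
     also have "\<dots> \<le> ennreal (E * r powr (- ?b)) * ennreal (C1 * ((1 - s) * \<delta> y' powr (- s) * (4 * D) powr s))"
      using s D1 y' by (intro mult_left_mono ball) auto
     also have "\<dots> \<le> ennreal (E * r powr (- ?b)) * ennreal (C1 * ((1 - s) * \<delta> y' powr (- s) * (4 * D)))"
     proof (intro mult_left_mono ennreal_leI)
      have "(4 * D) powr s \<le> (4 * D) powr 1" using s D1 by (intro powr_mono) auto
      then show "(4 * D) powr s \<le> 4 * D" using D1 by simp
     qed (use s C1 in auto)
     finally show ?thesis using E by (simp add: ennreal_mult'[symmetric] mult.assoc)
    qed
    have main: "?I \<le> ennreal (E * (2 * C2 + 8 * D * C1) *
      ((1 - s) * (\<delta> y powr (- s) * \<delta> y' powr (- s) * (r powr (- real DIM('a)) * (1 + r) powr (- s)))))"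
    proof -
     have ds: "r powr (- s) \<le> \<delta> y powr (- s)" using r y s by (intro powr_neg_antimono) auto
     show ?thesis
     proof (cases "r \<le> 1")
      case True
      have "1 powr (- s) \<le> 2 powr 1 * (1 + r) powr (- s)"
       by (rule powr_neg_le_scaled) (use True r s in auto)
      hence h: "1 \<le> 2 * (1 + r) powr (- s)" by simp
      have "E * (C2 * ((1 - s) * \<delta> y' powr (- s) * r powr (s - ?b))) =
       E * C2 * ((1 - s) * (r powr (- s) * \<delta> y' powr (- s) * (r powr (- real DIM('a)) * 1)))"
      proof -
       have "r powr (s - ?b) = r powr (- real DIM('a)) * r powr (- s)"
        by (subst powr_add[symmetric]) (simp add: algebra_simps)
       then show ?thesis by simp
      qed
      also have "\<dots> \<le> E * C2 * ((1 - s) * (\<delta> y powr (- s) * \<delta> y' powr (- s) * (r powr (- real DIM('a)) * (2 * (1 + r) powr (- s)))))"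
       using ds h s E C2 by (intro mult_left_mono mult_mono) auto
      also have "\<dots> = E * (2 * C2) * ((1 - s) * (\<delta> y powr (- s) * \<delta> y' powr (- s) * (r powr (- real DIM('a)) * (1 + r) powr (- s))))"
       by simp
      also have "\<dots> \<le> E * (2 * C2 + 8 * D * C1) * ((1 - s) * (\<delta> y powr (- s) * \<delta> y' powr (- s) * (r powr (- real DIM('a)) * (1 + r) powr (- s))))"
       using E C1 D1 s by (intro mult_right_mono mult_left_mono) auto
      finally show ?thesis using bd1 by (meson ennreal_leI order_trans)
     next
      case False
      have h: "r powr (- s) \<le> 2 powr 1 * (1 + r) powr (- s)"
       by (rule powr_neg_le_scaled) (use False r s in auto)
      have "E * (r powr (- ?b) * (C1 * ((1 - s) * \<delta> y' powr (- s) * (4 * D)))) =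
       E * C1 * (4 * D) * ((1 - s) * (r powr (- s) * \<delta> y' powr (- s) * (r powr (- real DIM('a)) * r powr (- s))))"
      proof -
       have "r powr (- ?b) = r powr (- real DIM('a)) * r powr (- s) * r powr (- s)"
        by (simp only: powr_add[symmetric]) (rule arg_cong[where f="\<lambda>t. r powr t"], simp)
       then show ?thesis by simp
      qed
      also have "\<dots> \<le> E * C1 * (4 * D) * ((1 - s) * (\<delta> y powr (- s) * \<delta> y' powr (- s) * (r powr (- real DIM('a)) * (2 powr 1 * (1 + r) powr (- s)))))"
       using ds h s E C1 D1 by (intro mult_left_mono mult_mono) auto
      also have "\<dots> = E * (8 * D * C1) * ((1 - s) * (\<delta> y powr (- s) * \<delta> y' powr (- s) * (r powr (- real DIM('a)) * (1 + r) powr (- s))))"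
       by simp
      also have "\<dots> \<le> E * (2 * C2 + 8 * D * C1) * ((1 - s) * (\<delta> y powr (- s) * \<delta> y' powr (- s) * (r powr (- real DIM('a)) * (1 + r) powr (- s))))"
       using E C2 s by (intro mult_right_mono mult_left_mono) auto
      finally show ?thesis using bd2 by (meson ennreal_leI order_trans)
     qed
    qed
    have "ennreal (1 - s) * ?I \<le> ennreal (1 - s) * ennreal (E * (2 * C2 + 8 * D * C1) *
      ((1 - s) * (\<delta> y powr (- s) * \<delta> y' powr (- s) * (r powr (- real DIM('a)) * (1 + r) powr (- s)))))"
     using main by (intro mult_left_mono) auto
    also have "\<dots> = ennreal (E * (2 * C2 + 8 * D * C1) *
      ((1 - s)\<^sup>2 * (\<delta> y powr (- s) * \<delta> y' powr (- s) * (r powr (- real DIM('a)) * (1 + r) powr (- s)))))"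
     using s by (subst ennreal_mult'[symmetric]) (auto simp: power2_eq_square mult_ac)
    also have "\<dots> \<le> ennreal (E * (2 * C2 + 8 * D * C1) * ((1 + 4 * D) powr (real DIM('a) + 1) * trace_kernel s \<Omega> y y'))"
     unfolding r_def using E C1 C2 D1 s y y' True
     by (intro ennreal_leI mult_left_mono trace_kernel_lower) auto
    finally show ?thesis by (simp add: C_def mult.assoc)
   next
    case False
    have z: "mker s x y' = 0" for x
     using mker_nonzeroD(5,7)[of s x y'] False by force
    show ?thesis by (simp add: z)
   qed
  qed
  with C show ?thesis by blast
qed

lemma trace_kernel_lower_near:
  assumes s: "0 < s" "s < 1" and y: "0 < \<delta> y" "\<delta> y \<le> 4 * D" and y': "0 < \<delta> y'" "\<delta> y' \<le> 4 * D"
   and yy: "dist y y' \<le> 9 * D"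
  defines "r \<equiv> dist y y' + \<delta> y + \<delta> y'"
  shows "(1 - s)\<^sup>2 * (\<delta> y powr (- s) * \<delta> y' powr (- s) * r powr (- real DIM('a)))
   \<le> (1 + 17 * D) * (1 + 4 * D) powr (real DIM('a) + 1) * trace_kernel s \<Omega> y y'"
proof -
  have r: "r > 0" "r \<le> 17 * D" unfolding r_def using y y' yy zero_le_dist[of y y'] by linarith+
  have "1 powr (- s) \<le> (1 + 17 * D) powr 1 * (1 + r) powr (- s)"
   using r s D1 by (intro powr_neg_le_scaled) auto
  then have h: "1 \<le> (1 + 17 * D) * (1 + r) powr (- s)" using D1 by simp
  have "(1 - s)\<^sup>2 * (\<delta> y powr (- s) * \<delta> y' powr (- s) * (r powr (- real DIM('a)) * 1)) \<le>
   (1 - s)\<^sup>2 * (\<delta> y powr (- s) * \<delta> y' powr (- s) * (r powr (- real DIM('a)) * ((1 + 17 * D) * (1 + r) powr (- s))))"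
   using h by (intro mult_left_mono) auto
  also have "\<dots> = (1 + 17 * D) * ((1 - s)\<^sup>2 * (\<delta> y powr (- s) * \<delta> y' powr (- s) * (r powr (- real DIM('a)) * (1 + r) powr (- s))))"
   by (simp only: mult_ac)
  also have "\<dots> \<le> (1 + 17 * D) * ((1 + 4 * D) powr (real DIM('a) + 1) * trace_kernel s \<Omega> y y')"
   unfolding r_def using s y y' D1 by (intro mult_left_mono trace_kernel_lower) auto
  finally show ?thesis by (simp add: mult.assoc)
qed

text \<open>For separated points \<open>dist x x'\<close> dominates \<open>dist y y' + \<delta> y + \<delta> y' + dist x y + dist x' y'\<close>, so that the
tail bound applies to the integral over \<open>x\<close> and then to the integral over \<open>x'\<close>.\<close>

lemma mker_interior_far_kernel:
  "\<exists>C>0. \<forall>s y y'. 0 < s \<longrightarrow> s < 1 \<longrightarrow> 0 < \<delta> y \<longrightarrow> 0 < \<delta> y' \<longrightarrow>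
   (\<integral>\<^sup>+x'. (\<integral>\<^sup>+x. ennreal (mker s x y) * ennreal (mker s x' y') *
     (ennreal (dist x x' powr (- (real DIM('a) + 2 * s))) *
      indicator {0..} (dist x x' - \<delta> x / 4) * indicator {0..} (dist x x' - \<delta> x' / 4))))
    \<le> ennreal (C * trace_kernel s \<Omega> y y')"
proof -
  obtain C2 where C2: "C2 > 0" and tail: "\<And>s y r b. 0 < s \<Longrightarrow> s < 1 \<Longrightarrow> 0 < \<delta> y \<Longrightarrow> 0 < r \<Longrightarrow>
   real DIM('a) + s \<le> b \<Longrightarrow> b \<le> real DIM('a) + 2 \<Longrightarrow>
   (\<integral>\<^sup>+x. ennreal (mker s x y) * ennreal ((r + dist x y) powr (- b))) \<le>
    ennreal (C2 * ((1 - s) * \<delta> y powr (- s) * r powr (s - b)))"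
   using mker_tail by blast
  define E where "E = 97 powr (real DIM('a) + 2)"
  have E: "E > 0" by (simp add: E_def)
  define C where "C = E * C2 * C2 * ((1 + 17 * D) * (1 + 4 * D) powr (real DIM('a) + 1))"
  have C: "C > 0" using E C2 D1 by (simp add: C_def add_pos_pos)
  have "(\<integral>\<^sup>+x'. (\<integral>\<^sup>+x. ennreal (mker s x y) * ennreal (mker s x' y') *
     (ennreal (dist x x' powr (- (real DIM('a) + 2 * s))) *
      indicator {0..} (dist x x' - \<delta> x / 4) * indicator {0..} (dist x x' - \<delta> x' / 4))))
    \<le> ennreal (C * trace_kernel s \<Omega> y y')"
   if s: "0 < s" "s < 1" and y: "0 < \<delta> y" and y': "0 < \<delta> y'" for s y y'
  proof -
   define r where "r = dist y y' + \<delta> y + \<delta> y'"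
   have r: "r > 0" unfolding r_def using y y' zero_le_dist[of y y'] by linarith
   let ?b = "real DIM('a) + 2 * s"
   let ?F = "\<lambda>x' x. ennreal (mker s x y) * ennreal (mker s x' y') * (ennreal (dist x x' powr (- ?b)) *
      indicator {0..} (dist x x' - \<delta> x / 4) * indicator {0..} (dist x x' - \<delta> x' / 4))"
   show ?thesis
   proof (cases "\<exists>x x'. mker s x y \<noteq> 0 \<and> mker s x' y' \<noteq> 0")
    case False
    have z: "?F x' x = 0" for x x'
    proof (cases "mker s x y = 0")
     case False
     then have "mker s x' y' = 0" using \<open>\<nexists>x x'. mker s x y \<noteq> 0 \<and> mker s x' y' \<noteq> 0\<close> by blast
     then show ?thesis by simp
    qed simp
    show ?thesis unfolding z by simp
   next
    case True
    then obtain w w' where w: "mker s w y \<noteq> 0" "mker s w' y' \<noteq> 0" by blast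
    note W = mker_nonzeroD[OF w(1)] and W' = mker_nonzeroD[OF w(2)]
    have "dist w w' \<le> D" using W(1) W'(1) diam closure_subset by blast
    moreover have "dist y y' \<le> dist w y + dist w w' + dist w' y'"
     using dist_triangle3[of y y' w] dist_triangle[of w y' w'] by linarith
    ultimately have near: "\<delta> y \<le> 4 * D" "\<delta> y' \<le> 4 * D" "dist y y' \<le> 9 * D"
     using W(5,7) W'(5,7) by linarith+
    have pt: "?F x' x \<le> ennreal (E * mker s x' y') *
      (ennreal (mker s x y) * ennreal (((r + dist x' y') + dist x y) powr (- ?b)))" for x x'
    proof (cases "mker s x y \<noteq> 0 \<and> mker s x' y' \<noteq> 0 \<and> \<delta> x / 4 \<le> dist x x' \<and> \<delta> x' / 4 \<le> dist x x'")
     case True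
     then have m: "mker s x y \<noteq> 0" "mker s x' y' \<noteq> 0" and f: "\<delta> x / 4 \<le> dist x x'" "\<delta> x' / 4 \<le> dist x x'"
      by auto
     note X = mker_nonzeroD[OF m(1)] and X' = mker_nonzeroD[OF m(2)]
     have "dist y y' \<le> dist x y + dist x x' + dist x' y'"
      using dist_triangle3[of y y' x] dist_triangle[of x y' x'] by linarith
     then have "r + dist x' y' + dist x y \<le> 97 * dist x x'"
      unfolding r_def using f X(3,5) X'(3,5) by linarith
     then have "dist x x' powr (- ?b) \<le> E * (r + dist x' y' + dist x y) powr (- ?b)"
      unfolding E_def using r s zero_le_dist[of x' y'] zero_le_dist[of x y] by (intro powr_neg_le_scaled) linarith+
     then have "mker s x y * mker s x' y' * dist x x' powr (- ?b) \<le>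
       mker s x y * mker s x' y' * (E * (r + dist x' y' + dist x y) powr (- ?b))"
      using mker_nonneg[OF s(2)] by (intro mult_left_mono) auto
     also have "\<dots> = E * mker s x' y' * (mker s x y * (r + dist x' y' + dist x y) powr (- ?b))"
      by (simp only: mult_ac)
     finally show ?thesis
      using f E mker_nonneg[OF s(2)]
      by (simp add: ennreal_mult[symmetric] ennreal_leI)
    qed (auto simp: indicator_def)
    have "(\<integral>\<^sup>+x'. (\<integral>\<^sup>+x. ?F x' x)) \<le>
     (\<integral>\<^sup>+x'. ennreal (E * (C2 * ((1 - s) * \<delta> y powr (- s)))) * (ennreal (mker s x' y') * ennreal ((r + dist x' y') powr (- (real DIM('a) + s)))))"
    proof (intro nn_integral_mono)
     fix x'
     have rx: "r + dist x' y' > 0" using r zero_le_dist[of x' y'] by linarith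
     have "(\<integral>\<^sup>+x. ?F x' x) \<le> (\<integral>\<^sup>+x. ennreal (E * mker s x' y') *
       (ennreal (mker s x y) * ennreal (((r + dist x' y') + dist x y) powr (- ?b))))"
      by (intro nn_integral_mono pt)
     also have "\<dots> = ennreal (E * mker s x' y') * (\<integral>\<^sup>+x. ennreal (mker s x y) * ennreal (((r + dist x' y') + dist x y) powr (- ?b)))"
      by (rule nn_integral_cmult) measurable
     also have "\<dots> \<le> ennreal (E * mker s x' y') * ennreal (C2 * ((1 - s) * \<delta> y powr (- s) * (r + dist x' y') powr (s - ?b)))"
      using s y rx by (intro mult_left_mono tail) auto
     also have "s - ?b = - (real DIM('a) + s)" by simp
     also have "ennreal (E * mker s x' y') * ennreal (C2 * ((1 - s) * \<delta> y powr (- s) * (r + dist x' y') powr (- (real DIM('a) + s))))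
      = ennreal (E * (C2 * ((1 - s) * \<delta> y powr (- s)))) * (ennreal (mker s x' y') * ennreal ((r + dist x' y') powr (- (real DIM('a) + s))))"
      using E C2 s mker_nonneg[OF s(2), of x' y'] by (simp add: ennreal_mult[symmetric] mult_ac)
     finally show "(\<integral>\<^sup>+x. ?F x' x) \<le> \<dots>" .
    qed
    also have "\<dots> = ennreal (E * (C2 * ((1 - s) * \<delta> y powr (- s)))) *
      (\<integral>\<^sup>+x'. ennreal (mker s x' y') * ennreal ((r + dist x' y') powr (- (real DIM('a) + s))))"
     by (rule nn_integral_cmult) measurable
    also have "\<dots> \<le> ennreal (E * (C2 * ((1 - s) * \<delta> y powr (- s)))) *
      ennreal (C2 * ((1 - s) * \<delta> y' powr (- s) * r powr (s - (real DIM('a) + s))))"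
     using s y' r by (intro mult_left_mono tail) auto
    also have "\<dots> = ennreal (E * C2 * C2 * ((1 - s)\<^sup>2 * (\<delta> y powr (- s) * \<delta> y' powr (- s) * r powr (- real DIM('a)))))"
     using E C2 s by (simp add: ennreal_mult[symmetric] mult_ac power2_eq_square)
    also have "\<dots> \<le> ennreal (E * C2 * C2 * ((1 + 17 * D) * (1 + 4 * D) powr (real DIM('a) + 1) * trace_kernel s \<Omega> y y'))"
     unfolding r_def using E C2 s y y' near
     by (intro ennreal_leI mult_left_mono trace_kernel_lower_near) auto
    finally show ?thesis by (simp add: C_def mult.assoc)
   qed
  qed
  with C show ?thesis by blast
qed

text \<open>For close points the integration over \<open>x'\<close> leaves the factor \<open>\<delta> x\<^sup>-\<^sup>2\<^sup>s\<close>. On the support \<open>\<delta> x\<close>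
dominates \<open>r + dist x y\<close>; one of the two kernels is estimated pointwise and the tail bound is applied
to the other.\<close>

lemma mker_interior_near_kernel:
  "\<exists>C>0. \<forall>s y y'. 0 < s \<longrightarrow> s < 1 \<longrightarrow> 0 < \<delta> y \<longrightarrow> 0 < \<delta> y' \<longrightarrow>
   (\<integral>\<^sup>+x. ennreal (mker s x y) * ennreal (mker s x y') * ennreal (\<delta> x powr (- (2 * s))))
    \<le> ennreal (C * trace_kernel s \<Omega> y y')"
proof -
  obtain C2 where C2: "C2 > 0" and tail: "\<And>s y r b. 0 < s \<Longrightarrow> s < 1 \<Longrightarrow> 0 < \<delta> y \<Longrightarrow> 0 < r \<Longrightarrow>
   real DIM('a) + s \<le> b \<Longrightarrow> b \<le> real DIM('a) + 2 \<Longrightarrow>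
   (\<integral>\<^sup>+x. ennreal (mker s x y) * ennreal ((r + dist x y) powr (- b))) \<le>
    ennreal (C2 * ((1 - s) * \<delta> y powr (- s) * r powr (s - b)))"
   using mker_tail by blast
  define E where "E = 20 powr (real DIM('a) + 2) * 4"
  have E: "E > 0" by (simp add: E_def)
  define C where "C = E * C2 * ((1 + 17 * D) * (1 + 4 * D) powr (real DIM('a) + 1))"
  have C: "C > 0" using E C2 D1 by (simp add: C_def add_pos_pos)
  have "(\<integral>\<^sup>+x. ennreal (mker s x y) * ennreal (mker s x y') * ennreal (\<delta> x powr (- (2 * s))))
    \<le> ennreal (C * trace_kernel s \<Omega> y y')"
   if s: "0 < s" "s < 1" and y: "0 < \<delta> y" and y': "0 < \<delta> y'" for s y y'
  proof -
   define r where "r = dist y y' + \<delta> y + \<delta> y'"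
   have r: "r > 0" unfolding r_def using y y' zero_le_dist[of y y'] by linarith
   let ?b = "real DIM('a) + s"
   let ?F = "\<lambda>x. ennreal (mker s x y) * ennreal (mker s x y') * ennreal (\<delta> x powr (- (2 * s)))"
   show ?thesis
   proof (cases "\<exists>x. mker s x y \<noteq> 0 \<and> mker s x y' \<noteq> 0")
    case False
    have z: "?F x = 0" for x
    proof (cases "mker s x y = 0")
     case False
     then have "mker s x y' = 0" using \<open>\<nexists>x. mker s x y \<noteq> 0 \<and> mker s x y' \<noteq> 0\<close> by blast
     then show ?thesis by simp
    qed simp
    show ?thesis unfolding z by simp
   next
    case True
    then obtain w where w: "mker s w y \<noteq> 0" "mker s w y' \<noteq> 0" by blast
    note W = mker_nonzeroD[OF w(1)] and W' = mker_nonzeroD[OF w(2)]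
    have near: "\<delta> y \<le> 4 * D" "\<delta> y' \<le> 4 * D" "dist y y' \<le> 9 * D"
     using W(5,7) W'(5,7) dist_triangle3[of y y' w] D1 by linarith+
    have pt: "?F x \<le> ennreal (E * ((1 - s) * \<delta> y' powr (- s))) *
      (ennreal (mker s x y) * ennreal ((r + dist x y) powr (- ?b)))" for x
    proof (cases "mker s x y \<noteq> 0 \<and> mker s x y' \<noteq> 0")
     case True
     then have m: "mker s x y \<noteq> 0" "mker s x y' \<noteq> 0" by auto
     note X = mker_nonzeroD[OF m(1)] and X' = mker_nonzeroD[OF m(2)]
     have rx: "r + dist x y \<le> 20 * \<delta> x"
      unfolding r_def using X(3,5) X'(3,5) dist_triangle3[of y y' x] by linarith
     have 1: "\<delta> x powr (- ?b) \<le> 20 powr (real DIM('a) + 2) * (r + dist x y) powr (- ?b)"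
      by (rule powr_neg_le_scaled[OF _ rx]) (use r s zero_le_dist[of x y] in linarith)+
     have 2: "(\<delta> y' / \<delta> x) powr (1 - s) \<le> 4"
     proof -
      have "\<delta> y' / \<delta> x \<le> 4" using X(6) X'(3,5) by (simp add: divide_le_eq)
      then have "(\<delta> y' / \<delta> x) powr (1 - s) \<le> 4 powr (1 - s)"
       using X(6) s by (intro powr_mono2) auto
      also have "\<dots> \<le> 4 powr 1" using s by (intro powr_mono) auto
      finally show ?thesis by simp
     qed
     have "mker s x y' * \<delta> x powr (- (2 * s)) = (1 - s) * \<delta> y' powr (- s) * ((\<delta> y' / \<delta> x) powr (1 - s) * \<delta> x powr (- ?b))"
     proof -
      have "mker s x y' = (1 - s) * \<delta> y' powr (1 - 2 * s) * \<delta> x powr (2 * s - 1 - real DIM('a))"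
       using m(2) by (simp add: mker_def split: if_splits)
      moreover have "\<delta> y' powr (1 - 2 * s) = \<delta> y' powr (- s) * \<delta> y' powr (1 - s)"
       by (subst powr_add[symmetric]) simp
      moreover have "(\<delta> y' / \<delta> x) powr (1 - s) = \<delta> x powr (- (1 - s)) * \<delta> y' powr (1 - s)"
       by (rule powr_divide_eq)
      moreover have "\<delta> x powr (2 * s - 1 - real DIM('a)) * \<delta> x powr (- (2 * s)) = \<delta> x powr (- (1 - s)) * \<delta> x powr (- ?b)"
       by (simp add: powr_add[symmetric])
      ultimately show ?thesis by (simp only: mult.assoc mult.left_commute mult.commute) 
     qed
     also have "\<dots> \<le> (1 - s) * \<delta> y' powr (- s) * (4 * (20 powr (real DIM('a) + 2) * (r + dist x y) powr (- ?b)))"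
      using 1 2 s by (intro mult_left_mono mult_mono) auto
     finally have "mker s x y * (mker s x y' * \<delta> x powr (- (2 * s))) \<le>
       mker s x y * ((1 - s) * \<delta> y' powr (- s) * (4 * (20 powr (real DIM('a) + 2) * (r + dist x y) powr (- ?b))))"
      using mker_nonneg[OF s(2)] by (intro mult_left_mono) auto
     also have "\<dots> = E * ((1 - s) * \<delta> y' powr (- s)) * (mker s x y * (r + dist x y) powr (- ?b))"
      by (simp add: E_def)
     finally show ?thesis
      using E s mker_nonneg[OF s(2)]
      by (simp add: ennreal_mult[symmetric] ennreal_leI mult.assoc)
    qed auto
    have "(\<integral>\<^sup>+x. ?F x) \<le> (\<integral>\<^sup>+x. ennreal (E * ((1 - s) * \<delta> y' powr (- s))) *
      (ennreal (mker s x y) * ennreal ((r + dist x y) powr (- ?b))))"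
     by (intro nn_integral_mono pt)
    also have "\<dots> = ennreal (E * ((1 - s) * \<delta> y' powr (- s))) *
      (\<integral>\<^sup>+x. ennreal (mker s x y) * ennreal ((r + dist x y) powr (- ?b)))"
     by (rule nn_integral_cmult) measurable
    also have "\<dots> \<le> ennreal (E * ((1 - s) * \<delta> y' powr (- s))) *
      ennreal (C2 * ((1 - s) * \<delta> y powr (- s) * r powr (s - ?b)))"
     using s y r by (intro mult_left_mono tail) auto
    also have "\<dots> = ennreal (E * C2 * ((1 - s)\<^sup>2 * (\<delta> y powr (- s) * \<delta> y' powr (- s) * r powr (- real DIM('a)))))"
     using E C2 s by (simp add: ennreal_mult[symmetric] mult_ac power2_eq_square)
    also have "\<dots> \<le> ennreal (E * C2 * ((1 + 17 * D) * (1 + 4 * D) powr (real DIM('a) + 1) * trace_kernel s \<Omega> y y'))"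
     unfolding r_def using E C2 s y y' near
     by (intro ennreal_leI mult_left_mono trace_kernel_lower_near) auto
    finally show ?thesis by (simp add: C_def mult.assoc)
   qed
  qed
  with C show ?thesis by blast
qed

end

section \<open>Weighted averages over the exterior\<close>

context lipschitz_domain
begin

text \<open>Equal to one up to distance \<open>2 * \<delta> x\<close>, which guarantees mass in the exterior, and zero from
distance \<open>3 * \<delta> x\<close> on.\<close>

definition cutoff :: "'a \<Rightarrow> 'a \<Rightarrow> real" where
  "cutoff x y = max 0 (min 1 (3 - dist x y / \<delta> x))"

definition avg_weight :: "real \<Rightarrow> 'a \<Rightarrow> 'a \<Rightarrow> real" where
  "avg_weight s x y = (if y \<notin> \<Omega> then cutoff x y * \<delta> y powr (1 - 2 * s) else 0)"

definition avg_mass :: "real \<Rightarrow> 'a \<Rightarrow> real" where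
  "avg_mass s x = (\<integral>y. avg_weight s x y \<partial>lborel)"

definition ext_avg :: "real \<Rightarrow> ('a \<Rightarrow> real) \<Rightarrow> 'a \<Rightarrow> real" where
  "ext_avg s g x = (\<integral>y. avg_weight s x y * g y \<partial>lborel) / avg_mass s x"

lemma cutoff_bounds: "0 \<le> cutoff x y" "cutoff x y \<le> 1"
  by (auto simp: cutoff_def)

lemma cutoff_support: "0 < \<delta> x \<Longrightarrow> cutoff x y \<noteq> 0 \<Longrightarrow> dist x y < 3 * \<delta> x"
proof -
  assume x: "0 < \<delta> x" and "cutoff x y \<noteq> 0"
  then have "dist x y / \<delta> x < 3" unfolding cutoff_def by linarith
  then show ?thesis using x by (simp add: divide_less_eq)
qed

lemma avg_weight_nonneg: "0 \<le> avg_weight s x y"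
  by (simp add: avg_weight_def cutoff_bounds)

lemma avg_weight_measurable [measurable]:
  assumes [measurable]: "f \<in> borel_measurable N" "g \<in> borel_measurable N"
  shows "(\<lambda>x. avg_weight s (f x) (g x)) \<in> borel_measurable N"
  unfolding avg_weight_def cutoff_def by measurable

lemma near_bdist:
  assumes "dist x x' \<le> \<delta> x / 4"
  shows "3 / 4 * \<delta> x \<le> \<delta> x'" "\<delta> x' \<le> 5 / 4 * \<delta> x"
  using bdist_lipschitz[of x x'] assms by (auto simp: abs_le_iff)

text \<open>The cutoff is Lipschitz at the scale of the distance to the boundary, and nearby centres
have their supports in the common ball that carries \<open>mker\<close>.\<close>

lemma cutoff_diff:
  assumes x: "0 < \<delta> x" and near: "dist x x' \<le> \<delta> x / 4"
  shows "\<bar>cutoff x y - cutoff x' y\<bar> \<le> 6 * (dist x x' / \<delta> x)"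
   and "cutoff x y \<noteq> 0 \<or> cutoff x' y \<noteq> 0 \<Longrightarrow> dist x y \<le> 4 * \<delta> x"
proof -
  note n = near_bdist[OF near]
  have x': "0 < \<delta> x'" using n x by linarith
  show sup: "dist x y \<le> 4 * \<delta> x" if "cutoff x y \<noteq> 0 \<or> cutoff x' y \<noteq> 0"
  proof (cases "cutoff x y \<noteq> 0")
   case True
   then show ?thesis using cutoff_support[OF x] x by force
  next
   case False
   then have "dist x' y < 3 * \<delta> x'" using that cutoff_support[OF x'] by blast
   then show ?thesis using dist_triangle[of x y x'] n near by linarith
  qed
  show "\<bar>cutoff x y - cutoff x' y\<bar> \<le> 6 * (dist x x' / \<delta> x)"
  proof (cases "cutoff x y \<noteq> 0 \<or> cutoff x' y \<noteq> 0")
   case True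
   have x'y: "dist x' y \<le> 5 * \<delta> x'"
   proof (cases "cutoff x' y \<noteq> 0")
    case True
    then show ?thesis using cutoff_support[OF x'] x' by force
   next
    case False
    then have "dist x y < 3 * \<delta> x" using \<open>cutoff x y \<noteq> 0 \<or> cutoff x' y \<noteq> 0\<close> cutoff_support[OF x] by blast
    then show ?thesis using dist_triangle3[of x' y x] near n by linarith
   qed
   have t1: "\<bar>dist x y - dist x' y\<bar> \<le> dist x x'"
    using dist_triangle[of x y x'] dist_triangle3[of x' y x] by (simp add: abs_le_iff)
   have "dist x y / \<delta> x - dist x' y / \<delta> x' = (dist x y - dist x' y) / \<delta> x + dist x' y / \<delta> x' * ((\<delta> x' - \<delta> x) / \<delta> x)"
    using x x' by (simp add: field_simps)
   then have "\<bar>dist x y / \<delta> x - dist x' y / \<delta> x'\<bar> \<le> \<bar>(dist x y - dist x' y) / \<delta> x\<bar> + \<bar>dist x' y / \<delta> x' * ((\<delta> x' - \<delta> x) / \<delta> x)\<bar>"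
    by linarith
   also have "\<dots> \<le> dist x x' / \<delta> x + 5 * (dist x x' / \<delta> x)"
   proof (rule add_mono)
    show "\<bar>(dist x y - dist x' y) / \<delta> x\<bar> \<le> dist x x' / \<delta> x"
     using t1 x by (simp add: divide_right_mono)
    have "\<bar>\<delta> x' - \<delta> x\<bar> \<le> dist x x'" using bdist_lipschitz[of x' x] by (simp add: dist_commute)
    then have "\<bar>(\<delta> x' - \<delta> x) / \<delta> x\<bar> \<le> dist x x' / \<delta> x" using x by (simp add: divide_right_mono)
    moreover have "\<bar>dist x' y / \<delta> x'\<bar> \<le> 5" using x'y x' by (simp add: divide_le_eq)
    ultimately show "\<bar>dist x' y / \<delta> x' * ((\<delta> x' - \<delta> x) / \<delta> x)\<bar> \<le> 5 * (dist x x' / \<delta> x)"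
     unfolding abs_mult by (intro mult_mono) auto
   qed
   finally have "\<bar>dist x y / \<delta> x - dist x' y / \<delta> x'\<bar> \<le> 6 * (dist x x' / \<delta> x)" by simp
   moreover have "\<bar>max 0 (min 1 (3 - a)) - max 0 (min 1 (3 - b))\<bar> \<le> \<bar>a - b\<bar>" for a b :: real
    by linarith
   ultimately show ?thesis unfolding cutoff_def by (meson order_trans)
  qed (use x in auto)
qed

lemma mker_eq:
  assumes "x \<in> \<Omega>" "y \<notin> \<Omega>" "dist x y \<le> 4 * \<delta> x" "s < 1"
  shows "\<delta> y powr (1 - 2 * s) = mker s x y * (\<delta> x powr (real DIM('a) + 1 - 2 * s) / (1 - s))"
proof -
  have "\<delta> x powr (2 * s - 1 - real DIM('a)) * \<delta> x powr (real DIM('a) + 1 - 2 * s) = 1"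
   using bdist_pos[OF assms(1)] by (simp add: powr_add[symmetric])
  then show ?thesis using assms by (simp add: mker_def field_simps)
qed

lemma avg_weight_le:
  assumes x: "x \<in> \<Omega>" and s: "s < 1" and near: "dist x x' \<le> \<delta> x / 4"
  shows "avg_weight s x' y \<le> mker s x y * (\<delta> x powr (real DIM('a) + 1 - 2 * s) / (1 - s))"
proof (cases "y \<notin> \<Omega> \<and> cutoff x' y \<noteq> 0")
  case True
  have "dist x y \<le> 4 * \<delta> x" using cutoff_diff(2)[OF bdist_pos[OF x] near] True by blast
  then have "\<delta> y powr (1 - 2 * s) = mker s x y * (\<delta> x powr (real DIM('a) + 1 - 2 * s) / (1 - s))"
   using True x s by (intro mker_eq) auto
  moreover have "cutoff x' y * \<delta> y powr (1 - 2 * s) \<le> 1 * \<delta> y powr (1 - 2 * s)"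
   by (intro mult_right_mono cutoff_bounds) auto
  ultimately show ?thesis using True by (simp add: avg_weight_def)
next
  case False
  then have "avg_weight s x' y = 0" by (auto simp: avg_weight_def)
  then show ?thesis using mker_nonneg[OF s] s by simp
qed

lemma avg_weight_diff:
  assumes x: "x \<in> \<Omega>" and s: "s < 1" and near: "dist x x' \<le> \<delta> x / 4"
  shows "\<bar>avg_weight s x y - avg_weight s x' y\<bar> \<le>
   6 * (dist x x' / \<delta> x) * (mker s x y * (\<delta> x powr (real DIM('a) + 1 - 2 * s) / (1 - s)))"
proof (cases "y \<notin> \<Omega> \<and> (cutoff x y \<noteq> 0 \<or> cutoff x' y \<noteq> 0)")
  case True
  have "dist x y \<le> 4 * \<delta> x" using cutoff_diff(2)[OF bdist_pos[OF x] near] True by blast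
  then have e: "\<delta> y powr (1 - 2 * s) = mker s x y * (\<delta> x powr (real DIM('a) + 1 - 2 * s) / (1 - s))"
   using True x s by (intro mker_eq) auto
  have "\<bar>cutoff x y - cutoff x' y\<bar> * \<delta> y powr (1 - 2 * s) \<le> 6 * (dist x x' / \<delta> x) * \<delta> y powr (1 - 2 * s)"
   by (intro mult_right_mono cutoff_diff bdist_pos x near) auto
  moreover have "avg_weight s x y - avg_weight s x' y = (cutoff x y - cutoff x' y) * \<delta> y powr (1 - 2 * s)"
   using True by (simp add: avg_weight_def left_diff_distrib)
  then have "\<bar>avg_weight s x y - avg_weight s x' y\<bar> = \<bar>cutoff x y - cutoff x' y\<bar> * \<delta> y powr (1 - 2 * s)"
   by (simp add: abs_mult)
  ultimately show ?thesis unfolding e by simp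
next
  case False
  then have "avg_weight s x y = 0" "avg_weight s x' y = 0" by (auto simp: avg_weight_def)
  then show ?thesis using mker_nonneg[OF s] s bdist_pos[OF x] by simp
qed

lemma mker_mass:
  "\<exists>C>0. \<forall>s x. 0 < s \<longrightarrow> s < 1 \<longrightarrow> (\<integral>\<^sup>+y. ennreal (mker s x y)) \<le> ennreal C"
proof -
  obtain C0 where C0: "C0 > 0" and int: "\<And>s z r. 0 < s \<Longrightarrow> s < 1 \<Longrightarrow> z \<in> frontier \<Omega> \<Longrightarrow> 0 < r \<Longrightarrow> r \<le> 8 * D \<Longrightarrow>
   (\<integral>\<^sup>+x. ennreal (\<delta> x powr (- s)) * indicator (cball z r) x) \<le>
    ennreal (C0 * (r powr (real DIM('a) - s) / (1 - s)))"
   using bdist_powr_integral by blast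
  define C where "C = C0 * 5 powr (real DIM('a) + 1)"
  have "(\<integral>\<^sup>+y. ennreal (mker s x y)) \<le> ennreal C" if s: "0 < s" "s < 1" for s x
  proof (cases "x \<in> \<Omega>")
   case True
   have x: "0 < \<delta> x" "\<delta> x \<le> D" using bdist_pos bdist_le_D True by auto
   obtain z where z: "z \<in> frontier \<Omega>" "dist x z = \<delta> x" using bdist_attained by blast
   define A where "A = (1 - s) * \<delta> x powr (2 * s - 1 - real DIM('a)) * (5 * \<delta> x) powr (1 - s)"
   have A: "A \<ge> 0" using s by (simp add: A_def)
   have "(\<integral>\<^sup>+y. ennreal (mker s x y)) \<le>
    (\<integral>\<^sup>+y. ennreal A * (ennreal (\<delta> y powr (- s)) * indicator (cball z (5 * \<delta> x)) y))"
   proof (intro nn_integral_mono)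
    fix y
    show "ennreal (mker s x y) \<le> ennreal A * (ennreal (\<delta> y powr (- s)) * indicator (cball z (5 * \<delta> x)) y)"
    proof (cases "mker s x y = 0")
     case False
     note X = mker_nonzeroD[OF False]
     have zy: "dist z y \<le> 5 * \<delta> x" using dist_triangle3[of z y x] X z by linarith
     have "mker s x y = (1 - s) * \<delta> y powr (1 - 2 * s) * \<delta> x powr (2 * s - 1 - real DIM('a))"
      using False by (simp add: mker_def split: if_splits)
     also have "\<delta> y powr (1 - 2 * s) = \<delta> y powr (- s) * \<delta> y powr (1 - s)"
      by (subst powr_add[symmetric]) simp
     also have "(1 - s) * (\<delta> y powr (- s) * \<delta> y powr (1 - s)) * \<delta> x powr (2 * s - 1 - real DIM('a))
      \<le> (1 - s) * (\<delta> y powr (- s) * (5 * \<delta> x) powr (1 - s)) * \<delta> x powr (2 * s - 1 - real DIM('a))"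
      using X s by (intro mult_right_mono mult_left_mono powr_mono2) auto
     also have "\<dots> = A * \<delta> y powr (- s)" by (simp add: A_def)
     finally show ?thesis using zy A by (simp add: indicator_def ennreal_mult[symmetric] ennreal_leI)
    qed simp
   qed
   also have "\<dots> = ennreal A * (\<integral>\<^sup>+y. ennreal (\<delta> y powr (- s)) * indicator (cball z (5 * \<delta> x)) y)"
    by (rule nn_integral_cmult) (unfold indicator_cball_eq, measurable)
   also have "\<dots> \<le> ennreal A * ennreal (C0 * ((5 * \<delta> x) powr (real DIM('a) - s) / (1 - s)))"
    using s z x D1 by (intro mult_left_mono int) auto
   also have "\<dots> = ennreal (C0 * (\<delta> x powr (2 * s - 1 - real DIM('a)) * ((5 * \<delta> x) powr (1 - s) * (5 * \<delta> x) powr (real DIM('a) - s))))"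
    using s by (subst ennreal_mult'[symmetric, OF A]) (simp add: A_def mult_ac)
   also have "(5 * \<delta> x) powr (1 - s) * (5 * \<delta> x) powr (real DIM('a) - s) = (5 * \<delta> x) powr (real DIM('a) + 1 - 2 * s)"
    by (subst powr_add[symmetric]) (simp add: algebra_simps)
   also have "\<dots> = 5 powr (real DIM('a) + 1 - 2 * s) * \<delta> x powr (real DIM('a) + 1 - 2 * s)"
    using x by (simp add: powr_mult)
   also have "\<delta> x powr (2 * s - 1 - real DIM('a)) * (5 powr (real DIM('a) + 1 - 2 * s) * \<delta> x powr (real DIM('a) + 1 - 2 * s))
     = 5 powr (real DIM('a) + 1 - 2 * s)"
   proof -
    have "\<delta> x powr (2 * s - 1 - real DIM('a)) * \<delta> x powr (real DIM('a) + 1 - 2 * s) = 1"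
     using x by (simp add: powr_add[symmetric])
    then show ?thesis by (simp add: mult.left_commute)
   qed
   also have "ennreal (C0 * 5 powr (real DIM('a) + 1 - 2 * s)) \<le> ennreal C"
    unfolding C_def using C0 s by (intro ennreal_leI mult_left_mono powr_mono) auto
   finally show ?thesis .
  qed (simp add: mker_def)
  moreover have "C > 0" using C0 by (simp add: C_def)
  ultimately show ?thesis by blast
qed

lemma mker_bounded_integrable:
  assumes s: "0 < s" "s < 1" and [measurable]: "f \<in> borel_measurable borel" and f: "\<And>y. \<bar>f y\<bar> \<le> A * mker s x y"
  shows "integrable lborel f"
proof (rule integrableI_bounded)
  obtain C where C: "(\<integral>\<^sup>+y. ennreal (mker s x y)) \<le> ennreal C" using mker_mass s by blast
  have "(\<integral>\<^sup>+y. ennreal (norm (f y))) \<le> (\<integral>\<^sup>+y. ennreal \<bar>A\<bar> * ennreal (mker s x y))"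
  proof (intro nn_integral_mono)
   fix y
   have "norm (f y) \<le> \<bar>A\<bar> * mker s x y"
    using f[of y] mult_right_mono[OF abs_ge_self[of A] mker_nonneg[OF s(2), of x y]] by simp
   then show "ennreal (norm (f y)) \<le> ennreal \<bar>A\<bar> * ennreal (mker s x y)"
    using mker_nonneg[OF s(2)] by (simp add: ennreal_mult[symmetric] ennreal_leI)
  qed
  also have "\<dots> = ennreal \<bar>A\<bar> * (\<integral>\<^sup>+y. ennreal (mker s x y))"
   by (rule nn_integral_cmult) measurable
  also have "\<dots> \<le> ennreal \<bar>A\<bar> * ennreal C" by (intro mult_left_mono C) simp
  also have "\<dots> < \<infinity>" by (simp add: ennreal_mult_less_top)
  finally show "(\<integral>\<^sup>+y. ennreal (norm (f y))) < \<infinity>" .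
qed simp

lemma avg_weight_integrable:
  assumes "x \<in> \<Omega>" "0 < s" "s < 1"
  shows "integrable lborel (avg_weight s x)"
proof -
  have "dist x x \<le> \<delta> x / 4" by simp
  from avg_weight_le[OF assms(1,3) this] show ?thesis
   using assms avg_weight_nonneg
   by (intro mker_bounded_integrable[where A="\<delta> x powr (real DIM('a) + 1 - 2 * s) / (1 - s)" and x=x and s=s])
    (auto simp: mult.commute)
qed

lemma avg_mass_lower:
  "\<exists>c>0. \<forall>s x. 0 < s \<longrightarrow> s < 1 \<longrightarrow> x \<in> \<Omega> \<longrightarrow>
   c * (\<delta> x powr (real DIM('a) + 1 - 2 * s) / (1 - s)) \<le> avg_mass s x"
proof -
  obtain c where c: "c > 0" and int: "\<And>s z r. 0 < s \<Longrightarrow> s < 1 \<Longrightarrow> z \<in> frontier \<Omega> \<Longrightarrow> 0 < r \<Longrightarrow> r \<le> D \<Longrightarrow>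
   ennreal (c * (r powr (real DIM('a) + 1 - 2 * s) / (1 - s))) \<le>
   (\<integral>\<^sup>+x. ennreal (\<delta> x powr (1 - 2 * s)) * indicator (cball z r - \<Omega>) x)"
   using exterior_mass_lower by blast
  have "c * (\<delta> x powr (real DIM('a) + 1 - 2 * s) / (1 - s)) \<le> avg_mass s x"
   if s: "0 < s" "s < 1" and x: "x \<in> \<Omega>" for s x
  proof -
   have dx: "0 < \<delta> x" "\<delta> x \<le> D" using bdist_pos bdist_le_D x by auto
   obtain z where z: "z \<in> frontier \<Omega>" "dist x z = \<delta> x" using bdist_attained by blast
   have "ennreal (c * (\<delta> x powr (real DIM('a) + 1 - 2 * s) / (1 - s))) \<le>
    (\<integral>\<^sup>+y. ennreal (\<delta> y powr (1 - 2 * s)) * indicator (cball z (\<delta> x) - \<Omega>) y)"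
    using s z dx by (intro int) auto
   also have "\<dots> \<le> (\<integral>\<^sup>+y. ennreal (avg_weight s x y))"
   proof (intro nn_integral_mono)
    fix y
    have "cutoff x y = 1" if "dist z y \<le> \<delta> x"
    proof -
     have "dist x y \<le> 2 * \<delta> x" using dist_triangle[of x y z] z that by linarith
     then show ?thesis using dx by (simp add: cutoff_def max_def min_def divide_le_eq)
    qed
    then show "ennreal (\<delta> y powr (1 - 2 * s)) * indicator (cball z (\<delta> x) - \<Omega>) y \<le> ennreal (avg_weight s x y)"
     by (auto simp: indicator_def avg_weight_def)
   qed
   also have "\<dots> = ennreal (avg_mass s x)"
    unfolding avg_mass_def using avg_weight_integrable[OF x s] avg_weight_nonneg
    by (intro nn_integral_eq_integral) auto
   finally show ?thesis
    by (subst (asm) ennreal_le_iff) (auto simp: avg_mass_def avg_weight_nonneg intro!: integral_nonneg)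
  qed
  with c show ?thesis by blast
qed

text \<open>Cauchy-Schwarz inequality with respect to the kernel, whose total mass is bounded.\<close>

lemma weighted_mean_sq:
  "\<exists>C>0. \<forall>s x A q f. 0 < s \<longrightarrow> s < 1 \<longrightarrow> 0 \<le> A \<longrightarrow> q \<in> borel_measurable borel \<longrightarrow> f \<in> borel_measurable borel \<longrightarrow>
   (\<forall>y. \<bar>q y\<bar> \<le> A * mker s x y) \<longrightarrow>
   ennreal ((\<integral>y. q y * f y \<partial>lborel)\<^sup>2) \<le> ennreal (C * A\<^sup>2) * (\<integral>\<^sup>+y. ennreal (mker s x y) * ennreal ((f y)\<^sup>2))"
proof -
  obtain C where C: "C > 0" and mass: "\<And>s x. 0 < s \<Longrightarrow> s < 1 \<Longrightarrow> (\<integral>\<^sup>+y. ennreal (mker s x y)) \<le> ennreal C"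
   using mker_mass by blast
  have "ennreal ((\<integral>y. q y * f y \<partial>lborel)\<^sup>2) \<le> ennreal (C * A\<^sup>2) * (\<integral>\<^sup>+y. ennreal (mker s x y) * ennreal ((f y)\<^sup>2))"
   if s: "0 < s" "s < 1" and A: "0 \<le> A" and [measurable]: "q \<in> borel_measurable borel" "f \<in> borel_measurable borel"
    and q: "\<And>y. \<bar>q y\<bar> \<le> A * mker s x y" for s x A q f
  proof (cases "integrable lborel (\<lambda>y. q y * f y)")
   case True
   note m0 = mker_nonneg[OF s(2)]
   let ?I = "\<integral>y. q y * f y \<partial>lborel"
   let ?N = "\<integral>\<^sup>+y. ennreal (sqrt (mker s x y)) * ennreal (sqrt (mker s x y) * \<bar>f y\<bar>)"
   have "ennreal \<bar>?I\<bar> \<le> (\<integral>\<^sup>+y. ennreal (norm (q y * f y)))"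
    using integral_norm_bound_ennreal[OF True] by simp
   also have "\<dots> \<le> (\<integral>\<^sup>+y. ennreal A * (ennreal (sqrt (mker s x y)) * ennreal (sqrt (mker s x y) * \<bar>f y\<bar>)))"
   proof (intro nn_integral_mono)
    fix y
    have "norm (q y * f y) \<le> A * mker s x y * \<bar>f y\<bar>"
     using mult_right_mono[OF q[of y], of "\<bar>f y\<bar>"] by (simp add: abs_mult)
    also have "\<dots> = A * (sqrt (mker s x y) * (sqrt (mker s x y) * \<bar>f y\<bar>))"
     using m0[of x y] by (simp add: mult.assoc[symmetric]) 
    finally have "ennreal (norm (q y * f y)) \<le> ennreal (A * (sqrt (mker s x y) * (sqrt (mker s x y) * \<bar>f y\<bar>)))"
     by (rule ennreal_leI)
    then show "ennreal (norm (q y * f y)) \<le> ennreal A * (ennreal (sqrt (mker s x y)) * ennreal (sqrt (mker s x y) * \<bar>f y\<bar>))"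
     using A m0[of x y] by (simp add: ennreal_mult)
   qed
   also have "\<dots> = ennreal A * ?N" by (rule nn_integral_cmult) measurable
   finally have "(ennreal \<bar>?I\<bar>)\<^sup>2 \<le> (ennreal A * ?N)\<^sup>2" by (intro power_mono) auto
   then have I2: "ennreal (?I\<^sup>2) \<le> ennreal (A\<^sup>2) * ?N\<^sup>2"
    using A by (simp add: power_mult_distrib ennreal_power)
   have "?N\<^sup>2 \<le> (\<integral>\<^sup>+y. (ennreal (sqrt (mker s x y)))\<^sup>2) * (\<integral>\<^sup>+y. (ennreal (sqrt (mker s x y) * \<bar>f y\<bar>))\<^sup>2)"
    by (rule Cauchy_Schwarz_nn_integral) measurable
   also have "(\<integral>\<^sup>+y. (ennreal (sqrt (mker s x y)))\<^sup>2) = (\<integral>\<^sup>+y. ennreal (mker s x y))"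
    using m0 by (intro nn_integral_cong) (simp add: ennreal_power)
   also have "(\<integral>\<^sup>+y. (ennreal (sqrt (mker s x y) * \<bar>f y\<bar>))\<^sup>2) = (\<integral>\<^sup>+y. ennreal (mker s x y) * ennreal ((f y)\<^sup>2))"
    using m0 by (intro nn_integral_cong) (simp add: ennreal_power power_mult_distrib ennreal_mult)
   also have "(\<integral>\<^sup>+y. ennreal (mker s x y)) * (\<integral>\<^sup>+y. ennreal (mker s x y) * ennreal ((f y)\<^sup>2))
    \<le> ennreal C * (\<integral>\<^sup>+y. ennreal (mker s x y) * ennreal ((f y)\<^sup>2))"
    by (intro mult_right_mono mass s) simp
   finally have "?N\<^sup>2 \<le> ennreal C * (\<integral>\<^sup>+y. ennreal (mker s x y) * ennreal ((f y)\<^sup>2))" .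
   then have "ennreal (A\<^sup>2) * ?N\<^sup>2 \<le> ennreal (A\<^sup>2) * (ennreal C * (\<integral>\<^sup>+y. ennreal (mker s x y) * ennreal ((f y)\<^sup>2)))"
    by (rule mult_left_mono) simp
   also have "\<dots> = ennreal (C * A\<^sup>2) * (\<integral>\<^sup>+y. ennreal (mker s x y) * ennreal ((f y)\<^sup>2))"
    using C by (simp add: ennreal_mult mult.assoc mult.left_commute)
   finally show ?thesis using I2 by (rule order_trans[rotated])
  next
   case False
   then show ?thesis by (simp add: not_integrable_integral_eq)
  qed
  with C show ?thesis by blast
qed

lemma avg_weight_mult_integrable:
  assumes x: "x \<in> \<Omega>" and s: "0 < s" "s < 1" and near: "dist x x' \<le> \<delta> x / 4" and [measurable]: "g \<in> borel_measurable borel"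
   and fin: "(\<integral>\<^sup>+y. ennreal (mker s x y) * ennreal ((g y)\<^sup>2)) < \<infinity>"
  shows "integrable lborel (\<lambda>y. avg_weight s x' y * g y)"
proof (rule integrableI_bounded)
  obtain C where C: "(\<integral>\<^sup>+y. ennreal (mker s x y)) \<le> ennreal C" using mker_mass s by blast
  define A where "A = \<delta> x powr (real DIM('a) + 1 - 2 * s) / (1 - s)"
  have A: "A \<ge> 0" using s by (simp add: A_def)
  note m0 = mker_nonneg[OF s(2)]
  have "(\<integral>\<^sup>+y. ennreal (norm (avg_weight s x' y * g y))) \<le>
   (\<integral>\<^sup>+y. ennreal A * (ennreal (mker s x y) + ennreal (mker s x y) * ennreal ((g y)\<^sup>2)))"
  proof (intro nn_integral_mono)
   fix y
   have g: "\<bar>g y\<bar> \<le> 1 + (g y)\<^sup>2"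
   proof -
    have "0 \<le> (\<bar>g y\<bar> - 1)\<^sup>2" by simp
    then have "2 * \<bar>g y\<bar> \<le> 1 + (g y)\<^sup>2" by (simp add: power2_diff)
    then show ?thesis by linarith
   qed
   have "norm (avg_weight s x' y * g y) = avg_weight s x' y * \<bar>g y\<bar>"
    using avg_weight_nonneg by (simp add: abs_mult)
   also have "\<dots> \<le> (mker s x y * A) * (1 + (g y)\<^sup>2)"
    unfolding A_def using avg_weight_nonneg m0 s by (intro mult_mono avg_weight_le x near g) auto
   also have "\<dots> = A * (mker s x y + mker s x y * (g y)\<^sup>2)" by (simp add: algebra_simps)
   finally have "ennreal (norm (avg_weight s x' y * g y)) \<le> ennreal (A * (mker s x y + mker s x y * (g y)\<^sup>2))"
    by (rule ennreal_leI)
   then show "ennreal (norm (avg_weight s x' y * g y)) \<le> ennreal A * (ennreal (mker s x y) + ennreal (mker s x y) * ennreal ((g y)\<^sup>2))"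
    using A m0[of x y] by (simp add: ennreal_mult)
  qed
  also have "\<dots> = ennreal A * (\<integral>\<^sup>+y. ennreal (mker s x y) + ennreal (mker s x y) * ennreal ((g y)\<^sup>2))"
   by (rule nn_integral_cmult) measurable
  also have "(\<integral>\<^sup>+y. ennreal (mker s x y) + ennreal (mker s x y) * ennreal ((g y)\<^sup>2)) =
   (\<integral>\<^sup>+y. ennreal (mker s x y)) + (\<integral>\<^sup>+y. ennreal (mker s x y) * ennreal ((g y)\<^sup>2))"
   by (rule nn_integral_add) measurable
  also have "ennreal A * \<dots> < \<infinity>"
   using C fin by (simp add: ennreal_mult_less_top less_le_trans) (meson ennreal_less_top le_less_trans)
  finally show "(\<integral>\<^sup>+y. ennreal (norm (avg_weight s x' y * g y))) < \<infinity>" .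
qed measurable

definition avg_const :: "real \<Rightarrow> bool" where
  "avg_const C \<longleftrightarrow> (\<forall>s g x x' c. 0 < s \<longrightarrow> s < 1 \<longrightarrow> g \<in> borel_measurable borel \<longrightarrow> x \<in> \<Omega> \<longrightarrow> x' \<in> \<Omega> \<longrightarrow> dist x x' \<le> \<delta> x / 4 \<longrightarrow>
   (\<integral>\<^sup>+y. ennreal (mker s x y) * ennreal ((g y)\<^sup>2)) < \<infinity> \<longrightarrow>
   ennreal ((ext_avg s g x' - c)\<^sup>2) \<le> ennreal C * (\<integral>\<^sup>+y. ennreal (mker s x y) * ennreal ((g y - c)\<^sup>2)) \<and>
   ennreal ((ext_avg s g x - ext_avg s g x')\<^sup>2) \<le> ennreal (C * (dist x x' / \<delta> x)\<^sup>2) *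
    (\<integral>\<^sup>+y. ennreal (mker s x y) * ennreal ((g y - ext_avg s g x')\<^sup>2)))"

text \<open>The first estimate is Jensen's inequality. In the second one, subtracting the value \<open>ext_avg s g x'\<close>
from \<open>g\<close> annihilates the average at \<open>x'\<close>, so that only the difference of the weights acts, and this
difference is small of order \<open>dist x x' / \<delta> x\<close>.\<close>

lemma avg_const_exists: "\<exists>C>0. avg_const C"
proof -
  from weighted_mean_sq obtain C0 where C0: "C0 > 0" and sq0: "\<forall>s x A q f. 0 < s \<longrightarrow> s < 1 \<longrightarrow> 0 \<le> A \<longrightarrow> q \<in> borel_measurable borel \<longrightarrow> f \<in> borel_measurable borel \<longrightarrow>
   (\<forall>y. \<bar>q y\<bar> \<le> A * mker s x y) \<longrightarrow>
   ennreal ((\<integral>y. q y * f y \<partial>lborel)\<^sup>2) \<le> ennreal (C0 * A\<^sup>2) * (\<integral>\<^sup>+y. ennreal (mker s x y) * ennreal ((f y)\<^sup>2))"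
   by (elim exE conjE)
  have sq: "\<And>s x A q f. 0 < s \<Longrightarrow> s < 1 \<Longrightarrow> 0 \<le> A \<Longrightarrow> q \<in> borel_measurable borel \<Longrightarrow> f \<in> borel_measurable borel \<Longrightarrow>
   (\<And>y. \<bar>q y\<bar> \<le> A * mker s x y) \<Longrightarrow>
   ennreal ((\<integral>y. q y * f y \<partial>lborel)\<^sup>2) \<le> ennreal (C0 * A\<^sup>2) * (\<integral>\<^sup>+y. ennreal (mker s x y) * ennreal ((f y)\<^sup>2))"
   by (rule sq0[rule_format])
  obtain c0 where c0: "c0 > 0" and low: "\<And>s x. 0 < s \<Longrightarrow> s < 1 \<Longrightarrow> x \<in> \<Omega> \<Longrightarrow>
   c0 * (\<delta> x powr (real DIM('a) + 1 - 2 * s) / (1 - s)) \<le> avg_mass s x"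
   using avg_mass_lower by blast
  define c1 where "c1 = c0 * (3 / 4) powr (real DIM('a) + 1)"
  have "(3 / 4) powr (real DIM('a) + 1) \<le> 1" by (intro powr_le1) auto
  then have c1: "c1 > 0" "c1 \<le> c0" using c0 by (simp_all add: c1_def mult_left_le)
  define C where "C = C0 * (6 / c1)\<^sup>2"
  have C: "C > 0" using C0 c1 by (simp add: C_def)
  have "ennreal ((ext_avg s g x' - c)\<^sup>2) \<le> ennreal C * (\<integral>\<^sup>+y. ennreal (mker s x y) * ennreal ((g y - c)\<^sup>2)) \<and>
   ennreal ((ext_avg s g x - ext_avg s g x')\<^sup>2) \<le> ennreal (C * (dist x x' / \<delta> x)\<^sup>2) *
    (\<integral>\<^sup>+y. ennreal (mker s x y) * ennreal ((g y - ext_avg s g x')\<^sup>2))"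
   if s: "0 < s" "s < 1" and [measurable]: "g \<in> borel_measurable borel" and x: "x \<in> \<Omega>" and x': "x' \<in> \<Omega>"
    and near: "dist x x' \<le> \<delta> x / 4"
    and fin: "(\<integral>\<^sup>+y. ennreal (mker s x y) * ennreal ((g y)\<^sup>2)) < \<infinity>" for s g x x' c
  proof -
   define B where "B = \<delta> x powr (real DIM('a) + 1 - 2 * s) / (1 - s)"
   have dx: "\<delta> x > 0" by (rule bdist_pos[OF x])
   have B: "B > 0" using dx s by (simp add: B_def)
   have nn: "dist x x \<le> \<delta> x / 4" using dx by simp
   have massx: "c1 * B \<le> avg_mass s x"
   proof -
    have "c1 * B \<le> c0 * B" using c1 B by (intro mult_right_mono) auto
    also have "\<dots> \<le> avg_mass s x" unfolding B_def by (rule low[OF s x])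
    finally show ?thesis .
   qed
   have massx': "c1 * B \<le> avg_mass s x'"
   proof -
    have n: "3 / 4 * \<delta> x \<le> \<delta> x'" by (rule near_bdist[OF near])
    have "(3 / 4) powr (real DIM('a) + 1) * \<delta> x powr (real DIM('a) + 1 - 2 * s) \<le>
     (3 / 4) powr (real DIM('a) + 1 - 2 * s) * \<delta> x powr (real DIM('a) + 1 - 2 * s)"
     using s by (intro mult_right_mono powr_mono') auto
    also have "\<dots> = (3 / 4 * \<delta> x) powr (real DIM('a) + 1 - 2 * s)" by (subst powr_mult) (use dx in simp_all)
    also have "\<dots> \<le> \<delta> x' powr (real DIM('a) + 1 - 2 * s)"
     using n dx s DIM_ge_1[where 'a='a] by (intro powr_mono2) linarith+
    finally have "c1 * B \<le> c0 * (\<delta> x' powr (real DIM('a) + 1 - 2 * s) / (1 - s))"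
    proof -
     assume "(3 / 4) powr (real DIM('a) + 1) * \<delta> x powr (real DIM('a) + 1 - 2 * s) \<le> \<delta> x' powr (real DIM('a) + 1 - 2 * s)"
     then have "c0 * ((3 / 4) powr (real DIM('a) + 1) * \<delta> x powr (real DIM('a) + 1 - 2 * s) / (1 - s))
      \<le> c0 * (\<delta> x' powr (real DIM('a) + 1 - 2 * s) / (1 - s))"
      using c0 s by (intro mult_left_mono divide_right_mono) auto
     then show ?thesis by (simp add: c1_def B_def)
    qed
    also have "\<dots> \<le> avg_mass s x'" by (rule low[OF s x'])
    finally show ?thesis .
   qed
   have cB: "c1 * B > 0" using c1 B by simp
   have Nx: "avg_mass s x > 0" "avg_mass s x' > 0" using massx massx' cB by linarith+
   have i1: "integrable lborel (\<lambda>y. avg_weight s x y * g y)" "integrable lborel (\<lambda>y. avg_weight s x' y * g y)"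
    by (rule avg_weight_mult_integrable[OF x s nn _ fin] avg_weight_mult_integrable[OF x s near _ fin]; measurable)+
   have i2: "integrable lborel (avg_weight s x)" "integrable lborel (avg_weight s x')"
    by (rule avg_weight_integrable[OF x s] avg_weight_integrable[OF x' s])+
   have scale: "a / N \<le> K / c1 * m" if "a \<le> K * (m * B)" "c1 * B \<le> N" "0 \<le> m" "0 \<le> K" for a N K m
   proof -
    have "a / N \<le> K * (m * B) / N" using that cB by (intro divide_right_mono) linarith+
    also have "\<dots> \<le> K * (m * B) / (c1 * B)" using that cB B by (intro divide_left_mono) auto
    also have "\<dots> = K / c1 * m" using B by simp
    finally show ?thesis .
   qed
   have J: "ennreal ((ext_avg s g x' - c)\<^sup>2) \<le> ennreal C * (\<integral>\<^sup>+y. ennreal (mker s x y) * ennreal ((g y - c)\<^sup>2))"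
   proof -
    have "(\<integral>y. avg_weight s x' y / avg_mass s x' * (g y - c) \<partial>lborel) =
     (\<integral>y. (avg_weight s x' y * g y) / avg_mass s x' - c / avg_mass s x' * avg_weight s x' y \<partial>lborel)"
     by (intro Bochner_Integration.integral_cong refl) (simp add: right_diff_distrib)
    also have "\<dots> = (\<integral>y. avg_weight s x' y * g y \<partial>lborel) / avg_mass s x' - c / avg_mass s x' * avg_mass s x'"
     unfolding avg_mass_def using i1 i2 by (subst Bochner_Integration.integral_diff) auto
    also have "\<dots> = ext_avg s g x' - c" using Nx by (simp add: ext_avg_def)
    finally have e: "ext_avg s g x' - c = (\<integral>y. avg_weight s x' y / avg_mass s x' * (g y - c) \<partial>lborel)" ..
    have "ennreal ((ext_avg s g x' - c)\<^sup>2) \<le> ennreal (C0 * (1 / c1)\<^sup>2) * (\<integral>\<^sup>+y. ennreal (mker s x y) * ennreal ((g y - c)\<^sup>2))"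
     unfolding e
    proof (rule sq[OF s])
     show "\<bar>avg_weight s x' y / avg_mass s x'\<bar> \<le> 1 / c1 * mker s x y" for y
     proof -
      have "avg_weight s x' y \<le> 1 * (mker s x y * B)"
       using avg_weight_le[OF x s(2) near, of y] unfolding B_def by (simp only: mult_1)
      from scale[OF this massx' mker_nonneg[OF s(2)]]
      have "avg_weight s x' y / avg_mass s x' \<le> 1 / c1 * mker s x y" by simp
      moreover have "0 \<le> avg_weight s x' y / avg_mass s x'"
       using avg_weight_nonneg[of s x' y] Nx by simp
      ultimately show ?thesis by (simp only: abs_of_nonneg)
     qed
     show "0 \<le> 1 / c1" using c1 by simp
    qed measurable
    also have "\<dots> \<le> ennreal C * (\<integral>\<^sup>+y. ennreal (mker s x y) * ennreal ((g y - c)\<^sup>2))"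
     unfolding C_def using C0 c1 by (intro mult_right_mono ennreal_leI mult_left_mono power_mono divide_right_mono) auto
    finally show ?thesis .
   qed
   have N: "ennreal ((ext_avg s g x - ext_avg s g x')\<^sup>2) \<le> ennreal (C * (dist x x' / \<delta> x)\<^sup>2) *
    (\<integral>\<^sup>+y. ennreal (mker s x y) * ennreal ((g y - ext_avg s g x')\<^sup>2))"
   proof -
    let ?c = "ext_avg s g x'"
    let ?q = "\<lambda>y. (avg_weight s x y - avg_weight s x' y) / avg_mass s x"
    have "(\<integral>y. ?q y * (g y - ?c) \<partial>lborel) =
     (\<integral>y. ((avg_weight s x y * g y - avg_weight s x' y * g y) - ?c * (avg_weight s x y - avg_weight s x' y)) / avg_mass s x \<partial>lborel)"
    proof (intro Bochner_Integration.integral_cong refl)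
     fix y
     have "(a - b) / N * (u - c) = ((a * u - b * u) - c * (a - b)) / N" for a b N u c :: real
     proof -
      have "(a * u - b * u) - c * (a - b) = (a - b) * (u - c)" by (simp add: algebra_simps)
      then show ?thesis by simp
     qed
     then show "?q y * (g y - ?c) = ((avg_weight s x y * g y - avg_weight s x' y * g y) - ?c * (avg_weight s x y - avg_weight s x' y)) / avg_mass s x" .
    qed
    also have "\<dots> = (((\<integral>y. avg_weight s x y * g y \<partial>lborel) - (\<integral>y. avg_weight s x' y * g y \<partial>lborel))
      - ?c * (avg_mass s x - avg_mass s x')) / avg_mass s x"
    proof -
     have "(\<integral>y. ((avg_weight s x y * g y - avg_weight s x' y * g y) - ?c * (avg_weight s x y - avg_weight s x' y)) / avg_mass s x \<partial>lborel)
      = (\<integral>y. (avg_weight s x y * g y - avg_weight s x' y * g y) - ?c * (avg_weight s x y - avg_weight s x' y) \<partial>lborel) / avg_mass s x"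
      by (rule integral_divide_zero)
     also have "(\<integral>y. (avg_weight s x y * g y - avg_weight s x' y * g y) - ?c * (avg_weight s x y - avg_weight s x' y) \<partial>lborel)
      = (\<integral>y. avg_weight s x y * g y - avg_weight s x' y * g y \<partial>lborel) - (\<integral>y. ?c * (avg_weight s x y - avg_weight s x' y) \<partial>lborel)"
      by (intro Bochner_Integration.integral_diff Bochner_Integration.integrable_diff integrable_mult_right i1 i2)
     also have "(\<integral>y. avg_weight s x y * g y - avg_weight s x' y * g y \<partial>lborel) = (\<integral>y. avg_weight s x y * g y \<partial>lborel) - (\<integral>y. avg_weight s x' y * g y \<partial>lborel)"
      by (intro Bochner_Integration.integral_diff i1)
     also have "(\<integral>y. ?c * (avg_weight s x y - avg_weight s x' y) \<partial>lborel) = ?c * (\<integral>y. avg_weight s x y - avg_weight s x' y \<partial>lborel)"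
      by (rule integral_mult_right_zero)
     also have "(\<integral>y. avg_weight s x y - avg_weight s x' y \<partial>lborel) = avg_mass s x - avg_mass s x'"
      unfolding avg_mass_def by (intro Bochner_Integration.integral_diff i2)
     finally show ?thesis .
    qed
    also have "\<dots> = ext_avg s g x - ?c"
    proof -
     have "?c * avg_mass s x' = (\<integral>y. avg_weight s x' y * g y \<partial>lborel)" using Nx by (simp add: ext_avg_def)
     then have e1: "(\<integral>y. avg_weight s x y * g y \<partial>lborel) - (\<integral>y. avg_weight s x' y * g y \<partial>lborel) - ?c * (avg_mass s x - avg_mass s x')
      = (\<integral>y. avg_weight s x y * g y \<partial>lborel) - ?c * avg_mass s x" by (simp add: right_diff_distrib)
     show ?thesis unfolding e1 using Nx by (simp add: ext_avg_def[of s g x] diff_divide_distrib)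
    qed
    finally have e: "ext_avg s g x - ?c = (\<integral>y. ?q y * (g y - ?c) \<partial>lborel)" ..
    have "ennreal ((ext_avg s g x - ?c)\<^sup>2) \<le> ennreal (C0 * (6 * (dist x x' / \<delta> x) / c1)\<^sup>2) *
      (\<integral>\<^sup>+y. ennreal (mker s x y) * ennreal ((g y - ?c)\<^sup>2))"
     unfolding e
    proof (rule sq[OF s])
     show "0 \<le> 6 * (dist x x' / \<delta> x) / c1" using dx c1 by simp
     show "\<bar>?q y\<bar> \<le> 6 * (dist x x' / \<delta> x) / c1 * mker s x y" for y
     proof -
      have "\<bar>avg_weight s x y - avg_weight s x' y\<bar> \<le> 6 * (dist x x' / \<delta> x) * (mker s x y * B)"
       unfolding B_def by (rule avg_weight_diff[OF x s(2) near])
      from scale[OF this massx mker_nonneg[OF s(2)]]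
      have "\<bar>avg_weight s x y - avg_weight s x' y\<bar> / avg_mass s x \<le> 6 * (dist x x' / \<delta> x) / c1 * mker s x y"
       using dx by simp
      moreover have "\<bar>?q y\<bar> = \<bar>avg_weight s x y - avg_weight s x' y\<bar> / avg_mass s x"
       using Nx by (simp only: abs_divide abs_of_pos)
      ultimately show ?thesis by (simp only:)
     qed
    qed measurable
    also have "C0 * (6 * (dist x x' / \<delta> x) / c1)\<^sup>2 = C * (dist x x' / \<delta> x)\<^sup>2"
     by (simp add: C_def power_mult_distrib power_divide mult_ac)
    finally show ?thesis .
   qed
   from J N show ?thesis by (rule conjI)
  qed
  then show ?thesis unfolding avg_const_def by (intro exI[of _ C] conjI[OF C] allI impI)
qed

end

section \<open>Boundedness of the extension\<close>

definition trace_mass :: "real \<Rightarrow> 'a::euclidean_space set \<Rightarrow> ('a \<Rightarrow> real) \<Rightarrow> ennreal" where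
  "trace_mass s \<Omega> g = (\<integral>\<^sup>+x. ennreal ((g x)\<^sup>2 * tau_density s \<Omega> x) * indicator (- \<Omega>) x)"

definition trace_energy :: "real \<Rightarrow> 'a::euclidean_space set \<Rightarrow> ('a \<Rightarrow> real) \<Rightarrow> ennreal" where
  "trace_energy s \<Omega> g = (\<integral>\<^sup>+x. (\<integral>\<^sup>+y. ennreal ((g x - g y)\<^sup>2 * trace_kernel s \<Omega> x y) * indicator (- \<Omega>) y)
   * indicator (- \<Omega>) x)"

definition gagliardo :: "real \<Rightarrow> ('a::euclidean_space \<Rightarrow> real) \<Rightarrow> 'a \<Rightarrow> 'a \<Rightarrow> ennreal" where
  "gagliardo s u x y = ennreal ((u x - u y)\<^sup>2) * ennreal (dist x y powr (- (real DIM('a) + 2 * s)))"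

lemma gagliardo_measurable [measurable]:
  assumes [measurable]: "u \<in> borel_measurable borel" "f \<in> borel_measurable N" "g \<in> borel_measurable N"
  shows "(\<lambda>x. gagliardo s u (f x) (g x)) \<in> borel_measurable N"
  unfolding gagliardo_def by measurable

lemma gagliardo_sym: "gagliardo s u x y = gagliardo s u y x"
  by (simp add: gagliardo_def dist_commute power2_commute)

lemma nn_integral_rotate4:
  fixes F :: "'a::euclidean_space \<Rightarrow> 'a \<Rightarrow> 'a \<Rightarrow> 'a \<Rightarrow> ennreal"
  assumes F: "(\<lambda>(a, b, c, d). F a b c d) \<in> borel_measurable (borel \<Otimes>\<^sub>M borel \<Otimes>\<^sub>M borel \<Otimes>\<^sub>M borel)"
  shows "(\<integral>\<^sup>+a b c d. F a b c d) =
   (\<integral>\<^sup>+c d b a. F a b c d)"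
proof -
  have [measurable]: "(\<lambda>w. F (p w) (q w) (r w) (t w)) \<in> borel_measurable N"
   if [measurable]: "p \<in> borel_measurable N" "q \<in> borel_measurable N" "r \<in> borel_measurable N" "t \<in> borel_measurable N"
   for p q r t and N :: "'b measure"
   using measurable_compose[of "\<lambda>w. (p w, q w, r w, t w)" N, OF _ F] by simp
  have "(\<integral>\<^sup>+a b c d. F a b c d) =
    (\<integral>\<^sup>+a c b d. F a b c d)"
   by (rule nn_integral_cong, rule nn_integral_swap) measurable
  also have "\<dots> = (\<integral>\<^sup>+c a b d. F a b c d)"
   by (rule nn_integral_swap) measurable
  also have "\<dots> = (\<integral>\<^sup>+c a d b. F a b c d)"
   by (rule nn_integral_cong, rule nn_integral_cong, rule nn_integral_swap) measurable
  also have "\<dots> = (\<integral>\<^sup>+c d a b. F a b c d)"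
   by (rule nn_integral_cong, rule nn_integral_swap) measurable
  also have "\<dots> = (\<integral>\<^sup>+c d b a. F a b c d)"
   by (rule nn_integral_cong, rule nn_integral_cong, rule nn_integral_swap) measurable
  finally show ?thesis .
qed

lemma nn_integral_rotate3:
  fixes F :: "'a::euclidean_space \<Rightarrow> 'a \<Rightarrow> 'a \<Rightarrow> ennreal"
  assumes F: "(\<lambda>(a, b, c). F a b c) \<in> borel_measurable (borel \<Otimes>\<^sub>M borel \<Otimes>\<^sub>M borel)"
  shows "(\<integral>\<^sup>+a b c. F a b c) =
   (\<integral>\<^sup>+b c a. F a b c)"
proof -
  have [measurable]: "(\<lambda>w. F (p w) (q w) (r w)) \<in> borel_measurable N"
   if [measurable]: "p \<in> borel_measurable N" "q \<in> borel_measurable N" "r \<in> borel_measurable N"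
   for p q r and N :: "'b measure"
   using measurable_compose[of "\<lambda>w. (p w, q w, r w)" N, OF _ F] by simp
  have "(\<integral>\<^sup>+a b c. F a b c) =
    (\<integral>\<^sup>+b a c. F a b c)"
   by (rule nn_integral_swap) measurable
  also have "\<dots> = (\<integral>\<^sup>+b c a. F a b c)"
   by (rule nn_integral_cong, rule nn_integral_swap) measurable
  finally show ?thesis .
qed

context lipschitz_domain
begin

text \<open>The integrals in \<open>ext_avg\<close> converge under this condition, which every Borel function of finite trace norm
satisfies.\<close>

definition averageable :: "real \<Rightarrow> ('a \<Rightarrow> real) \<Rightarrow> bool" where
  "averageable s g \<longleftrightarrow> g \<in> borel_measurable borel \<and>
   (\<forall>x\<in>\<Omega>. (\<integral>\<^sup>+y. ennreal (mker s x y) * ennreal ((g y)\<^sup>2)) < \<infinity>)"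

definition extension :: "real \<Rightarrow> ('a \<Rightarrow> real) \<Rightarrow> 'a \<Rightarrow> real" where
  "extension s g x = (if x \<in> \<Omega> then ext_avg s g x else g x)"

lemma extension_measurable [measurable]:
  assumes [measurable]: "g \<in> borel_measurable borel"
  shows "extension s g \<in> borel_measurable borel"
proof -
  have [measurable]: "(\<lambda>x. \<integral>y. avg_weight s x y * g y \<partial>lborel) \<in> borel_measurable borel"
   by (rule lborel.borel_measurable_lebesgue_integral) measurable
  have [measurable]: "avg_mass s \<in> borel_measurable borel"
   unfolding avg_mass_def by (rule lborel.borel_measurable_lebesgue_integral) measurable
  show ?thesis unfolding extension_def ext_avg_def by measurable
qed

text \<open>After Fubini's theorem each energy of the extension is a double integral of squared increments of
\<open>g\<close> against a kernel \<open>H\<close>; a pointwise bound for \<open>H\<close> away from the boundary is enough because the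
boundary is a null set.\<close>

lemma kernel_compare:
  assumes s: "s < 1" and C: "0 \<le> C" and [measurable]: "g \<in> borel_measurable borel"
   and H: "\<And>y y'. y \<notin> \<Omega> \<Longrightarrow> y' \<notin> \<Omega> \<Longrightarrow> 0 < \<delta> y \<Longrightarrow> 0 < \<delta> y' \<Longrightarrow> H y y' \<le> ennreal (C * trace_kernel s \<Omega> y y')"
   and zero: "\<And>y y'. y \<in> \<Omega> \<or> y' \<in> \<Omega> \<Longrightarrow> H y y' = 0"
  shows "(\<integral>\<^sup>+y y'. ennreal ((g y - g y')\<^sup>2) * H y y') \<le> ennreal C * trace_energy s \<Omega> g"
proof -
  note k0 = trace_kernel_nonneg[OF s]
  have "(\<integral>\<^sup>+y y'. ennreal ((g y - g y')\<^sup>2) * H y y') \<le>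
   (\<integral>\<^sup>+y y'. ennreal C * ((ennreal ((g y - g y')\<^sup>2 * trace_kernel s \<Omega> y y') * indicator (- \<Omega>) y') * indicator (- \<Omega>) y))"
  proof (rule nn_integral_mono_AE, rule AE_mp[OF AE_bdist_pos], rule AE_I2, rule impI,
    rule nn_integral_mono_AE, rule AE_mp[OF AE_bdist_pos], rule AE_I2, rule impI)
   fix y y' assume d: "0 < \<delta> y" "0 < \<delta> y'"
   show "ennreal ((g y - g y')\<^sup>2) * H y y' \<le>
    ennreal C * ((ennreal ((g y - g y')\<^sup>2 * trace_kernel s \<Omega> y y') * indicator (- \<Omega>) y') * indicator (- \<Omega>) y)"
   proof (cases "y \<in> \<Omega> \<or> y' \<in> \<Omega>")
    case True
    then have "H y y' = 0" by (rule zero)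
    then show ?thesis by simp
   next
    case False
    then have "ennreal ((g y - g y')\<^sup>2) * H y y' \<le> ennreal ((g y - g y')\<^sup>2) * ennreal (C * trace_kernel s \<Omega> y y')"
     using d by (intro mult_left_mono H) auto
    then show ?thesis using False C k0[of y y'] by (simp add: ennreal_mult mult_ac)
   qed
  qed
  also have "\<dots> = (\<integral>\<^sup>+y. ennreal C * ((\<integral>\<^sup>+y'. ennreal ((g y - g y')\<^sup>2 * trace_kernel s \<Omega> y y') * indicator (- \<Omega>) y') * indicator (- \<Omega>) y))"
   by (intro nn_integral_cong) (simp add: nn_integral_cmult nn_integral_multc)
  also have "\<dots> = ennreal C * trace_energy s \<Omega> g"
   unfolding trace_energy_def by (rule nn_integral_cmult) measurable
  finally show ?thesis .
qed

lemma tau_density_lower: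
  assumes s: "0 < s" "s < 1" and y: "\<delta> y \<le> 4 * D"
  shows "(1 - s) * \<delta> y powr (- s) \<le> (1 + 4 * D) powr (real DIM('a) + 1) * tau_density s \<Omega> y"
proof -
  have "(1 + \<delta> y) powr (real DIM('a) + s) \<le> (1 + 4 * D) powr (real DIM('a) + s)"
   using y s by (intro powr_mono2) auto
  also have "\<dots> \<le> (1 + 4 * D) powr (real DIM('a) + 1)" using s D1 by (intro powr_mono) auto
  finally have "1 \<le> (1 + 4 * D) powr (real DIM('a) + 1) * (1 / (1 + \<delta> y) powr (real DIM('a) + s))"
   using bdist_nonneg[of y] by (simp add: le_divide_eq add_nonneg_eq_0_iff)
  then have "(1 - s) * \<delta> y powr (- s) * 1 \<le> (1 - s) * \<delta> y powr (- s) * ((1 + 4 * D) powr (real DIM('a) + 1) * (1 / (1 + \<delta> y) powr (real DIM('a) + s)))"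
   using s by (intro mult_left_mono) auto
  then show ?thesis by (simp add: tau_density_def powr_minus_divide mult.commute)
qed

lemma tau_density_nonneg: "s < 1 \<Longrightarrow> 0 \<le> tau_density s \<Omega> y"
  by (simp add: tau_density_def)

lemma tau_density_measurable [measurable]: "tau_density s \<Omega> \<in> borel_measurable borel"
  unfolding tau_density_def by measurable

lemma averageable_of_trace_mass:
  assumes s: "0 < s" "s < 1" and [measurable]: "g \<in> borel_measurable borel" and fin: "trace_mass s \<Omega> g < \<infinity>"
  shows "averageable s g"
  unfolding averageable_def
proof (intro conjI ballI)
  fix x assume x: "x \<in> \<Omega>"
  define K where "K = (4 * D) powr (1 - s) * \<delta> x powr (2 * s - 1 - real DIM('a)) * (1 + 4 * D) powr (real DIM('a) + 1)"
  have K: "K \<ge> 0" by (simp add: K_def)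
  have "(\<integral>\<^sup>+y. ennreal (mker s x y) * ennreal ((g y)\<^sup>2)) \<le>
   (\<integral>\<^sup>+y. ennreal K * (ennreal ((g y)\<^sup>2 * tau_density s \<Omega> y) * indicator (- \<Omega>) y))"
  proof (intro nn_integral_mono)
   fix y
   show "ennreal (mker s x y) * ennreal ((g y)\<^sup>2) \<le> ennreal K * (ennreal ((g y)\<^sup>2 * tau_density s \<Omega> y) * indicator (- \<Omega>) y)"
   proof (cases "mker s x y = 0")
    case False
    note X = mker_nonzeroD[OF False]
    have dy: "\<delta> y \<le> 4 * D" using X by linarith
    have "mker s x y = (1 - s) * \<delta> y powr (1 - 2 * s) * \<delta> x powr (2 * s - 1 - real DIM('a))"
     using False by (simp add: mker_def split: if_splits)
    also have "\<delta> y powr (1 - 2 * s) = \<delta> y powr (- s) * \<delta> y powr (1 - s)"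
     by (subst powr_add[symmetric]) simp
    also have "(1 - s) * (\<delta> y powr (- s) * \<delta> y powr (1 - s)) * \<delta> x powr (2 * s - 1 - real DIM('a))
     = ((1 - s) * \<delta> y powr (- s)) * (\<delta> y powr (1 - s) * \<delta> x powr (2 * s - 1 - real DIM('a)))" by simp
    also have "\<dots> \<le> ((1 + 4 * D) powr (real DIM('a) + 1) * tau_density s \<Omega> y) * ((4 * D) powr (1 - s) * \<delta> x powr (2 * s - 1 - real DIM('a)))"
     using s dy tau_density_nonneg[OF s(2), of y] by (intro mult_mono tau_density_lower mult_right_mono powr_mono2) auto
    also have "\<dots> = K * tau_density s \<Omega> y" by (simp add: K_def)
    finally have "mker s x y * (g y)\<^sup>2 \<le> K * tau_density s \<Omega> y * (g y)\<^sup>2" by (intro mult_right_mono) auto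
    then show ?thesis using X K mker_nonneg[OF s(2)] tau_density_nonneg[OF s(2), of y]
     by (simp add: indicator_def ennreal_mult[symmetric] ennreal_leI mult_ac)
   qed simp
  qed
  also have "\<dots> = ennreal K * trace_mass s \<Omega> g"
   unfolding trace_mass_def by (rule nn_integral_cmult) measurable
  also have "\<dots> < \<infinity>" using fin by (simp add: ennreal_mult_less_top)
  finally show "(\<integral>\<^sup>+y. ennreal (mker s x y) * ennreal ((g y)\<^sup>2)) < \<infinity>" .
qed simp

lemma avg_constD:
  assumes C: "avg_const C" and s: "0 < s" "s < 1" and g: "averageable s g" and x: "x \<in> \<Omega>" "x' \<in> \<Omega>" "dist x x' \<le> \<delta> x / 4"
  shows "ennreal ((ext_avg s g x' - c)\<^sup>2) \<le> ennreal C * (\<integral>\<^sup>+y. ennreal (mker s x y) * ennreal ((g y - c)\<^sup>2))"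
   and "ennreal ((ext_avg s g x - ext_avg s g x')\<^sup>2) \<le> ennreal (C * (dist x x' / \<delta> x)\<^sup>2) *
    (\<integral>\<^sup>+y. ennreal (mker s x y) * ennreal ((g y - ext_avg s g x')\<^sup>2))"
proof -
  have gm: "g \<in> borel_measurable borel" and fin: "(\<integral>\<^sup>+y. ennreal (mker s x y) * ennreal ((g y)\<^sup>2)) < \<infinity>"
   using g x(1) unfolding averageable_def by (blast, blast)
  note b = C[unfolded avg_const_def, rule_format, OF s gm x fin]
  show "ennreal ((ext_avg s g x' - c)\<^sup>2) \<le> ennreal C * (\<integral>\<^sup>+y. ennreal (mker s x y) * ennreal ((g y - c)\<^sup>2))"
   by (rule b[THEN conjunct1])
  show "ennreal ((ext_avg s g x - ext_avg s g x')\<^sup>2) \<le> ennreal (C * (dist x x' / \<delta> x)\<^sup>2) *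
    (\<integral>\<^sup>+y. ennreal (mker s x y) * ennreal ((g y - ext_avg s g x')\<^sup>2))"
   by (rule b[THEN conjunct2])
qed

text \<open>Jensen's inequality with the constant zero, and \<open>mker_ball\<close> for the integral over the interior point.\<close>

lemma extension_L2:
  "\<exists>C>0. \<forall>s g. 0 < s \<longrightarrow> s < 1 \<longrightarrow> averageable s g \<longrightarrow>
   (\<integral>\<^sup>+x. ennreal ((extension s g x)\<^sup>2) * indicator \<Omega> x) \<le> ennreal C * trace_mass s \<Omega> g"
proof -
  obtain C0 where C0: "C0 > 0" and C0c: "avg_const C0" using avg_const_exists by blast
  note J = avg_constD(1)[OF C0c]
  obtain C1 where C1: "C1 > 0" and ball: "\<And>s y r. 0 < s \<Longrightarrow> s < 1 \<Longrightarrow> 0 < \<delta> y \<Longrightarrow> 0 < r \<Longrightarrow>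
   (\<integral>\<^sup>+x. ennreal (mker s x y) * indicator {..r} (dist x y)) \<le>
    ennreal (C1 * ((1 - s) * \<delta> y powr (- s) * r powr s))"
   using mker_ball by blast
  define A where "A = C1 * (4 * D) * (1 + 4 * D) powr (real DIM('a) + 1)"
  have A: "A > 0" using C1 D1 by (simp add: A_def)
  have "(\<integral>\<^sup>+x. ennreal ((extension s g x)\<^sup>2) * indicator \<Omega> x) \<le> ennreal (C0 * A) * trace_mass s \<Omega> g"
   if s: "0 < s" "s < 1" and g: "averageable s g" for s g
  proof -
   have [measurable]: "g \<in> borel_measurable borel" using g by (simp add: averageable_def)
   have mb: "(\<integral>\<^sup>+x. ennreal (mker s x y)) \<le> ennreal (A * tau_density s \<Omega> y) * indicator (- \<Omega>) y" if y: "0 < \<delta> y" for y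
   proof (cases "\<delta> y \<le> 4 * D \<and> y \<notin> \<Omega>")
    case True
    have "(\<integral>\<^sup>+x. ennreal (mker s x y)) = (\<integral>\<^sup>+x. ennreal (mker s x y) * indicator {..4 * D} (dist x y))"
    proof (intro nn_integral_cong)
     show "ennreal (mker s x y) = ennreal (mker s x y) * indicator {..4 * D} (dist x y)" for x
      using mker_nonzeroD(7)[of s x y] by (cases "mker s x y = 0") (auto simp: indicator_def)
    qed
    also have "\<dots> \<le> ennreal (C1 * ((1 - s) * \<delta> y powr (- s) * (4 * D) powr s))"
     using s y D1 by (intro ball) auto
    also have "\<dots> \<le> ennreal (A * tau_density s \<Omega> y)"
    proof (rule ennreal_leI)
     have "(4 * D) powr s \<le> (4 * D) powr 1" using s D1 by (intro powr_mono) auto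
     then have "(4 * D) powr s \<le> 4 * D" using D1 by simp
     then have "C1 * ((1 - s) * \<delta> y powr (- s) * (4 * D) powr s) \<le>
      C1 * ((1 + 4 * D) powr (real DIM('a) + 1) * tau_density s \<Omega> y * (4 * D))"
      using C1 s True tau_density_nonneg[OF s(2), of y] by (intro mult_left_mono mult_mono tau_density_lower) auto
     then show "C1 * ((1 - s) * \<delta> y powr (- s) * (4 * D) powr s) \<le> A * tau_density s \<Omega> y"
      by (simp add: A_def mult_ac)
    qed
    finally show ?thesis using True by simp
   next
    case False
    have z: "mker s x y = 0" for x
     using mker_nonzeroD(2,5,7)[of s x y] False by force
    show ?thesis unfolding z by simp
   qed
   have "(\<integral>\<^sup>+x. ennreal ((extension s g x)\<^sup>2) * indicator \<Omega> x) \<le>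
    (\<integral>\<^sup>+x. ennreal C0 * (\<integral>\<^sup>+y. ennreal (mker s x y) * ennreal ((g y)\<^sup>2)))"
   proof (intro nn_integral_mono)
    fix x
    show "ennreal ((extension s g x)\<^sup>2) * indicator \<Omega> x \<le> ennreal C0 * (\<integral>\<^sup>+y. ennreal (mker s x y) * ennreal ((g y)\<^sup>2))"
     using J[OF s g, of x x 0] by (cases "x \<in> \<Omega>") (auto simp: extension_def)
   qed
   also have "\<dots> = ennreal C0 * (\<integral>\<^sup>+x y. ennreal (mker s x y) * ennreal ((g y)\<^sup>2))"
    by (rule nn_integral_cmult) measurable
   also have "(\<integral>\<^sup>+x y. ennreal (mker s x y) * ennreal ((g y)\<^sup>2)) =
    (\<integral>\<^sup>+y x. ennreal (mker s x y) * ennreal ((g y)\<^sup>2))"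
    by (rule nn_integral_swap) measurable
   also have "\<dots> = (\<integral>\<^sup>+y. (\<integral>\<^sup>+x. ennreal (mker s x y)) * ennreal ((g y)\<^sup>2))"
    by (intro nn_integral_cong nn_integral_multc) measurable
   also have "\<dots> \<le> (\<integral>\<^sup>+y. ennreal A * (ennreal ((g y)\<^sup>2 * tau_density s \<Omega> y) * indicator (- \<Omega>) y))"
   proof (rule nn_integral_mono_AE, rule AE_mp[OF AE_bdist_pos], rule AE_I2, rule impI)
    fix y assume y: "0 < \<delta> y"
    have "(\<integral>\<^sup>+x. ennreal (mker s x y)) * ennreal ((g y)\<^sup>2) \<le> (ennreal (A * tau_density s \<Omega> y) * indicator (- \<Omega>) y) * ennreal ((g y)\<^sup>2)"
     by (intro mult_right_mono mb y) simp
    then show "(\<integral>\<^sup>+x. ennreal (mker s x y)) * ennreal ((g y)\<^sup>2) \<le> ennreal A * (ennreal ((g y)\<^sup>2 * tau_density s \<Omega> y) * indicator (- \<Omega>) y)"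
     using A tau_density_nonneg[OF s(2), of y] by (simp add: ennreal_mult mult_ac)
   qed
   also have "\<dots> = ennreal A * trace_mass s \<Omega> g"
    unfolding trace_mass_def by (rule nn_integral_cmult) measurable
   also have "ennreal C0 * (ennreal A * trace_mass s \<Omega> g) = ennreal (C0 * A) * trace_mass s \<Omega> g"
    using C0 A by (simp add: ennreal_mult mult.assoc)
   finally show ?thesis by (simp add: mult_left_mono)
  qed
  moreover have "C0 * A > 0" using C0 A by simp
  ultimately show ?thesis by (intro exI[of _ "C0 * A"] conjI allI impI)
qed

text \<open>The exterior point keeps its own value, so only one average has to be expanded.\<close>

lemma extension_energy_exterior:
  "\<exists>C>0. \<forall>s g. 0 < s \<longrightarrow> s < 1 \<longrightarrow> averageable s g \<longrightarrow>
   ennreal (1 - s) * (\<integral>\<^sup>+x y. gagliardo s (extension s g) x y * (indicator \<Omega> x * indicator (- \<Omega>) y))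
    \<le> ennreal C * trace_energy s \<Omega> g"
proof -
  obtain C0 where C0: "C0 > 0" and C0c: "avg_const C0" using avg_const_exists by blast
  note J = avg_constD(1)[OF C0c]
  obtain C1 where C1: "C1 > 0" and ker: "\<And>s y y'. 0 < s \<Longrightarrow> s < 1 \<Longrightarrow> y \<notin> \<Omega> \<Longrightarrow> 0 < \<delta> y \<Longrightarrow> 0 < \<delta> y' \<Longrightarrow>
   ennreal (1 - s) * (\<integral>\<^sup>+x. ennreal (mker s x y') * ennreal (dist x y powr (- (real DIM('a) + 2 * s))))
    \<le> ennreal (C1 * trace_kernel s \<Omega> y y')"
   using mker_exterior_kernel by blast
  have "ennreal (1 - s) * (\<integral>\<^sup>+x y. gagliardo s (extension s g) x y * (indicator \<Omega> x * indicator (- \<Omega>) y))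
    \<le> ennreal (C0 * C1) * trace_energy s \<Omega> g"
   if s: "0 < s" "s < 1" and g: "averageable s g" for s g
  proof -
   have [measurable]: "g \<in> borel_measurable borel" using g by (simp add: averageable_def)
   let ?b = "real DIM('a) + 2 * s"
   let ?K = "\<lambda>x y. ennreal (dist x y powr (- ?b))"
   define H where "H y y' = ennreal (1 - s) * (\<integral>\<^sup>+x. ennreal (mker s x y') * ?K x y) * indicator (- \<Omega>) y" for y y'
   have "(\<integral>\<^sup>+x y. gagliardo s (extension s g) x y * (indicator \<Omega> x * indicator (- \<Omega>) y)) \<le>
    (\<integral>\<^sup>+x y. ennreal C0 * (\<integral>\<^sup>+y'. ennreal (mker s x y') * ennreal ((g y' - g y)\<^sup>2)) * (?K x y * indicator (- \<Omega>) y))"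
   proof (intro nn_integral_mono)
    fix x y
    show "gagliardo s (extension s g) x y * (indicator \<Omega> x * indicator (- \<Omega>) y) \<le>
     ennreal C0 * (\<integral>\<^sup>+y'. ennreal (mker s x y') * ennreal ((g y' - g y)\<^sup>2)) * (?K x y * indicator (- \<Omega>) y)"
    proof (cases "x \<in> \<Omega> \<and> y \<notin> \<Omega>")
     case True
     then have "ennreal ((ext_avg s g x - g y)\<^sup>2) * ?K x y \<le>
      (ennreal C0 * (\<integral>\<^sup>+y'. ennreal (mker s x y') * ennreal ((g y' - g y)\<^sup>2))) * ?K x y"
      by (intro mult_right_mono J s g) auto
     then show ?thesis using True by (simp add: gagliardo_def extension_def)
    qed (auto simp: indicator_def)
   qed
   also have "\<dots> = (\<integral>\<^sup>+x y y'. ennreal C0 * (ennreal (mker s x y') * ennreal ((g y' - g y)\<^sup>2)) * (?K x y * indicator (- \<Omega>) y))"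
    by (simp add: nn_integral_cmult nn_integral_multc)
   also have "\<dots> = (\<integral>\<^sup>+y y' x. ennreal C0 * (ennreal (mker s x y') * ennreal ((g y' - g y)\<^sup>2)) * (?K x y * indicator (- \<Omega>) y))"
    by (rule nn_integral_rotate3) measurable
   also have "\<dots> = (\<integral>\<^sup>+y y' x. (ennreal C0 * ennreal ((g y - g y')\<^sup>2) * indicator (- \<Omega>) y) * (ennreal (mker s x y') * ?K x y))"
    by (intro nn_integral_cong) (simp add: power2_commute[of "g _" "g _"] mult_ac)
   also have "\<dots> = (\<integral>\<^sup>+y y'. (ennreal C0 * ennreal ((g y - g y')\<^sup>2) * indicator (- \<Omega>) y) * (\<integral>\<^sup>+x. ennreal (mker s x y') * ?K x y))"
    by (intro nn_integral_cong nn_integral_cmult) measurable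
   finally have "ennreal (1 - s) * (\<integral>\<^sup>+x y. gagliardo s (extension s g) x y * (indicator \<Omega> x * indicator (- \<Omega>) y)) \<le>
    ennreal (1 - s) * (\<integral>\<^sup>+y y'. (ennreal C0 * ennreal ((g y - g y')\<^sup>2) * indicator (- \<Omega>) y) * (\<integral>\<^sup>+x. ennreal (mker s x y') * ?K x y))"
    by (rule mult_left_mono) simp
   also have "\<dots> = (\<integral>\<^sup>+y y'. ennreal (1 - s) * ((ennreal C0 * ennreal ((g y - g y')\<^sup>2) * indicator (- \<Omega>) y) * (\<integral>\<^sup>+x. ennreal (mker s x y') * ?K x y)))"
    by (simp add: nn_integral_cmult)
   also have "\<dots> = (\<integral>\<^sup>+y y'. ennreal C0 * (ennreal ((g y - g y')\<^sup>2) * H y y'))"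
    by (intro nn_integral_cong) (simp add: H_def mult_ac)
   also have "\<dots> = ennreal C0 * (\<integral>\<^sup>+y y'. ennreal ((g y - g y')\<^sup>2) * H y y')"
    unfolding H_def by (simp add: nn_integral_cmult)
   also have "\<dots> \<le> ennreal C0 * (ennreal C1 * trace_energy s \<Omega> g)"
   proof (intro mult_left_mono kernel_compare)
    show "H y y' \<le> ennreal (C1 * trace_kernel s \<Omega> y y')" if "y \<notin> \<Omega>" "y' \<notin> \<Omega>" "0 < \<delta> y" "0 < \<delta> y'" for y y'
     using ker[OF s that(1,3,4)] that by (simp add: H_def)
    show "H y y' = 0" if "y \<in> \<Omega> \<or> y' \<in> \<Omega>" for y y'
    proof (cases "y \<in> \<Omega>")
     case False
     then have z: "mker s x y' = 0" for x using that by (simp add: mker_def)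
     show ?thesis unfolding H_def z by simp
    qed (simp add: H_def)
   qed (use s C1 in auto)
   finally show ?thesis using C0 C1 by (simp add: ennreal_mult mult.assoc)
  qed
  moreover have "C0 * C1 > 0" using C0 C1 by simp
  ultimately show ?thesis by (intro exI[of _ "C0 * C1"] conjI allI impI)
qed

text \<open>Both averages are expanded separately.\<close>

lemma extension_energy_far:
  "\<exists>C>0. \<forall>s g. 0 < s \<longrightarrow> s < 1 \<longrightarrow> averageable s g \<longrightarrow>
   (\<integral>\<^sup>+x x'. gagliardo s (extension s g) x x' * (indicator \<Omega> x * indicator \<Omega> x' *
     (indicator {0..} (dist x x' - \<delta> x / 4) * indicator {0..} (dist x x' - \<delta> x' / 4))))
    \<le> ennreal C * trace_energy s \<Omega> g"
proof -
  obtain C0 where C0: "C0 > 0" and C0c: "avg_const C0" using avg_const_exists by blast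
  note J = avg_constD(1)[OF C0c]
  obtain C1 where C1: "C1 > 0" and ker: "\<And>s y y'. 0 < s \<Longrightarrow> s < 1 \<Longrightarrow> 0 < \<delta> y \<Longrightarrow> 0 < \<delta> y' \<Longrightarrow>
   (\<integral>\<^sup>+x'. (\<integral>\<^sup>+x. ennreal (mker s x y) * ennreal (mker s x' y') *
     (ennreal (dist x x' powr (- (real DIM('a) + 2 * s))) *
      indicator {0..} (dist x x' - \<delta> x / 4) * indicator {0..} (dist x x' - \<delta> x' / 4))))
    \<le> ennreal (C1 * trace_kernel s \<Omega> y y')"
   using mker_interior_far_kernel by blast
  have "(\<integral>\<^sup>+x x'. gagliardo s (extension s g) x x' * (indicator \<Omega> x * indicator \<Omega> x' *
     (indicator {0..} (dist x x' - \<delta> x / 4) * indicator {0..} (dist x x' - \<delta> x' / 4))))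
    \<le> ennreal (C0 * C0 * C1) * trace_energy s \<Omega> g"
   if s: "0 < s" "s < 1" and g: "averageable s g" for s g
  proof -
   have [measurable]: "g \<in> borel_measurable borel" using g by (simp add: averageable_def)
   let ?b = "real DIM('a) + 2 * s"
   let ?K = "\<lambda>x x'. ennreal (dist x x' powr (- ?b)) * indicator {0..} (dist x x' - \<delta> x / 4) * indicator {0..} (dist x x' - \<delta> x' / 4)"
   define H where "H y y' = (\<integral>\<^sup>+x'. (\<integral>\<^sup>+x. ennreal (mker s x y) * ennreal (mker s x' y') * ?K x x'))" for y y'
   have sq: "ennreal ((ext_avg s g x - ext_avg s g x')\<^sup>2) \<le> (\<integral>\<^sup>+y y'. ennreal (C0 * C0) * (ennreal (mker s x y) * ennreal (mker s x' y') * ennreal ((g y - g y')\<^sup>2)))"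
    if x: "x \<in> \<Omega>" "x' \<in> \<Omega>" for x x'
   proof -
    have "ennreal ((ext_avg s g x - ext_avg s g x')\<^sup>2) \<le> ennreal C0 * (\<integral>\<^sup>+y. ennreal (mker s x y) * ennreal ((ext_avg s g x' - g y)\<^sup>2))"
     using J[OF s g x(1) x(1), of "ext_avg s g x'"] by (simp add: power2_commute[of "ext_avg s g x'"])
    also have "\<dots> \<le> ennreal C0 * (\<integral>\<^sup>+y. ennreal (mker s x y) * (ennreal C0 * (\<integral>\<^sup>+y'. ennreal (mker s x' y') * ennreal ((g y' - g y)\<^sup>2))))"
     using J[OF s g x(2) x(2)] by (intro mult_left_mono nn_integral_mono) auto
    also have "\<dots> = (\<integral>\<^sup>+y. ennreal C0 * (ennreal (mker s x y) * (ennreal C0 * (\<integral>\<^sup>+y'. ennreal (mker s x' y') * ennreal ((g y' - g y)\<^sup>2)))))"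
     by (rule nn_integral_cmult[symmetric]) measurable
    also have "\<dots> = (\<integral>\<^sup>+y. (ennreal (C0 * C0) * ennreal (mker s x y)) * (\<integral>\<^sup>+y'. ennreal (mker s x' y') * ennreal ((g y' - g y)\<^sup>2)))"
     using C0 by (intro nn_integral_cong) (simp add: ennreal_mult mult_ac)
    also have "\<dots> = (\<integral>\<^sup>+y y'. (ennreal (C0 * C0) * ennreal (mker s x y)) * (ennreal (mker s x' y') * ennreal ((g y' - g y)\<^sup>2)))"
     by (intro nn_integral_cong nn_integral_cmult[symmetric]) measurable
    also have "\<dots> = (\<integral>\<^sup>+y y'. ennreal (C0 * C0) * (ennreal (mker s x y) * ennreal (mker s x' y') * ennreal ((g y - g y')\<^sup>2)))"
     by (intro nn_integral_cong) (simp add: power2_commute[of "g _" "g _"] mult_ac)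
    finally show ?thesis .
   qed
   have "(\<integral>\<^sup>+x x'. gagliardo s (extension s g) x x' * (indicator \<Omega> x * indicator \<Omega> x' *
     (indicator {0..} (dist x x' - \<delta> x / 4) * indicator {0..} (dist x x' - \<delta> x' / 4)))) \<le>
    (\<integral>\<^sup>+x x'. (\<integral>\<^sup>+y y'. ennreal (C0 * C0) * (ennreal (mker s x y) * ennreal (mker s x' y') * ennreal ((g y - g y')\<^sup>2))) * ?K x x')"
   proof (intro nn_integral_mono)
    fix x x'
    show "gagliardo s (extension s g) x x' * (indicator \<Omega> x * indicator \<Omega> x' *
     (indicator {0..} (dist x x' - \<delta> x / 4) * indicator {0..} (dist x x' - \<delta> x' / 4))) \<le>
     (\<integral>\<^sup>+y y'. ennreal (C0 * C0) * (ennreal (mker s x y) * ennreal (mker s x' y') * ennreal ((g y - g y')\<^sup>2))) * ?K x x'"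
    proof (cases "x \<in> \<Omega> \<and> x' \<in> \<Omega>")
     case True
     then have "gagliardo s (extension s g) x x' * (indicator \<Omega> x * indicator \<Omega> x' *
      (indicator {0..} (dist x x' - \<delta> x / 4) * indicator {0..} (dist x x' - \<delta> x' / 4)))
      = ennreal ((ext_avg s g x - ext_avg s g x')\<^sup>2) * ?K x x'"
      by (simp add: gagliardo_def extension_def mult.assoc)
     then show ?thesis using True by (simp only:) (intro mult_right_mono sq, auto)
    qed (auto simp: indicator_def)
   qed
   also have "\<dots> = (\<integral>\<^sup>+x x' y y'. ennreal (C0 * C0) * (ennreal (mker s x y) * ennreal (mker s x' y') * ennreal ((g y - g y')\<^sup>2)) * ?K x x')"
    by (simp add: nn_integral_multc)
   also have "\<dots> = (\<integral>\<^sup>+y y' x' x. ennreal (C0 * C0) * (ennreal (mker s x y) * ennreal (mker s x' y') * ennreal ((g y - g y')\<^sup>2)) * ?K x x')"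
    by (rule nn_integral_rotate4) measurable
   also have "\<dots> = (\<integral>\<^sup>+y y' x' x. (ennreal (C0 * C0) * ennreal ((g y - g y')\<^sup>2)) * (ennreal (mker s x y) * ennreal (mker s x' y') * ?K x x'))"
    by (intro nn_integral_cong) (simp only: mult_ac)
   also have "\<dots> = (\<integral>\<^sup>+y y'. ennreal (C0 * C0) * (ennreal ((g y - g y')\<^sup>2) * H y y'))"
    unfolding H_def by (simp add: nn_integral_cmult mult.assoc)
   also have "\<dots> = ennreal (C0 * C0) * (\<integral>\<^sup>+y y'. ennreal ((g y - g y')\<^sup>2) * H y y')"
    unfolding H_def by (simp add: nn_integral_cmult)
   also have "\<dots> \<le> ennreal (C0 * C0) * (ennreal C1 * trace_energy s \<Omega> g)"
   proof (intro mult_left_mono kernel_compare)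
    show "H y y' \<le> ennreal (C1 * trace_kernel s \<Omega> y y')" if "y \<notin> \<Omega>" "y' \<notin> \<Omega>" "0 < \<delta> y" "0 < \<delta> y'" for y y'
     unfolding H_def by (rule ker[OF s that(3,4)])
    show "H y y' = 0" if yy: "y \<in> \<Omega> \<or> y' \<in> \<Omega>" for y y'
    proof -
     have z: "ennreal (mker s x y) * ennreal (mker s x' y') = 0" for x x' using yy by (auto simp: mker_def)
     show ?thesis unfolding H_def z by simp
    qed
   qed (use s C1 in auto)
   finally show ?thesis using C0 C1 by (simp add: ennreal_mult mult.assoc)
  qed
  moreover have "C0 * C0 * C1 > 0" using C0 C1 by simp
  ultimately show ?thesis by (intro exI[of _ "C0 * C0 * C1"] conjI allI impI)
qed

text \<open>The factor \<open>(dist x x' / \<delta> x)\<^sup>2\<close> from the difference of the weights makes the integral over \<open>x'\<close> converge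
on the diagonal; its value is of order \<open>\<delta> x\<^sup>-\<^sup>2\<^sup>s / (1 - s)\<close>, and the factor \<open>1 - s\<close> cancels the denominator.\<close>

lemma extension_energy_near:
  "\<exists>C>0. \<forall>s g. 0 < s \<longrightarrow> s < 1 \<longrightarrow> averageable s g \<longrightarrow>
   ennreal (1 - s) * (\<integral>\<^sup>+x x'. gagliardo s (extension s g) x x' * (indicator \<Omega> x * indicator \<Omega> x' *
     indicator {0..} (\<delta> x / 4 - dist x x')))
    \<le> ennreal C * trace_energy s \<Omega> g"
proof -
  let ?S = "sphere_area TYPE('a)"
  have S: "?S > 0" by (rule sphere_area_pos)
  obtain C0 where C0: "C0 > 0" and C0c: "avg_const C0" using avg_const_exists by blast
  note J = avg_constD(1)[OF C0c] and N = avg_constD(2)[OF C0c]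
  obtain C1 where C1: "C1 > 0" and ker: "\<And>s y y'. 0 < s \<Longrightarrow> s < 1 \<Longrightarrow> 0 < \<delta> y \<Longrightarrow> 0 < \<delta> y' \<Longrightarrow>
   (\<integral>\<^sup>+x. ennreal (mker s x y) * ennreal (mker s x y') * ennreal (\<delta> x powr (- (2 * s))))
    \<le> ennreal (C1 * trace_kernel s \<Omega> y y')"
   using mker_interior_near_kernel by blast
  define C where "C = C0 * C0 * ?S * C1"
  have "ennreal (1 - s) * (\<integral>\<^sup>+x x'. gagliardo s (extension s g) x x' * (indicator \<Omega> x * indicator \<Omega> x' *
     indicator {0..} (\<delta> x / 4 - dist x x')))
    \<le> ennreal C * trace_energy s \<Omega> g"
   if s: "0 < s" "s < 1" and g: "averageable s g" for s g
  proof -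
   have [measurable]: "g \<in> borel_measurable borel" using g by (simp add: averageable_def)
   let ?b = "real DIM('a) + 2 * s"
   define W where "W x = (\<integral>\<^sup>+y y'. ennreal (mker s x y) * ennreal (mker s x y') * ennreal ((g y - g y')\<^sup>2))" for x
   have [measurable]: "W \<in> borel_measurable borel" unfolding W_def by measurable
   have sq: "ennreal ((ext_avg s g x - ext_avg s g x')\<^sup>2) \<le> ennreal (C0 * C0 * (dist x x' / \<delta> x)\<^sup>2) * W x"
    if x: "x \<in> \<Omega>" "x' \<in> \<Omega>" "dist x x' \<le> \<delta> x / 4" for x x'
   proof -
    have "ennreal ((ext_avg s g x - ext_avg s g x')\<^sup>2) \<le> ennreal (C0 * (dist x x' / \<delta> x)\<^sup>2) * (\<integral>\<^sup>+y. ennreal (mker s x y) * ennreal ((ext_avg s g x' - g y)\<^sup>2))"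
     using N[OF s g x] by (simp add: power2_commute[of "ext_avg s g x'"])
    also have "\<dots> \<le> ennreal (C0 * (dist x x' / \<delta> x)\<^sup>2) * (\<integral>\<^sup>+y. ennreal (mker s x y) * (ennreal C0 * (\<integral>\<^sup>+y'. ennreal (mker s x y') * ennreal ((g y' - g y)\<^sup>2))))"
     using J[OF s g x] by (intro mult_left_mono nn_integral_mono) auto
    also have "(\<integral>\<^sup>+y. ennreal (mker s x y) * (ennreal C0 * (\<integral>\<^sup>+y'. ennreal (mker s x y') * ennreal ((g y' - g y)\<^sup>2)))) =
     (\<integral>\<^sup>+y. ennreal C0 * (ennreal (mker s x y) * (\<integral>\<^sup>+y'. ennreal (mker s x y') * ennreal ((g y' - g y)\<^sup>2))))"
     by (intro nn_integral_cong) (simp only: mult_ac)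
    also have "\<dots> = ennreal C0 * (\<integral>\<^sup>+y. ennreal (mker s x y) * (\<integral>\<^sup>+y'. ennreal (mker s x y') * ennreal ((g y' - g y)\<^sup>2)))"
     by (rule nn_integral_cmult) measurable
    also have "(\<integral>\<^sup>+y. ennreal (mker s x y) * (\<integral>\<^sup>+y'. ennreal (mker s x y') * ennreal ((g y' - g y)\<^sup>2))) =
     (\<integral>\<^sup>+y y'. ennreal (mker s x y) * (ennreal (mker s x y') * ennreal ((g y' - g y)\<^sup>2)))"
     by (intro nn_integral_cong nn_integral_cmult[symmetric]) measurable
    also have "\<dots> = W x"
     unfolding W_def by (intro nn_integral_cong) (simp add: power2_commute[of "g _" "g _"] mult_ac)
    also have "ennreal (C0 * (dist x x' / \<delta> x)\<^sup>2) * (ennreal C0 * W x) = ennreal (C0 * C0 * (dist x x' / \<delta> x)\<^sup>2) * W x"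
     using C0 by (simp add: ennreal_mult mult_ac)
    finally show ?thesis .
   qed
   define B where "B x = C0 * C0 * (1 / \<delta> x)\<^sup>2" for x
   have B: "B x \<ge> 0" for x using C0 by (simp add: B_def)
   have [measurable]: "B \<in> borel_measurable borel" unfolding B_def by measurable
   have "(\<integral>\<^sup>+x x'. gagliardo s (extension s g) x x' * (indicator \<Omega> x * indicator \<Omega> x' *
     indicator {0..} (\<delta> x / 4 - dist x x'))) \<le>
    (\<integral>\<^sup>+x x'. (ennreal (B x) * W x * indicator \<Omega> x) *
     (ennreal (dist x' x powr ((2 - 2 * s) - real DIM('a))) * indicator {..\<delta> x / 4} (dist x' x)))"
   proof (intro nn_integral_mono)
    fix x x'
    show "gagliardo s (extension s g) x x' * (indicator \<Omega> x * indicator \<Omega> x' * indicator {0..} (\<delta> x / 4 - dist x x')) \<le>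
     (ennreal (B x) * W x * indicator \<Omega> x) *
     (ennreal (dist x' x powr ((2 - 2 * s) - real DIM('a))) * indicator {..\<delta> x / 4} (dist x' x))"
    proof (cases "x \<in> \<Omega> \<and> x' \<in> \<Omega> \<and> dist x x' \<le> \<delta> x / 4")
     case True
     have e: "(dist x x' / \<delta> x)\<^sup>2 * dist x x' powr (- ?b) = (1 / \<delta> x)\<^sup>2 * dist x x' powr ((2 - 2 * s) - real DIM('a))"
     proof (cases "dist x x' = 0")
      case False
      then have "(dist x x')\<^sup>2 = dist x x' powr 2" by (simp add: powr_numeral)
      moreover have "dist x x' powr 2 * dist x x' powr (- ?b) = dist x x' powr ((2 - 2 * s) - real DIM('a))"
       by (subst powr_add[symmetric]) (simp add: algebra_simps)
      ultimately show ?thesis by (simp add: power_divide)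
     qed simp
     have "ennreal ((ext_avg s g x - ext_avg s g x')\<^sup>2) * ennreal (dist x x' powr (- ?b)) \<le>
      (ennreal (C0 * C0 * (dist x x' / \<delta> x)\<^sup>2) * W x) * ennreal (dist x x' powr (- ?b))"
      using True by (intro mult_right_mono sq) auto
     also have "\<dots> = (ennreal (C0 * C0 * (dist x x' / \<delta> x)\<^sup>2) * ennreal (dist x x' powr (- ?b))) * W x"
      by (simp only: mult_ac)
     also have "ennreal (C0 * C0 * (dist x x' / \<delta> x)\<^sup>2) * ennreal (dist x x' powr (- ?b)) =
       ennreal (C0 * C0 * ((dist x x' / \<delta> x)\<^sup>2 * dist x x' powr (- ?b)))"
      using C0 by (subst ennreal_mult[symmetric]) (auto simp: mult.assoc)
     also have "\<dots> = ennreal (B x) * ennreal (dist x x' powr ((2 - 2 * s) - real DIM('a)))"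
      unfolding e using C0 by (subst ennreal_mult[symmetric]) (auto simp: B_def mult.assoc)
     finally show ?thesis using True
      by (simp add: gagliardo_def extension_def dist_commute[of x' x] mult_ac)
    qed (auto simp: indicator_def)
   qed
   also have "\<dots> = (\<integral>\<^sup>+x. (ennreal (B x) * W x * indicator \<Omega> x) * ennreal (?S * ((\<delta> x / 4) powr (2 - 2 * s) / (2 - 2 * s))))"
   proof (rule nn_integral_cong)
    fix x
    have "(\<integral>\<^sup>+x'. ennreal (dist x' x powr ((2 - 2 * s) - real DIM('a))) * indicator {..\<delta> x / 4} (dist x' x))
     = ennreal (?S * ((\<delta> x / 4) powr (2 - 2 * s) / (2 - 2 * s)))"
     using s by (intro nn_integral_dist_powr_near) auto
    then show "(\<integral>\<^sup>+x'. (ennreal (B x) * W x * indicator \<Omega> x) *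
     (ennreal (dist x' x powr ((2 - 2 * s) - real DIM('a))) * indicator {..\<delta> x / 4} (dist x' x)))
     = (ennreal (B x) * W x * indicator \<Omega> x) * ennreal (?S * ((\<delta> x / 4) powr (2 - 2 * s) / (2 - 2 * s)))"
     by (subst nn_integral_cmult) auto
   qed
   finally have 1: "ennreal (1 - s) * (\<integral>\<^sup>+x x'. gagliardo s (extension s g) x x' * (indicator \<Omega> x * indicator \<Omega> x' *
     indicator {0..} (\<delta> x / 4 - dist x x'))) \<le>
    ennreal (1 - s) * (\<integral>\<^sup>+x. (ennreal (B x) * W x * indicator \<Omega> x) * ennreal (?S * ((\<delta> x / 4) powr (2 - 2 * s) / (2 - 2 * s))))"
    by (rule mult_left_mono) simp
   also have "\<dots> = (\<integral>\<^sup>+x. ennreal (1 - s) * ((ennreal (B x) * W x * indicator \<Omega> x) * ennreal (?S * ((\<delta> x / 4) powr (2 - 2 * s) / (2 - 2 * s)))))"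
    by (rule nn_integral_cmult[symmetric]) measurable
   also have "\<dots> \<le> (\<integral>\<^sup>+x. ennreal (C0 * C0 * ?S) * (W x * ennreal (\<delta> x powr (- (2 * s)))))"
   proof (intro nn_integral_mono)
    fix x
    show "ennreal (1 - s) * ((ennreal (B x) * W x * indicator \<Omega> x) * ennreal (?S * ((\<delta> x / 4) powr (2 - 2 * s) / (2 - 2 * s)))) \<le>
     ennreal (C0 * C0 * ?S) * (W x * ennreal (\<delta> x powr (- (2 * s))))"
    proof (cases "x \<in> \<Omega>")
     case True
     have dx: "\<delta> x > 0" by (rule bdist_pos[OF True])
     have "(\<delta> x / 4) powr (2 - 2 * s) \<le> \<delta> x powr (2 - 2 * s)" using dx s by (intro powr_mono2) auto
     also have "\<dots> = \<delta> x powr 2 * \<delta> x powr (- (2 * s))" by (subst powr_add[symmetric]) simp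
     finally have p: "(\<delta> x / 4) powr (2 - 2 * s) \<le> (\<delta> x)\<^sup>2 * \<delta> x powr (- (2 * s))" using dx by (simp add: powr_numeral)
     have "(1 - s) * (B x * (?S * ((\<delta> x / 4) powr (2 - 2 * s) / (2 - 2 * s)))) = C0 * C0 * (1 / \<delta> x)\<^sup>2 * ?S * ((\<delta> x / 4) powr (2 - 2 * s)) / 2"
     proof -
      have "(1 - s) * (X / (2 - 2 * s)) = X / 2" for X
      proof -
       have e: "2 - 2 * s = (1 - s) * 2" by simp
       have "(1 - s) * (X / ((1 - s) * 2)) = X / 2" using s by (subst mult_divide_mult_cancel_left[symmetric, of "1 - s"]) simp_all
       then show ?thesis by (simp only: e)
      qed
      note e3 = this[of "(\<delta> x / 4) powr (2 - 2 * s)"]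
      have "(1 - s) * (B x * (?S * ((\<delta> x / 4) powr (2 - 2 * s) / (2 - 2 * s)))) =
       C0 * C0 * (1 / \<delta> x)\<^sup>2 * ?S * ((1 - s) * ((\<delta> x / 4) powr (2 - 2 * s) / (2 - 2 * s)))"
       unfolding B_def by (simp only: mult_ac)
      also have "\<dots> = C0 * C0 * (1 / \<delta> x)\<^sup>2 * ?S * ((\<delta> x / 4) powr (2 - 2 * s)) / 2"
       unfolding e3 by simp
      finally show ?thesis .
     qed
     also have "\<dots> \<le> C0 * C0 * (1 / \<delta> x)\<^sup>2 * ?S * ((\<delta> x)\<^sup>2 * \<delta> x powr (- (2 * s))) / 2"
      using p C0 S by (intro divide_right_mono mult_left_mono) auto
     also have "\<dots> \<le> C0 * C0 * (1 / \<delta> x)\<^sup>2 * ?S * ((\<delta> x)\<^sup>2 * \<delta> x powr (- (2 * s)))"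
      using C0 S by simp
     also have "\<dots> = C0 * C0 * ?S * \<delta> x powr (- (2 * s))" using dx by (simp add: power_divide)
     finally have q: "(1 - s) * (B x * (?S * ((\<delta> x / 4) powr (2 - 2 * s) / (2 - 2 * s)))) \<le> C0 * C0 * ?S * \<delta> x powr (- (2 * s))" .
     have "ennreal (1 - s) * ((ennreal (B x) * W x * indicator \<Omega> x) * ennreal (?S * ((\<delta> x / 4) powr (2 - 2 * s) / (2 - 2 * s)))) =
      ennreal (1 - s) * (ennreal (B x) * ennreal (?S * ((\<delta> x / 4) powr (2 - 2 * s) / (2 - 2 * s)))) * W x"
      using True by (simp add: mult_ac)
     also have "ennreal (1 - s) * (ennreal (B x) * ennreal (?S * ((\<delta> x / 4) powr (2 - 2 * s) / (2 - 2 * s)))) =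
      ennreal ((1 - s) * (B x * (?S * ((\<delta> x / 4) powr (2 - 2 * s) / (2 - 2 * s)))))"
      by (rule ennreal_mult_assoc3) (use s S B in auto)
     also have "\<dots> * W x \<le> ennreal (C0 * C0 * ?S * \<delta> x powr (- (2 * s))) * W x"
      by (intro mult_right_mono ennreal_leI q) simp
     finally show ?thesis using C0 S by (simp add: ennreal_mult mult_ac)
    qed simp
   qed
   also have "\<dots> = ennreal (C0 * C0 * ?S) * (\<integral>\<^sup>+x. W x * ennreal (\<delta> x powr (- (2 * s))))"
    by (rule nn_integral_cmult) measurable
   also have "(\<integral>\<^sup>+x. W x * ennreal (\<delta> x powr (- (2 * s)))) =
    (\<integral>\<^sup>+x y y'. ennreal (mker s x y) * ennreal (mker s x y') * ennreal ((g y - g y')\<^sup>2) * ennreal (\<delta> x powr (- (2 * s))))"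
    unfolding W_def by (simp add: nn_integral_multc)
   also have "\<dots> = (\<integral>\<^sup>+y y' x. ennreal (mker s x y) * ennreal (mker s x y') * ennreal ((g y - g y')\<^sup>2) * ennreal (\<delta> x powr (- (2 * s))))"
    by (rule nn_integral_rotate3) measurable
   also have "\<dots> = (\<integral>\<^sup>+y y' x. ennreal ((g y - g y')\<^sup>2) * (ennreal (mker s x y) * ennreal (mker s x y') * ennreal (\<delta> x powr (- (2 * s)))))"
    by (intro nn_integral_cong) (simp only: mult_ac)
   also have "\<dots> = (\<integral>\<^sup>+y y'. ennreal ((g y - g y')\<^sup>2) * (\<integral>\<^sup>+x. ennreal (mker s x y) * ennreal (mker s x y') * ennreal (\<delta> x powr (- (2 * s)))))"
    by (intro nn_integral_cong nn_integral_cmult) measurable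
   also have "\<dots> \<le> ennreal C1 * trace_energy s \<Omega> g"
   proof (rule kernel_compare)
    show "(\<integral>\<^sup>+x. ennreal (mker s x y) * ennreal (mker s x y') * ennreal (\<delta> x powr (- (2 * s)))) \<le> ennreal (C1 * trace_kernel s \<Omega> y y')"
     if "y \<notin> \<Omega>" "y' \<notin> \<Omega>" "0 < \<delta> y" "0 < \<delta> y'" for y y'
     by (rule ker[OF s that(3,4)])
    show "(\<integral>\<^sup>+x. ennreal (mker s x y) * ennreal (mker s x y') * ennreal (\<delta> x powr (- (2 * s)))) = 0" if yy: "y \<in> \<Omega> \<or> y' \<in> \<Omega>" for y y'
    proof -
     have z: "ennreal (mker s x y) * ennreal (mker s x y') = 0" for x using yy by (auto simp: mker_def)
     show ?thesis unfolding z by simp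
    qed
   qed (use s C1 in auto)
   finally have "ennreal (1 - s) * (\<integral>\<^sup>+x x'. gagliardo s (extension s g) x x' * (indicator \<Omega> x * indicator \<Omega> x' *
     indicator {0..} (\<delta> x / 4 - dist x x'))) \<le> ennreal (C0 * C0 * ?S) * (ennreal C1 * trace_energy s \<Omega> g)"
    by (simp add: mult_left_mono)
   then show ?thesis using C0 C1 S by (simp add: C_def ennreal_mult mult.assoc)
  qed
  moreover have "C > 0" using C0 C1 S by (simp add: C_def)
  ultimately show ?thesis by (intro exI[of _ C] conjI allI impI)
qed

end

section \<open>A fractional Poincare inequality with the factor \<open>1 - s\<close>\<close>

lemma dyadic_scale:
  fixes t Q :: real
  assumes "0 < t" "t \<le> Q"
  shows "\<exists>k. Q / 2 ^ Suc k < t \<and> t \<le> Q / 2 ^ k"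
proof -
  have Q: "0 < Q" using assms by linarith
  obtain n where n: "(1 / 2) ^ n < t / Q"
   using real_arch_pow_inv[of "t / Q" "1 / 2"] assms Q by auto
  then have ex: "Q / 2 ^ n < t" using Q by (simp add: power_one_over field_simps)
  define m where "m = (LEAST n. Q / 2 ^ n < t)"
  have m: "Q / 2 ^ m < t" unfolding m_def by (rule LeastI[of _ n]) (rule ex)
  have "m \<noteq> 0" using m assms(2) by (cases m) auto
  then obtain k where k: "m = Suc k" by (cases m) auto
  have "\<not> Q / 2 ^ k < t" using not_less_Least[of k "\<lambda>n. Q / 2 ^ n < t"] k unfolding m_def by simp
  then show ?thesis using m k by (intro exI[of _ k]) auto
qed

lemma ennreal_annulus:
  fixes X Y A :: ennreal
  assumes X: "X = Y + A" "X \<le> ennreal q * Y" "X < \<infinity>" and q: "1 \<le> q"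
  shows "A \<le> ennreal (1 - 1 / q) * X"
proof -
  have fin: "Y < \<infinity>" "A < \<infinity>" using X by (auto simp: ennreal_add_less_top)
  obtain y where y: "Y = ennreal y" "0 \<le> y" using fin(1) by (cases Y) auto
  obtain a where a: "A = ennreal a" "0 \<le> a" using fin(2) by (cases A) auto
  have "X = ennreal (y + a)" using X(1) y a by simp
  then have "ennreal (y + a) \<le> ennreal (q * y)" using X(2) y q by (simp add: ennreal_mult)
  then have "y + a \<le> q * y" using y q by (subst (asm) ennreal_le_iff) auto
  then have "(y + a) / q \<le> y" using q by (simp add: divide_le_eq mult.commute)
  then have "a \<le> (1 - 1 / q) * (y + a)" by (simp add: left_diff_distrib)
  then have "ennreal a \<le> ennreal ((1 - 1 / q) * (y + a))" by (rule ennreal_leI)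
  also have "\<dots> = ennreal (1 - 1 / q) * X"
   unfolding \<open>X = ennreal (y + a)\<close> using q y a by (intro ennreal_mult) auto
  finally show ?thesis using a by simp
qed

lemma one_minus_powr_le:
  fixes t :: real
  shows "1 - 4 powr (- t) \<le> 2 * max 0 t"
proof (cases "t \<ge> 0")
  case True
  have e4: "(4::real) \<le> exp 2"
  proof -
   have "2 * 2 \<le> exp 1 * exp (1::real)" using exp_ge_add_one_self[of "1::real"] by (intro mult_mono) auto
   also have "\<dots> = exp 2" unfolding exp_add[symmetric] by simp
   finally show ?thesis by simp
  qed
  then have "ln 4 \<le> ln (exp (2::real))" by (subst ln_le_cancel_iff) auto
  then have l4: "ln 4 \<le> (2::real)" by simp
  have "1 + (- t * ln 4) \<le> exp (- t * ln 4)" by (rule exp_ge_add_one_self)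
  then have "1 - 4 powr (- t) \<le> t * ln 4" by (simp add: powr_def)
  also have "\<dots> \<le> t * 2" using l4 True by (intro mult_left_mono)
  finally show ?thesis using True by simp
next
  case False
  then have "1 \<le> 4 powr (- t)" by (simp add: ge_one_powr_ge_zero)
  then show ?thesis by simp
qed

lemma ennreal_pos_mult_top: "0 < c \<Longrightarrow> ennreal c * top = top"
  by (simp add: ennreal_mult_top)

definition pair_energy :: "real \<Rightarrow> ('a::euclidean_space \<Rightarrow> real) \<Rightarrow> 'a set \<Rightarrow> real \<Rightarrow> ennreal" where
  "pair_energy s v S r = (\<integral>\<^sup>+x y. gagliardo s v x y * (indicator S x * indicator S y * indicator {..r} (dist x y)))"

text \<open>Splitting an increment at the midpoint halves the scale and costs only the factor \<open>4\<^sup>1\<^sup>-\<^sup>s\<close>.\<close>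

lemma pair_energy_midpoint:
  fixes v :: "'a::euclidean_space \<Rightarrow> real"
  assumes S: "convex S" and [measurable]: "S \<in> sets borel" "v \<in> borel_measurable borel" and s: "0 < s" "s < 1"
  shows "pair_energy s v S (2 * r) \<le> ennreal (4 powr (1 - s)) * pair_energy s v S r"
proof -
  let ?b = "real DIM('a) + 2 * s"
  let ?m = "\<lambda>x y. (1 / 2) *\<^sub>R (x + y) :: 'a"
  let ?I = "\<lambda>x y r. indicator S x * indicator S y * indicator {..r} (dist x y) :: ennreal"
  define L where "L = (\<integral>\<^sup>+x y. gagliardo s v x (?m x y) * ?I x y (2 * r))"
  have d1: "dist x (?m x y) = dist x y / 2" for x y
  proof -
   have "x - ?m x y = (1 / 2) *\<^sub>R (x - y)"
    by (simp add: algebra_simps flip: scaleR_left_distrib)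
   then show ?thesis by (simp add: dist_norm)
  qed
  have d2: "dist (?m x y) y = dist x y / 2" for x y
   using d1[of y x] by (simp add: dist_commute add.commute)
  have pt: "gagliardo s v x y \<le> ennreal (2 * 2 powr (- ?b)) * (gagliardo s v x (?m x y) + gagliardo s v y (?m y x))" for x y
  proof -
   have sq: "(v x - v y)\<^sup>2 \<le> 2 * (v x - v (?m x y))\<^sup>2 + 2 * (v y - v (?m x y))\<^sup>2"
    using sum_squares_ge_zero[of "(v x - v (?m x y)) + (v y - v (?m x y))" 0]
    by (simp add: power2_eq_square algebra_simps)
   have p: "dist x y powr (- ?b) = 2 powr (- ?b) * (dist x y / 2) powr (- ?b)"
    using powr_mult[of 2 "dist x y / 2" "- ?b"] by simp
   have "gagliardo s v x y = ennreal ((v x - v y)\<^sup>2 * dist x y powr (- ?b))"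
    by (simp add: gagliardo_def ennreal_mult)
   also have "\<dots> \<le> ennreal ((2 * (v x - v (?m x y))\<^sup>2 + 2 * (v y - v (?m x y))\<^sup>2) * dist x y powr (- ?b))"
    by (intro ennreal_leI mult_right_mono sq) simp
   also have "(2 * (v x - v (?m x y))\<^sup>2 + 2 * (v y - v (?m x y))\<^sup>2) * dist x y powr (- ?b) =
    (2 * 2 powr (- ?b)) * ((v x - v (?m x y))\<^sup>2 * (dist x y / 2) powr (- ?b) + (v y - v (?m x y))\<^sup>2 * (dist x y / 2) powr (- ?b))"
    unfolding p by (simp add: algebra_simps)
   also have "ennreal \<dots> = ennreal (2 * 2 powr (- ?b)) * (gagliardo s v x (?m x y) + gagliardo s v y (?m y x))"
   proof -
    have mm: "?m y x = ?m x y" by (simp add: add.commute)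
    have d3: "dist y (?m x y) = dist x y / 2" using d2[of x y] by (simp only: dist_commute)
    show ?thesis unfolding mm gagliardo_def d1 d3 by (simp add: ennreal_mult)
   qed
   finally show ?thesis .
  qed
  have "pair_energy s v S (2 * r) \<le> (\<integral>\<^sup>+x y. ennreal (2 * 2 powr (- ?b)) *
    (gagliardo s v x (?m x y) * ?I x y (2 * r) + gagliardo s v y (?m y x) * ?I y x (2 * r)))"
   unfolding pair_energy_def
  proof (intro nn_integral_mono)
   fix x y
   have "gagliardo s v x y * ?I x y (2 * r) \<le> (ennreal (2 * 2 powr (- ?b)) * (gagliardo s v x (?m x y) + gagliardo s v y (?m y x))) * ?I x y (2 * r)"
    by (intro mult_right_mono pt) simp
   also have "\<dots> = ennreal (2 * 2 powr (- ?b)) *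
    (gagliardo s v x (?m x y) * ?I x y (2 * r) + gagliardo s v y (?m y x) * ?I y x (2 * r))"
    by (simp only: dist_commute[of y x] mult.commute[of "indicator S y"] distrib_right mult.assoc)
   finally show "gagliardo s v x y * ?I x y (2 * r) \<le> \<dots>" .
  qed
  also have "\<dots> = ennreal (2 * 2 powr (- ?b)) * (\<integral>\<^sup>+x y. gagliardo s v x (?m x y) * ?I x y (2 * r) + gagliardo s v y (?m y x) * ?I y x (2 * r))"
   by (simp add: nn_integral_cmult)
  also have "(\<integral>\<^sup>+x y. gagliardo s v x (?m x y) * ?I x y (2 * r) + gagliardo s v y (?m y x) * ?I y x (2 * r))
   = L + (\<integral>\<^sup>+x y. gagliardo s v y (?m y x) * ?I y x (2 * r))"
   unfolding L_def by (simp add: nn_integral_add)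
  also have "(\<integral>\<^sup>+x y. gagliardo s v y (?m y x) * ?I y x (2 * r)) = L"
   unfolding L_def by (rule nn_integral_swap) measurable
  finally have 1: "pair_energy s v S (2 * r) \<le> ennreal (2 * 2 powr (- ?b)) * (L + L)" .
  have "L \<le> (\<integral>\<^sup>+x. ennreal (2 ^ DIM('a)) * (\<integral>\<^sup>+u. gagliardo s v x u * ?I x u r))"
   unfolding L_def
  proof (intro nn_integral_mono)
   fix x :: 'a
   have "(\<integral>\<^sup>+y. gagliardo s v x (?m x y) * ?I x y (2 * r)) =
    ennreal (2 ^ DIM('a)) * (\<integral>\<^sup>+u. gagliardo s v x (?m x (- x + 2 *\<^sub>R u)) * ?I x (- x + 2 *\<^sub>R u) (2 * r))"
    by (rule nn_integral_lborel_dilate) auto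
   also have "\<dots> \<le> ennreal (2 ^ DIM('a)) * (\<integral>\<^sup>+u. gagliardo s v x u * ?I x u r)"
   proof (intro mult_left_mono nn_integral_mono)
    fix u
    have mu: "?m x (- x + 2 *\<^sub>R u) = u" by simp
    have "?I x (- x + 2 *\<^sub>R u) (2 * r) \<le> ?I x u r"
    proof (cases "x \<in> S \<and> - x + 2 *\<^sub>R u \<in> S \<and> dist x (- x + 2 *\<^sub>R u) \<le> 2 * r")
     case True
     then have "(1 / 2) *\<^sub>R x + (1 / 2) *\<^sub>R (- x + 2 *\<^sub>R u) \<in> S" by (intro convexD[OF S]) auto
     then have "?m x (- x + 2 *\<^sub>R u) \<in> S" by (simp only: scaleR_add_right)
     moreover have "dist x u \<le> r" using d1[of x "- x + 2 *\<^sub>R u"] True unfolding mu by simp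
     ultimately show ?thesis using True unfolding mu by (simp add: indicator_def)
    qed (auto simp: indicator_def)
    then show "gagliardo s v x (?m x (- x + 2 *\<^sub>R u)) * ?I x (- x + 2 *\<^sub>R u) (2 * r) \<le> gagliardo s v x u * ?I x u r"
     unfolding mu by (intro mult_left_mono) auto
   qed simp
   finally show "(\<integral>\<^sup>+y. gagliardo s v x (?m x y) * ?I x y (2 * r)) \<le> \<dots>" .
  qed
  also have "\<dots> = ennreal (2 ^ DIM('a)) * pair_energy s v S r"
   unfolding pair_energy_def by (rule nn_integral_cmult) measurable
  finally have 2: "L \<le> ennreal (2 ^ DIM('a)) * pair_energy s v S r" .
  have "pair_energy s v S (2 * r) \<le> ennreal (2 * 2 powr (- ?b)) * (ennreal (2 ^ DIM('a)) * pair_energy s v S r + ennreal (2 ^ DIM('a)) * pair_energy s v S r)"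
   using 1 2 by (meson add_mono mult_left_mono order_trans zero_le)
  also have "\<dots> = ennreal (2 * 2 powr (- ?b) * (2 ^ DIM('a) + 2 ^ DIM('a))) * pair_energy s v S r"
  proof -
   have "ennreal c * (ennreal a * P + ennreal a * P) = ennreal (c * (a + a)) * P" if "0 \<le> c" "0 \<le> a" for c a P
   proof -
    have "ennreal a * P + ennreal a * P = (ennreal a + ennreal a) * P" by (rule distrib_right[symmetric])
    also have "ennreal a + ennreal a = ennreal (a + a)" using that by (intro ennreal_plus[symmetric])
    finally have "ennreal c * (ennreal a * P + ennreal a * P) = (ennreal c * ennreal (a + a)) * P"
     by (simp only: mult.assoc)
    also have "ennreal c * ennreal (a + a) = ennreal (c * (a + a))" using that by (intro ennreal_mult[symmetric]) auto
    finally show ?thesis .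
   qed
   note e = this
   have p: "0 \<le> 2 * 2 powr (- ?b)" "0 \<le> (2::real) ^ DIM('a)" by simp_all
   show ?thesis by (rule e[OF p])
  qed
  also have "2 * 2 powr (- ?b) * (2 ^ DIM('a) + 2 ^ DIM('a)) = 4 powr (1 - s)"
  proof -
   have a: "(2::real) ^ DIM('a) = 2 powr (real DIM('a))" by (simp add: powr_realpow)
   have "(4::real) powr (1 - s) = (2 powr 2) powr (1 - s)" by (simp add: powr_numeral)
   also have "\<dots> = 2 powr (2 - 2 * s)" unfolding powr_powr by (simp add: algebra_simps)
   finally have b: "(4::real) powr (1 - s) = 2 powr (2 - 2 * s)" .
   have "2 * 2 powr (- ?b) * (2 powr (real DIM('a)) + 2 powr (real DIM('a))) = 2 powr 2 * (2 powr (- ?b) * 2 powr (real DIM('a)))"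
    by (simp add: powr_numeral)
   also have "\<dots> = 2 powr (2 - 2 * s)" unfolding powr_add[symmetric] by simp
   finally show ?thesis unfolding a b .
  qed
  finally show ?thesis .
qed

text \<open>By the midpoint inequality, dyadic annuli of distances each carry at most a fraction of order \<open>1 - s\<close>
of the energy, while on the annulus at distance \<open>Q / 2\<^sup>k\<close> the kernel is large enough to make the
unweighted increments summable over \<open>k\<close>.\<close>

lemma fractional_poincare:
  fixes v :: "'a::euclidean_space \<Rightarrow> real"
  assumes S: "convex S" and [measurable]: "S \<in> sets borel" "v \<in> borel_measurable borel" and s: "0 < s" "s < 1"
   and Q: "1 \<le> Q" "\<And>x y. x \<in> S \<Longrightarrow> y \<in> S \<Longrightarrow> dist x y \<le> Q"
  shows "(\<integral>\<^sup>+x y. ennreal ((v x - v y)\<^sup>2) * (indicator S x * indicator S y)) \<le>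
   ennreal (4 * Q powr (real DIM('a) + 2) * (1 - s)) *
    (\<integral>\<^sup>+x y. gagliardo s v x y * (indicator S x * indicator S y))"
proof -
  let ?b = "real DIM('a) + 2 * s"
  let ?E = "\<integral>\<^sup>+x y. gagliardo s v x y * (indicator S x * indicator S y)"
  let ?c = "4 * Q powr (real DIM('a) + 2) * (1 - s)"
  let ?q = "4 powr (1 - s)"
  show ?thesis
  proof (cases "?E < \<infinity>")
   case False
   then have "?E = \<infinity>" by (simp add: less_top[symmetric])
   moreover have "?c > 0" using s Q by simp
   then have "ennreal ?c * top = top" by (rule ennreal_pos_mult_top)
   ultimately show ?thesis by (simp only: infinity_ennreal_def top_greatest)
  next
   case True
   have q: "1 \<le> ?q" using s by (simp add: ge_one_powr_ge_zero)
   define A where "A k x y = gagliardo s v x y * (indicator S x * indicator S y * indicator {Q / 2 ^ Suc k<..Q / 2 ^ k} (dist x y))" for k x y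
   have [measurable]: "(\<lambda>w. A k (f w) (g w)) \<in> borel_measurable N"
    if [measurable]: "f \<in> borel_measurable N" "g \<in> borel_measurable N" for k f g and N :: "'z measure"
    unfolding A_def by measurable
   have ann: "(\<integral>\<^sup>+x y. A k x y) \<le> ennreal (2 * (1 - s)) * ?E" for k
   proof -
    let ?X = "pair_energy s v S (2 * (Q / 2 ^ Suc k))" and ?Y = "pair_energy s v S (Q / 2 ^ Suc k)"
    let ?A = "\<integral>\<^sup>+x y. A k x y"
    have le: "?X \<le> ?E" unfolding pair_energy_def by (intro nn_integral_mono) (auto simp: indicator_def)
    have sc: "2 * (Q / 2 ^ Suc k) = Q / 2 ^ k" by simp
    have "Q / 2 ^ Suc k \<le> Q / 2 ^ k" using Q by (intro divide_left_mono) auto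
    then have "?X = (\<integral>\<^sup>+x y. gagliardo s v x y * (indicator S x * indicator S y * indicator {..Q / 2 ^ Suc k} (dist x y)) + A k x y)"
     unfolding pair_energy_def sc A_def
     by (intro nn_integral_cong) (auto simp: indicator_def)
    also have "\<dots> = ?Y + ?A" unfolding pair_energy_def by (simp add: nn_integral_add)
    finally have "?A \<le> ennreal (1 - 1 / ?q) * ?X"
     by (rule ennreal_annulus[OF _ pair_energy_midpoint[OF S assms(2,3) s] le_less_trans[OF le True] q])
    also have "\<dots> \<le> ennreal (2 * (1 - s)) * ?E"
    proof (intro mult_mono ennreal_leI le)
     have "1 / ?q = 4 powr (- (1 - s))" by (rule powr_minus_divide[symmetric])
     then have "1 - 1 / ?q \<le> 2 * max 0 (1 - s)" using one_minus_powr_le[of "1 - s"] by (simp only:)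
     also have "max 0 (1 - s) = 1 - s" using s by (intro max_absorb2) auto
     finally show "1 - 1 / ?q \<le> 2 * (1 - s)" .
    qed auto
    finally show ?thesis .
   qed
   (* Since d + 2 s is at least one, the inverse of the kernel on the k-th annulus is at most c k. *)
   define c where "c k = Q powr (real DIM('a) + 2) * (1 / 2) ^ k" for k :: nat
   have c0: "0 \<le> c k" for k by (simp add: c_def)
   have pt: "ennreal ((v x - v y)\<^sup>2) * (indicator S x * indicator S y) \<le> (\<Sum>k. ennreal (c k) * A k x y)" for x y
   proof (cases "x \<in> S \<and> y \<in> S \<and> x \<noteq> y")
    case True
    then have xy: "x \<in> S" "y \<in> S" "0 < dist x y" "dist x y \<le> Q" using Q(2) by auto
    obtain k where k: "Q / 2 ^ Suc k < dist x y" "dist x y \<le> Q / 2 ^ k" using dyadic_scale[OF xy(3,4)] by blast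
    have "dist x y powr ?b \<le> (Q * (1 / 2) ^ k) powr ?b"
     using k s by (intro powr_mono2) (auto simp: power_one_over)
    also have "\<dots> = Q powr ?b * ((1 / 2) ^ k) powr ?b" using Q by (simp add: powr_mult)
    also have "\<dots> \<le> Q powr (real DIM('a) + 2) * ((1 / 2) ^ k) powr 1"
    proof (intro mult_mono)
     show "Q powr ?b \<le> Q powr (real DIM('a) + 2)" using s Q by (intro powr_mono) auto
     have "1 \<le> ?b" using DIM_ge_1[where 'a='a] s by linarith
     then show "((1 / 2) ^ k) powr ?b \<le> ((1 / 2) ^ k :: real) powr 1"
      by (intro powr_mono') (auto simp: power_le_one)
    qed auto
    finally have "dist x y powr ?b \<le> c k" by (simp add: c_def)
    then have "(v x - v y)\<^sup>2 * (dist x y powr ?b * dist x y powr (- ?b)) \<le> (v x - v y)\<^sup>2 * (c k * dist x y powr (- ?b))"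
     by (intro mult_left_mono mult_right_mono) auto
    moreover have "dist x y powr ?b * dist x y powr (- ?b) = 1" using xy by (simp add: powr_add[symmetric])
    ultimately have "(v x - v y)\<^sup>2 \<le> c k * ((v x - v y)\<^sup>2 * dist x y powr (- ?b))" by (simp add: mult_ac)
    then have "ennreal ((v x - v y)\<^sup>2) * (indicator S x * indicator S y) \<le> ennreal (c k) * A k x y"
     using xy k c0[of k] unfolding A_def gagliardo_def
     by (simp add: indicator_def ennreal_mult[symmetric] ennreal_leI)
    also have "\<dots> \<le> (\<Sum>k. ennreal (c k) * A k x y)"
     using sum_le_suminf[OF summableI, of "{k}" "\<lambda>k. ennreal (c k) * A k x y"] by simp
    finally show ?thesis .
   qed (auto simp: indicator_def)
   have "(\<integral>\<^sup>+x y. ennreal ((v x - v y)\<^sup>2) * (indicator S x * indicator S y)) \<le>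
    (\<integral>\<^sup>+x y. (\<Sum>k. ennreal (c k) * A k x y))"
    by (intro nn_integral_mono pt)
   also have "\<dots> = (\<Sum>k. ennreal (c k) * (\<integral>\<^sup>+x y. A k x y))"
   proof -
    have "(\<integral>\<^sup>+x y. (\<Sum>k. ennreal (c k) * A k x y)) = (\<integral>\<^sup>+x. (\<Sum>k. \<integral>\<^sup>+y. ennreal (c k) * A k x y))"
     by (rule nn_integral_cong, rule nn_integral_suminf) measurable
    also have "\<dots> = (\<Sum>k. \<integral>\<^sup>+x y. ennreal (c k) * A k x y)"
     by (rule nn_integral_suminf) measurable
    also have "(\<lambda>k. \<integral>\<^sup>+x y. ennreal (c k) * A k x y) = (\<lambda>k. ennreal (c k) * (\<integral>\<^sup>+x y. A k x y))"
     by (rule ext) (simp add: nn_integral_cmult)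
    finally show ?thesis .
   qed
   also have "\<dots> \<le> (\<Sum>k. ennreal (c k) * (ennreal (2 * (1 - s)) * ?E))"
    by (rule suminf_le[OF _ summableI summableI], rule mult_left_mono[OF ann]) simp
   also have "\<dots> = (\<Sum>k. ennreal (c k)) * (ennreal (2 * (1 - s)) * ?E)"
    by (rule ennreal_suminf_multc)
   also have "(\<Sum>k. ennreal (c k)) = ennreal (Q powr (real DIM('a) + 2) * 2)"
   proof -
    have "c sums (Q powr (real DIM('a) + 2) * (1 / (1 - 1 / 2)))"
     unfolding c_def by (intro sums_mult geometric_sums) simp
    then show ?thesis using c0 by (intro suminf_ennreal_eq) auto
   qed
   also have "ennreal (Q powr (real DIM('a) + 2) * 2) * (ennreal (2 * (1 - s)) * ?E) = ennreal ?c * ?E"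
   proof -
    have "ennreal (Q powr (real DIM('a) + 2) * 2) * ennreal (2 * (1 - s)) = ennreal ?c"
     using s by (subst ennreal_mult[symmetric]) (auto simp: mult_ac)
    then show ?thesis by (simp only: mult.assoc[symmetric])
   qed
   finally show ?thesis .
  qed
qed

section \<open>Traces in a chart\<close>

definition dom_energy :: "real \<Rightarrow> 'a::euclidean_space set \<Rightarrow> ('a \<Rightarrow> real) \<Rightarrow> ennreal" where
  "dom_energy s \<Omega> u = (\<integral>\<^sup>+x y. gagliardo s u x y * indicator \<Omega> x)"

text \<open>For \<open>w\<close> in the cone the height at \<open>x + \<rho> *\<^sub>R w\<close> exceeds the height at \<open>x\<close> by at least \<open>2 * \<rho>\<close>. Inside a
chart such points lie in the domain as soon as the depth of \<open>x\<close> is at most \<open>\<rho>\<close>.\<close>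

definition cone :: "real \<Rightarrow> 'a::euclidean_space \<Rightarrow> real \<Rightarrow> 'a set" where
  "cone M e k = {w. norm w \<le> k \<and> 2 + M * norm (w - (w \<bullet> e) *\<^sub>R e) \<le> w \<bullet> e}"

lemma cone_borel [measurable]: "cone M e k \<in> sets borel"
proof -
  have "closed (cone M e k)" unfolding cone_def
   by (intro closed_Collect_conj closed_Collect_le continuous_intros)
  then show ?thesis by (rule borel_closed)
qed

lemma cone_convex:
  assumes "M \<ge> 0"
  shows "convex (cone M e k)"
proof (rule convexI)
  fix v w :: 'a and a b :: real
  assume v: "v \<in> cone M e k" and w: "w \<in> cone M e k" and ab: "0 \<le> a" "0 \<le> b" "a + b = 1"
  have "norm (a *\<^sub>R v + b *\<^sub>R w) \<le> a * norm v + b * norm w"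
   using norm_triangle_ineq[of "a *\<^sub>R v" "b *\<^sub>R w"] ab by simp
  also have "\<dots> \<le> k" using v w ab by (intro convex_bound_le) (auto simp: cone_def)
  finally have 1: "norm (a *\<^sub>R v + b *\<^sub>R w) \<le> k" .
  let ?p = "\<lambda>w. w - (w \<bullet> e) *\<^sub>R e"
  have "?p (a *\<^sub>R v + b *\<^sub>R w) = a *\<^sub>R ?p v + b *\<^sub>R ?p w"
   by (simp add: inner_add_left algebra_simps)
  then have "norm (?p (a *\<^sub>R v + b *\<^sub>R w)) \<le> a * norm (?p v) + b * norm (?p w)"
   using norm_triangle_ineq[of "a *\<^sub>R ?p v" "b *\<^sub>R ?p w"] ab by simp
  then have "M * norm (?p (a *\<^sub>R v + b *\<^sub>R w)) \<le> M * (a * norm (?p v) + b * norm (?p w))"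
   using assms by (intro mult_left_mono)
  also have "\<dots> = a * (2 + M * norm (?p v)) + b * (2 + M * norm (?p w)) - 2 * (a + b)"
   by (simp add: algebra_simps)
  also have "\<dots> \<le> a * (v \<bullet> e) + b * (w \<bullet> e) - 2 * (a + b)"
   using v w ab by (intro diff_right_mono add_mono mult_left_mono) (auto simp: cone_def)
  finally have 2: "2 + M * norm (?p (a *\<^sub>R v + b *\<^sub>R w)) \<le> (a *\<^sub>R v + b *\<^sub>R w) \<bullet> e"
   using ab by (simp add: inner_add_left)
  show "a *\<^sub>R v + b *\<^sub>R w \<in> cone M e k" using 1 2 by (simp add: cone_def)
qed

lemma cone_mono: "k \<le> k' \<Longrightarrow> cone M e k \<subseteq> cone M e k'"
  by (auto simp: cone_def)

lemma cone_double:
  assumes "w \<in> cone M e k"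
  shows "2 *\<^sub>R w \<in> cone M e (2 * k)"
proof -
  have "(2 *\<^sub>R w) - ((2 *\<^sub>R w) \<bullet> e) *\<^sub>R e = 2 *\<^sub>R (w - (w \<bullet> e) *\<^sub>R e)" by (simp add: algebra_simps)
  then show ?thesis using assms unfolding cone_def by simp
qed

text \<open>Dilated copies of the cone with comparable scales and vertices contain a common ball. The unit ball
around \<open>(6 * M + 7) *\<^sub>R e\<close> is far enough up the axis to stay in the cone when it is shrunk by a factor
two and shifted by a vector of norm at most one, and \<open>2 * (6 * M + 8) + 1 = 12 * M + 17\<close> bounds its enlargement.\<close>

lemma cone_overlap:
  assumes M: "M \<ge> 1" and e: "norm e = 1" and w: "norm (w - (6 * M + 7) *\<^sub>R e) \<le> 1"
   and a: "norm a \<le> 1" and q: "1 / 2 \<le> q" "q \<le> 2"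
  shows "a + q *\<^sub>R w \<in> cone M e (12 * M + 17)"
proof -
  let ?P = "6 * M + 7"
  let ?p = "\<lambda>w. w - (w \<bullet> e) *\<^sub>R e"
  have ee: "e \<bullet> e = 1" using e by (simp add: norm_eq_1)
  define d where "d = w - ?P *\<^sub>R e"
  have w_eq: "w = ?P *\<^sub>R e + d" by (simp add: d_def)
  have d: "norm d \<le> 1" using w by (simp add: d_def)
  have de: "\<bar>d \<bullet> e\<bar> \<le> 1" using Cauchy_Schwarz_ineq2[of d e] d e by simp
  have ae: "\<bar>a \<bullet> e\<bar> \<le> 1" using Cauchy_Schwarz_ineq2[of a e] a e by simp
  have "norm w \<le> ?P + 1" using norm_triangle_ineq[of "?P *\<^sub>R e" d] M d e unfolding w_eq[symmetric] by simp
  then have "q * norm w \<le> 2 * (?P + 1)" using q M by (intro mult_mono) auto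
  then have 1: "norm (a + q *\<^sub>R w) \<le> 12 * M + 17"
   using norm_triangle_ineq[of a "q *\<^sub>R w"] a q by simp
  have pe: "?p (a + q *\<^sub>R w) = ?p a + q *\<^sub>R ?p d"
   unfolding w_eq by (simp add: inner_add_left ee algebra_simps)
  have "\<bar>q\<bar> = q" using q by simp
  then have "norm (?p (a + q *\<^sub>R w)) \<le> norm (?p a) + q * norm (?p d)"
   using norm_triangle_ineq[of "?p a" "q *\<^sub>R ?p d"] unfolding pe norm_scaleR by (simp only:)
  also have "\<dots> \<le> 1 + 2 * 1"
   using norm_projection_le[OF e, of a] norm_projection_le[OF e, of d] a d q
   by (intro add_mono mult_mono) auto
  finally have "M * norm (?p (a + q *\<^sub>R w)) \<le> M * 3" using M by (intro mult_left_mono) auto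
  moreover have "3 * M + 2 \<le> (a + q *\<^sub>R w) \<bullet> e"
  proof -
   have "w \<bullet> e = ?P + d \<bullet> e" unfolding w_eq by (simp add: inner_add_left ee)
   then have "w \<bullet> e \<ge> 6 * M + 6" using de by linarith
   then have "q * (w \<bullet> e) \<ge> 1 / 2 * (6 * M + 6)" using q M by (intro mult_mono) auto
   then show ?thesis using ae by (simp add: inner_add_left)
  qed
  ultimately show ?thesis using 1 by (simp add: cone_def)
qed

lemma dyadic_above:
  fixes t r :: real
  assumes "0 < t" "t \<le> 2 * r"
  shows "\<exists>i. r < 2 ^ i * t \<and> 2 ^ i * t \<le> 2 * r"
proof -
  obtain k where "2 * r / 2 ^ Suc k < t" "t \<le> 2 * r / 2 ^ k" using dyadic_scale[OF assms] by blast
  then show ?thesis by (intro exI[of _ k]) (simp add: field_simps)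
qed

lemma contraction_suminf:
  fixes G r :: "nat \<Rightarrow> ennreal" and q :: real
  assumes q: "0 \<le> q" "q < 1" and step: "\<And>j. G (Suc j) \<le> ennreal q * G j + r j"
  shows "(\<Sum>j. G j) \<le> ennreal (1 / (1 - q)) * (G 0 + (\<Sum>j. r j))"
proof (cases "G 0 + (\<Sum>j. r j) < \<infinity>")
  case False
  then have "G 0 + (\<Sum>j. r j) = top" by (simp add: less_top[symmetric])
  moreover have "ennreal (1 / (1 - q)) * top = top" using q by (intro ennreal_pos_mult_top) simp
  ultimately have "ennreal (1 / (1 - q)) * (G 0 + (\<Sum>j. r j)) = top" by (simp only:)
  then show ?thesis by (simp only: top_greatest)
next
  case True
  let ?T = "G 0 + (\<Sum>j. r j)"
  have r: "(\<Sum>j<n. r j) \<le> (\<Sum>j. r j)" for n by (rule sum_le_suminf) auto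
  have partial: "(\<Sum>j<n. G j) \<le> ennreal (1 / (1 - q)) * ?T" for n
  proof -
   have fin: "(\<Sum>j<n. G j) < \<infinity>" for n
   proof -
    have "G n < \<infinity> \<and> r n < \<infinity>" for n
    proof (induction n)
     case 0
     show ?case using True r[of 1] by (auto simp: ennreal_add_less_top intro: le_less_trans)
    next
     case (Suc n)
     have "r (Suc n) \<le> (\<Sum>j<Suc (Suc n). r j)" by (simp add: add_increasing)
     also have "\<dots> \<le> (\<Sum>j. r j)" by (rule r)
     finally have "r (Suc n) < \<infinity>" using True by (auto simp: ennreal_add_less_top intro: le_less_trans)
     moreover have "ennreal q * G n + r n < \<infinity>" using Suc by (simp add: ennreal_mult_less_top ennreal_add_less_top)
     ultimately show ?case using step[of n] by (auto intro: le_less_trans)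
    qed
    then show ?thesis by (induction n) (simp_all add: ennreal_add_less_top)
   qed
   have "(\<Sum>j<n. G j) \<le> (\<Sum>j<Suc n. G j)" by simp
   also have "\<dots> = G 0 + (\<Sum>j<n. G (Suc j))" by (rule sum.lessThan_Suc_shift)
   also have "\<dots> \<le> G 0 + (\<Sum>j<n. ennreal q * G j + r j)" by (intro add_left_mono sum_mono step)
   also have "\<dots> = ennreal q * (\<Sum>j<n. G j) + (G 0 + (\<Sum>j<n. r j))"
    by (simp add: sum.distrib sum_distrib_left add_ac)
   also have "\<dots> \<le> ennreal q * (\<Sum>j<n. G j) + ?T" by (intro add_left_mono r)
   finally have le: "(\<Sum>j<n. G j) \<le> ennreal q * (\<Sum>j<n. G j) + ?T" .
   obtain x where x: "(\<Sum>j<n. G j) = ennreal x" "0 \<le> x" using fin[of n] by (cases "\<Sum>j<n. G j") auto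
   obtain y where y: "?T = ennreal y" "0 \<le> y" using True by (cases ?T) auto
   have "ennreal x \<le> ennreal (q * x + y)" using le x y q by (simp add: ennreal_mult)
   then have "x \<le> q * x + y" using x y q by (subst (asm) ennreal_le_iff) auto
   then have "x \<le> 1 / (1 - q) * y" using q by (simp add: field_simps)
   then have "ennreal x \<le> ennreal (1 / (1 - q)) * ennreal y"
    using q y by (subst ennreal_mult[symmetric]) (auto intro: ennreal_leI)
   then show ?thesis using x y by simp
  qed
  show ?thesis by (rule suminf_le_const[OF summableI partial])
qed

lemma geometric_weight_sum:
  fixes t :: real
  assumes t: "0 < t" "t < 1"
  shows "(\<Sum>j. ennreal (t * (2 ^ j) powr (- t))) \<le> ennreal 2"
proof -
  let ?x = "2 powr (- t)"
  have x: "0 < ?x" "?x < 1" using t by (auto simp: powr_less_one)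
  have "?x = exp ((1 - t) *\<^sub>R 0 + t *\<^sub>R (- ln 2))" by (simp add: powr_def)
  also have "\<dots> \<le> (1 - t) * exp 0 + t * exp (- ln 2)"
   using convex_onD[OF exp_convex, of t 0 "- ln 2"] t by simp
  also have "\<dots> = 1 - t / 2" by (simp add: exp_minus field_simps)
  finally have le: "t / 2 \<le> 1 - ?x" by simp
  have e: "t * (2 ^ j) powr (- t) = t * ?x ^ j" for j
   by (simp add: powr_realpow[symmetric] powr_powr mult.commute)
  have "(\<lambda>j. t * ?x ^ j) sums (t * (1 / (1 - ?x)))"
   using x by (intro sums_mult geometric_sums) auto
  then have "(\<Sum>j. ennreal (t * ?x ^ j)) = ennreal (t * (1 / (1 - ?x)))"
   using t x by (intro suminf_ennreal_eq) auto
  also have "\<dots> \<le> ennreal 2"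
   using le x t by (intro ennreal_leI) (simp add: divide_le_eq)
  finally show ?thesis unfolding e .
qed

text \<open>One chart, in which the depth \<open>- h x\<close> of an exterior point replaces its distance to the boundary.\<close>

locale trace_chart =
  fixes \<Omega> :: "'a::euclidean_space set" and M R :: real and e z0 :: 'a and h :: "'a \<Rightarrow> real"
  assumes dom_borel [measurable]: "\<Omega> \<in> sets borel" and M1: "M \<ge> 1" and R0: "0 < R" "R \<le> 1"
   and hf: "height_function M e h" and h0: "h z0 = 0"
   and chart: "\<And>x. x \<in> ball z0 R \<Longrightarrow> 0 < h x \<Longrightarrow> x \<in> \<Omega>"
begin

text \<open>The size of the cones comes from \<open>cone_overlap\<close>; up to the scale \<open>top_scale\<close> the doubled cones over
points of the half ball stay in the chart.\<close>

definition "K = 12 * M + 17"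
definition "top_scale = R / (8 * K)"

abbreviation "cone1 \<equiv> cone M e K"
abbreviation "cone2 \<equiv> cone M e (2 * K)"

lemma K: "K \<ge> 29" "K \<ge> 1" using M1 by (auto simp: K_def)

lemma top_scale: "0 < top_scale" "top_scale \<le> 1" "2 * K * top_scale < R / 2"
  using R0 K by (auto simp: top_scale_def divide_le_eq)

lemma h_measurable [measurable]: "h \<in> borel_measurable borel"
  by (rule height_functionD(4)[OF hf])

lemma cone_height:
  assumes "w \<in> cone M e k" "0 \<le> \<rho>"
  shows "h x + 2 * \<rho> \<le> h (x + \<rho> *\<^sub>R w)"
proof -
  let ?p = "w - (w \<bullet> e) *\<^sub>R e"
  have eq: "x + \<rho> *\<^sub>R w = (x + \<rho> *\<^sub>R ?p) + (\<rho> * (w \<bullet> e)) *\<^sub>R e" by (simp add: algebra_simps)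
  have "h (x + \<rho> *\<^sub>R w) = h (x + \<rho> *\<^sub>R ?p) + \<rho> * (w \<bullet> e)"
   unfolding eq by (rule height_functionD(3)[OF hf])
  moreover have "\<bar>h (x + \<rho> *\<^sub>R ?p) - h x\<bar> \<le> M * (\<rho> * norm ?p)"
   using height_functionD(2)[OF hf, of "x + \<rho> *\<^sub>R ?p" x] assms(2) by (simp add: dist_norm)
  moreover have "\<rho> * (2 + M * norm ?p) \<le> \<rho> * (w \<bullet> e)"
   using assms by (intro mult_left_mono) (auto simp: cone_def)
  ultimately show ?thesis by (simp add: algebra_simps)
qed

lemma cone_in_dom:
  assumes x: "x \<in> cball z0 (R / 2)" "- \<rho> \<le> h x" and \<rho>: "0 < \<rho>" "\<rho> \<le> top_scale" and w: "w \<in> cone2"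
  shows "x + \<rho> *\<^sub>R w \<in> \<Omega>" "\<rho> \<le> h (x + \<rho> *\<^sub>R w)"
proof -
  show hl: "\<rho> \<le> h (x + \<rho> *\<^sub>R w)" using cone_height[OF w, of \<rho> x] x \<rho> by linarith
  have "norm (\<rho> *\<^sub>R w) \<le> top_scale * (2 * K)"
   using \<rho> w K unfolding norm_scaleR by (intro mult_mono) (auto simp: cone_def)
  then have "dist x (x + \<rho> *\<^sub>R w) < R / 2" using top_scale(3) by (simp add: dist_norm mult_ac)
  then have "x + \<rho> *\<^sub>R w \<in> ball z0 R" using x dist_triangle[of z0 "x + \<rho> *\<^sub>R w" x] unfolding mem_ball mem_cball by linarith
  then show "x + \<rho> *\<^sub>R w \<in> \<Omega>" using hl \<rho> by (intro chart) auto
qed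

text \<open>The exterior points for which the \<open>j\<close>-th dyadic multiple of the depth is an admissible scale.\<close>

definition level :: "nat \<Rightarrow> 'a set" where
  "level j = {x \<in> cball z0 (R / 2). h x < 0 \<and> 2 ^ j * (- h x) \<le> top_scale}"

definition oscillation :: "('a \<Rightarrow> real) \<Rightarrow> 'a \<Rightarrow> real \<Rightarrow> ennreal" where
  "oscillation u x \<rho> = (\<integral>\<^sup>+w. ennreal ((u x - u (x + \<rho> *\<^sub>R w))\<^sup>2) * indicator cone1 w)"

text \<open>The weight is what remains of the trace kernel at \<open>x\<close> when the other variable is integrated over the
points at distance about \<open>2 ^ j * (- h x)\<close>.\<close>

definition scale_energy :: "real \<Rightarrow> ('a \<Rightarrow> real) \<Rightarrow> nat \<Rightarrow> ennreal" where
  "scale_energy s u j = (\<integral>\<^sup>+x. ennreal ((1 - s) * (- h x) powr (- s) * (2 ^ j * (- h x)) powr (- s)) *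
   oscillation u x (2 ^ j * (- h x)) * indicator (level j) x)"

lemma level_measurable [measurable]: "level j \<in> sets borel"
proof -
  have "level j = cball z0 (R / 2) \<inter> {x \<in> space borel. h x < 0 \<and> 2 ^ j * (- h x) \<le> top_scale}"
   by (auto simp: level_def)
  also have "\<dots> \<in> sets borel"
  proof (rule sets.Int)
   show "{x \<in> space borel. h x < 0 \<and> 2 ^ j * (- h x) \<le> top_scale} \<in> sets borel" by measurable
  qed simp
  finally show ?thesis .
qed

lemma oscillation_measurable [measurable]:
  assumes [measurable]: "u \<in> borel_measurable borel" "f \<in> borel_measurable borel"
  shows "(\<lambda>x. oscillation u x (f x)) \<in> borel_measurable borel"
  unfolding oscillation_def by measurable

lemma cone_translate_integral:
  fixes F :: "'a \<Rightarrow> ennreal"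
  assumes [measurable]: "F \<in> borel_measurable borel" and \<rho>: "\<rho> > 0"
  shows "(\<integral>\<^sup>+w. F (x + \<rho> *\<^sub>R w) * indicator C w) \<le> ennreal (\<rho> powr (- real DIM('a))) * (\<integral>\<^sup>+z. F z)"
proof -
  have "(\<integral>\<^sup>+z. F z) = ennreal (\<rho> ^ DIM('a)) * (\<integral>\<^sup>+w. F (x + \<rho> *\<^sub>R w))"
   by (rule nn_integral_lborel_dilate[OF assms])
  moreover have "ennreal (\<rho> powr (- real DIM('a))) * (ennreal (\<rho> ^ DIM('a)) * I) = I" for I
  proof -
   have "ennreal (\<rho> powr (- real DIM('a))) * ennreal (\<rho> ^ DIM('a)) = 1"
    using \<rho> by (subst ennreal_mult[symmetric]) (auto simp: powr_minus powr_realpow)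
   then show ?thesis by (simp add: mult.assoc[symmetric])
  qed
  moreover have "(\<integral>\<^sup>+w. F (x + \<rho> *\<^sub>R w) * indicator C w) \<le> (\<integral>\<^sup>+w. F (x + \<rho> *\<^sub>R w))"
   by (intro nn_integral_mono) (auto simp: indicator_def)
  ultimately show ?thesis by simp
qed

text \<open>At the scale of its own depth, the points of the cone over \<open>x\<close> have distance at most \<open>K\<close> times the depth,
so the weight is dominated by the Gagliardo kernel.\<close>

lemma scale_energy_0:
  assumes [measurable]: "u \<in> borel_measurable borel" and s: "0 < s" "s < 1"
  shows "scale_energy s u 0 \<le> ennreal (K powr (real DIM('a) + 2)) * (ennreal (1 - s) * dom_energy s \<Omega> u)"
proof -
  let ?b = "real DIM('a) + 2 * s"
  let ?k = "K powr (real DIM('a) + 2)"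
  have pt: "ennreal ((1 - s) * (- h x) powr (- s) * (- h x) powr (- s)) * oscillation u x (- h x) \<le>
   ennreal (?k * (1 - s)) * (\<integral>\<^sup>+z. gagliardo s u z x * indicator \<Omega> z)"
   if x: "x \<in> level 0" for x
  proof -
   define t where "t = - h x"
   have t: "0 < t" "t \<le> top_scale" "x \<in> cball z0 (R / 2)" using x by (auto simp: level_def t_def)
   have "ennreal (t powr (- (2 * s))) * oscillation u x t =
     (\<integral>\<^sup>+w. ennreal (t powr (- (2 * s))) * (ennreal ((u x - u (x + t *\<^sub>R w))\<^sup>2) * indicator cone1 w))"
    unfolding oscillation_def by (rule nn_integral_cmult[symmetric]) measurable
   also have "\<dots> \<le> (\<integral>\<^sup>+w. (ennreal (?k * t powr real DIM('a)) * (gagliardo s u (x + t *\<^sub>R w) x * indicator \<Omega> (x + t *\<^sub>R w))) * indicator cone1 w)"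
   proof (intro nn_integral_mono)
    fix w
    show "ennreal (t powr (- (2 * s))) * (ennreal ((u x - u (x + t *\<^sub>R w))\<^sup>2) * indicator cone1 w) \<le>
     (ennreal (?k * t powr real DIM('a)) * (gagliardo s u (x + t *\<^sub>R w) x * indicator \<Omega> (x + t *\<^sub>R w))) * indicator cone1 w"
    proof (cases "w \<in> cone1")
     case True
     have w2: "w \<in> cone2" using True cone_mono[of K "2 * K"] K by auto
     have inO: "x + t *\<^sub>R w \<in> \<Omega>" by (rule cone_in_dom(1)[OF t(3) _ t(1,2) w2]) (simp add: t_def)
     have dd: "dist (x + t *\<^sub>R w) x = t * norm w" using t by (simp add: dist_norm)
     have "2 \<le> norm w"
     proof -
      have "2 \<le> w \<bullet> e" using True M1 by (auto simp: cone_def intro: order_trans[of 2 "2 + M * norm (w - (w \<bullet> e) *\<^sub>R e)"])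
      also have "\<dots> \<le> norm w" using norm_cauchy_schwarz[of w e] height_functionD(1)[OF hf] by simp
      finally show ?thesis .
     qed
     then have "0 < norm w" by linarith
     then have "0 < t * norm w" using t by (intro mult_pos_pos)
     moreover have "t * norm w \<le> t * K" using t True by (intro mult_left_mono) (auto simp: cone_def)
     then have "t * norm w \<le> K * t" by (simp only: mult.commute)
     ultimately have "t powr (- ?b) \<le> ?k * (t * norm w) powr (- ?b)"
      using s K by (intro powr_neg_le_scaled) auto
     then have "t powr real DIM('a) * t powr (- ?b) \<le> t powr real DIM('a) * (?k * (t * norm w) powr (- ?b))"
      by (intro mult_left_mono) auto
     moreover have "t powr real DIM('a) * t powr (- ?b) = t powr (- (2 * s))"
      by (subst powr_add[symmetric]) simp
     ultimately have "t powr (- (2 * s)) * (u x - u (x + t *\<^sub>R w))\<^sup>2 \<le> t powr real DIM('a) * (?k * (t * norm w) powr (- ?b)) * (u x - u (x + t *\<^sub>R w))\<^sup>2"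
      by (intro mult_right_mono) auto
     then have "t powr (- (2 * s)) * (u x - u (x + t *\<^sub>R w))\<^sup>2 \<le> ?k * t powr real DIM('a) * ((u (x + t *\<^sub>R w) - u x)\<^sup>2 * dist (x + t *\<^sub>R w) x powr (- ?b))"
      unfolding dd by (simp add: power2_commute mult_ac)
     then have "ennreal (t powr (- (2 * s)) * (u x - u (x + t *\<^sub>R w))\<^sup>2) \<le> ennreal (?k * t powr real DIM('a) * ((u (x + t *\<^sub>R w) - u x)\<^sup>2 * dist (x + t *\<^sub>R w) x powr (- ?b)))"
      by (rule ennreal_leI)
     then show ?thesis using True inO by (simp add: gagliardo_def ennreal_mult)
    qed simp
   qed
   also have "\<dots> \<le> ennreal (t powr (- real DIM('a))) * (\<integral>\<^sup>+z. ennreal (?k * t powr real DIM('a)) * (gagliardo s u z x * indicator \<Omega> z))"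
    by (rule cone_translate_integral[OF _ t(1)]) measurable
   also have "\<dots> = ennreal (t powr (- real DIM('a))) * (ennreal (?k * t powr real DIM('a)) * (\<integral>\<^sup>+z. gagliardo s u z x * indicator \<Omega> z))"
    by (subst nn_integral_cmult) auto
   also have "\<dots> = (ennreal (t powr (- real DIM('a))) * ennreal (?k * t powr real DIM('a))) * (\<integral>\<^sup>+z. gagliardo s u z x * indicator \<Omega> z)"
    by (simp only: mult.assoc)
   also have "ennreal (t powr (- real DIM('a))) * ennreal (?k * t powr real DIM('a)) = ennreal ?k"
   proof -
    have "t powr (- real DIM('a)) * t powr real DIM('a) = 1" using t by (simp add: powr_add[symmetric])
    then have "t powr (- real DIM('a)) * (?k * t powr real DIM('a)) = ?k" by (simp add: mult.left_commute)
    then show ?thesis by (subst ennreal_mult[symmetric]) auto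
   qed
   finally have "ennreal (1 - s) * (ennreal (t powr (- (2 * s))) * oscillation u x t) \<le>
     ennreal (1 - s) * (ennreal ?k * (\<integral>\<^sup>+z. gagliardo s u z x * indicator \<Omega> z))"
    by (intro mult_left_mono) auto
   moreover have "(1 - s) * t powr (- s) * t powr (- s) = (1 - s) * t powr (- (2 * s))"
    by (simp add: powr_add[symmetric])
   ultimately show ?thesis unfolding t_def[symmetric] using s by (simp add: ennreal_mult mult_ac)
  qed
  have "scale_energy s u 0 \<le> (\<integral>\<^sup>+x. ennreal (?k * (1 - s)) * (\<integral>\<^sup>+z. gagliardo s u z x * indicator \<Omega> z))"
   unfolding scale_energy_def
  proof (intro nn_integral_mono)
   fix x
   show "ennreal ((1 - s) * (- h x) powr (- s) * (2 ^ 0 * (- h x)) powr (- s)) * oscillation u x (2 ^ 0 * (- h x)) * indicator (level 0) x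
    \<le> ennreal (?k * (1 - s)) * (\<integral>\<^sup>+z. gagliardo s u z x * indicator \<Omega> z)"
    using pt[of x] by (cases "x \<in> level 0") auto
  qed
  also have "\<dots> = ennreal (?k * (1 - s)) * (\<integral>\<^sup>+x z. gagliardo s u z x * indicator \<Omega> z)"
   by (rule nn_integral_cmult) measurable
  also have "(\<integral>\<^sup>+x z. gagliardo s u z x * indicator \<Omega> z) = dom_energy s \<Omega> u"
   unfolding dom_energy_def by (rule nn_integral_swap) measurable
  finally show ?thesis using s by (simp add: ennreal_mult mult.assoc)
qed

definition cone_vol :: real where "cone_vol = measure lborel cone1"

lemma cone_vol: "emeasure lborel cone1 = ennreal cone_vol" "cone_vol > 0"
proof -
  have "cone1 \<subseteq> cball 0 K" by (auto simp: cone_def)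
  then have "emeasure lborel cone1 \<le> emeasure lborel (cball (0::'a) K)" by (intro emeasure_mono) auto
  also have "\<dots> < \<infinity>" using K by (simp add: emeasure_cball)
  finally have fin: "emeasure lborel cone1 \<noteq> \<infinity>" by simp
  show e: "emeasure lborel cone1 = ennreal cone_vol"
   unfolding cone_vol_def by (rule emeasure_eq_ennreal_measure) (use fin in simp)
  have "cball ((6 * M + 7) *\<^sub>R e) 1 \<subseteq> cone1"
  proof
   fix w assume "w \<in> cball ((6 * M + 7) *\<^sub>R e) 1"
   then have "norm (w - (6 * M + 7) *\<^sub>R e) \<le> 1" by (simp add: dist_norm norm_minus_commute)
   from cone_overlap[OF M1 height_functionD(1)[OF hf] this, of 0 1] show "w \<in> cone1" by (simp add: K_def)
  qed
  then have "emeasure lborel (cball ((6 * M + 7) *\<^sub>R e) 1) \<le> emeasure lborel cone1" by (intro emeasure_mono) auto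
  moreover have "0 < emeasure lborel (cball ((6 * M + 7) *\<^sub>R e) 1)" by (simp add: emeasure_cball)
  ultimately have "0 < emeasure lborel cone1" by (rule less_le_trans[rotated])
  then show "cone_vol > 0" unfolding e by simp
qed

lemma sq_add_le:
  fixes a b \<eta> :: real
  assumes "\<eta> > 0"
  shows "(a + b)\<^sup>2 \<le> (1 + \<eta>) * a\<^sup>2 + (1 + 1 / \<eta>) * b\<^sup>2"
proof -
  have "0 \<le> (sqrt \<eta> * a - b / sqrt \<eta>)\<^sup>2" by simp
  also have "\<dots> = \<eta> * a\<^sup>2 + b\<^sup>2 / \<eta> - 2 * a * b"
   using assms by (simp add: power2_diff power_mult_distrib power_divide)
  finally show ?thesis by (simp add: power2_sum distrib_right)
qed

text \<open>Increments between interior points: they arise when the values on the cone at the scale \<open>\<rho>\<close> are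
compared with those at the scale \<open>2 * \<rho>\<close>, both of which lie in the dilated cone of size \<open>2 * K\<close>.\<close>

definition cross :: "('a \<Rightarrow> real) \<Rightarrow> 'a \<Rightarrow> real \<Rightarrow> ennreal" where
  "cross u x \<rho> = (\<integral>\<^sup>+w w'. ennreal ((u (x + \<rho> *\<^sub>R w) - u (x + \<rho> *\<^sub>R w'))\<^sup>2) * (indicator cone2 w * indicator cone2 w'))"

lemma cross_measurable [measurable]:
  assumes [measurable]: "u \<in> borel_measurable borel" "f \<in> borel_measurable borel"
  shows "(\<lambda>x. cross u x (f x)) \<in> borel_measurable borel"
  unfolding cross_def by measurable

lemma oscillation_double:
  assumes [measurable]: "u \<in> borel_measurable borel" and \<eta>: "\<eta> > 0"
  shows "oscillation u x (2 * \<rho>) \<le> ennreal (1 + \<eta>) * oscillation u x \<rho> + ennreal ((1 + 1 / \<eta>) / cone_vol) * cross u x \<rho>"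
proof -
  let ?f = "\<lambda>w'. ennreal ((u x - u (x + (2 * \<rho>) *\<^sub>R w'))\<^sup>2)"
  let ?g = "\<lambda>w. ennreal ((u x - u (x + \<rho> *\<^sub>R w))\<^sup>2)"
  let ?k = "\<lambda>w w'. ennreal ((u (x + \<rho> *\<^sub>R w) - u (x + (2 * \<rho>) *\<^sub>R w'))\<^sup>2)"
  note cv = cone_vol
  have "ennreal cone_vol * oscillation u x (2 * \<rho>) = (\<integral>\<^sup>+w. oscillation u x (2 * \<rho>) * indicator cone1 w)"
   by (subst nn_integral_cmult_indicator) (simp_all add: cv mult.commute)
  also have "\<dots> = (\<integral>\<^sup>+w w'. ?f w' * indicator cone1 w' * indicator cone1 w)"
   unfolding oscillation_def by (simp add: nn_integral_multc)
  also have "\<dots> \<le> (\<integral>\<^sup>+w w'. ennreal (1 + \<eta>) * (?g w * indicator cone1 w * indicator cone1 w') +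
    ennreal (1 + 1 / \<eta>) * (?k w w' * indicator cone1 w' * indicator cone1 w))"
  proof (intro nn_integral_mono)
   fix w w'
   have "(u x - u (x + (2 * \<rho>) *\<^sub>R w'))\<^sup>2 \<le> (1 + \<eta>) * (u x - u (x + \<rho> *\<^sub>R w))\<^sup>2 + (1 + 1 / \<eta>) * (u (x + \<rho> *\<^sub>R w) - u (x + (2 * \<rho>) *\<^sub>R w'))\<^sup>2"
    using sq_add_le[OF \<eta>, of "u x - u (x + \<rho> *\<^sub>R w)" "u (x + \<rho> *\<^sub>R w) - u (x + (2 * \<rho>) *\<^sub>R w')"] by simp
   then have "?f w' \<le> ennreal ((1 + \<eta>) * (u x - u (x + \<rho> *\<^sub>R w))\<^sup>2 + (1 + 1 / \<eta>) * (u (x + \<rho> *\<^sub>R w) - u (x + (2 * \<rho>) *\<^sub>R w'))\<^sup>2)"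
    by (rule ennreal_leI)
   also have "\<dots> = ennreal (1 + \<eta>) * ?g w + ennreal (1 + 1 / \<eta>) * ?k w w'"
    using \<eta> by (subst ennreal_plus) (auto simp: ennreal_mult)
   finally show "?f w' * indicator cone1 w' * indicator cone1 w \<le> ennreal (1 + \<eta>) * (?g w * indicator cone1 w * indicator cone1 w') +
    ennreal (1 + 1 / \<eta>) * (?k w w' * indicator cone1 w' * indicator cone1 w)"
    by (auto simp: indicator_def)
  qed
  also have "\<dots> = (\<integral>\<^sup>+w. ennreal (1 + \<eta>) * (?g w * indicator cone1 w * ennreal cone_vol) + ennreal (1 + 1 / \<eta>) *
    (\<integral>\<^sup>+w'. ?k w w' * indicator cone1 w' * indicator cone1 w))"
  proof (rule nn_integral_cong)
   fix w
   have "(\<integral>\<^sup>+w'. ennreal (1 + \<eta>) * (?g w * indicator cone1 w * indicator cone1 w')) = ennreal (1 + \<eta>) * (?g w * indicator cone1 w * ennreal cone_vol)"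
    by (simp add: nn_integral_cmult nn_integral_cmult_indicator cv)
   then show "(\<integral>\<^sup>+w'. ennreal (1 + \<eta>) * (?g w * indicator cone1 w * indicator cone1 w') +
    ennreal (1 + 1 / \<eta>) * (?k w w' * indicator cone1 w' * indicator cone1 w)) = ennreal (1 + \<eta>) * (?g w * indicator cone1 w * ennreal cone_vol) + ennreal (1 + 1 / \<eta>) *
    (\<integral>\<^sup>+w'. ?k w w' * indicator cone1 w' * indicator cone1 w)"
    by (subst nn_integral_add) (simp_all add: nn_integral_cmult)
  qed
  also have "\<dots> = ennreal (1 + \<eta>) * (oscillation u x \<rho> * ennreal cone_vol) + ennreal (1 + 1 / \<eta>) *
    (\<integral>\<^sup>+w w'. ?k w w' * indicator cone1 w' * indicator cone1 w)"
   unfolding oscillation_def by (subst nn_integral_add) (simp_all add: nn_integral_cmult nn_integral_multc)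
  also have "\<dots> \<le> ennreal (1 + \<eta>) * (oscillation u x \<rho> * ennreal cone_vol) + ennreal (1 + 1 / \<eta>) * cross u x \<rho>"
  proof (intro add_left_mono mult_left_mono)
   show "(\<integral>\<^sup>+w w'. ?k w w' * indicator cone1 w' * indicator cone1 w) \<le> cross u x \<rho>"
    unfolding cross_def
   proof (rule nn_integral_mono)
    fix w
    let ?F = "\<lambda>w'. ennreal ((u (x + \<rho> *\<^sub>R w) - u (x + \<rho> *\<^sub>R w'))\<^sup>2) * (indicator cone2 w * indicator cone2 w')"
    have "(\<integral>\<^sup>+w'. ?k w w' * indicator cone1 w' * indicator cone1 w) \<le> (\<integral>\<^sup>+w'. ?F (0 + 2 *\<^sub>R w'))"
    proof (rule nn_integral_mono)
     fix w'
     show "?k w w' * indicator cone1 w' * indicator cone1 w \<le> ?F (0 + 2 *\<^sub>R w')"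
     proof (cases "w \<in> cone1 \<and> w' \<in> cone1")
      case True
      then have "w \<in> cone2" "2 *\<^sub>R w' \<in> cone2" using cone_mono[of K "2 * K" M e] K cone_double by auto
      then show ?thesis by (simp add: indicator_def mult.commute)
     qed (auto simp: indicator_def)
    qed
    also have "\<dots> = 1 * (\<integral>\<^sup>+w'. ?F (0 + 2 *\<^sub>R w'))" by simp
    also have "\<dots> \<le> ennreal (2 ^ DIM('a)) * (\<integral>\<^sup>+w'. ?F (0 + 2 *\<^sub>R w'))"
     by (intro mult_right_mono) (auto simp: ennreal_ge_1)
    also have "\<dots> = (\<integral>\<^sup>+w'. ?F w')"
     by (rule nn_integral_lborel_dilate[symmetric]) auto
    finally show "(\<integral>\<^sup>+w'. ?k w w' * indicator cone1 w' * indicator cone1 w) \<le> (\<integral>\<^sup>+w'. ?F w')" .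
   qed
  qed simp
  also have "\<dots> = (ennreal (1 + \<eta>) * oscillation u x \<rho> + ennreal ((1 + 1 / \<eta>) / cone_vol) * cross u x \<rho>) * ennreal (cone_vol * 1)"
  proof -
   have "ennreal ((1 + 1 / \<eta>) / cone_vol) * ennreal cone_vol = ennreal (1 + 1 / \<eta>)"
    using cv \<eta> by (subst ennreal_mult[symmetric]) auto
   then have "ennreal (1 + 1 / \<eta>) * cross u x \<rho> = ennreal ((1 + 1 / \<eta>) / cone_vol) * cross u x \<rho> * ennreal cone_vol"
    by (metis mult.assoc mult.commute)
   then show ?thesis by (simp add: distrib_right mult.assoc)
  qed
  finally have "ennreal cone_vol * oscillation u x (2 * \<rho>) \<le> (ennreal (1 + \<eta>) * oscillation u x \<rho> + ennreal ((1 + 1 / \<eta>) / cone_vol) * cross u x \<rho>) * ennreal (cone_vol * 1)" .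
  from ennreal_cancel_le(1)[OF cv(2) _ this] show ?thesis by simp
qed

definition cross_energy :: "real \<Rightarrow> ('a \<Rightarrow> real) \<Rightarrow> nat \<Rightarrow> ennreal" where
  "cross_energy s u j = (\<integral>\<^sup>+x. ennreal ((1 - s) * (- h x) powr (- s) * (2 ^ j * (- h x)) powr (- s)) *
   cross u x (2 ^ j * (- h x)) * indicator (level j) x)"

text \<open>Doubling the scale gains the factor \<open>2\<^sup>-\<^sup>s\<close> from the weight, at the price of interior increments.\<close>

lemma scale_energy_Suc:
  assumes [measurable]: "u \<in> borel_measurable borel" and s: "0 < s" "s < 1" and \<eta>: "\<eta> > 0"
  shows "scale_energy s u (Suc j) \<le> ennreal (2 powr (- s) * (1 + \<eta>)) * scale_energy s u j +
   ennreal ((1 + 1 / \<eta>) / cone_vol) * cross_energy s u j"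
proof -
  let ?w = "\<lambda>j x. ennreal ((1 - s) * (- h x) powr (- s) * (2 ^ j * (- h x)) powr (- s))"
  let ?a = "ennreal (2 powr (- s) * (1 + \<eta>))" and ?b = "ennreal ((1 + 1 / \<eta>) / cone_vol)"
  have "scale_energy s u (Suc j) \<le> (\<integral>\<^sup>+x. ?a * (?w j x * oscillation u x (2 ^ j * (- h x)) * indicator (level j) x) +
    ?b * (?w j x * cross u x (2 ^ j * (- h x)) * indicator (level j) x))"
   unfolding scale_energy_def
  proof (rule nn_integral_mono)
   fix x
   show "?w (Suc j) x * oscillation u x (2 ^ Suc j * (- h x)) * indicator (level (Suc j)) x \<le>
    ?a * (?w j x * oscillation u x (2 ^ j * (- h x)) * indicator (level j) x) +
    ?b * (?w j x * cross u x (2 ^ j * (- h x)) * indicator (level j) x)"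
   proof (cases "x \<in> level (Suc j)")
    case True
    define t where "t = - h x"
    define \<rho> where "\<rho> = 2 ^ j * t"
    have t: "t > 0" using True by (simp add: level_def t_def)
    have \<rho>: "\<rho> > 0" using t by (simp add: \<rho>_def)
    have \<rho>2: "2 ^ Suc j * t = 2 * \<rho>" by (simp add: \<rho>_def)
    from True have a: "x \<in> cball z0 (R / 2)" "h x < 0" "2 ^ Suc j * t \<le> top_scale"
     by (simp_all only: level_def mem_Collect_eq t_def)
    then have lj: "x \<in> level j"
     using \<rho> unfolding level_def mem_Collect_eq \<rho>2 t_def[symmetric] \<rho>_def[symmetric] by auto
    have p: "(2 * \<rho>) powr (- s) = 2 powr (- s) * \<rho> powr (- s)" using \<rho> by (simp add: powr_mult)
    have p1: "2 powr (- s) \<le> (1::real)" using s powr_mono[of "- s" 0 "2::real"] by simp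
    have "ennreal ((1 - s) * t powr (- s) * (2 * \<rho>) powr (- s)) * oscillation u x (2 * \<rho>) \<le>
     ennreal ((1 - s) * t powr (- s) * (2 * \<rho>) powr (- s)) * (ennreal (1 + \<eta>) * oscillation u x \<rho> + ?b * cross u x \<rho>)"
     by (intro mult_left_mono oscillation_double \<eta>) auto
    also have wt: "ennreal ((1 - s) * t powr (- s) * (2 * \<rho>) powr (- s)) = ennreal (2 powr (- s)) * ennreal ((1 - s) * t powr (- s) * \<rho> powr (- s))"
     unfolding p using s by (subst ennreal_mult[symmetric]) (auto simp: mult_ac)
    also have "ennreal (2 powr (- s)) * ennreal ((1 - s) * t powr (- s) * \<rho> powr (- s)) * (ennreal (1 + \<eta>) * oscillation u x \<rho> + ?b * cross u x \<rho>)
     = (ennreal (2 powr (- s)) * ennreal (1 + \<eta>)) * (ennreal ((1 - s) * t powr (- s) * \<rho> powr (- s)) * oscillation u x \<rho>) +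
      ennreal (2 powr (- s)) * (?b * (ennreal ((1 - s) * t powr (- s) * \<rho> powr (- s)) * cross u x \<rho>))"
     by (simp only: distrib_left mult_ac)
    also have "\<dots> \<le> ?a * (ennreal ((1 - s) * t powr (- s) * \<rho> powr (- s)) * oscillation u x \<rho>) +
      1 * (?b * (ennreal ((1 - s) * t powr (- s) * \<rho> powr (- s)) * cross u x \<rho>))"
    proof -
     have q1: "ennreal (2 powr (- s)) * ennreal (1 + \<eta>) = ?a" using \<eta> by (intro ennreal_mult[symmetric]) auto
     have q2: "ennreal (2 powr (- s)) \<le> 1" using p1 by (simp add: ennreal_le_1)
     show ?thesis unfolding q1 by (intro add_mono mult_right_mono q2 order_refl) auto
    qed
    finally show ?thesis
     using True lj unfolding t_def[symmetric] \<rho>2 \<rho>_def[symmetric] wt by simp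
   qed simp
  qed
  also have "\<dots> = ?a * scale_energy s u j + ?b * cross_energy s u j"
   unfolding scale_energy_def cross_energy_def by (subst nn_integral_add) (simp_all add: nn_integral_cmult)
  finally show ?thesis .
qed

definition "cross_const = 4 * (4 * K) powr (real DIM('a) + 2) *
  ((2 * K * M) powr real DIM('a) * (unit_ball_vol (real DIM('a)) * 2 ^ DIM('a) * (2 * K) powr (real DIM('a) - 1) * 2))"

lemma cross_const_pos: "cross_const > 0"
  using K M1 by (simp add: cross_const_def)

text \<open>The cone is convex and of bounded size, so the Poincare inequality applies after rescaling.\<close>

lemma cross_le_energy:
  assumes [measurable]: "u \<in> borel_measurable borel" and s: "0 < s" "s < 1" and \<rho>: "\<rho> > 0"
  shows "cross u x \<rho> \<le> ennreal (4 * (4 * K) powr (real DIM('a) + 2) * (1 - s) * \<rho> powr (2 * s)) *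
   (\<integral>\<^sup>+w. (\<integral>\<^sup>+y. gagliardo s u (x + \<rho> *\<^sub>R w) y) * indicator cone2 w)"
proof -
  let ?b = "real DIM('a) + 2 * s"
  let ?c = "4 * (4 * K) powr (real DIM('a) + 2) * (1 - s)"
  let ?v = "\<lambda>w. u (x + \<rho> *\<^sub>R w)"
  have "cross u x \<rho> \<le> ennreal ?c * (\<integral>\<^sup>+w w'. gagliardo s ?v w w' * (indicator cone2 w * indicator cone2 w'))"
   unfolding cross_def
  proof (rule fractional_poincare)
   show "convex cone2" using M1 by (intro cone_convex) auto
   show "1 \<le> 4 * K" using K by simp
   show "dist w w' \<le> 4 * K" if "w \<in> cone2" "w' \<in> cone2" for w w'
    using that norm_triangle_ineq4[of w w'] by (simp add: cone_def dist_norm)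
  qed (use s in auto)
  also have "(\<integral>\<^sup>+w w'. gagliardo s ?v w w' * (indicator cone2 w * indicator cone2 w')) \<le>
    (\<integral>\<^sup>+w. ennreal (\<rho> powr (2 * s)) * ((\<integral>\<^sup>+y. gagliardo s u (x + \<rho> *\<^sub>R w) y) * indicator cone2 w))"
  proof (rule nn_integral_mono)
   fix w
   have sc: "gagliardo s ?v w w' = ennreal (\<rho> powr ?b) * gagliardo s u (x + \<rho> *\<^sub>R w) (x + \<rho> *\<^sub>R w')" for w'
   proof -
    have "dist (x + \<rho> *\<^sub>R w) (x + \<rho> *\<^sub>R w') = \<rho> * dist w w'"
     using \<rho> by (simp add: dist_norm scaleR_diff_right[symmetric])
    then have "\<rho> powr ?b * dist (x + \<rho> *\<^sub>R w) (x + \<rho> *\<^sub>R w') powr (- ?b) = dist w w' powr (- ?b)"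
     using \<rho> by (simp add: powr_mult powr_add[symmetric] mult.assoc[symmetric])
    then have "ennreal (dist w w' powr (- ?b)) = ennreal (\<rho> powr ?b) * ennreal (dist (x + \<rho> *\<^sub>R w) (x + \<rho> *\<^sub>R w') powr (- ?b))"
     by (subst ennreal_mult[symmetric]) auto
    then show ?thesis by (simp add: gagliardo_def mult.left_commute)
   qed
   have "(\<integral>\<^sup>+w'. gagliardo s ?v w w' * (indicator cone2 w * indicator cone2 w')) =
    (\<integral>\<^sup>+w'. (ennreal (\<rho> powr ?b) * indicator cone2 w) * (gagliardo s u (x + \<rho> *\<^sub>R w) (x + \<rho> *\<^sub>R w') * indicator cone2 w'))"
    unfolding sc by (simp only: mult_ac)
   also have "\<dots> = (ennreal (\<rho> powr ?b) * indicator cone2 w) * (\<integral>\<^sup>+w'. gagliardo s u (x + \<rho> *\<^sub>R w) (x + \<rho> *\<^sub>R w') * indicator cone2 w')"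
    by (rule nn_integral_cmult) measurable
   also have "\<dots> \<le> (ennreal (\<rho> powr ?b) * indicator cone2 w) * (ennreal (\<rho> powr (- real DIM('a))) * (\<integral>\<^sup>+y. gagliardo s u (x + \<rho> *\<^sub>R w) y))"
    by (intro mult_left_mono cone_translate_integral \<rho>) auto
   also have "\<dots> = (ennreal (\<rho> powr ?b) * ennreal (\<rho> powr (- real DIM('a)))) * ((\<integral>\<^sup>+y. gagliardo s u (x + \<rho> *\<^sub>R w) y) * indicator cone2 w)"
    by (simp only: mult_ac)
   also have "ennreal (\<rho> powr ?b) * ennreal (\<rho> powr (- real DIM('a))) = ennreal (\<rho> powr (2 * s))"
    by (subst ennreal_mult[symmetric]) (auto simp: powr_add[symmetric])
   finally show "(\<integral>\<^sup>+w'. gagliardo s ?v w w' * (indicator cone2 w * indicator cone2 w')) \<le>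
    ennreal (\<rho> powr (2 * s)) * ((\<integral>\<^sup>+y. gagliardo s u (x + \<rho> *\<^sub>R w) y) * indicator cone2 w)" .
  qed
  also have "\<dots> = ennreal (\<rho> powr (2 * s)) * (\<integral>\<^sup>+w. (\<integral>\<^sup>+y. gagliardo s u (x + \<rho> *\<^sub>R w) y) * indicator cone2 w)"
   by (rule nn_integral_cmult) measurable
  finally have "cross u x \<rho> \<le> ennreal ?c * (ennreal (\<rho> powr (2 * s)) * (\<integral>\<^sup>+w. (\<integral>\<^sup>+y. gagliardo s u (x + \<rho> *\<^sub>R w) y) * indicator cone2 w))"
   by (simp add: mult_left_mono)
  also have "\<dots> = ennreal (?c * \<rho> powr (2 * s)) * (\<integral>\<^sup>+w. (\<integral>\<^sup>+y. gagliardo s u (x + \<rho> *\<^sub>R w) y) * indicator cone2 w)"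
   using s by (simp add: ennreal_mult mult.assoc)
  finally show ?thesis .
qed

text \<open>The exterior points that see \<open>z\<close> at the scale \<open>2 ^ j * (- h x)\<close> lie in a layer of width \<open>h z / 2 ^ j\<close>
and at distance at most a multiple of \<open>h z\<close>.\<close>

lemma layer_count:
  "(\<integral>\<^sup>+x. ennreal ((2 ^ j * (- h x)) powr (- real DIM('a))) *
    (indicator cone2 ((1 / (2 ^ j * (- h x))) *\<^sub>R (z - x)) * indicator (level j) x)) \<le>
   ennreal ((2 * K * M) powr real DIM('a) * (unit_ball_vol (real DIM('a)) * 2 ^ DIM('a) * (2 * K) powr (real DIM('a) - 1) * 2) / 2 ^ j) * indicator \<Omega> z"
proof -
  let ?d = "real DIM('a)"
  let ?F = "\<lambda>x. ennreal ((2 ^ j * (- h x)) powr (- ?d)) * (indicator cone2 ((1 / (2 ^ j * (- h x))) *\<^sub>R (z - x)) * indicator (level j) x)"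
  have geo: "z \<in> \<Omega> \<and> 0 < h z \<and> h z \<le> 2 * K * M * (2 ^ j * (- h x)) \<and> dist z x \<le> 2 * K * h z \<and> \<bar>h x\<bar> \<le> h z / 2 ^ j"
   if c: "(1 / (2 ^ j * (- h x))) *\<^sub>R (z - x) \<in> cone2" and x: "x \<in> level j" for x
  proof -
   define \<rho> where "\<rho> = 2 ^ j * (- h x)"
   have hx: "h x < 0" "x \<in> cball z0 (R / 2)" "\<rho> \<le> top_scale" using x by (auto simp: level_def \<rho>_def)
   have \<rho>: "0 < \<rho>" unfolding \<rho>_def using hx by (intro mult_pos_pos) auto
   define w where "w = (1 / \<rho>) *\<^sub>R (z - x)"
   have w: "w \<in> cone2" using c by (simp add: w_def \<rho>_def)
   have zx: "z = x + \<rho> *\<^sub>R w" using \<rho> by (simp add: w_def)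
   have "(-h x) * 1 \<le> (-h x) * 2 ^ j" using hx by (intro mult_left_mono) auto
   then have "- \<rho> \<le> h x" by (simp add: \<rho>_def mult.commute)
   note cd = cone_in_dom[OF hx(2) this \<rho> hx(3) w, folded zx]
   have "dist z x = \<rho> * norm w" using \<rho> by (simp add: zx dist_norm)
   also have "\<dots> \<le> \<rho> * (2 * K)" using w \<rho> by (intro mult_left_mono) (auto simp: cone_def)
   finally have d: "dist z x \<le> 2 * K * \<rho>" by (simp add: mult.commute)
   also have "\<dots> \<le> 2 * K * h z" using cd K by (intro mult_left_mono) auto
   finally have d2: "dist z x \<le> 2 * K * h z" .
   have "h z \<le> h x + M * dist z x" using height_functionD(2)[OF hf, of z x] by linarith
   also have "\<dots> \<le> 0 + M * (2 * K * \<rho>)" using hx d M1 by (intro add_mono mult_left_mono) auto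
   finally have "h z \<le> 2 * K * M * \<rho>" by (simp add: mult_ac)
   moreover have "\<bar>h x\<bar> \<le> h z / 2 ^ j"
    using cd hx by (simp add: \<rho>_def le_divide_eq mult.commute)
   ultimately show ?thesis using cd \<rho> d2 by (simp add: \<rho>_def)
  qed
  show ?thesis
  proof (cases "z \<in> \<Omega> \<and> 0 < h z")
   case False
   have z: "?F x = 0" for x using geo[of x] False by (auto simp: indicator_def)
   show ?thesis unfolding z by simp
  next
   case True
   define H where "H = h z"
   have H: "H > 0" "z \<in> \<Omega>" using True by (auto simp: H_def)
   let ?a = "(2 * K * M) powr ?d * H powr (- ?d)"
   have "(\<integral>\<^sup>+x. ?F x) \<le> (\<integral>\<^sup>+x. (ennreal ?a * indicator {- (H / 2 ^ j)..H / 2 ^ j} (h x)) * indicator (cball z (2 * K * H)) x)"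
   proof (rule nn_integral_mono)
    fix x
    show "?F x \<le> (ennreal ?a * indicator {- (H / 2 ^ j)..H / 2 ^ j} (h x)) * indicator (cball z (2 * K * H)) x"
    proof (cases "(1 / (2 ^ j * (- h x))) *\<^sub>R (z - x) \<in> cone2 \<and> x \<in> level j")
     case True
     note g = geo[OF True[THEN conjunct1] True[THEN conjunct2]]
     have KM: "1 \<le> 2 * K * M" using K M1 mult_mono[of 1 "2 * K" 1 M] by simp
     have "(2 ^ j * (- h x)) powr (- ?d) \<le> ?a"
      using g KM H by (intro powr_neg_le_scaled) (auto simp: H_def)
     then show ?thesis using g True by (simp add: H_def indicator_def abs_le_iff ennreal_leI)
    qed (auto simp: indicator_def)
   qed
   also have "\<dots> \<le> ennreal (unit_ball_vol ?d * 2 ^ DIM('a) * (2 * K * H) powr (?d - 1)) *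
     (\<integral>\<^sup>+t. ennreal ?a * indicator {- (H / 2 ^ j)..H / 2 ^ j} t)"
    using K H by (intro layer_upper[OF hf]) auto
   also have "(\<integral>\<^sup>+t. ennreal ?a * indicator {- (H / 2 ^ j)..H / 2 ^ j} t) = ennreal ?a * ennreal (2 * (H / 2 ^ j))"
    using H by (subst nn_integral_cmult_indicator) auto
   also have "ennreal (unit_ball_vol ?d * 2 ^ DIM('a) * (2 * K * H) powr (?d - 1)) * (ennreal ?a * ennreal (2 * (H / 2 ^ j))) =
    ennreal (unit_ball_vol ?d * 2 ^ DIM('a) * (2 * K * H) powr (?d - 1) * (?a * (2 * (H / 2 ^ j))))"
    by (rule ennreal_mult_assoc3) (use H K in auto)
   also have "unit_ball_vol ?d * 2 ^ DIM('a) * (2 * K * H) powr (?d - 1) * (?a * (2 * (H / 2 ^ j))) =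
    (2 * K * M) powr ?d * (unit_ball_vol ?d * 2 ^ DIM('a) * (2 * K) powr (?d - 1) * 2) / 2 ^ j"
   proof -
    have p: "(2 * K * H) powr (?d - 1) = (2 * K) powr (?d - 1) * H powr (?d - 1)" using K H by (simp add: powr_mult)
    have "H powr (?d - 1) * (H powr (- ?d) * H powr 1) = 1"
     unfolding powr_add[symmetric] using H by simp
    then have one: "H powr (?d - 1) * (H powr (- ?d) * H) = 1" using H by simp
    have "unit_ball_vol ?d * 2 ^ DIM('a) * ((2 * K) powr (?d - 1) * H powr (?d - 1)) * ((2 * K * M) powr ?d * H powr (- ?d) * (2 * (H / 2 ^ j)))
     = (H powr (?d - 1) * (H powr (- ?d) * H)) * ((2 * K * M) powr ?d * (unit_ball_vol ?d * 2 ^ DIM('a) * (2 * K) powr (?d - 1) * 2) / 2 ^ j)"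
    proof -
     have "U * T * (Kp * Hq) * (Kd * Hd * (2 * (H / J))) = (Hq * (Hd * H)) * (Kd * (U * T * Kp * 2) / J)"
      for U T Kp Hq Kd Hd J :: real by (simp add: mult_ac)
     then show ?thesis .
    qed
    also note one
    finally show ?thesis unfolding p by (simp only: mult_1_left)
   qed
   finally show ?thesis using H by simp
  qed
qed

text \<open>Of the factors \<open>2 ^ j\<close>, the weight and the Poincare inequality leave the power \<open>s\<close> and the width of the
layer contributes the power \<open>- 1\<close>.\<close>

lemma cross_energy_le:
  assumes [measurable]: "u \<in> borel_measurable borel" and s: "0 < s" "s < 1"
  shows "cross_energy s u j \<le> ennreal (cross_const * ((1 - s) * (2 ^ j) powr (- (1 - s)))) * (ennreal (1 - s) * dom_energy s \<Omega> u)"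
proof -
  let ?d = "real DIM('a)"
  let ?c = "4 * (4 * K) powr (?d + 2)"
  let ?L = "(2 * K * M) powr ?d * (unit_ball_vol ?d * 2 ^ DIM('a) * (2 * K) powr (?d - 1) * 2)"
  define \<Gamma> where "\<Gamma> z = (\<integral>\<^sup>+y. gagliardo s u z y)" for z
  have [measurable]: "\<Gamma> \<in> borel_measurable borel" unfolding \<Gamma>_def by measurable
  let ?\<rho> = "\<lambda>x. 2 ^ j * (- h x)"
  let ?N = "\<lambda>x z. ennreal (?\<rho> x powr (- ?d)) * (indicator cone2 ((1 / ?\<rho> x) *\<^sub>R (z - x)) * indicator (level j) x)"
  have "cross_energy s u j \<le> (\<integral>\<^sup>+x. ennreal (?c * (1 - s) * (1 - s) * (2 ^ j) powr s) * (\<integral>\<^sup>+z. ?N x z * \<Gamma> z))"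
   unfolding cross_energy_def
  proof (rule nn_integral_mono)
   fix x
   show "ennreal ((1 - s) * (- h x) powr (- s) * ?\<rho> x powr (- s)) * cross u x (?\<rho> x) * indicator (level j) x \<le>
    ennreal (?c * (1 - s) * (1 - s) * (2 ^ j) powr s) * (\<integral>\<^sup>+z. ?N x z * \<Gamma> z)"
   proof (cases "x \<in> level j")
    case True
    define t where "t = - h x"
    have t: "t > 0" using True by (simp add: level_def t_def)
    define \<rho> where "\<rho> = 2 ^ j * t"
    have \<rho>: "\<rho> > 0" using t by (simp add: \<rho>_def)
    have "(\<integral>\<^sup>+z. ?N x z * \<Gamma> z) = ennreal (\<rho> ^ DIM('a)) * (\<integral>\<^sup>+w. ?N x (x + \<rho> *\<^sub>R w) * \<Gamma> (x + \<rho> *\<^sub>R w))"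
     by (rule nn_integral_lborel_dilate[OF _ \<rho>]) measurable
    also have "\<dots> = ennreal (\<rho> ^ DIM('a)) * (\<integral>\<^sup>+w. ennreal (\<rho> powr (- ?d)) * (\<Gamma> (x + \<rho> *\<^sub>R w) * indicator cone2 w))"
    proof -
     have e: "?\<rho> x = \<rho>" by (simp only: \<rho>_def t_def)
     show ?thesis using True \<rho> unfolding e by (simp add: mult_ac)
    qed
    also have "\<dots> = ennreal (\<rho> ^ DIM('a)) * (ennreal (\<rho> powr (- ?d)) * (\<integral>\<^sup>+w. \<Gamma> (x + \<rho> *\<^sub>R w) * indicator cone2 w))"
     by (subst nn_integral_cmult) auto
    also have "\<dots> = (ennreal (\<rho> ^ DIM('a)) * ennreal (\<rho> powr (- ?d))) * (\<integral>\<^sup>+w. \<Gamma> (x + \<rho> *\<^sub>R w) * indicator cone2 w)"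
     by (simp only: mult.assoc)
    also have "ennreal (\<rho> ^ DIM('a)) * ennreal (\<rho> powr (- ?d)) = 1"
     using \<rho> by (subst ennreal_mult[symmetric]) (auto simp: powr_minus powr_realpow)
    finally have NI: "(\<integral>\<^sup>+z. ?N x z * \<Gamma> z) = (\<integral>\<^sup>+w. \<Gamma> (x + \<rho> *\<^sub>R w) * indicator cone2 w)" by simp
    have "ennreal ((1 - s) * t powr (- s) * \<rho> powr (- s)) * cross u x \<rho> \<le>
     ennreal ((1 - s) * t powr (- s) * \<rho> powr (- s)) * (ennreal (?c * (1 - s) * \<rho> powr (2 * s)) * (\<integral>\<^sup>+z. ?N x z * \<Gamma> z))"
    proof -
     have "cross u x \<rho> \<le> ennreal (?c * (1 - s) * \<rho> powr (2 * s)) * (\<integral>\<^sup>+w. \<Gamma> (x + \<rho> *\<^sub>R w) * indicator cone2 w)"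
      unfolding \<Gamma>_def by (rule cross_le_energy[OF assms(1) s \<rho>])
     then show ?thesis unfolding NI by (intro mult_left_mono) auto
    qed
    also have "\<dots> = (ennreal ((1 - s) * t powr (- s) * \<rho> powr (- s)) * ennreal (?c * (1 - s) * \<rho> powr (2 * s))) * (\<integral>\<^sup>+z. ?N x z * \<Gamma> z)"
     by (simp only: mult.assoc)
    also have "ennreal ((1 - s) * t powr (- s) * \<rho> powr (- s)) * ennreal (?c * (1 - s) * \<rho> powr (2 * s)) =
      ennreal (?c * (1 - s) * (1 - s) * (2 ^ j) powr s)"
    proof -
     have "\<rho> powr (- s) * \<rho> powr (2 * s) = \<rho> powr s" unfolding powr_add[symmetric] by simp
     also have "\<dots> = (2 ^ j) powr s * t powr s" using t by (simp add: \<rho>_def powr_mult)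
     finally have "t powr (- s) * (\<rho> powr (- s) * \<rho> powr (2 * s)) = (2 ^ j) powr s * (t powr (- s) * t powr s)" by simp
     also have "t powr (- s) * t powr s = 1" using t by (simp add: powr_add[symmetric])
     finally have e: "t powr (- s) * (\<rho> powr (- s) * \<rho> powr (2 * s)) = (2 ^ j) powr s" by simp
     have "(1 - s) * t powr (- s) * \<rho> powr (- s) * (?c * (1 - s) * \<rho> powr (2 * s)) =
      ?c * (1 - s) * (1 - s) * (t powr (- s) * (\<rho> powr (- s) * \<rho> powr (2 * s)))" by (simp only: mult_ac)
     then show ?thesis unfolding e using s by (subst ennreal_mult[symmetric]) auto
    qed
    finally show ?thesis using True unfolding t_def[symmetric] \<rho>_def[symmetric] by simp
   qed simp
  qed
  also have "\<dots> = ennreal (?c * (1 - s) * (1 - s) * (2 ^ j) powr s) * (\<integral>\<^sup>+x z. ?N x z * \<Gamma> z)"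
   by (rule nn_integral_cmult) measurable
  also have "(\<integral>\<^sup>+x z. ?N x z * \<Gamma> z) = (\<integral>\<^sup>+z x. ?N x z * \<Gamma> z)"
   by (rule nn_integral_swap) measurable
  also have "\<dots> = (\<integral>\<^sup>+z. (\<integral>\<^sup>+x. ?N x z) * \<Gamma> z)"
   by (rule nn_integral_cong, rule nn_integral_multc) measurable
  also have "\<dots> \<le> (\<integral>\<^sup>+z. (ennreal (?L / 2 ^ j) * indicator \<Omega> z) * \<Gamma> z)"
   by (intro nn_integral_mono mult_right_mono layer_count) auto
  also have "\<dots> = (\<integral>\<^sup>+z. ennreal (?L / 2 ^ j) * (\<integral>\<^sup>+y. gagliardo s u z y * indicator \<Omega> z))"
  proof (rule nn_integral_cong)
   fix z
   have "(\<integral>\<^sup>+y. gagliardo s u z y * indicator \<Omega> z) = \<Gamma> z * indicator \<Omega> z"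
    unfolding \<Gamma>_def by (rule nn_integral_multc) measurable
   then show "(ennreal (?L / 2 ^ j) * indicator \<Omega> z) * \<Gamma> z = ennreal (?L / 2 ^ j) * (\<integral>\<^sup>+y. gagliardo s u z y * indicator \<Omega> z)"
    by (simp only: mult_ac)
  qed
  also have "\<dots> = ennreal (?L / 2 ^ j) * dom_energy s \<Omega> u"
   unfolding dom_energy_def by (rule nn_integral_cmult) measurable
  finally have "cross_energy s u j \<le> ennreal (?c * (1 - s) * (1 - s) * (2 ^ j) powr s) * (ennreal (?L / 2 ^ j) * dom_energy s \<Omega> u)"
   by (simp add: mult_left_mono)
  also have "\<dots> = (ennreal (?c * (1 - s) * (1 - s) * (2 ^ j) powr s) * ennreal (?L / 2 ^ j)) * dom_energy s \<Omega> u"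
   by (simp only: mult.assoc)
  also have "ennreal (?c * (1 - s) * (1 - s) * (2 ^ j) powr s) * ennreal (?L / 2 ^ j) = ennreal (cross_const * ((1 - s) * (2 ^ j) powr (- (1 - s)))) * ennreal (1 - s)"
  proof -
   have "((2::real) ^ j) powr (- (1 - s)) = (2 ^ j) powr s * (2 ^ j) powr (- 1)"
    unfolding powr_add[symmetric] by simp
   then have p: "((2::real) ^ j) powr (- (1 - s)) = (2 ^ j) powr s / 2 ^ j"
    by (simp add: powr_minus divide_inverse)
   have "?c * (1 - s) * (1 - s) * (2 ^ j) powr s * (?L / 2 ^ j) = cross_const * ((1 - s) * (2 ^ j) powr (- (1 - s))) * (1 - s)"
    unfolding p cross_const_def by (simp only: mult_ac times_divide_eq_right times_divide_eq_left)
   moreover have "0 \<le> ?L / 2 ^ j" using K M1 by simp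
   ultimately show ?thesis using s cross_const_pos by (simp only: ennreal_mult[symmetric] mult_nonneg_nonneg less_imp_le diff_ge_0_iff_ge powr_ge_zero zero_le_numeral)
  qed
  finally show ?thesis by (simp add: mult.assoc)
qed

text \<open>The gain \<open>2\<^sup>-\<^sup>s\<close> of each doubling makes the energies of all scales summable; this is where the
lower bound on \<open>s\<close> enters.\<close>

lemma scale_energy_sum:
  assumes ss: "0 < ss" "ss < 1"
  shows "\<exists>C>0. \<forall>s u. ss < s \<longrightarrow> s < 1 \<longrightarrow> u \<in> borel_measurable borel \<longrightarrow>
   (\<Sum>j. scale_energy s u j) \<le> ennreal C * (ennreal (1 - s) * dom_energy s \<Omega> u)"
proof -
  (* Young's parameter makes 2^(-s) (1 + \<eta>) at most 2^(-ss/2), uniformly in s > ss. *)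
  define \<eta> where "\<eta> = 2 powr (ss / 2) - 1"
  have "1 < 2 powr (ss / 2)" using ss powr_less_mono[of 0 "ss / 2" "2::real"] by simp
  then have \<eta>: "\<eta> > 0" by (simp add: \<eta>_def)
  define q where "q = 2 powr (- (ss / 2))"
  have q: "0 < q" "q < 1" using ss powr_less_mono[of "- (ss / 2)" 0 "2::real"] by (auto simp: q_def)
  define b where "b = (1 + 1 / \<eta>) / cone_vol"
  have b: "b > 0" using \<eta> cone_vol(2) by (simp add: b_def add_pos_pos)
  define C where "C = 1 / (1 - q) * (K powr (real DIM('a) + 2) + b * cross_const * 2)"
  have Kp: "K powr (real DIM('a) + 2) > 0" using K by simp
  have C: "C > 0" using q b cross_const_pos Kp by (simp add: C_def add_pos_pos)
  have "(\<Sum>j. scale_energy s u j) \<le> ennreal C * (ennreal (1 - s) * dom_energy s \<Omega> u)"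
   if s: "ss < s" "s < 1" and u [measurable]: "u \<in> borel_measurable borel" for s u
  proof -
   have s0: "0 < s" using s ss by simp
   let ?X = "ennreal (1 - s) * dom_energy s \<Omega> u"
   let ?r = "\<lambda>j. ennreal (b * cross_const) * (ennreal ((1 - s) * (2 ^ j) powr (- (1 - s))) * ?X)"
   have step: "scale_energy s u (Suc j) \<le> ennreal q * scale_energy s u j + ?r j" for j
   proof -
    have "2 powr (- s) * (1 + \<eta>) = 2 powr (ss / 2 - s)" by (simp add: \<eta>_def powr_add[symmetric])
    also have "\<dots> \<le> q" unfolding q_def using s by (intro powr_mono) auto
    finally have qq: "2 powr (- s) * (1 + \<eta>) \<le> q" .
    have "scale_energy s u (Suc j) \<le> ennreal (2 powr (- s) * (1 + \<eta>)) * scale_energy s u j + ennreal b * cross_energy s u j"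
     unfolding b_def by (rule scale_energy_Suc[OF u s0 s(2) \<eta>])
    also have "\<dots> \<le> ennreal q * scale_energy s u j + ennreal b * (ennreal (cross_const * ((1 - s) * (2 ^ j) powr (- (1 - s)))) * ?X)"
     by (intro add_mono mult_right_mono mult_left_mono ennreal_leI qq cross_energy_le u s0 s) auto
    also have "ennreal b * (ennreal (cross_const * ((1 - s) * (2 ^ j) powr (- (1 - s)))) * ?X) = ?r j"
    proof -
     have "ennreal b * ennreal (cross_const * ((1 - s) * (2 ^ j) powr (- (1 - s)))) = ennreal (b * cross_const) * ennreal ((1 - s) * (2 ^ j) powr (- (1 - s)))"
      using b cross_const_pos s by (subst (1 2) ennreal_mult[symmetric]) (auto simp: mult.assoc)
     then show ?thesis by (simp only: mult.assoc[symmetric])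
    qed
    finally show ?thesis .
   qed
   have "(\<Sum>j. ?r j) = ennreal (b * cross_const) * ((\<Sum>j. ennreal ((1 - s) * (2 ^ j) powr (- (1 - s)))) * ?X)"
    by (simp only: ennreal_suminf_cmult ennreal_suminf_multc)
   also have "\<dots> \<le> ennreal (b * cross_const) * (ennreal 2 * ?X)"
    using s s0 by (intro mult_left_mono mult_right_mono geometric_weight_sum) auto
   finally have rs: "(\<Sum>j. ?r j) \<le> ennreal (b * cross_const) * (ennreal 2 * ?X)" .
   have "(\<Sum>j. scale_energy s u j) \<le> ennreal (1 / (1 - q)) * (scale_energy s u 0 + (\<Sum>j. ?r j))"
    by (rule contraction_suminf[where r="?r" and q=q, OF less_imp_le[OF q(1)] q(2) step])
   also have "\<dots> \<le> ennreal (1 / (1 - q)) * (ennreal (K powr (real DIM('a) + 2)) * ?X + ennreal (b * cross_const) * (ennreal 2 * ?X))"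
    by (intro mult_left_mono add_mono scale_energy_0 u s0 s rs) auto
   also have "\<dots> = ennreal C * ?X"
   proof -
    have "ennreal (b * cross_const) * (ennreal 2 * ?X) = ennreal (b * cross_const * 2) * ?X"
     using b cross_const_pos by (subst ennreal_mult) (auto simp: mult.assoc)
    moreover have "ennreal (K powr (real DIM('a) + 2)) * ?X + ennreal (b * cross_const * 2) * ?X = ennreal (K powr (real DIM('a) + 2) + b * cross_const * 2) * ?X"
     using b cross_const_pos Kp by (subst ennreal_plus) (auto simp: distrib_right)
    moreover have "ennreal (1 / (1 - q)) * ennreal (K powr (real DIM('a) + 2) + b * cross_const * 2) = ennreal C"
     unfolding C_def using q b cross_const_pos Kp by (intro ennreal_mult[symmetric]) auto
    ultimately show ?thesis by (simp only: mult.assoc[symmetric])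
   qed
   finally show ?thesis .
  qed
  then show ?thesis by (intro exI[of _ C] conjI[OF C] allI impI)
qed

lemma le_suminf_ennreal:
  fixes f :: "nat \<Rightarrow> ennreal"
  shows "f k \<le> (\<Sum>i. f i)"
  using sum_le_suminf[OF summableI, of "{k}" f] by simp

text \<open>Both dilated cones contain the image of one fixed ball, over which the triangle inequality through a
common interior point is averaged.\<close>

lemma oscillation_pair:
  assumes [measurable]: "u \<in> borel_measurable borel" and \<rho>: "0 < \<rho>" "0 < \<rho>'" and d: "dist x y \<le> \<rho>'"
   and q: "\<rho>' \<le> 2 * \<rho>" "\<rho> \<le> 2 * \<rho>'"
  shows "ennreal (unit_ball_vol (real DIM('a))) * ennreal ((u x - u y)\<^sup>2) \<le>
   ennreal (2 * 2 ^ DIM('a)) * (oscillation u x \<rho> + oscillation u y \<rho>')"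
proof -
  let ?B = "cball ((6 * M + 7) *\<^sub>R e) 1"
  let ?q = "\<rho> / \<rho>'" and ?a = "(1 / \<rho>') *\<^sub>R (x - y)"
  let ?F = "\<lambda>w'. ennreal ((u y - u (y + \<rho>' *\<^sub>R w'))\<^sup>2) * indicator cone1 w'"
  have q': "1 / 2 \<le> ?q" "?q \<le> 2" using \<rho> q by (auto simp: field_simps)
  have na: "norm ?a \<le> 1" using d \<rho> by (simp add: dist_norm divide_le_eq)
  have shift_eq: "y + \<rho>' *\<^sub>R (?a + ?q *\<^sub>R w) = x + \<rho> *\<^sub>R w" for w
   using \<rho> by (simp add: scaleR_add_right)
  have inB: "w \<in> cone1 \<and> ?a + ?q *\<^sub>R w \<in> cone1" if "w \<in> ?B" for w
  proof -
   have w: "norm (w - (6 * M + 7) *\<^sub>R e) \<le> 1" using that by (simp add: dist_norm norm_minus_commute)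
   note ov = cone_overlap[OF M1 height_functionD(1)[OF hf] w]
   show ?thesis using ov[of 0 1] ov[OF na q'] by (simp add: K_def)
  qed
  have "ennreal (unit_ball_vol (real DIM('a))) * ennreal ((u x - u y)\<^sup>2) = (\<integral>\<^sup>+w. ennreal ((u x - u y)\<^sup>2) * indicator ?B w)"
   by (subst nn_integral_cmult_indicator) (auto simp: emeasure_cball mult.commute)
  also have "\<dots> \<le> (\<integral>\<^sup>+w. ennreal 2 * (ennreal ((u x - u (x + \<rho> *\<^sub>R w))\<^sup>2) * indicator cone1 w) + ennreal 2 * ?F (?a + ?q *\<^sub>R w))"
  proof (rule nn_integral_mono)
   fix w
   show "ennreal ((u x - u y)\<^sup>2) * indicator ?B w \<le> ennreal 2 * (ennreal ((u x - u (x + \<rho> *\<^sub>R w))\<^sup>2) * indicator cone1 w) + ennreal 2 * ?F (?a + ?q *\<^sub>R w)"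
   proof (cases "w \<in> ?B")
    case True
    have "(u x - u y)\<^sup>2 \<le> 2 * (u x - u (x + \<rho> *\<^sub>R w))\<^sup>2 + 2 * (u (x + \<rho> *\<^sub>R w) - u y)\<^sup>2"
     using sq_add_le[of 1 "u x - u (x + \<rho> *\<^sub>R w)" "u (x + \<rho> *\<^sub>R w) - u y"] by simp
    then have "ennreal ((u x - u y)\<^sup>2) \<le> ennreal (2 * (u x - u (x + \<rho> *\<^sub>R w))\<^sup>2 + 2 * (u y - u (x + \<rho> *\<^sub>R w))\<^sup>2)"
     by (intro ennreal_leI) (simp add: power2_commute)
    also have "\<dots> = ennreal 2 * ennreal ((u x - u (x + \<rho> *\<^sub>R w))\<^sup>2) + ennreal 2 * ennreal ((u y - u (x + \<rho> *\<^sub>R w))\<^sup>2)"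
     by (subst ennreal_plus) (auto simp: ennreal_mult)
    finally show ?thesis using True inB[OF True] unfolding shift_eq by simp
   qed simp
  qed
  also have "\<dots> = ennreal 2 * oscillation u x \<rho> + ennreal 2 * (\<integral>\<^sup>+w. ?F (?a + ?q *\<^sub>R w))"
   unfolding oscillation_def by (subst nn_integral_add) (simp_all add: nn_integral_cmult)
  also have "\<dots> \<le> ennreal 2 * (ennreal (2 ^ DIM('a)) * oscillation u x \<rho>) + ennreal 2 * (ennreal (2 ^ DIM('a)) * oscillation u y \<rho>')"
  proof (intro add_mono mult_left_mono)
   have one: "1 \<le> ennreal (2 ^ DIM('a))" by (simp add: ennreal_ge_1)
   show "oscillation u x \<rho> \<le> ennreal (2 ^ DIM('a)) * oscillation u x \<rho>"
    using mult_right_mono[OF one, of "oscillation u x \<rho>"] by simp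
   have osc: "oscillation u y \<rho>' = ennreal (?q ^ DIM('a)) * (\<integral>\<^sup>+w. ?F (?a + ?q *\<^sub>R w))"
    unfolding oscillation_def using \<rho> by (intro nn_integral_lborel_dilate) auto
   have "1 \<le> 2 * ?q" using q' by linarith
   then have "1 \<le> (2 * ?q) ^ DIM('a)" by (rule one_le_power)
   then have one_q: "1 \<le> 2 ^ DIM('a) * ?q ^ DIM('a)" unfolding power_mult_distrib .
   have "0 \<le> ?q ^ DIM('a)" using \<rho> by simp
   then have "ennreal (2 ^ DIM('a)) * ennreal (?q ^ DIM('a)) = ennreal (2 ^ DIM('a) * ?q ^ DIM('a))"
    by (intro ennreal_mult[symmetric]) auto
   moreover have "1 \<le> ennreal (2 ^ DIM('a) * ?q ^ DIM('a))" using one_q unfolding ennreal_ge_1 .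
   ultimately have "1 \<le> ennreal (2 ^ DIM('a)) * ennreal (?q ^ DIM('a))" by (simp only:)
   from mult_right_mono[OF this, of "\<integral>\<^sup>+w. ?F (?a + ?q *\<^sub>R w)"]
   show "(\<integral>\<^sup>+w. ?F (?a + ?q *\<^sub>R w)) \<le> ennreal (2 ^ DIM('a)) * oscillation u y \<rho>'"
    unfolding osc by (simp add: mult.assoc)
  qed auto
  also have "\<dots> = ennreal (2 * 2 ^ DIM('a)) * (oscillation u x \<rho> + oscillation u y \<rho>')"
   by (subst ennreal_mult) (auto simp: distrib_left mult.assoc)
  finally show ?thesis .
qed

text \<open>So small that the scale that matches a pair of points does not exceed \<open>top_scale\<close>.\<close>

definition "near_radius = top_scale / (8 * M)"

definition near :: "'a set" where
  "near = {x \<in> cball z0 near_radius. h x < 0}"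

definition pair_dist :: "'a \<Rightarrow> 'a \<Rightarrow> real" where
  "pair_dist x y = dist x y + (- h x) + (- h y)"

lemma near_radius: "0 < near_radius" "near_radius \<le> R / 2" "near_radius \<le> 1" "M * near_radius = top_scale / 8"
proof -
  show "0 < near_radius" "M * near_radius = top_scale / 8" using top_scale M1 by (auto simp: near_radius_def)
  have "near_radius \<le> top_scale / 1" unfolding near_radius_def using M1 top_scale by (intro divide_left_mono) auto
  moreover have "top_scale \<le> R / 2"
   using top_scale(3) mult_right_mono[of 1 "2 * K" top_scale] K top_scale(1) by linarith
  ultimately show "near_radius \<le> R / 2" "near_radius \<le> 1" using top_scale(2) by linarith+
qed

lemma near_measurable [measurable]: "near \<in> sets borel"
proof -
  have "near = cball z0 near_radius \<inter> {x \<in> space borel. h x < 0}" by (auto simp: near_def)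
  also have "\<dots> \<in> sets borel"
  proof (rule sets.Int)
   show "{x \<in> space borel. h x < 0} \<in> sets borel" by measurable
  qed simp
  finally show ?thesis .
qed

lemma near_height:
  assumes "x \<in> near"
  shows "0 < - h x" "- h x \<le> top_scale / 8" "x \<in> cball z0 (R / 2)" "dist z0 x \<le> near_radius"
proof -
  show "0 < - h x" "dist z0 x \<le> near_radius" using assms by (auto simp: near_def)
  then show "x \<in> cball z0 (R / 2)" using near_radius by simp
  have "- h x \<le> M * dist x z0" using height_functionD(2)[OF hf, of x z0] h0 by simp
  also have "\<dots> \<le> M * near_radius" using assms M1 by (intro mult_left_mono) (auto simp: near_def dist_commute)
  finally show "- h x \<le> top_scale / 8" using near_radius by simp
qed

lemma near_pair_dist:
  assumes "x \<in> near" "y \<in> near"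
  shows "pair_dist x y \<le> top_scale / 2" "- h x < pair_dist x y" "- h y < pair_dist x y" "dist x y < pair_dist x y"
proof -
  note X = near_height[OF assms(1)] and Y = near_height[OF assms(2)]
  have "dist x y \<le> dist z0 x + dist z0 y" by (rule dist_triangle3)
  moreover have "near_radius \<le> M * near_radius" using mult_right_mono[OF M1, of near_radius] near_radius(1) by simp
  ultimately show "pair_dist x y \<le> top_scale / 2"
   unfolding pair_dist_def using X Y near_radius(4) by linarith
  show "- h x < pair_dist x y" "- h y < pair_dist x y" "dist x y < pair_dist x y"
   unfolding pair_dist_def using X Y zero_le_dist[of x y] by linarith+
qed

definition scale_match :: "nat \<Rightarrow> 'a \<Rightarrow> 'a \<Rightarrow> ennreal" where
  "scale_match i x y = (if pair_dist x y < 2 ^ i * (- h x) \<and> 2 ^ i * (- h x) \<le> 2 * pair_dist x y then 1 else 0)"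

definition pair_weight :: "real \<Rightarrow> 'a \<Rightarrow> 'a \<Rightarrow> ennreal" where
  "pair_weight s x y = ennreal ((1 - s)\<^sup>2 * (- h x) powr (- s) * (- h y) powr (- s) * pair_dist x y powr (- real DIM('a))) *
   (indicator near x * indicator near y)"

lemma pair_dist_sym: "pair_dist x y = pair_dist y x"
  by (simp add: pair_dist_def dist_commute)

lemma pair_weight_sym: "pair_weight s x y = pair_weight s y x"
  by (simp add: pair_weight_def pair_dist_sym[of x y] mult_ac)

lemma scale_match_measurable [measurable]:
  assumes [measurable]: "f \<in> borel_measurable N" "g \<in> borel_measurable N"
  shows "(\<lambda>x. scale_match i (f x) (g x)) \<in> borel_measurable N"
  unfolding scale_match_def pair_dist_def by measurable

lemma pair_weight_measurable [measurable]:
  assumes [measurable]: "f \<in> borel_measurable N" "g \<in> borel_measurable N"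
  shows "(\<lambda>x. pair_weight s (f x) (g x)) \<in> borel_measurable N"
  unfolding pair_weight_def pair_dist_def by measurable

definition "weight_const = 2 ^ DIM('a) * (unit_ball_vol (real DIM('a)) * 2 ^ DIM('a)) * 2"

lemma weight_const_pos: "weight_const > 0"
  by (simp add: weight_const_def)

text \<open>For fixed \<open>x\<close> the matching points \<open>y\<close> lie in a ball of radius \<open>\<rho> = 2 ^ i * (- h x)\<close>, and the layer
integral of the depth of \<open>y\<close> to the power \<open>- s\<close> yields \<open>\<rho>\<^sup>d\<^sup>-\<^sup>s / (1 - s)\<close>.\<close>

lemma pair_weight_match:
  assumes s: "0 < s" "s < 1"
  shows "(\<integral>\<^sup>+y. pair_weight s x y * scale_match i x y) \<le>
   ennreal weight_const * (ennreal ((1 - s) * (- h x) powr (- s) * (2 ^ i * (- h x)) powr (- s)) * indicator (level i) x)"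
proof (cases "\<exists>y. pair_weight s x y * scale_match i x y \<noteq> 0")
  case False
  then have z: "pair_weight s x y * scale_match i x y = 0" for y by blast
  show ?thesis unfolding z by simp
next
  case True
  then obtain y0 where "pair_weight s x y0 * scale_match i x y0 \<noteq> 0" by blast
  then have y0: "x \<in> near" "y0 \<in> near" "2 ^ i * (- h x) \<le> 2 * pair_dist x y0"
   by (auto simp: pair_weight_def scale_match_def indicator_def split: if_splits)
  let ?d = "real DIM('a)"
  define t where "t = - h x"
  define \<rho> where "\<rho> = 2 ^ i * t"
  note X = near_height[OF y0(1)]
  have t: "0 < t" using X by (simp add: t_def)
  have \<rho>: "0 < \<rho>" unfolding \<rho>_def using t by (intro mult_pos_pos) auto
  have "\<rho> \<le> top_scale" using y0(3) near_pair_dist(1)[OF y0(1,2)] by (simp add: \<rho>_def t_def)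
  then have lev: "x \<in> level i" using X by (simp add: level_def \<rho>_def t_def)
  let ?A = "(1 - s)\<^sup>2 * t powr (- s) * (2 powr ?d * \<rho> powr (- ?d))"
  let ?f = "\<lambda>\<sigma>. ennreal (\<bar>\<sigma>\<bar> powr ((1 - s) - 1)) * indicator {-\<rho>..\<rho>} \<sigma>"
  have "(\<integral>\<^sup>+y. pair_weight s x y * scale_match i x y) \<le> (\<integral>\<^sup>+y. (ennreal ?A * ?f (h y)) * indicator (cball x \<rho>) y)"
  proof (rule nn_integral_mono)
   fix y
   show "pair_weight s x y * scale_match i x y \<le> (ennreal ?A * ?f (h y)) * indicator (cball x \<rho>) y"
   proof (cases "pair_weight s x y * scale_match i x y = 0")
    case False
    then have y: "y \<in> near" "pair_dist x y < \<rho>" "\<rho> \<le> 2 * pair_dist x y"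
     by (auto simp: pair_weight_def scale_match_def indicator_def \<rho>_def t_def split: if_splits)
    note Y = near_height[OF y(1)] and P = near_pair_dist[OF y0(1) y(1)]
    have "pair_dist x y powr (- ?d) \<le> 2 powr ?d * \<rho> powr (- ?d)"
     using y \<rho> by (intro powr_neg_le_scaled) auto
    then have "(1 - s)\<^sup>2 * t powr (- s) * (- h y) powr (- s) * pair_dist x y powr (- ?d) \<le>
     (1 - s)\<^sup>2 * t powr (- s) * (- h y) powr (- s) * (2 powr ?d * \<rho> powr (- ?d))"
     by (intro mult_left_mono) auto
    also have "\<dots> = ?A * \<bar>h y\<bar> powr (- s)" using Y(1) by (simp add: mult_ac)
    finally have "ennreal ((1 - s)\<^sup>2 * t powr (- s) * (- h y) powr (- s) * pair_dist x y powr (- ?d)) \<le> ennreal ?A * ennreal (\<bar>h y\<bar> powr (- s))"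
     by (subst ennreal_mult[symmetric]) (auto intro: ennreal_leI)
    moreover have "h y \<in> {-\<rho>..\<rho>}" "y \<in> cball x \<rho>" using P y Y by auto
    ultimately show ?thesis using y y0
     by (simp add: pair_weight_def scale_match_def \<rho>_def[symmetric] t_def[symmetric])
   next
    case True
    show ?thesis unfolding True by (rule zero_le)
   qed
  qed
  also have "\<dots> \<le> ennreal (unit_ball_vol ?d * 2 ^ DIM('a) * \<rho> powr (?d - 1)) * (\<integral>\<^sup>+\<sigma>. ennreal ?A * ?f \<sigma>)"
   by (rule layer_upper[OF hf _ \<rho>]) measurable
  also have "(\<integral>\<^sup>+\<sigma>. ennreal ?A * ?f \<sigma>) = ennreal ?A * ennreal (2 * (\<rho> powr (1 - s) / (1 - s)))"
   using s \<rho> nn_integral_abs_powr_near[of "1 - s" \<rho>] by (subst nn_integral_cmult) simp_all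
  also have "ennreal (unit_ball_vol ?d * 2 ^ DIM('a) * \<rho> powr (?d - 1)) * (ennreal ?A * ennreal (2 * (\<rho> powr (1 - s) / (1 - s)))) =
   ennreal (unit_ball_vol ?d * 2 ^ DIM('a) * \<rho> powr (?d - 1) * (?A * (2 * (\<rho> powr (1 - s) / (1 - s)))))"
   by (rule ennreal_mult_assoc3) (use s in auto)
  also have "unit_ball_vol ?d * 2 ^ DIM('a) * \<rho> powr (?d - 1) * (?A * (2 * (\<rho> powr (1 - s) / (1 - s)))) =
   weight_const * ((1 - s) * t powr (- s) * \<rho> powr (- s))"
  proof -
   have e1: "\<rho> powr (?d - 1) * (\<rho> powr (- ?d) * \<rho> powr (1 - s)) = \<rho> powr (- s)"
    unfolding powr_add[symmetric] by simp
   have e2: "(2::real) powr ?d = 2 ^ DIM('a)" by (simp add: powr_realpow)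
   have "V * T * P * ((1 - s)\<^sup>2 * X * (T' * Q) * (2 * (Z / (1 - s)))) = (T' * (V * T) * 2) * ((1 - s) * X * (P * (Q * Z)))" for V T P X T' Q Z :: real
    using s by (simp add: power2_eq_square)
   then show ?thesis unfolding weight_const_def e1[symmetric] e2 .
  qed
  finally show ?thesis using lev s weight_const_pos
   unfolding t_def[symmetric] \<rho>_def[symmetric] by (simp add: ennreal_mult)
qed

text \<open>Each of the two points is compared with the interior at its own dyadic scale next to the distance of
the pair; by symmetry it suffices to integrate one of the two contributions.\<close>

lemma near_pair_energy:
  assumes [measurable]: "u \<in> borel_measurable borel" and s: "0 < s" "s < 1"
  shows "(\<integral>\<^sup>+x y. pair_weight s x y * ennreal ((u x - u y)\<^sup>2)) \<le>
   ennreal (2 * (2 * 2 ^ DIM('a)) * weight_const / unit_ball_vol (real DIM('a))) * (\<Sum>i. scale_energy s u i)"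
proof -
  let ?w = "unit_ball_vol (real DIM('a))"
  let ?c = "2 * 2 ^ DIM('a) :: real"
  define T where "T x y = (\<Sum>i. oscillation u x (2 ^ i * (- h x)) * scale_match i x y)" for x y
  have [measurable]: "(\<lambda>w. T (f w) (g w)) \<in> borel_measurable N"
   if [measurable]: "f \<in> borel_measurable N" "g \<in> borel_measurable N" for f g and N :: "'z measure"
  proof -
   have [measurable]: "(\<lambda>w. oscillation u (f w) (2 ^ i * (- h (f w)))) \<in> borel_measurable N" for i
    using measurable_compose[OF that(1) oscillation_measurable[OF assms(1), of "\<lambda>x. 2 ^ i * (- h x)"]] by simp
   show ?thesis unfolding T_def by measurable
  qed
  have pt: "ennreal ?w * (pair_weight s x y * ennreal ((u x - u y)\<^sup>2)) \<le> ennreal ?c * (pair_weight s x y * T x y + pair_weight s y x * T y x)" for x y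
  proof (cases "x \<in> near \<and> y \<in> near")
   case True
   then have xy: "x \<in> near" "y \<in> near" by auto
   note P = near_pair_dist[OF xy] and X = near_height[OF xy(1)] and Y = near_height[OF xy(2)]
   obtain i where i: "pair_dist x y < 2 ^ i * (- h x)" "2 ^ i * (- h x) \<le> 2 * pair_dist x y"
    using dyadic_above[of "- h x" "pair_dist x y"] X P by auto
   obtain j where j: "pair_dist x y < 2 ^ j * (- h y)" "2 ^ j * (- h y) \<le> 2 * pair_dist x y"
    using dyadic_above[of "- h y" "pair_dist x y"] Y P by auto
   have "ennreal ?w * ennreal ((u x - u y)\<^sup>2) \<le> ennreal ?c * (oscillation u x (2 ^ i * (- h x)) + oscillation u y (2 ^ j * (- h y)))"
    by (rule oscillation_pair) (use i j X Y P zero_le_dist[of x y] in \<open>auto intro: mult_pos_neg\<close>)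
   also have "\<dots> \<le> ennreal ?c * (T x y + T y x)"
   proof (intro mult_left_mono add_mono)
    note one = le_suminf_ennreal
    show "oscillation u x (2 ^ i * (- h x)) \<le> T x y"
     using one[of "\<lambda>i. oscillation u x (2 ^ i * (- h x)) * scale_match i x y" i] i
     unfolding T_def by (simp add: scale_match_def)
    show "oscillation u y (2 ^ j * (- h y)) \<le> T y x"
     using one[of "\<lambda>i. oscillation u y (2 ^ i * (- h y)) * scale_match i y x" j] j
     unfolding T_def by (simp add: scale_match_def pair_dist_sym[of y x])
   qed simp
   finally have "pair_weight s x y * (ennreal ?w * ennreal ((u x - u y)\<^sup>2)) \<le> pair_weight s x y * (ennreal ?c * (T x y + T y x))"
    by (intro mult_left_mono) auto
   then show ?thesis unfolding pair_weight_sym[of s y x] by (simp only: distrib_left distrib_right mult_ac)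
  next
   case False
   then have "pair_weight s x y = 0" by (auto simp: pair_weight_def)
   then show ?thesis by simp
  qed
  let ?S = "\<integral>\<^sup>+x y. pair_weight s x y * T x y"
  have S: "?S \<le> ennreal weight_const * (\<Sum>i. scale_energy s u i)"
  proof -
   have "?S = (\<integral>\<^sup>+x. (\<Sum>i. \<integral>\<^sup>+y. oscillation u x (2 ^ i * (- h x)) * (pair_weight s x y * scale_match i x y)))"
   proof (rule nn_integral_cong)
    fix x
    have "pair_weight s x y * T x y = (\<Sum>i. oscillation u x (2 ^ i * (- h x)) * (pair_weight s x y * scale_match i x y))" for y
     unfolding T_def ennreal_suminf_cmult[symmetric] by (simp only: mult_ac)
    then have "(\<integral>\<^sup>+y. pair_weight s x y * T x y) = (\<integral>\<^sup>+y. (\<Sum>i. oscillation u x (2 ^ i * (- h x)) * (pair_weight s x y * scale_match i x y)))"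
     by (simp only:)
    also have "\<dots> = (\<Sum>i. \<integral>\<^sup>+y. oscillation u x (2 ^ i * (- h x)) * (pair_weight s x y * scale_match i x y))"
     by (rule nn_integral_suminf) measurable
    finally show "(\<integral>\<^sup>+y. pair_weight s x y * T x y) = \<dots>" .
   qed
   also have "\<dots> \<le> (\<integral>\<^sup>+x. (\<Sum>i. ennreal weight_const * (ennreal ((1 - s) * (- h x) powr (- s) * (2 ^ i * (- h x)) powr (- s)) *
     oscillation u x (2 ^ i * (- h x)) * indicator (level i) x)))"
   proof (rule nn_integral_mono, rule suminf_le[OF _ summableI summableI])
    fix x i
    have "(\<integral>\<^sup>+y. oscillation u x (2 ^ i * (- h x)) * (pair_weight s x y * scale_match i x y)) =
     oscillation u x (2 ^ i * (- h x)) * (\<integral>\<^sup>+y. pair_weight s x y * scale_match i x y)"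
     by (rule nn_integral_cmult) measurable
    also have "\<dots> \<le> oscillation u x (2 ^ i * (- h x)) * (ennreal weight_const * (ennreal ((1 - s) * (- h x) powr (- s) * (2 ^ i * (- h x)) powr (- s)) * indicator (level i) x))"
     by (intro mult_left_mono pair_weight_match s) simp
    finally show "(\<integral>\<^sup>+y. oscillation u x (2 ^ i * (- h x)) * (pair_weight s x y * scale_match i x y)) \<le>
     ennreal weight_const * (ennreal ((1 - s) * (- h x) powr (- s) * (2 ^ i * (- h x)) powr (- s)) * oscillation u x (2 ^ i * (- h x)) * indicator (level i) x)"
     by (simp only: mult_ac)
   qed
   also have "\<dots> = (\<Sum>i. \<integral>\<^sup>+x. ennreal weight_const * (ennreal ((1 - s) * (- h x) powr (- s) * (2 ^ i * (- h x)) powr (- s)) *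
     oscillation u x (2 ^ i * (- h x)) * indicator (level i) x))"
    by (rule nn_integral_suminf) measurable
   also have "\<dots> = (\<Sum>i. ennreal weight_const * scale_energy s u i)"
    unfolding scale_energy_def by (subst nn_integral_cmult) auto
   also have "\<dots> = ennreal weight_const * (\<Sum>i. scale_energy s u i)" by (rule ennreal_suminf_cmult)
   finally show ?thesis .
  qed
  have "ennreal ?w * (\<integral>\<^sup>+x y. pair_weight s x y * ennreal ((u x - u y)\<^sup>2)) =
   (\<integral>\<^sup>+x y. ennreal ?w * (pair_weight s x y * ennreal ((u x - u y)\<^sup>2)))"
   by (simp add: nn_integral_cmult)
  also have "\<dots> \<le> (\<integral>\<^sup>+x y. ennreal ?c * (pair_weight s x y * T x y + pair_weight s y x * T y x))"
   by (intro nn_integral_mono pt)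
  also have "\<dots> = ennreal ?c * (?S + (\<integral>\<^sup>+x y. pair_weight s y x * T y x))"
   by (simp add: nn_integral_cmult nn_integral_add)
  also have "(\<integral>\<^sup>+x y. pair_weight s y x * T y x) = ?S"
   by (rule nn_integral_swap) measurable
  also have "ennreal ?c * (?S + ?S) \<le> ennreal ?c * (ennreal weight_const * (\<Sum>i. scale_energy s u i) + ennreal weight_const * (\<Sum>i. scale_energy s u i))"
   by (intro mult_left_mono add_mono S) auto
  also have "\<dots> = (\<Sum>i. scale_energy s u i) * ennreal (?w * (2 * ?c * weight_const / ?w))"
  proof -
   have "ennreal (?w * (2 * ?c * weight_const / ?w)) = ennreal ?c * (ennreal weight_const + ennreal weight_const)"
   proof -
    have w0: "?w > 0" by (rule unit_ball_vol_pos) simp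
    have "w * (X / w) = X" if "w > 0" for w X :: real using that by simp
    from this[OF w0] have "?w * (2 * ?c * weight_const / ?w) = 2 * ?c * weight_const" .
    also have "\<dots> = ?c * (weight_const + weight_const)" by simp
    also have "ennreal \<dots> = ennreal ?c * ennreal (weight_const + weight_const)"
     using weight_const_pos by (intro ennreal_mult) auto
    also have "ennreal (weight_const + weight_const) = ennreal weight_const + ennreal weight_const"
     using weight_const_pos by (intro ennreal_plus) auto
    finally show ?thesis .
   qed
   then show ?thesis by (simp only: distrib_left distrib_right mult_ac)
  qed
  finally have fin: "ennreal ?w * (\<integral>\<^sup>+x y. pair_weight s x y * ennreal ((u x - u y)\<^sup>2)) \<le> (\<Sum>i. scale_energy s u i) * ennreal (?w * (2 * ?c * weight_const / ?w))" .
  show ?thesis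
  proof (rule ennreal_cancel_le(1)[OF _ _ fin])
   show "0 < ?w" by (rule unit_ball_vol_pos) simp
   show "0 \<le> 2 * ?c * weight_const / ?w" using weight_const_pos by simp
  qed
qed

text \<open>At the top scale the cone over \<open>x\<close> has volume bounded below, so \<open>u x\<close> differs from a mean of \<open>u\<close> over
a part of the domain by the oscillation at one admissible scale.\<close>

lemma near_trace_mass:
  "\<exists>C>0. \<forall>s u. 0 < s \<longrightarrow> s < 1 \<longrightarrow> u \<in> borel_measurable borel \<longrightarrow>
   (\<integral>\<^sup>+x. ennreal ((1 - s) * (- h x) powr (- s)) * ennreal ((u x)\<^sup>2) * indicator near x) \<le>
   ennreal C * ((\<Sum>i. scale_energy s u i) + (\<integral>\<^sup>+x. ennreal ((u x)\<^sup>2) * indicator \<Omega> x))"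
proof -
  let ?d = "real DIM('a)"
  define c1 where "c1 = 2 / cone_vol"
  define c2 where "c2 = c1 * (top_scale / 2) powr (- ?d)"
  define c3 where "c3 = unit_ball_vol ?d * 2 ^ DIM('a) * 2"
  have c: "c1 > 0" "c2 > 0" "c3 > 0" using cone_vol(2) top_scale by (auto simp: c1_def c2_def c3_def)
  define C where "C = c1 + c2 * c3"
  have C: "C > 0" using c by (simp add: C_def add_pos_pos)
  have "(\<integral>\<^sup>+x. ennreal ((1 - s) * (- h x) powr (- s)) * ennreal ((u x)\<^sup>2) * indicator near x) \<le>
   ennreal C * ((\<Sum>i. scale_energy s u i) + (\<integral>\<^sup>+x. ennreal ((u x)\<^sup>2) * indicator \<Omega> x))"
   if s: "0 < s" "s < 1" and [measurable]: "u \<in> borel_measurable borel" for s u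
  proof -
   let ?L = "\<integral>\<^sup>+x. ennreal ((u x)\<^sup>2) * indicator \<Omega> x"
   let ?S = "\<Sum>i. scale_energy s u i"
   let ?g = "\<lambda>i x. ennreal ((1 - s) * (- h x) powr (- s) * (2 ^ i * (- h x)) powr (- s)) * oscillation u x (2 ^ i * (- h x)) * indicator (level i) x"
   let ?W = "\<lambda>x. ennreal ((1 - s) * (- h x) powr (- s))"
   have pt: "?W x * ennreal ((u x)\<^sup>2) * indicator near x \<le> ennreal c1 * (\<Sum>i. ?g i x) + ennreal c2 * (?L * (?W x * indicator near x))" for x
   proof (cases "x \<in> near")
    case True
    note X = near_height[OF True]
    (* The scale of x closest to the top scale. *)
    obtain i where i: "top_scale / 2 < 2 ^ i * (- h x)" "2 ^ i * (- h x) \<le> top_scale"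
     using dyadic_above[of "- h x" "top_scale / 2"] X top_scale by auto
    define \<rho> where "\<rho> = 2 ^ i * (- h x)"
    have \<rho>: "0 < \<rho>" "\<rho> \<le> top_scale" "top_scale / 2 < \<rho>" using i top_scale by (auto simp: \<rho>_def)
    have "(- h x) * 1 \<le> (- h x) * 2 ^ i" using X(1) by (intro mult_left_mono) auto
    then have hr: "- \<rho> \<le> h x" by (simp add: \<rho>_def mult.commute)
    have "ennreal cone_vol * ennreal ((u x)\<^sup>2) = (\<integral>\<^sup>+w. ennreal ((u x)\<^sup>2) * indicator cone1 w)"
     by (subst nn_integral_cmult_indicator) (simp_all add: cone_vol mult.commute)
    also have "\<dots> \<le> (\<integral>\<^sup>+w. ennreal 2 * (ennreal ((u x - u (x + \<rho> *\<^sub>R w))\<^sup>2) * indicator cone1 w) +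
      ennreal 2 * ((ennreal ((u (x + \<rho> *\<^sub>R w))\<^sup>2) * indicator \<Omega> (x + \<rho> *\<^sub>R w)) * indicator cone1 w))"
    proof (rule nn_integral_mono)
     fix w
     show "ennreal ((u x)\<^sup>2) * indicator cone1 w \<le> ennreal 2 * (ennreal ((u x - u (x + \<rho> *\<^sub>R w))\<^sup>2) * indicator cone1 w) +
      ennreal 2 * ((ennreal ((u (x + \<rho> *\<^sub>R w))\<^sup>2) * indicator \<Omega> (x + \<rho> *\<^sub>R w)) * indicator cone1 w)"
     proof (cases "w \<in> cone1")
      case True
      then have "w \<in> cone2" using cone_mono[of K "2 * K" M e] K by auto
      then have inO: "x + \<rho> *\<^sub>R w \<in> \<Omega>" by (rule cone_in_dom(1)[OF X(3) hr \<rho>(1,2)])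
      have "(u x)\<^sup>2 \<le> 2 * (u x - u (x + \<rho> *\<^sub>R w))\<^sup>2 + 2 * (u (x + \<rho> *\<^sub>R w))\<^sup>2"
       using sq_add_le[of 1 "u x - u (x + \<rho> *\<^sub>R w)" "u (x + \<rho> *\<^sub>R w)"] by simp
      then have "ennreal ((u x)\<^sup>2) \<le> ennreal (2 * (u x - u (x + \<rho> *\<^sub>R w))\<^sup>2 + 2 * (u (x + \<rho> *\<^sub>R w))\<^sup>2)" by (rule ennreal_leI)
      also have "\<dots> = ennreal 2 * ennreal ((u x - u (x + \<rho> *\<^sub>R w))\<^sup>2) + ennreal 2 * ennreal ((u (x + \<rho> *\<^sub>R w))\<^sup>2)"
       by (subst ennreal_plus) (auto simp: ennreal_mult)
      finally show ?thesis using True inO by simp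
     qed simp
    qed
    also have "\<dots> = ennreal 2 * oscillation u x \<rho> + ennreal 2 * (\<integral>\<^sup>+w. (ennreal ((u (x + \<rho> *\<^sub>R w))\<^sup>2) * indicator \<Omega> (x + \<rho> *\<^sub>R w)) * indicator cone1 w)"
     unfolding oscillation_def by (subst nn_integral_add) (simp_all add: nn_integral_cmult)
    also have "\<dots> \<le> ennreal 2 * oscillation u x \<rho> + ennreal 2 * (ennreal ((top_scale / 2) powr (- ?d)) * ?L)"
    proof (intro add_left_mono mult_left_mono)
     have "(\<integral>\<^sup>+w. (ennreal ((u (x + \<rho> *\<^sub>R w))\<^sup>2) * indicator \<Omega> (x + \<rho> *\<^sub>R w)) * indicator cone1 w) \<le> ennreal (\<rho> powr (- ?d)) * ?L"
      by (rule cone_translate_integral[OF _ \<rho>(1)]) measurable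
     also have "\<dots> \<le> ennreal ((top_scale / 2) powr (- ?d)) * ?L"
      using \<rho> top_scale by (intro mult_right_mono ennreal_leI powr_neg_antimono) auto
     finally show "(\<integral>\<^sup>+w. (ennreal ((u (x + \<rho> *\<^sub>R w))\<^sup>2) * indicator \<Omega> (x + \<rho> *\<^sub>R w)) * indicator cone1 w) \<le> \<dots>" .
    qed simp
    also have "\<dots> = (ennreal c1 * oscillation u x \<rho> + ennreal c2 * ?L) * ennreal (cone_vol * 1)"
    proof -
     have v1: "ennreal c1 * ennreal cone_vol = ennreal 2"
      using cone_vol(2) c by (subst ennreal_mult[symmetric]) (auto simp: c1_def)
     have "c2 * cone_vol = 2 * (top_scale / 2) powr (- ?d)" using cone_vol(2) by (simp add: c2_def c1_def)
     then have v2: "ennreal c2 * ennreal cone_vol = ennreal 2 * ennreal ((top_scale / 2) powr (- ?d))"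
      using cone_vol(2) c ennreal_mult[of c2 cone_vol] ennreal_mult[of 2 "(top_scale / 2) powr (- ?d)"] by simp
     have "(ennreal c1 * oscillation u x \<rho> + ennreal c2 * ?L) * ennreal cone_vol = (ennreal c1 * ennreal cone_vol) * oscillation u x \<rho> + (ennreal c2 * ennreal cone_vol) * ?L"
      by (simp only: distrib_left distrib_right mult_ac)
     then show ?thesis unfolding v1 v2 by (simp add: mult.assoc)
    qed
    finally have "ennreal ((u x)\<^sup>2) \<le> ennreal 1 * (ennreal c1 * oscillation u x \<rho> + ennreal c2 * ?L)"
     using cone_vol(2) by (intro ennreal_cancel_le(1)[of cone_vol 1]) auto
    then have le: "?W x * ennreal ((u x)\<^sup>2) \<le> ?W x * (ennreal c1 * oscillation u x \<rho> + ennreal c2 * ?L)"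
     by (intro mult_left_mono) auto
    have "?W x * oscillation u x \<rho> \<le> ?g i x"
    proof -
     have "1 powr (- s) \<le> \<rho> powr (- s)" using \<rho> top_scale s by (intro powr_neg_antimono) auto
     then have "(1 - s) * (- h x) powr (- s) * 1 \<le> (1 - s) * (- h x) powr (- s) * \<rho> powr (- s)"
      using s by (intro mult_left_mono) auto
     then have "?W x * oscillation u x \<rho> \<le> ennreal ((1 - s) * (- h x) powr (- s) * \<rho> powr (- s)) * oscillation u x \<rho>"
      by (intro mult_right_mono ennreal_leI) auto
     moreover have "x \<in> level i" using X \<rho> by (simp add: level_def \<rho>_def)
     ultimately show ?thesis by (simp add: \<rho>_def)
    qed
    also have "?g i x \<le> (\<Sum>i. ?g i x)" by (rule le_suminf_ennreal)
    finally have osc: "?W x * oscillation u x \<rho> \<le> (\<Sum>i. ?g i x)" .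
    have "?W x * (ennreal c1 * oscillation u x \<rho> + ennreal c2 * ?L) = ennreal c1 * (?W x * oscillation u x \<rho>) + ennreal c2 * (?L * ?W x)"
     by (simp only: distrib_left mult_ac)
    also have "\<dots> \<le> ennreal c1 * (\<Sum>i. ?g i x) + ennreal c2 * (?L * ?W x)"
     by (intro add_right_mono mult_left_mono osc) simp
    finally show ?thesis using le True by simp
   qed simp
   have w: "(\<integral>\<^sup>+x. ?W x * indicator near x) \<le> ennreal c3"
   proof -
    let ?f = "\<lambda>\<sigma>. ennreal (1 - s) * (ennreal (\<bar>\<sigma>\<bar> powr ((1 - s) - 1)) * indicator {-1..1} \<sigma>)"
    have "(\<integral>\<^sup>+x. ?W x * indicator near x) \<le> (\<integral>\<^sup>+x. ?f (h x) * indicator (cball z0 near_radius) x)"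
    proof (rule nn_integral_mono)
     fix x
     show "?W x * indicator near x \<le> ?f (h x) * indicator (cball z0 near_radius) x"
     proof (cases "x \<in> near")
      case True
      note X = near_height[OF True]
      have "h x \<in> {-1..1}" using X top_scale by auto
      then show ?thesis using X s True by (simp add: ennreal_mult near_def)
     qed simp
    qed
    also have "\<dots> \<le> ennreal (unit_ball_vol ?d * 2 ^ DIM('a) * near_radius powr (?d - 1)) * (\<integral>\<^sup>+\<sigma>. ?f \<sigma>)"
     by (rule layer_upper[OF hf _ near_radius(1)]) measurable
    also have "(\<integral>\<^sup>+\<sigma>. ?f \<sigma>) = ennreal (1 - s) * ennreal (2 * (1 powr (1 - s) / (1 - s)))"
     using s nn_integral_abs_powr_near[of "1 - s" 1] by (subst nn_integral_cmult) simp_all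
    also have "\<dots> = ennreal 2"
    proof -
     have "a * (2 * (1 powr a / a)) = 2" if "a > 0" for a :: real using that by simp
     from this[of "1 - s"] show ?thesis using s by (subst ennreal_mult[symmetric]) auto
    qed
    also have "ennreal (unit_ball_vol ?d * 2 ^ DIM('a) * near_radius powr (?d - 1)) * ennreal 2 \<le> ennreal (unit_ball_vol ?d * 2 ^ DIM('a) * 1) * ennreal 2"
     using near_radius DIM_ge_1[where 'a='a] by (intro mult_right_mono ennreal_leI mult_left_mono powr_le1) auto
    also have "\<dots> = ennreal c3" unfolding c3_def by (subst ennreal_mult[symmetric]) auto
    finally show ?thesis .
   qed
   have "(\<integral>\<^sup>+x. ?W x * ennreal ((u x)\<^sup>2) * indicator near x) \<le> (\<integral>\<^sup>+x. ennreal c1 * (\<Sum>i. ?g i x) + ennreal c2 * (?L * (?W x * indicator near x)))"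
    by (intro nn_integral_mono pt)
   also have "\<dots> = ennreal c1 * (\<integral>\<^sup>+x. (\<Sum>i. ?g i x)) + ennreal c2 * (?L * (\<integral>\<^sup>+x. ?W x * indicator near x))"
    by (subst nn_integral_add) (simp_all add: nn_integral_cmult)
   also have "(\<integral>\<^sup>+x. (\<Sum>i. ?g i x)) = ?S"
    unfolding scale_energy_def by (rule nn_integral_suminf) measurable
   also have "ennreal c1 * ?S + ennreal c2 * (?L * (\<integral>\<^sup>+x. ?W x * indicator near x)) \<le> ennreal c1 * ?S + ennreal c2 * (?L * ennreal c3)"
    by (intro add_left_mono mult_left_mono w) auto
   also have "\<dots> = ennreal c1 * ?S + ennreal (c2 * c3) * ?L" using c by (simp add: ennreal_mult mult_ac)
   also have "\<dots> \<le> ennreal C * ?S + ennreal C * ?L"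
    unfolding C_def using c by (intro add_mono mult_right_mono ennreal_leI) auto
   finally show ?thesis by (simp only: distrib_left)
  qed
  then show ?thesis by (intro exI[of _ C] conjI[OF C] allI impI)
qed

end

section \<open>Boundedness of the trace\<close>

context lipschitz_domain
begin

lemma tau_density_le:
  assumes s: "0 < s" "s < 1"
  shows "tau_density s \<Omega> x \<le> (1 - s) * \<delta> x powr (- s)"
proof -
  have "1 powr (real DIM('a) + s) \<le> (1 + \<delta> x) powr (real DIM('a) + s)" using s by (intro powr_mono2) auto
  then have "1 / (1 + \<delta> x) powr (real DIM('a) + s) \<le> 1" by (simp add: divide_le_eq)
  then have "(1 - s) * \<delta> x powr (- s) * (1 / (1 + \<delta> x) powr (real DIM('a) + s)) \<le> (1 - s) * \<delta> x powr (- s) * 1"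
   using s by (intro mult_left_mono) auto
  then show ?thesis by (simp add: tau_density_def powr_minus_divide)
qed

text \<open>Near the boundary the integral of \<open>\<delta>\<^sup>-\<^sup>s\<close> compensates the factor \<open>1 - s\<close>; at infinity the density decays
like the power \<open>- d - 2 s\<close> of the distance, which is integrable uniformly for \<open>s > ss\<close>.\<close>

lemma tau_density_total:
  assumes ss: "0 < ss" "ss < 1"
  shows "\<exists>C>0. \<forall>s. ss < s \<longrightarrow> s < 1 \<longrightarrow> (\<integral>\<^sup>+x. ennreal (tau_density s \<Omega> x) * indicator (- \<Omega>) x) \<le> ennreal C"
proof -
  obtain C0 where C0: "C0 > 0" and int: "\<And>s z r. 0 < s \<Longrightarrow> s < 1 \<Longrightarrow> z \<in> frontier \<Omega> \<Longrightarrow> 0 < r \<Longrightarrow> r \<le> 8 * D \<Longrightarrow>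
   (\<integral>\<^sup>+x. ennreal (\<delta> x powr (- s)) * indicator (cball z r) x) \<le>
    ennreal (C0 * (r powr (real DIM('a) - s) / (1 - s)))"
   using bdist_powr_integral by blast
  obtain z where z: "z \<in> frontier \<Omega>" using frontier_nonempty by blast
  let ?S = "sphere_area TYPE('a)"
  have S: "?S > 0" by (rule sphere_area_pos)
  define C where "C = C0 * (2 * D) powr real DIM('a) + 2 powr (real DIM('a) + 2) * (?S / (2 * ss))"
  have C: "C > 0" using C0 S ss D1 by (simp add: C_def add_pos_pos)
  have "(\<integral>\<^sup>+x. ennreal (tau_density s \<Omega> x) * indicator (- \<Omega>) x) \<le> ennreal C" if s: "ss < s" "s < 1" for s
  proof -
   have s0: "0 < s" using s ss by simp
   have far: "tau_density s \<Omega> x \<le> 2 powr (real DIM('a) + 2) * dist x z powr (- (2 * s) - real DIM('a))" if x: "2 * D < dist x z" for x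
   proof -
    obtain p where p: "p \<in> frontier \<Omega>" "dist x p = \<delta> x" using bdist_attained by blast
    have "dist p z \<le> D" using p z frontier_closure diam by blast
    then have d: "dist x z \<le> 2 * \<delta> x" using dist_triangle[of x z p] p x by linarith
    then have dp: "0 < \<delta> x" using x D1 by linarith
    have "tau_density s \<Omega> x = (1 - s) * (\<delta> x powr (- s) * (1 + \<delta> x) powr (- (real DIM('a) + s)))"
     by (simp only: tau_density_def powr_minus divide_inverse inverse_mult_distrib mult.assoc)
    also have "\<dots> \<le> 1 * (\<delta> x powr (- s) * \<delta> x powr (- (real DIM('a) + s)))"
     using dp s0 s by (intro mult_mono powr_neg_antimono) auto
    also have "\<dots> = \<delta> x powr (- (2 * s + real DIM('a)))" by (simp add: powr_add[symmetric])
    also have "\<dots> \<le> 2 powr (real DIM('a) + 2) * dist x z powr (- (2 * s + real DIM('a)))"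
     using d x D1 s0 s by (intro powr_neg_le_scaled) auto
    also have "- (2 * s + real DIM('a)) = - (2 * s) - real DIM('a)" by simp
    finally show ?thesis .
   qed
   have "(\<integral>\<^sup>+x. ennreal (tau_density s \<Omega> x) * indicator (- \<Omega>) x) \<le>
    (\<integral>\<^sup>+x. ennreal (1 - s) * (ennreal (\<delta> x powr (- s)) * indicator {..2 * D} (dist z x)) +
     ennreal (2 powr (real DIM('a) + 2)) * (ennreal (dist x z powr (- (2 * s) - real DIM('a))) * indicator {2 * D..} (dist x z)))"
   proof (rule nn_integral_mono)
    fix x
    show "ennreal (tau_density s \<Omega> x) * indicator (- \<Omega>) x \<le> ennreal (1 - s) * (ennreal (\<delta> x powr (- s)) * indicator {..2 * D} (dist z x)) +
     ennreal (2 powr (real DIM('a) + 2)) * (ennreal (dist x z powr (- (2 * s) - real DIM('a))) * indicator {2 * D..} (dist x z))"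
    proof (cases "dist x z \<le> 2 * D")
     case True
     have "ennreal (tau_density s \<Omega> x) \<le> ennreal ((1 - s) * \<delta> x powr (- s))" by (intro ennreal_leI tau_density_le s0 s)
     then have "ennreal (tau_density s \<Omega> x) * indicator (- \<Omega>) x \<le> ennreal (1 - s) * (ennreal (\<delta> x powr (- s)) * indicator {..2 * D} (dist z x))"
      using True s by (auto simp: indicator_def ennreal_mult dist_commute)
     then show ?thesis by (rule add_increasing2[rotated]) simp
    next
     case False
     then have "ennreal (tau_density s \<Omega> x) \<le> ennreal (2 powr (real DIM('a) + 2) * dist x z powr (- (2 * s) - real DIM('a)))"
      by (intro ennreal_leI far) simp
     then have "ennreal (tau_density s \<Omega> x) * indicator (- \<Omega>) x \<le> ennreal (2 powr (real DIM('a) + 2)) * (ennreal (dist x z powr (- (2 * s) - real DIM('a))) * indicator {2 * D..} (dist x z))"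
      using False by (auto simp: indicator_def ennreal_mult)
     then show ?thesis by (rule add_increasing[rotated]) simp
    qed
   qed
   also have "\<dots> = ennreal (1 - s) * (\<integral>\<^sup>+x. ennreal (\<delta> x powr (- s)) * indicator {..2 * D} (dist z x)) +
     ennreal (2 powr (real DIM('a) + 2)) * (\<integral>\<^sup>+x. ennreal (dist x z powr (- (2 * s) - real DIM('a))) * indicator {2 * D..} (dist x z))"
    by (subst nn_integral_add) (simp_all add: nn_integral_cmult)
   also have "\<dots> \<le> ennreal (1 - s) * ennreal (C0 * ((2 * D) powr (real DIM('a) - s) / (1 - s))) +
     ennreal (2 powr (real DIM('a) + 2)) * ennreal (?S * ((2 * D) powr (- (2 * s)) / (2 * s)))"
   proof (intro add_mono mult_left_mono)
    show "(\<integral>\<^sup>+x. ennreal (\<delta> x powr (- s)) * indicator {..2 * D} (dist z x)) \<le> ennreal (C0 * ((2 * D) powr (real DIM('a) - s) / (1 - s)))"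
     using int[OF s0 s(2) z, of "2 * D"] D1 by (simp add: indicator_cball_eq)
    show "(\<integral>\<^sup>+x. ennreal (dist x z powr (- (2 * s) - real DIM('a))) * indicator {2 * D..} (dist x z)) \<le> ennreal (?S * ((2 * D) powr (- (2 * s)) / (2 * s)))"
     using nn_integral_dist_powr_far[of "2 * s" "2 * D" z] s0 D1 by simp
   qed auto
   also have "\<dots> \<le> ennreal (C0 * (2 * D) powr real DIM('a)) + ennreal (2 powr (real DIM('a) + 2) * (?S / (2 * ss)))"
   proof (rule add_mono)
    have "(1 - s) * (C0 * ((2 * D) powr (real DIM('a) - s) / (1 - s))) = C0 * (2 * D) powr (real DIM('a) - s)" using s by simp
    also have "\<dots> \<le> C0 * (2 * D) powr real DIM('a)" using C0 D1 s0 by (intro mult_left_mono powr_mono) auto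
    finally show "ennreal (1 - s) * ennreal (C0 * ((2 * D) powr (real DIM('a) - s) / (1 - s))) \<le> ennreal (C0 * (2 * D) powr real DIM('a))"
     using s C0 by (subst ennreal_mult[symmetric]) (auto intro: ennreal_leI)
    have "(2 * D) powr (- (2 * s)) \<le> (2 * D) powr 0" using D1 s0 by (intro powr_mono) auto
    then have "(2 * D) powr (- (2 * s)) / (2 * s) \<le> 1 / (2 * ss)" using s s0 ss D1 by (intro frac_le) auto
    then have "2 powr (real DIM('a) + 2) * (?S * ((2 * D) powr (- (2 * s)) / (2 * s))) \<le> 2 powr (real DIM('a) + 2) * (?S * (1 / (2 * ss)))"
     using S by (intro mult_left_mono) auto
    then show "ennreal (2 powr (real DIM('a) + 2)) * ennreal (?S * ((2 * D) powr (- (2 * s)) / (2 * s))) \<le> ennreal (2 powr (real DIM('a) + 2) * (?S / (2 * ss)))"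
     using S s0 by (subst ennreal_mult[symmetric]) (auto intro: ennreal_leI)
   qed
   also have "\<dots> = ennreal C" unfolding C_def using C0 S ss by (intro ennreal_plus[symmetric]) auto
   finally show ?thesis .
  qed
  then show ?thesis by (intro exI[of _ C] conjI[OF C] allI impI)
qed

text \<open>The base of the power in the trace kernel is \<open>(1 + \<delta> x) * (1 + \<delta> y) - 1 + dist x y\<close>, and in
the three cases it is at least a fixed multiple of \<open>(1 + \<delta> x) * (1 + \<delta> y)\<close>.\<close>

lemma trace_kernel_far:
  assumes s: "0 < s" "s < 1" and \<rho>: "0 < \<rho>" "\<rho> \<le> 1" and far: "\<rho> \<le> \<delta> x \<or> \<rho> \<le> \<delta> y \<or> \<rho> \<le> dist x y"
  shows "trace_kernel s \<Omega> x y \<le> (2 / \<rho>) ^ DIM('a) * (tau_density s \<Omega> x * tau_density s \<Omega> y)"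
proof -
  let ?P = "dist x y + \<delta> x * \<delta> y + \<delta> x + \<delta> y"
  let ?Y = "(1 + \<delta> x) * (1 + \<delta> y)"
  have Y: "1 \<le> ?Y" "1 + \<delta> x \<le> ?Y" "1 + \<delta> y \<le> ?Y"
   using bdist_nonneg[of x] bdist_nonneg[of y] by (auto simp: algebra_simps)
  have P: "?P = ?Y - 1 + dist x y" by (simp add: algebra_simps)
  have "\<rho> / 2 * ?Y \<le> ?P"
  proof (cases "\<rho> \<le> dist x y")
   case True
   have "\<rho> * (?Y - 1) \<le> 1 * (?Y - 1)" using Y \<rho> by (intro mult_right_mono) auto
   then have "\<rho> * ?Y \<le> ?P" unfolding P using True by (simp add: right_diff_distrib)
   moreover have "\<rho> / 2 * ?Y \<le> \<rho> * ?Y" using \<rho> Y by (intro mult_right_mono) auto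
   ultimately show ?thesis by linarith
  next
   case False
   then have Yr: "1 + \<rho> \<le> ?Y" using far Y by linarith
   have "\<rho> / 2 * ?Y \<le> ?Y - 1"
   proof -
    have "1 \<le> (1 - \<rho> / 2) * (1 + \<rho>)"
    proof -
     have "\<rho> * \<rho> \<le> \<rho> * 1" using \<rho> by (intro mult_left_mono) auto
     then show ?thesis by (simp add: algebra_simps)
    qed
    also have "\<dots> \<le> (1 - \<rho> / 2) * ?Y" using Yr \<rho> by (intro mult_left_mono) auto
    finally show ?thesis by (simp add: left_diff_distrib)
   qed
   then show ?thesis unfolding P using zero_le_dist[of x y] by linarith
  qed
  then have "?Y \<le> (2 / \<rho>) * ?P" using \<rho> by (simp add: field_simps)
  then have "?P powr (- real DIM('a)) \<le> (2 / \<rho>) powr real DIM('a) * ?Y powr (- real DIM('a))"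
   using Y \<rho> by (intro powr_neg_le_scaled) auto
  also have "(2 / \<rho>) powr real DIM('a) = (2 / \<rho>) ^ DIM('a)" using \<rho> by (simp add: powr_realpow)
  finally have Pd: "?P powr (- real DIM('a)) \<le> (2 / \<rho>) ^ DIM('a) * ?Y powr (- real DIM('a))" .
  have P0: "?P > 0" using \<open>\<rho> / 2 * ?Y \<le> ?P\<close> \<rho> Y by (smt (verit) divide_pos_pos mult_pos_pos)
  have tk: "trace_kernel s \<Omega> x y = (1 - s)\<^sup>2 * (\<delta> x powr (- s) * \<delta> y powr (- s) *
    ((1 + \<delta> x) powr (- s) * (1 + \<delta> y) powr (- s))) * ?P powr (- real DIM('a))"
   unfolding trace_kernel_def using P0 by (simp add: powr_minus powr_realpow divide_inverse mult_ac)
  have tt: "(1 - s)\<^sup>2 * (\<delta> x powr (- s) * \<delta> y powr (- s) * ((1 + \<delta> x) powr (- s) * (1 + \<delta> y) powr (- s))) * ?Y powr (- real DIM('a))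
   = tau_density s \<Omega> x * tau_density s \<Omega> y"
  proof -
   have p: "(1 + \<delta> w) powr (real DIM('a) + s) = (1 + \<delta> w) powr (real DIM('a)) * (1 + \<delta> w) powr s" for w
    by (rule powr_add)
   have y: "?Y powr (- real DIM('a)) = (1 + \<delta> x) powr (- real DIM('a)) * (1 + \<delta> y) powr (- real DIM('a))"
    by (rule powr_mult) 
   show ?thesis unfolding tau_density_def p y
    by (simp add: powr_minus divide_inverse power2_eq_square mult_ac)
  qed
  have "trace_kernel s \<Omega> x y \<le> (1 - s)\<^sup>2 * (\<delta> x powr (- s) * \<delta> y powr (- s) *
    ((1 + \<delta> x) powr (- s) * (1 + \<delta> y) powr (- s))) * ((2 / \<rho>) ^ DIM('a) * ?Y powr (- real DIM('a)))"
   unfolding tk by (intro mult_left_mono Pd) auto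
  also have "\<dots> = (2 / \<rho>) ^ DIM('a) * (tau_density s \<Omega> x * tau_density s \<Omega> y)"
   unfolding tt[symmetric] by (simp only: mult_ac)
  finally show ?thesis .
qed

definition dom_vol :: real where "dom_vol = measure lborel \<Omega>"

lemma dom_vol: "emeasure lborel \<Omega> = ennreal dom_vol" "dom_vol > 0"
proof -
  obtain x where x: "x \<in> \<Omega>" using dom_nonempty by blast
  have "\<Omega> \<subseteq> cball x D"
  proof
   fix y assume "y \<in> \<Omega>"
   then have "dist x y \<le> D" using diam x closure_subset by blast
   then show "y \<in> cball x D" by simp
  qed
  then have "emeasure lborel \<Omega> \<le> emeasure lborel (cball x D)" by (intro emeasure_mono) auto
  also have "\<dots> < \<infinity>" using D1 by (simp add: emeasure_cball)
  finally have fin: "emeasure lborel \<Omega> \<noteq> \<infinity>" by simp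
  show e: "emeasure lborel \<Omega> = ennreal dom_vol"
   unfolding dom_vol_def by (rule emeasure_eq_ennreal_measure) (use fin in simp)
  obtain r where r: "r > 0" "cball x r \<subseteq> \<Omega>" using open_dom x open_contains_cball by blast
  have "0 < emeasure lborel (cball x r)" using r by (simp add: emeasure_cball)
  also have "\<dots> \<le> emeasure lborel \<Omega>" using r by (intro emeasure_mono) auto
  finally show "dom_vol > 0" unfolding e by simp
qed

abbreviation dom_L2 :: "('a \<Rightarrow> real) \<Rightarrow> ennreal" where
  "dom_L2 u \<equiv> (\<integral>\<^sup>+x. ennreal ((u x)\<^sup>2) * indicator \<Omega> x)"

lemma two_sq_le: "ennreal ((a + b)\<^sup>2) \<le> ennreal 2 * ennreal (a\<^sup>2) + ennreal 2 * ennreal (b\<^sup>2)"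
proof -
  have "0 \<le> (a - b)\<^sup>2" by simp
  then have "(a + b)\<^sup>2 \<le> 2 * a\<^sup>2 + 2 * b\<^sup>2" by (simp add: power2_sum power2_diff)
  then have "ennreal ((a + b)\<^sup>2) \<le> ennreal (2 * a\<^sup>2 + 2 * b\<^sup>2)" by (rule ennreal_leI)
  also have "\<dots> = ennreal 2 * ennreal (a\<^sup>2) + ennreal 2 * ennreal (b\<^sup>2)"
   by (subst ennreal_plus) (auto simp: ennreal_mult)
  finally show ?thesis .
qed

text \<open>Far from the boundary the density at \<open>x\<close> is at most a multiple of \<open>(1 - s) * dist y x powr (- d - 2 * s)\<close>
for every \<open>y\<close> in the domain; hence \<open>u x\<close> can be compared with \<open>u y\<close> and averaged over \<open>y\<close>.\<close>

lemma far_trace_mass: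
  assumes ss: "0 < ss" "ss < 1" and \<rho>: "0 < \<rho>" "\<rho> \<le> 1"
  shows "\<exists>C>0. \<forall>s u. ss < s \<longrightarrow> s < 1 \<longrightarrow> u \<in> borel_measurable borel \<longrightarrow>
   (\<integral>\<^sup>+x. ennreal ((u x)\<^sup>2 * tau_density s \<Omega> x) * indicator (- \<Omega>) x * indicator {\<rho>..} (\<delta> x)) \<le>
    ennreal C * (dom_L2 u + ennreal (1 - s) * dom_energy s \<Omega> u)"
proof -
  obtain C0 where C0: "C0 > 0" and tot: "\<And>s. ss < s \<Longrightarrow> s < 1 \<Longrightarrow> (\<integral>\<^sup>+x. ennreal (tau_density s \<Omega> x) * indicator (- \<Omega>) x) \<le> ennreal C0"
   using tau_density_total[OF ss] by blast
  note V = dom_vol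
  define c1 where "c1 = (2 / \<rho>) * D powr (real DIM('a) + 2)"
  have c1: "c1 > 0" using \<rho> D1 by (simp add: c1_def)
  define C where "C = 2 * (C0 + c1) / dom_vol"
  have C: "C > 0" using C0 c1 V(2) by (simp add: C_def add_pos_pos)
  have "(\<integral>\<^sup>+x. ennreal ((u x)\<^sup>2 * tau_density s \<Omega> x) * indicator (- \<Omega>) x * indicator {\<rho>..} (\<delta> x)) \<le>
    ennreal C * (dom_L2 u + ennreal (1 - s) * dom_energy s \<Omega> u)"
   if s: "ss < s" "s < 1" and [measurable]: "u \<in> borel_measurable borel" for s u
  proof -
   have s0: "0 < s" using s ss by simp
   let ?b = "real DIM('a) + 2 * s"
   let ?E = "ennreal (1 - s) * dom_energy s \<Omega> u"
   have tau: "tau_density s \<Omega> x \<le> c1 * ((1 - s) * dist y x powr (- ?b))" if x: "x \<notin> \<Omega>" "\<rho> \<le> \<delta> x" and y: "y \<in> \<Omega>" for x y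
   proof -
    have dx: "0 < \<delta> x" using x \<rho> by linarith
    obtain p where p: "p \<in> frontier \<Omega>" "dist x p = \<delta> x" using bdist_attained by blast
    have "dist p y \<le> D" using p y frontier_closure closure_subset diam by blast
    then have "dist y x \<le> \<delta> x + D" using dist_triangle[of x y p] p by (simp add: dist_commute)
    also have "\<dots> \<le> D * (1 + \<delta> x)" using mult_right_mono[OF D1, of "\<delta> x"] by (simp add: algebra_simps)
    finally have dy: "dist y x \<le> D * (1 + \<delta> x)" .
    have dyx: "0 < dist y x" using x y by auto
    have "1 + \<delta> x \<le> (2 / \<rho>) * \<delta> x"
    proof -
     have "\<rho> * 1 + \<rho> * \<delta> x \<le> \<delta> x + 1 * \<delta> x" using x \<rho> by (intro add_mono mult_right_mono) auto
     then show ?thesis using \<rho> by (simp add: field_simps)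
    qed
    then have 1: "\<delta> x powr (- s) \<le> (2 / \<rho>) powr 1 * (1 + \<delta> x) powr (- s)"
     using dx \<rho> s0 s by (intro powr_neg_le_scaled) auto
    have "tau_density s \<Omega> x = (1 - s) * (\<delta> x powr (- s) * (1 + \<delta> x) powr (- (real DIM('a) + s)))"
     by (simp only: tau_density_def powr_minus divide_inverse inverse_mult_distrib mult.assoc)
    also have "\<dots> \<le> (1 - s) * (((2 / \<rho>) powr 1 * (1 + \<delta> x) powr (- s)) * (1 + \<delta> x) powr (- (real DIM('a) + s)))"
     using 1 s by (intro mult_left_mono mult_right_mono) auto
    also have "\<dots> = (1 - s) * ((2 / \<rho>) * (1 + \<delta> x) powr (- ?b))"
    proof -
     have "(1 + \<delta> x) powr (- s) * (1 + \<delta> x) powr (- (real DIM('a) + s)) = (1 + \<delta> x) powr (- ?b)"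
      unfolding powr_add[symmetric] by (rule arg_cong[where f="\<lambda>t. (1 + \<delta> x) powr t"]) simp
     then show ?thesis using \<rho> by (simp add: mult.assoc)
    qed
    also have "\<dots> \<le> (1 - s) * ((2 / \<rho>) * (D powr (real DIM('a) + 2) * dist y x powr (- ?b)))"
     using dy dyx D1 s0 s \<rho> by (intro mult_left_mono powr_neg_le_scaled) auto
    finally show ?thesis by (simp add: c1_def mult_ac)
   qed
   have pt: "ennreal dom_vol * (ennreal ((u x)\<^sup>2 * tau_density s \<Omega> x) * indicator (- \<Omega>) x * indicator {\<rho>..} (\<delta> x)) \<le>
    ennreal (2 * c1) * (ennreal (1 - s) * (\<integral>\<^sup>+y. gagliardo s u y x * indicator \<Omega> y)) + ennreal 2 * (dom_L2 u * (ennreal (tau_density s \<Omega> x) * indicator (- \<Omega>) x))" for x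
   proof (cases "x \<notin> \<Omega> \<and> \<rho> \<le> \<delta> x")
    case True
    note t0 = tau_density_nonneg[OF s(2), of x]
    have "ennreal dom_vol * ennreal ((u x)\<^sup>2 * tau_density s \<Omega> x) = (\<integral>\<^sup>+y. ennreal ((u x)\<^sup>2 * tau_density s \<Omega> x) * indicator \<Omega> y)"
     by (subst nn_integral_cmult_indicator) (simp_all add: V mult.commute)
    also have "\<dots> \<le> (\<integral>\<^sup>+y. ennreal (2 * c1 * (1 - s)) * (gagliardo s u y x * indicator \<Omega> y) + (ennreal 2 * ennreal (tau_density s \<Omega> x)) * (ennreal ((u y)\<^sup>2) * indicator \<Omega> y))"
    proof (rule nn_integral_mono)
     fix y
     show "ennreal ((u x)\<^sup>2 * tau_density s \<Omega> x) * indicator \<Omega> y \<le> ennreal (2 * c1 * (1 - s)) * (gagliardo s u y x * indicator \<Omega> y) + (ennreal 2 * ennreal (tau_density s \<Omega> x)) * (ennreal ((u y)\<^sup>2) * indicator \<Omega> y)"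
     proof (cases "y \<in> \<Omega>")
      case yO: True
      have "ennreal ((u x)\<^sup>2) \<le> ennreal 2 * ennreal ((u y - u x)\<^sup>2) + ennreal 2 * ennreal ((u y)\<^sup>2)"
       using two_sq_le[of "u x - u y" "u y"] by (simp add: power2_commute)
      then have "ennreal ((u x)\<^sup>2) * ennreal (tau_density s \<Omega> x) \<le> (ennreal 2 * ennreal ((u y - u x)\<^sup>2) + ennreal 2 * ennreal ((u y)\<^sup>2)) * ennreal (tau_density s \<Omega> x)"
       by (rule mult_right_mono) simp
      also have "\<dots> = ennreal 2 * (ennreal ((u y - u x)\<^sup>2) * ennreal (tau_density s \<Omega> x)) + ennreal 2 * ennreal (tau_density s \<Omega> x) * ennreal ((u y)\<^sup>2)"
       unfolding distrib_right mult.assoc by (simp only: mult.commute[of "ennreal ((u y)\<^sup>2)"])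
      also have "\<dots> \<le> ennreal 2 * (ennreal ((u y - u x)\<^sup>2) * ennreal (c1 * ((1 - s) * dist y x powr (- ?b)))) + ennreal 2 * ennreal (tau_density s \<Omega> x) * ennreal ((u y)\<^sup>2)"
       using True yO by (intro add_right_mono mult_left_mono ennreal_leI tau) auto
      also have "ennreal 2 * (ennreal ((u y - u x)\<^sup>2) * ennreal (c1 * ((1 - s) * dist y x powr (- ?b)))) = ennreal (2 * c1 * (1 - s)) * gagliardo s u y x"
      proof -
       have "ennreal 2 * ennreal (c1 * ((1 - s) * dist y x powr (- ?b))) = ennreal (2 * c1 * (1 - s)) * ennreal (dist y x powr (- ?b))"
        using c1 s by (subst (1 2) ennreal_mult[symmetric]) (auto simp: mult_ac)
       then have "ennreal ((u y - u x)\<^sup>2) * (ennreal 2 * ennreal (c1 * ((1 - s) * dist y x powr (- ?b)))) =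
        ennreal ((u y - u x)\<^sup>2) * (ennreal (2 * c1 * (1 - s)) * ennreal (dist y x powr (- ?b)))" by (rule arg_cong)
       then show ?thesis unfolding gagliardo_def by (simp only: mult_ac)
      qed
      finally show ?thesis using yO t0 by (simp only: ennreal_mult[OF zero_le_power2] indicator_simps mult_1_right)
     qed simp
    qed
    also have "\<dots> = ennreal (2 * c1 * (1 - s)) * (\<integral>\<^sup>+y. gagliardo s u y x * indicator \<Omega> y) + (ennreal 2 * ennreal (tau_density s \<Omega> x)) * dom_L2 u"
     by (subst nn_integral_add) (simp_all add: nn_integral_cmult)
    also have "ennreal (2 * c1 * (1 - s)) = ennreal (2 * c1) * ennreal (1 - s)"
     using c1 s by (intro ennreal_mult) auto
    finally show ?thesis using True by (simp add: mult_ac)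
   qed auto
   have "ennreal dom_vol * (\<integral>\<^sup>+x. ennreal ((u x)\<^sup>2 * tau_density s \<Omega> x) * indicator (- \<Omega>) x * indicator {\<rho>..} (\<delta> x)) =
    (\<integral>\<^sup>+x. ennreal dom_vol * (ennreal ((u x)\<^sup>2 * tau_density s \<Omega> x) * indicator (- \<Omega>) x * indicator {\<rho>..} (\<delta> x)))"
    by (rule nn_integral_cmult[symmetric]) measurable
   also have "\<dots> \<le> (\<integral>\<^sup>+x. ennreal (2 * c1) * (ennreal (1 - s) * (\<integral>\<^sup>+y. gagliardo s u y x * indicator \<Omega> y)) + ennreal 2 * (dom_L2 u * (ennreal (tau_density s \<Omega> x) * indicator (- \<Omega>) x)))"
    by (intro nn_integral_mono pt)
   also have "\<dots> = ennreal (2 * c1) * (ennreal (1 - s) * (\<integral>\<^sup>+x y. gagliardo s u y x * indicator \<Omega> y)) +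
    ennreal 2 * (dom_L2 u * (\<integral>\<^sup>+x. ennreal (tau_density s \<Omega> x) * indicator (- \<Omega>) x))"
    by (subst nn_integral_add) (simp_all add: nn_integral_cmult)
   also have "(\<integral>\<^sup>+x y. gagliardo s u y x * indicator \<Omega> y) = dom_energy s \<Omega> u"
    unfolding dom_energy_def by (rule nn_integral_swap) measurable
   also have "ennreal (2 * c1) * ?E + ennreal 2 * (dom_L2 u * (\<integral>\<^sup>+x. ennreal (tau_density s \<Omega> x) * indicator (- \<Omega>) x)) \<le>
    ennreal (2 * (C0 + c1)) * ?E + ennreal (2 * (C0 + c1)) * dom_L2 u"
   proof (rule add_mono)
    show "ennreal (2 * c1) * ?E \<le> ennreal (2 * (C0 + c1)) * ?E" using C0 by (intro mult_right_mono ennreal_leI) auto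
    have "ennreal 2 * (dom_L2 u * (\<integral>\<^sup>+x. ennreal (tau_density s \<Omega> x) * indicator (- \<Omega>) x)) \<le> ennreal 2 * (dom_L2 u * ennreal C0)"
     by (intro mult_left_mono tot s) auto
    also have "\<dots> = ennreal (2 * C0) * dom_L2 u" using C0 by (subst ennreal_mult) (auto simp: mult_ac)
    also have "\<dots> \<le> ennreal (2 * (C0 + c1)) * dom_L2 u" using c1 by (intro mult_right_mono ennreal_leI) auto
    finally show "ennreal 2 * (dom_L2 u * (\<integral>\<^sup>+x. ennreal (tau_density s \<Omega> x) * indicator (- \<Omega>) x)) \<le> ennreal (2 * (C0 + c1)) * dom_L2 u" .
   qed
   also have "\<dots> = (dom_L2 u + ?E) * ennreal (dom_vol * C)"
   proof -
    have "dom_vol * C = 2 * (C0 + c1)" using V(2) by (simp add: C_def)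
    then show ?thesis by (simp only: distrib_right mult.commute[of "ennreal (2 * (C0 + c1))"] add.commute)
   qed
   finally have fin: "ennreal dom_vol * (\<integral>\<^sup>+x. ennreal ((u x)\<^sup>2 * tau_density s \<Omega> x) * indicator (- \<Omega>) x * indicator {\<rho>..} (\<delta> x)) \<le> (dom_L2 u + ?E) * ennreal (dom_vol * C)" .
   show ?thesis by (rule ennreal_cancel_le(1)[OF V(2) less_imp_le[OF C] fin])
  qed
  then show ?thesis by (intro exI[of _ C] conjI[OF C] allI impI)
qed

definition "chart_radius = R / (8 * (12 * M + 17)) / (8 * M)"

lemma chart_radius: "0 < chart_radius" "chart_radius \<le> R / (4 * M)" "chart_radius \<le> 1"
proof -
  have K: "1 \<le> 8 * (12 * M + 17)" using M1 by simp
  show "0 < chart_radius" using R0 M1 by (simp add: chart_radius_def)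
  have "R / (8 * (12 * M + 17)) \<le> R / 1" using R0 K by (intro divide_left_mono) auto
  then have "chart_radius \<le> R / (8 * M)" unfolding chart_radius_def using M1 by (intro divide_right_mono) auto
  also have "\<dots> \<le> R / (4 * M)" using R0 M1 by (intro divide_left_mono) auto
  finally show "chart_radius \<le> R / (4 * M)" .
  also have "\<dots> \<le> 1" using R0 R1 M1 by (simp add: divide_le_eq)
  finally show "chart_radius \<le> 1" .
qed

text \<open>In the chart, depth and distance to the boundary are comparable, and so are the weights of the trace
space and those of the chart.\<close>

lemma chart_trace:
  assumes ss: "0 < ss" "ss < 1" and z: "z \<in> frontier \<Omega>"
  shows "\<exists>C>0. \<forall>s u. ss < s \<longrightarrow> s < 1 \<longrightarrow> u \<in> borel_measurable borel \<longrightarrow>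
   (\<integral>\<^sup>+x. ennreal ((u x)\<^sup>2 * tau_density s \<Omega> x) * indicator (- \<Omega>) x * indicator (cball z chart_radius) x) \<le>
    ennreal C * (dom_L2 u + ennreal (1 - s) * dom_energy s \<Omega> u) \<and>
   (\<integral>\<^sup>+x y. ennreal ((u x - u y)\<^sup>2 * trace_kernel s \<Omega> x y) * (indicator (- \<Omega>) x * indicator (- \<Omega>) y) *
     (indicator (cball z chart_radius) x * indicator (cball z chart_radius) y)) \<le>
    ennreal C * (dom_L2 u + ennreal (1 - s) * dom_energy s \<Omega> u)"
proof -
  obtain e h where h: "height_function M e h" and iff: "\<And>x. x \<in> ball z R \<Longrightarrow> x \<in> \<Omega> \<longleftrightarrow> 0 < h x" and h0: "h z = 0"
   and up: "\<And>x. x \<in> cball z (R / (4 * M)) \<Longrightarrow> \<delta> x \<le> \<bar>h x\<bar>" and low: "\<And>x. x \<in> cball z (R / (4 * M)) \<Longrightarrow> \<bar>h x\<bar> \<le> M * \<delta> x"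
   using chart_obtain[OF z] by metis
  interpret tc: trace_chart \<Omega> M R e z h
   by unfold_locales (use M1 R0 R1 h h0 iff in auto)
  have nr: "tc.near_radius = chart_radius"
   by (simp add: tc.near_radius_def tc.top_scale_def tc.K_def chart_radius_def)
  have rR: "chart_radius < R"
  proof -
   have "R / (4 * M) \<le> R / 4" using R0 M1 by (intro divide_left_mono) auto
   then show ?thesis using chart_radius(2) R0 by linarith
  qed
  have inside: "x \<in> tc.near \<and> 0 < - h x \<and> - h x \<le> M * \<delta> x" if x: "x \<notin> \<Omega>" "x \<in> cball z chart_radius" and d: "0 < \<delta> x" for x
  proof -
   have x4: "x \<in> cball z (R / (4 * M))" using x chart_radius by simp
   have "x \<in> ball z R" using x rR by simp
   then have "h x \<le> 0" using iff x by force
   moreover have "0 < \<bar>h x\<bar>" using up[OF x4] d by linarith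
   ultimately show ?thesis using low[OF x4] x by (simp add: tc.near_def nr)
  qed
  have comp: "\<delta> x powr (- s) \<le> M * (- h x) powr (- s)" if x: "x \<notin> \<Omega>" "x \<in> cball z chart_radius" "0 < \<delta> x" and s: "0 < s" "s < 1" for x s
  proof -
   have "\<delta> x powr (- s) \<le> M powr 1 * (- h x) powr (- s)"
   proof (rule powr_neg_le_scaled)
    have x4: "x \<in> cball z (R / (4 * M))" using x chart_radius by simp
    have "\<delta> x > 0" by fact
    show "- h x \<le> M * \<delta> x" "0 < - h x" using inside[OF x] by auto
   qed (use M1 s in auto)
   then show ?thesis using M1 by simp
  qed
  obtain Cs where Cs: "Cs > 0" and sums: "\<And>s u. ss < s \<Longrightarrow> s < 1 \<Longrightarrow> u \<in> borel_measurable borel \<Longrightarrow>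
   (\<Sum>j. tc.scale_energy s u j) \<le> ennreal Cs * (ennreal (1 - s) * dom_energy s \<Omega> u)"
   using tc.scale_energy_sum[OF ss] by blast
  obtain Cm where Cm: "Cm > 0" and mass: "\<And>s u. 0 < s \<Longrightarrow> s < 1 \<Longrightarrow> u \<in> borel_measurable borel \<Longrightarrow>
   (\<integral>\<^sup>+x. ennreal ((1 - s) * (- h x) powr (- s)) * ennreal ((u x)\<^sup>2) * indicator tc.near x) \<le>
   ennreal Cm * ((\<Sum>i. tc.scale_energy s u i) + (\<integral>\<^sup>+x. ennreal ((u x)\<^sup>2) * indicator \<Omega> x))"
   using tc.near_trace_mass by blast
  define Cp where "Cp = 2 * (2 * 2 ^ DIM('a)) * tc.weight_const / unit_ball_vol (real DIM('a))"
  have Cp: "Cp > 0" using tc.weight_const_pos by (simp add: Cp_def)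
  define A where "A = M * Cm * (Cs + 1)"
  define B where "B = M powr (real DIM('a) + 2) * Cp * Cs"
  have AB: "A > 0" "B > 0" using M1 Cm Cs Cp by (auto simp: A_def B_def)
  let ?X = "\<lambda>s u. dom_L2 u + ennreal (1 - s) * dom_energy s \<Omega> u"
  have "(\<integral>\<^sup>+x. ennreal ((u x)\<^sup>2 * tau_density s \<Omega> x) * indicator (- \<Omega>) x * indicator (cball z chart_radius) x) \<le> ennreal (A + B) * ?X s u \<and>
   (\<integral>\<^sup>+x y. ennreal ((u x - u y)\<^sup>2 * trace_kernel s \<Omega> x y) * (indicator (- \<Omega>) x * indicator (- \<Omega>) y) *
     (indicator (cball z chart_radius) x * indicator (cball z chart_radius) y)) \<le> ennreal (A + B) * ?X s u"
   if s: "ss < s" "s < 1" and u [measurable]: "u \<in> borel_measurable borel" for s u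
  proof
   have s0: "0 < s" using s ss by simp
   let ?E = "ennreal (1 - s) * dom_energy s \<Omega> u"
   let ?S = "\<Sum>i. tc.scale_energy s u i"
   have S: "?S \<le> ennreal Cs * ?E" by (rule sums[OF s u])
   have "(\<integral>\<^sup>+x. ennreal ((u x)\<^sup>2 * tau_density s \<Omega> x) * indicator (- \<Omega>) x * indicator (cball z chart_radius) x) \<le>
    (\<integral>\<^sup>+x. ennreal M * (ennreal ((1 - s) * (- h x) powr (- s)) * ennreal ((u x)\<^sup>2) * indicator tc.near x))"
   proof (rule nn_integral_mono_AE, rule AE_mp[OF AE_bdist_pos], rule AE_I2, rule impI)
    fix x assume d: "0 < \<delta> x"
    show "ennreal ((u x)\<^sup>2 * tau_density s \<Omega> x) * indicator (- \<Omega>) x * indicator (cball z chart_radius) x \<le>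
     ennreal M * (ennreal ((1 - s) * (- h x) powr (- s)) * ennreal ((u x)\<^sup>2) * indicator tc.near x)"
    proof (cases "x \<notin> \<Omega> \<and> x \<in> cball z chart_radius")
     case True
     then have x: "x \<notin> \<Omega>" "x \<in> cball z chart_radius" by auto
     have "tau_density s \<Omega> x \<le> (1 - s) * \<delta> x powr (- s)" by (rule tau_density_le[OF s0 s(2)])
     also have "\<dots> \<le> (1 - s) * (M * (- h x) powr (- s))" using comp[OF x d s0 s(2)] s by (intro mult_left_mono) auto
     finally have "(u x)\<^sup>2 * tau_density s \<Omega> x \<le> (u x)\<^sup>2 * ((1 - s) * (M * (- h x) powr (- s)))" by (intro mult_left_mono) auto
     then have "ennreal ((u x)\<^sup>2 * tau_density s \<Omega> x) \<le> ennreal (M * ((1 - s) * (- h x) powr (- s) * (u x)\<^sup>2))"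
      by (intro ennreal_leI) (simp add: mult_ac)
     then show ?thesis using x inside[OF x d] M1 s by (simp add: ennreal_mult)
    qed auto
   qed
   also have "\<dots> = ennreal M * (\<integral>\<^sup>+x. ennreal ((1 - s) * (- h x) powr (- s)) * ennreal ((u x)\<^sup>2) * indicator tc.near x)"
    by (rule nn_integral_cmult) measurable
   also have "\<dots> \<le> ennreal M * (ennreal Cm * (?S + dom_L2 u))" by (intro mult_left_mono mass s0 s u) simp
   also have "\<dots> \<le> ennreal M * (ennreal Cm * (ennreal (Cs + 1) * ?E + ennreal (Cs + 1) * dom_L2 u))"
   proof (intro mult_left_mono add_mono)
    show "?S \<le> ennreal (Cs + 1) * ?E" using S by (rule order_trans) (intro mult_right_mono ennreal_leI, auto)
    have "1 \<le> ennreal (Cs + 1)" using Cs by simp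
    from mult_right_mono[OF this, of "dom_L2 u"] show "dom_L2 u \<le> ennreal (Cs + 1) * dom_L2 u" by simp
   qed auto
   also have "\<dots> = ennreal A * ?X s u"
   proof -
    have "ennreal A = ennreal M * (ennreal Cm * ennreal (Cs + 1))"
     unfolding A_def using M1 Cm Cs by (subst ennreal_mult_assoc3) (auto simp: mult.assoc)
    then show ?thesis by (simp only: distrib_left mult.assoc add.commute)
   qed
   also have "\<dots> \<le> ennreal (A + B) * ?X s u" using AB by (intro mult_right_mono ennreal_leI) auto
   finally show "(\<integral>\<^sup>+x. ennreal ((u x)\<^sup>2 * tau_density s \<Omega> x) * indicator (- \<Omega>) x * indicator (cball z chart_radius) x) \<le> ennreal (A + B) * ?X s u" .
   have "(\<integral>\<^sup>+x y. ennreal ((u x - u y)\<^sup>2 * trace_kernel s \<Omega> x y) * (indicator (- \<Omega>) x * indicator (- \<Omega>) y) *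
     (indicator (cball z chart_radius) x * indicator (cball z chart_radius) y)) \<le>
    (\<integral>\<^sup>+x y. ennreal (M powr (real DIM('a) + 2)) * (tc.pair_weight s x y * ennreal ((u x - u y)\<^sup>2)))"
   proof (rule nn_integral_mono_AE, rule AE_mp[OF AE_bdist_pos], rule AE_I2, rule impI,
     rule nn_integral_mono_AE, rule AE_mp[OF AE_bdist_pos], rule AE_I2, rule impI)
    fix x y assume d: "0 < \<delta> x" "0 < \<delta> y"
    show "ennreal ((u x - u y)\<^sup>2 * trace_kernel s \<Omega> x y) * (indicator (- \<Omega>) x * indicator (- \<Omega>) y) *
     (indicator (cball z chart_radius) x * indicator (cball z chart_radius) y) \<le> ennreal (M powr (real DIM('a) + 2)) * (tc.pair_weight s x y * ennreal ((u x - u y)\<^sup>2))"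
    proof (cases "x \<notin> \<Omega> \<and> x \<in> cball z chart_radius \<and> y \<notin> \<Omega> \<and> y \<in> cball z chart_radius")
     case True
     then have x: "x \<notin> \<Omega>" "x \<in> cball z chart_radius" and y: "y \<notin> \<Omega>" "y \<in> cball z chart_radius" by auto
     note ix = inside[OF x d(1)] and iy = inside[OF y d(2)]
     let ?P = "dist x y + \<delta> x * \<delta> y + \<delta> x + \<delta> y"
     have pd: "0 < tc.pair_dist x y" unfolding tc.pair_dist_def using ix iy zero_le_dist[of x y] by linarith
     have "dist x y \<le> M * dist x y" using mult_right_mono[OF M1, of "dist x y"] by simp
     then have "tc.pair_dist x y \<le> M * (dist x y + \<delta> x + \<delta> y)"
      unfolding tc.pair_dist_def using ix iy by (simp add: distrib_left)
     also have "\<dots> \<le> M * ?P" using M1 by (intro mult_left_mono) auto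
     finally have P: "?P powr (- real DIM('a)) \<le> M powr real DIM('a) * tc.pair_dist x y powr (- real DIM('a))"
      using pd M1 by (intro powr_neg_le_scaled) auto
     have P0: "0 < ?P" using d zero_le_dist[of x y] by (simp add: add_nonneg_pos)
     have one: "(1 + \<delta> w) powr (- s) \<le> 1" for w
      using powr_neg_antimono[of 1 "1 + \<delta> w" s] s0 by simp
     have "trace_kernel s \<Omega> x y = (1 - s)\<^sup>2 * (\<delta> x powr (- s) * \<delta> y powr (- s)) *
      ((1 + \<delta> x) powr (- s) * (1 + \<delta> y) powr (- s)) * ?P powr (- real DIM('a))"
      unfolding trace_kernel_def using P0 by (simp add: powr_minus powr_realpow divide_inverse mult_ac)
     also have "\<dots> \<le> (1 - s)\<^sup>2 * ((M * (- h x) powr (- s)) * (M * (- h y) powr (- s))) * (1 * 1) * (M powr real DIM('a) * tc.pair_dist x y powr (- real DIM('a)))"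
      using comp[OF x d(1) s0 s(2)] comp[OF y d(2) s0 s(2)] one P M1
      by (intro mult_mono mult_left_mono) auto
     also have "\<dots> = M powr (real DIM('a) + 2) * ((1 - s)\<^sup>2 * (- h x) powr (- s) * (- h y) powr (- s) * tc.pair_dist x y powr (- real DIM('a)))"
     proof -
      have "M powr (real DIM('a) + 2) = M powr real DIM('a) * (M * M)" using M1 by (simp add: powr_add powr_numeral power2_eq_square)
      then show ?thesis by (simp only: mult_ac mult_1_left)
     qed
     finally have tk: "trace_kernel s \<Omega> x y \<le> M powr (real DIM('a) + 2) * ((1 - s)\<^sup>2 * (- h x) powr (- s) * (- h y) powr (- s) * tc.pair_dist x y powr (- real DIM('a)))" .
     let ?q = "(1 - s)\<^sup>2 * (- h x) powr (- s) * (- h y) powr (- s) * tc.pair_dist x y powr (- real DIM('a))"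
     have q0: "0 \<le> ?q" by simp
     have "ennreal ((u x - u y)\<^sup>2 * trace_kernel s \<Omega> x y) \<le> ennreal ((u x - u y)\<^sup>2 * (M powr (real DIM('a) + 2) * ?q))"
      by (intro ennreal_leI mult_left_mono tk) simp
     also have "\<dots> = ennreal (M powr (real DIM('a) + 2)) * (ennreal ?q * ennreal ((u x - u y)\<^sup>2))"
      using ennreal_mult_assoc3[of "M powr (real DIM('a) + 2)" ?q "(u x - u y)\<^sup>2"] q0 by (simp add: mult_ac)
     finally show ?thesis using x y ix iy by (simp add: tc.pair_weight_def)
    next
     case False
     then have "(indicator (- \<Omega>) x * indicator (- \<Omega>) y) * (indicator (cball z chart_radius) x * indicator (cball z chart_radius) y) = (0::ennreal)"
      by (auto simp: indicator_def)
     then show ?thesis by (simp only: mult.assoc mult_zero_right zero_le)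
    qed
   qed
   also have "\<dots> = ennreal (M powr (real DIM('a) + 2)) * (\<integral>\<^sup>+x y. tc.pair_weight s x y * ennreal ((u x - u y)\<^sup>2))"
    by (simp add: nn_integral_cmult)
   also have "\<dots> \<le> ennreal (M powr (real DIM('a) + 2)) * (ennreal Cp * ?S)"
    unfolding Cp_def by (intro mult_left_mono tc.near_pair_energy u s0 s) simp
   also have "\<dots> \<le> ennreal (M powr (real DIM('a) + 2)) * (ennreal Cp * (ennreal Cs * ?E))"
    by (intro mult_left_mono S) auto
   also have "\<dots> = ennreal B * ?E"
   proof -
    have "ennreal B = ennreal (M powr (real DIM('a) + 2)) * (ennreal Cp * ennreal Cs)"
     unfolding B_def using M1 Cp Cs by (subst ennreal_mult_assoc3) (auto simp: mult.assoc)
    then show ?thesis by (simp only: mult.assoc)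
   qed
   also have "\<dots> \<le> ennreal (A + B) * ?X s u" using AB by (intro mult_mono ennreal_leI) auto
   finally show "(\<integral>\<^sup>+x y. ennreal ((u x - u y)\<^sup>2 * trace_kernel s \<Omega> x y) * (indicator (- \<Omega>) x * indicator (- \<Omega>) y) *
     (indicator (cball z chart_radius) x * indicator (cball z chart_radius) y)) \<le> ennreal (A + B) * ?X s u" .
  qed
  then show ?thesis using AB by (intro exI[of _ "A + B"] conjI[OF add_pos_pos] allI impI)
qed

lemma near_frontier_cover:
  assumes F: "frontier \<Omega> \<subseteq> (\<Union>z\<in>F. ball z \<rho>)" and x: "\<delta> x < \<rho>"
  obtains z where "z \<in> F" "x \<in> cball z (2 * \<rho>)"
proof -
  obtain p where p: "p \<in> frontier \<Omega>" "dist x p = \<delta> x" using bdist_attained by blast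
  then obtain z where z: "z \<in> F" "dist z p < \<rho>" using F by auto
  have "dist z x \<le> 2 * \<rho>" using dist_triangle[of z x p] p z x by (simp add: dist_commute)
  then show ?thesis using z by (intro that[of z]) auto
qed

lemma sum_ennreal_mult_le:
  assumes C: "\<And>z. z \<in> F \<Longrightarrow> 0 \<le> C z" and f: "\<And>z. z \<in> F \<Longrightarrow> f z \<le> ennreal (C z) * X"
  shows "(\<Sum>z\<in>F. f z) \<le> ennreal (\<Sum>z\<in>F. C z) * X"
proof -
  have "(\<Sum>z\<in>F. f z) \<le> (\<Sum>z\<in>F. ennreal (C z) * X)" by (intro sum_mono f)
  also have "\<dots> = ennreal (\<Sum>z\<in>F. C z) * X"
   using C by (simp add: sum_distrib_right[symmetric] sum_ennreal)
  finally show ?thesis .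
qed

text \<open>Finitely many chart balls cover a neighbourhood of the boundary and contain every pair of
exterior points that are close to it and to each other. For all other pairs the kernel is dominated
by a product, and their energy by the weighted square integral.\<close>

lemma trace_bound:
  assumes ss: "0 < ss" "ss < 1"
  shows "\<exists>C>0. \<forall>s u. ss < s \<longrightarrow> s < 1 \<longrightarrow> u \<in> borel_measurable borel \<longrightarrow>
   trace_mass s \<Omega> u + trace_energy s \<Omega> u \<le> ennreal C * (dom_L2 u + ennreal (1 - s) * dom_energy s \<Omega> u)"
proof -
  define \<rho> where "\<rho> = chart_radius / 3"
  have \<rho>: "0 < \<rho>" "\<rho> \<le> 1" using chart_radius by (auto simp: \<rho>_def)
  obtain F where F: "finite F" "F \<subseteq> frontier \<Omega>" "frontier \<Omega> \<subseteq> (\<Union>z\<in>F. ball z \<rho>)"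
   using frontier_cover[OF \<rho>(1)] by blast
  let ?X = "\<lambda>s u. dom_L2 u + ennreal (1 - s) * dom_energy s \<Omega> u"
  let ?B = "\<lambda>z. cball z chart_radius"
  define Q where "Q z C \<longleftrightarrow> C > 0 \<and> (\<forall>s u. ss < s \<longrightarrow> s < 1 \<longrightarrow> u \<in> borel_measurable borel \<longrightarrow>
   (\<integral>\<^sup>+x. ennreal ((u x)\<^sup>2 * tau_density s \<Omega> x) * indicator (- \<Omega>) x * indicator (?B z) x) \<le> ennreal C * ?X s u \<and>
   (\<integral>\<^sup>+x y. ennreal ((u x - u y)\<^sup>2 * trace_kernel s \<Omega> x y) * (indicator (- \<Omega>) x * indicator (- \<Omega>) y) *
     (indicator (?B z) x * indicator (?B z) y)) \<le> ennreal C * ?X s u)" for z C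
  have "\<exists>C. \<forall>z\<in>F. Q z (C z)"
  proof (rule bchoice, rule ballI)
   fix z assume "z \<in> F"
   then have "z \<in> frontier \<Omega>" using F by blast
   from chart_trace[OF ss this] show "\<exists>C. Q z C" unfolding Q_def .
  qed
  then obtain Cz where Cz: "\<And>z. z \<in> F \<Longrightarrow> Q z (Cz z)" by blast
  have Cz0: "0 \<le> Cz z" if "z \<in> F" for z using Cz[OF that] unfolding Q_def by simp
  obtain Cf where Cf: "Cf > 0" and far: "\<And>s u. ss < s \<Longrightarrow> s < 1 \<Longrightarrow> u \<in> borel_measurable borel \<Longrightarrow>
   (\<integral>\<^sup>+x. ennreal ((u x)\<^sup>2 * tau_density s \<Omega> x) * indicator (- \<Omega>) x * indicator {\<rho>..} (\<delta> x)) \<le> ennreal Cf * ?X s u"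
   using far_trace_mass[OF ss \<rho>] by blast
  obtain C0 where C0: "C0 > 0" and tot: "\<And>s. ss < s \<Longrightarrow> s < 1 \<Longrightarrow> (\<integral>\<^sup>+x. ennreal (tau_density s \<Omega> x) * indicator (- \<Omega>) x) \<le> ennreal C0"
   using tau_density_total[OF ss] by blast
  define c where "c = (2 / \<rho>) ^ DIM('a)"
  have c: "c > 0" using \<rho> by (simp add: c_def)
  define A where "A = (\<Sum>z\<in>F. Cz z)"
  have A: "A \<ge> 0" unfolding A_def by (intro sum_nonneg Cz0)
  define C where "C = (A + Cf) + (A + 4 * c * C0 * (A + Cf))"
  have C: "C > 0" unfolding C_def
   by (rule add_pos_nonneg) (use A Cf c C0 in \<open>auto intro!: add_nonneg_pos add_nonneg_nonneg mult_nonneg_nonneg\<close>)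
  have "trace_mass s \<Omega> u + trace_energy s \<Omega> u \<le> ennreal C * ?X s u"
   if s: "ss < s" "s < 1" and u [measurable]: "u \<in> borel_measurable borel" for s u
  proof -
   have s0: "0 < s" using s ss by simp
   let ?W = "\<lambda>x. ennreal ((u x)\<^sup>2 * tau_density s \<Omega> x) * indicator (- \<Omega>) x"
   let ?T = "\<lambda>x. ennreal (tau_density s \<Omega> x) * indicator (- \<Omega>) x"
   let ?K = "\<lambda>x y. ennreal ((u x - u y)\<^sup>2 * trace_kernel s \<Omega> x y) * (indicator (- \<Omega>) x * indicator (- \<Omega>) y)"
   have mb [measurable]: "(\<lambda>x. indicator (?B z) x :: ennreal) \<in> borel_measurable borel" for z
    by (rule borel_measurable_indicator, rule borel_closed, rule closed_cball)
   have single: "f z \<le> (\<Sum>z\<in>F. f z)" if "z \<in> F" for z and f :: "'a \<Rightarrow> ennreal"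
    using that F(1) by (intro member_le_sum) auto
   have mass: "trace_mass s \<Omega> u \<le> ennreal (A + Cf) * ?X s u"
   proof -
    have "trace_mass s \<Omega> u \<le> (\<integral>\<^sup>+x. (\<Sum>z\<in>F. ?W x * indicator (?B z) x) + ?W x * indicator {\<rho>..} (\<delta> x))"
     unfolding trace_mass_def
    proof (rule nn_integral_mono)
     fix x
     show "?W x \<le> (\<Sum>z\<in>F. ?W x * indicator (?B z) x) + ?W x * indicator {\<rho>..} (\<delta> x)"
     proof (cases "\<delta> x < \<rho>")
      case True
      from near_frontier_cover[OF F(3) this] obtain z where z: "z \<in> F" "x \<in> cball z (2 * \<rho>)" by blast
      have "x \<in> ?B z" using z \<rho> by (simp add: \<rho>_def)
      then have "?W x = ?W x * indicator (?B z) x" by simp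
      also have "\<dots> \<le> (\<Sum>z\<in>F. ?W x * indicator (?B z) x)" by (rule single[OF z(1)])
      finally show ?thesis using True by simp
     qed simp
    qed
    also have "\<dots> = (\<Sum>z\<in>F. \<integral>\<^sup>+x. ?W x * indicator (?B z) x) + (\<integral>\<^sup>+x. ?W x * indicator {\<rho>..} (\<delta> x))"
     by (subst nn_integral_add) (simp_all add: nn_integral_sum)
    also have "\<dots> \<le> ennreal A * ?X s u + ennreal Cf * ?X s u"
     unfolding A_def using Cz s u unfolding Q_def by (intro add_mono far s u sum_ennreal_mult_le Cz0) auto
    also have "\<dots> = ennreal (A + Cf) * ?X s u" using A Cf by (simp add: distrib_right[symmetric] ennreal_plus[symmetric] del: ennreal_plus)
    finally show ?thesis .
   qed
   (* Pairs that need not lie in a common chart ball. *)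
   have farK: "?K x y \<le> ennreal (2 * c) * (?W x * ?T y) + ennreal (2 * c) * (?T x * ?W y)"
    if f: "\<rho> \<le> \<delta> x \<or> \<rho> \<le> \<delta> y \<or> \<rho> \<le> dist x y" for x y
   proof (cases "x \<notin> \<Omega> \<and> y \<notin> \<Omega>")
    case True
    note t0 = tau_density_nonneg[OF s(2)]
    have "(u x - u y)\<^sup>2 \<le> 2 * (u x)\<^sup>2 + 2 * (u y)\<^sup>2"
     using zero_le_power2[of "u x + u y"] by (simp add: power2_sum power2_diff)
    then have "(u x - u y)\<^sup>2 * trace_kernel s \<Omega> x y \<le> (2 * (u x)\<^sup>2 + 2 * (u y)\<^sup>2) * (c * (tau_density s \<Omega> x * tau_density s \<Omega> y))"
     unfolding c_def by (intro mult_mono trace_kernel_far[OF s0 s(2) \<rho> f] trace_kernel_nonneg[OF s(2)]) auto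
    also have "\<dots> = 2 * c * ((u x)\<^sup>2 * tau_density s \<Omega> x * tau_density s \<Omega> y) + 2 * c * (tau_density s \<Omega> x * ((u y)\<^sup>2 * tau_density s \<Omega> y))"
     by (simp add: algebra_simps)
    finally have "ennreal ((u x - u y)\<^sup>2 * trace_kernel s \<Omega> x y) \<le>
     ennreal (2 * c * ((u x)\<^sup>2 * tau_density s \<Omega> x * tau_density s \<Omega> y) + 2 * c * (tau_density s \<Omega> x * ((u y)\<^sup>2 * tau_density s \<Omega> y)))"
     by (rule ennreal_leI)
    also have "\<dots> = ennreal (2 * c) * (ennreal ((u x)\<^sup>2 * tau_density s \<Omega> x) * ennreal (tau_density s \<Omega> y)) +
     ennreal (2 * c) * (ennreal (tau_density s \<Omega> x) * ennreal ((u y)\<^sup>2 * tau_density s \<Omega> y))"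
     using c t0[of x] t0[of y] by (simp add: ennreal_plus ennreal_mult)
    finally show ?thesis using True by simp
   qed auto
   have energy: "trace_energy s \<Omega> u \<le> ennreal A * ?X s u + ennreal (4 * c * C0) * trace_mass s \<Omega> u"
   proof -
    have "trace_energy s \<Omega> u = (\<integral>\<^sup>+x y. ?K x y)"
    proof -
     have "?K x y = ennreal ((u x - u y)\<^sup>2 * trace_kernel s \<Omega> x y) * indicator (- \<Omega>) y * indicator (- \<Omega>) x" for x y
      by (simp only: mult_ac)
     then show ?thesis unfolding trace_energy_def
      by (intro nn_integral_cong) (simp add: nn_integral_multc)
    qed
    also have "\<dots> \<le> (\<integral>\<^sup>+x y. (\<Sum>z\<in>F. ?K x y * (indicator (?B z) x * indicator (?B z) y)) +
      (ennreal (2 * c) * (?W x * ?T y) + ennreal (2 * c) * (?T x * ?W y)))"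
    proof (intro nn_integral_mono)
     fix x y
     show "?K x y \<le> (\<Sum>z\<in>F. ?K x y * (indicator (?B z) x * indicator (?B z) y)) +
      (ennreal (2 * c) * (?W x * ?T y) + ennreal (2 * c) * (?T x * ?W y))"
     proof (cases "\<rho> \<le> \<delta> x \<or> \<rho> \<le> \<delta> y \<or> \<rho> \<le> dist x y")
      case True
      show ?thesis by (rule order_trans[OF farK[OF True]]) simp
     next
      case False
      then have near: "\<delta> x < \<rho>" "dist x y < \<rho>" by auto
      from near_frontier_cover[OF F(3) near(1)] obtain z where z: "z \<in> F" "x \<in> cball z (2 * \<rho>)" by blast
      have "x \<in> ?B z" "y \<in> ?B z" using z \<rho> near dist_triangle[of z y x] by (auto simp: \<rho>_def)
      then have "?K x y = ?K x y * (indicator (?B z) x * indicator (?B z) y)" by simp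
      also have "\<dots> \<le> (\<Sum>z\<in>F. ?K x y * (indicator (?B z) x * indicator (?B z) y))" by (rule single[OF z(1)])
      finally show ?thesis by (rule order_trans) simp
     qed
    qed
    also have "\<dots> = (\<integral>\<^sup>+x. (\<Sum>z\<in>F. \<integral>\<^sup>+y. ?K x y * (indicator (?B z) x * indicator (?B z) y)) +
      (ennreal (2 * c) * (?W x * (\<integral>\<^sup>+y. ?T y)) + ennreal (2 * c) * (?T x * trace_mass s \<Omega> u)))"
     unfolding trace_mass_def
     by (intro nn_integral_cong) (simp add: nn_integral_add nn_integral_sum nn_integral_cmult)
    also have "\<dots> = (\<Sum>z\<in>F. \<integral>\<^sup>+x y. ?K x y * (indicator (?B z) x * indicator (?B z) y)) +
      (ennreal (2 * c) * (trace_mass s \<Omega> u * (\<integral>\<^sup>+y. ?T y)) + ennreal (2 * c) * ((\<integral>\<^sup>+y. ?T y) * trace_mass s \<Omega> u))"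
     unfolding trace_mass_def
     by (simp add: nn_integral_add nn_integral_sum nn_integral_cmult nn_integral_multc)
    also have "\<dots> \<le> ennreal A * ?X s u + (ennreal (2 * c) * (trace_mass s \<Omega> u * ennreal C0) + ennreal (2 * c) * (ennreal C0 * trace_mass s \<Omega> u))"
     unfolding A_def using Cz s u unfolding Q_def
     by (intro add_mono mult_left_mono mult_right_mono tot s sum_ennreal_mult_le Cz0) auto
    also have "ennreal (2 * c) * (trace_mass s \<Omega> u * ennreal C0) + ennreal (2 * c) * (ennreal C0 * trace_mass s \<Omega> u) = ennreal (4 * c * C0) * trace_mass s \<Omega> u"
    proof -
     have "ennreal (4 * c * C0) = ennreal (2 * c) * ennreal C0 + ennreal (2 * c) * ennreal C0"
      using c C0 by (simp add: ennreal_mult[symmetric] ennreal_plus[symmetric] del: ennreal_plus)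
     then show ?thesis by (simp only: distrib_right mult.assoc mult.commute[of "trace_mass s \<Omega> u"])
    qed
    finally show ?thesis .
   qed
   have "trace_mass s \<Omega> u + trace_energy s \<Omega> u \<le> ennreal (A + Cf) * ?X s u + (ennreal A * ?X s u + ennreal (4 * c * C0) * (ennreal (A + Cf) * ?X s u))"
    by (intro add_mono mass order_trans[OF energy] mult_left_mono) auto
   also have "\<dots> = ennreal C * ?X s u"
   proof -
    have e1: "ennreal (4 * c * C0 * (A + Cf)) = ennreal (4 * c * C0) * ennreal (A + Cf)"
     using A Cf c C0 by (intro ennreal_mult) auto
    have "ennreal C = ennreal (A + Cf) + (ennreal A + ennreal (4 * c * C0) * ennreal (A + Cf))"
     unfolding C_def using A Cf c C0 by (subst ennreal_plus, simp, simp, subst ennreal_plus, simp_all add: e1)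
    then show ?thesis by (simp only: distrib_right mult.assoc)
   qed
   finally show ?thesis .
  qed
  then show ?thesis by (intro exI[of _ C] conjI[OF C] allI impI)
qed

text \<open>Two interior points are close compared with one of their distances to the boundary or separated
compared with both.\<close>

lemma extension_bound:
  "\<exists>C>0. \<forall>s g. 0 < s \<longrightarrow> s < 1 \<longrightarrow> averageable s g \<longrightarrow>
   ennreal (1 - s) * dom_energy s \<Omega> (extension s g) \<le> ennreal C * trace_energy s \<Omega> g"
proof -
  obtain C1 where C1: "C1 > 0" and ext: "\<And>s g. 0 < s \<Longrightarrow> s < 1 \<Longrightarrow> averageable s g \<Longrightarrow>
   ennreal (1 - s) * (\<integral>\<^sup>+x y. gagliardo s (extension s g) x y * (indicator \<Omega> x * indicator (- \<Omega>) y))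
    \<le> ennreal C1 * trace_energy s \<Omega> g"
   using extension_energy_exterior by blast
  obtain C2 where C2: "C2 > 0" and far: "\<And>s g. 0 < s \<Longrightarrow> s < 1 \<Longrightarrow> averageable s g \<Longrightarrow>
   (\<integral>\<^sup>+x x'. gagliardo s (extension s g) x x' * (indicator \<Omega> x * indicator \<Omega> x' *
     (indicator {0..} (dist x x' - \<delta> x / 4) * indicator {0..} (dist x x' - \<delta> x' / 4))))
    \<le> ennreal C2 * trace_energy s \<Omega> g"
   using extension_energy_far by blast
  obtain C3 where C3: "C3 > 0" and near: "\<And>s g. 0 < s \<Longrightarrow> s < 1 \<Longrightarrow> averageable s g \<Longrightarrow>
   ennreal (1 - s) * (\<integral>\<^sup>+x x'. gagliardo s (extension s g) x x' * (indicator \<Omega> x * indicator \<Omega> x' *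
     indicator {0..} (\<delta> x / 4 - dist x x')))
    \<le> ennreal C3 * trace_energy s \<Omega> g"
   using extension_energy_near by blast
  have "ennreal (1 - s) * dom_energy s \<Omega> (extension s g) \<le> ennreal (C1 + C2 + (C3 + C3)) * trace_energy s \<Omega> g"
   if s: "0 < s" "s < 1" and g: "averageable s g" for s g
  proof -
   have [measurable]: "g \<in> borel_measurable borel" using g by (simp add: averageable_def)
   let ?G = "gagliardo s (extension s g)"
   let ?e = "\<lambda>x y. ?G x y * (indicator \<Omega> x * indicator (- \<Omega>) y)"
   let ?f = "\<lambda>x x'. ?G x x' * (indicator \<Omega> x * indicator \<Omega> x' *
     (indicator {0..} (dist x x' - \<delta> x / 4) * indicator {0..} (dist x x' - \<delta> x' / 4)))"
   let ?n = "\<lambda>x x'. ?G x x' * (indicator \<Omega> x * indicator \<Omega> x' * indicator {0..} (\<delta> x / 4 - dist x x'))"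
   let ?I = "\<lambda>k. \<integral>\<^sup>+x y. k x y"
   have "dom_energy s \<Omega> (extension s g) \<le> ?I (\<lambda>x y. ?e x y + ?f x y + (?n x y + ?n y x))"
    unfolding dom_energy_def
   proof (intro nn_integral_mono)
    fix x y
    show "?G x y * indicator \<Omega> x \<le> ?e x y + ?f x y + (?n x y + ?n y x)"
     unfolding gagliardo_sym[of s _ y x]
     by (cases "x \<in> \<Omega>"; cases "y \<in> \<Omega>"; cases "dist x y \<le> \<delta> x / 4"; cases "dist x y \<le> \<delta> y / 4")
      (simp_all add: indicator_def dist_commute add_increasing add_increasing2)
   qed
   also have "\<dots> = ?I ?e + ?I ?f + (?I ?n + ?I (\<lambda>x y. ?n y x))"
    by (simp add: nn_integral_add)
   also have "?I (\<lambda>x y. ?n y x) = ?I ?n"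
    by (rule nn_integral_swap) measurable
   finally have "ennreal (1 - s) * dom_energy s \<Omega> (extension s g) \<le> ennreal (1 - s) * (?I ?e + ?I ?f + (?I ?n + ?I ?n))"
    by (intro mult_left_mono) auto
   also have "\<dots> = ennreal (1 - s) * ?I ?e + ennreal (1 - s) * ?I ?f + (ennreal (1 - s) * ?I ?n + ennreal (1 - s) * ?I ?n)"
    by (simp only: distrib_left)
   also have "\<dots> \<le> ennreal C1 * trace_energy s \<Omega> g + ennreal C2 * trace_energy s \<Omega> g + (ennreal C3 * trace_energy s \<Omega> g + ennreal C3 * trace_energy s \<Omega> g)"
   proof (intro add_mono ext near s g)
    have "ennreal (1 - s) * ?I ?f \<le> 1 * ?I ?f" using s by (intro mult_right_mono) auto
    then show "ennreal (1 - s) * ?I ?f \<le> ennreal C2 * trace_energy s \<Omega> g" using far[OF s g] by simp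
   qed
   also have "\<dots> = ennreal (C1 + C2 + (C3 + C3)) * trace_energy s \<Omega> g"
    using C1 C2 C3 by (simp only: ennreal_plus add_nonneg_nonneg less_imp_le distrib_right)
   finally show ?thesis .
  qed
  then show ?thesis using C1 C2 C3 by (intro exI[of _ "C1 + C2 + (C3 + C3)"] conjI add_pos_pos allI impI) auto
qed

end

section \<open>Passage to the function spaces\<close>

lemma esqrt_le:
  assumes C: "0 < C" and AB: "A \<le> ennreal (C\<^sup>2) * B"
  shows "esqrt A \<le> ennreal C * esqrt B"
proof (cases B)
  case top
  then show ?thesis using C by (simp add: esqrt_def ennreal_mult_top)
next
  case (real b)
  then have "A \<le> ennreal (C\<^sup>2 * b)" using AB by (simp add: ennreal_mult)
  then obtain a where a: "A = ennreal a" "0 \<le> a" "a \<le> C\<^sup>2 * b"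
   using real by (cases A) (auto simp: top_unique)
  have "sqrt a \<le> C * sqrt b" using a(3) C real_sqrt_le_mono[OF a(3)] by (simp add: real_sqrt_mult)
  then show ?thesis using a real C by (simp add: esqrt_def ennreal_mult[symmetric] ennreal_leI)
qed

lemma esqrt_finite_iff: "esqrt A < \<infinity> \<longleftrightarrow> A < \<infinity>"
  by (auto simp: esqrt_def less_top)

text \<open>Continuity only concerns differences of small norm, so the bound is required for differences of
finite norm.\<close>

lemma continuous_linear_operator_of_bound:
  assumes C: "0 < C"
   and diff: "\<And>u v. u \<in> X \<Longrightarrow> v \<in> X \<Longrightarrow> N (\<lambda>x. v x - u x) < \<infinity> \<Longrightarrow>
    M (\<lambda>x. F v x - F u x) \<le> ennreal C * N (\<lambda>x. v x - u x)"
   and "\<And>u. u \<in> X \<Longrightarrow> F u \<in> Y"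
   and "\<And>u v. u \<in> X \<Longrightarrow> v \<in> X \<Longrightarrow> ae_eq_on A u v \<Longrightarrow> ae_eq_on B (F u) (F v)"
   and "\<And>u v. u \<in> X \<Longrightarrow> v \<in> X \<Longrightarrow> ae_eq_on B (F (\<lambda>x. u x + v x)) (\<lambda>x. F u x + F v x)"
   and "\<And>c u. u \<in> X \<Longrightarrow> ae_eq_on B (F (\<lambda>x. c * u x)) (\<lambda>x. c * F u x)"
  shows "continuous_linear_operator A X N B Y M F"
proof -
  have "\<exists>\<delta>>0. \<forall>v\<in>X. N (\<lambda>x. v x - u x) < ennreal \<delta> \<longrightarrow> M (\<lambda>x. F v x - F u x) < ennreal \<epsilon>"
   if u: "u \<in> X" and e: "0 < \<epsilon>" for u \<epsilon>
  proof (intro exI[of _ "\<epsilon> / C"] conjI ballI impI)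
   fix v assume v: "v \<in> X" and N: "N (\<lambda>x. v x - u x) < ennreal (\<epsilon> / C)"
   have "M (\<lambda>x. F v x - F u x) \<le> ennreal C * N (\<lambda>x. v x - u x)"
    using N by (intro diff u v) (auto intro: order.strict_trans)
   also have "\<dots> < ennreal C * ennreal (\<epsilon> / C)"
    using C N by (intro ennreal_mult_strict_left_mono) auto
   also have "\<dots> = ennreal \<epsilon>" using C e by (simp add: ennreal_mult[symmetric])
   finally show "M (\<lambda>x. F v x - F u x) < ennreal \<epsilon>" .
  qed (use C e in simp)
  then show ?thesis unfolding continuous_linear_operator_def using assms(3-6) by blast
qed

text \<open>The identity \<open>Gamma (2 - s) = (1 - s) * Gamma (1 - s)\<close> isolates the factor \<open>1 - s\<close>; apart from \<open>s\<close>, the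
remaining quotient is continuous and positive on the closed interval \<open>[0, 1]\<close>.\<close>

lemma kappa_bounds:
  assumes d: "0 < d"
  shows "\<exists>c>0. \<exists>C>0. \<forall>s\<in>{0<..<1}. c * (s * (1 - s)) \<le> kappa d s \<and> kappa d s \<le> C * (1 - s)"
proof -
  define q where "q s = 2 powr (2 * s) * Gamma ((real d + 2 * s) / 2) / (pi powr (real d / 2) * Gamma (2 - s))" for s
  have nonpos: "x \<notin> \<int>\<^sub>\<le>\<^sub>0" if "0 < x" for x :: real using that nonpos_Ints_nonpos[of x] by linarith
  have num: "0 < (real d + 2 * s) / 2" "0 < 2 - s" if "s \<in> {0..1}" for s using that d by auto
  have Gp: "0 < Gamma ((real d + 2 * s) / 2)" "0 < Gamma (2 - s)" if "s \<in> {0..1}" for s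
   by (intro Gamma_real_pos num that)+
  have qp: "0 < q s" if "s \<in> {0..1}" for s using Gp[OF that] by (simp add: q_def)
  have c1: "continuous_on {0..1} (\<lambda>s. Gamma ((real d + 2 * s) / 2))"
   by (rule continuous_on_compose2[OF continuous_on_Gamma[of "{0<..}"]])
    (use num nonpos in \<open>auto intro!: continuous_intros\<close>)
  have c2: "continuous_on {0..1} (\<lambda>s::real. Gamma (2 - s))"
   by (rule continuous_on_compose2[OF continuous_on_Gamma[of "{0<..}"]])
    (use num nonpos in \<open>auto intro!: continuous_intros\<close>)
  have cont: "continuous_on {0..1} q"
   unfolding q_def using Gp by (intro continuous_intros c1 c2) (auto dest: Gp)
  obtain a where a: "a \<in> {0..1}" "\<And>s. s \<in> {0..1} \<Longrightarrow> q a \<le> q s"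
   using continuous_attains_inf[OF _ _ cont] by auto
  obtain b where b: "b \<in> {0..1}" "\<And>s. s \<in> {0..1} \<Longrightarrow> q s \<le> q b"
   using continuous_attains_sup[OF _ _ cont] by auto
  have "q a * (s * (1 - s)) \<le> kappa d s \<and> kappa d s \<le> q b * (1 - s)" if s: "s \<in> {0<..<1}" for s
  proof -
   have "Gamma (2 - s) = (1 - s) * Gamma (1 - s)"
    using Gamma_plus1[OF nonpos[of "1 - s"]] s by (simp add: algebra_simps)
   then have k: "kappa d s = q s * (s * (1 - s))" using s by (simp add: kappa_def q_def)
   have "q s * (s * (1 - s)) \<le> q s * (1 * (1 - s))"
    using s qp[of s] by (intro mult_left_mono mult_right_mono) auto
   also have "\<dots> \<le> q b * (1 - s)" using b(2)[of s] s by simp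
   finally show ?thesis unfolding k using a(2)[of s] s by (auto intro!: mult_right_mono)
  qed
  then show ?thesis using qp[OF a(1)] qp[OF b(1)]
   by (intro exI[of _ "q a"] conjI exI[of _ "q b"] ballI) auto
qed

lemma T_norm_eq:
  fixes \<Omega> :: "(real^'n) set"
  assumes "\<And>x. x \<notin> \<Omega> \<Longrightarrow> f x = g x"
  shows "T_norm s \<Omega> f = esqrt (trace_mass s \<Omega> g + trace_energy s \<Omega> g)"
proof -
  have "trace_mass s \<Omega> g = (\<integral>\<^sup>+x\<in>- \<Omega>. ennreal ((f x)\<^sup>2 * tau_weight s \<Omega> x) \<partial>lborel)"
   unfolding trace_mass_def using assms
   by (intro nn_integral_cong) (auto simp: indicator_def tau_density_def tau_weight_def)
  moreover have "trace_energy s \<Omega> g =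
   (\<integral>\<^sup>+x\<in>- \<Omega>. (\<integral>\<^sup>+y\<in>- \<Omega>. ennreal ((f x - f y)\<^sup>2 * k_kernel s \<Omega> x y) \<partial>lborel) \<partial>lborel)"
  proof -
   have "(\<integral>\<^sup>+y\<in>- \<Omega>. ennreal ((g x - g y)\<^sup>2 * trace_kernel s \<Omega> x y) \<partial>lborel) =
    (\<integral>\<^sup>+y\<in>- \<Omega>. ennreal ((f x - f y)\<^sup>2 * k_kernel s \<Omega> x y) \<partial>lborel)" if "x \<notin> \<Omega>" for x
    using assms[OF that]
    by (intro nn_integral_cong) (auto simp: indicator_def trace_kernel_def k_kernel_def dist_norm assms)
   then show ?thesis unfolding trace_energy_def by (intro nn_integral_cong) (auto simp: indicator_def)
  qed
  ultimately show ?thesis by (simp add: T_norm_def)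
qed

text \<open>The region of integration consists of the pairs with at least one point in the domain; by
symmetry the two choices of that point contribute equally.\<close>

lemma V_energy_bounds:
  fixes \<Omega> :: "(real^'n) set"
  assumes \<Omega> [measurable]: "\<Omega> \<in> sets borel" and u [measurable]: "u \<in> borel_measurable borel"
  shows "ennreal (kappa CARD('n) s / 2) * dom_energy s \<Omega> u \<le> V_energy s \<Omega> u"
   and "V_energy s \<Omega> u \<le> ennreal (kappa CARD('n) s / 2) * (2 * dom_energy s \<Omega> u)"
proof -
  let ?S = "UNIV \<times> UNIV - (- \<Omega>) \<times> (- \<Omega>)"
  let ?f = "\<lambda>p. gagliardo s u (fst p) (snd p) * indicator ?S p"
  have "?S = {p. fst p \<in> \<Omega> \<or> snd p \<in> \<Omega>}" by auto
  then have ind: "indicator ?S (x, y) = (if x \<in> \<Omega> \<or> y \<in> \<Omega> then 1 else (0::ennreal))" for x y :: "real^'n"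
   by (simp add: indicator_def)
  have "?f = (\<lambda>p. gagliardo s u (fst p) (snd p) * (if fst p \<in> \<Omega> \<or> snd p \<in> \<Omega> then 1 else 0))"
   by (rule ext) (auto simp: indicator_def)
  moreover have "(\<lambda>p. gagliardo s u (fst p) (snd p) * (if fst p \<in> \<Omega> \<or> snd p \<in> \<Omega> then 1 else 0)) \<in> borel_measurable (lborel \<Otimes>\<^sub>M lborel)"
   by measurable
  ultimately have m: "?f \<in> borel_measurable (lborel \<Otimes>\<^sub>M lborel)" by simp
  have "V_energy s \<Omega> u = ennreal (kappa CARD('n) s / 2) * (\<integral>\<^sup>+p. ?f p \<partial>(lborel \<Otimes>\<^sub>M lborel))"
  proof -
   have eq: "ennreal ((u x - u y)\<^sup>2 / norm (x - y) powr (real CARD('n) + 2 * s)) =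
    ennreal ((u x - u y)\<^sup>2) * ennreal (dist x y powr - (real DIM(real^'n) + 2 * s))" for x y
    unfolding powr_minus_divide dist_norm by (simp add: ennreal_mult[symmetric])
   show ?thesis unfolding V_energy_def gagliardo_def eq ..
  qed
  also have "(\<integral>\<^sup>+p. ?f p \<partial>(lborel \<Otimes>\<^sub>M lborel)) = (\<integral>\<^sup>+x y. ?f (x, y))"
   by (rule lborel.nn_integral_fst[OF m, symmetric])
  finally have V: "V_energy s \<Omega> u = ennreal (kappa CARD('n) s / 2) * (\<integral>\<^sup>+x y. ?f (x, y))" .
  have "dom_energy s \<Omega> u \<le> (\<integral>\<^sup>+x y. ?f (x, y))"
   unfolding dom_energy_def by (intro nn_integral_mono) (simp add: ind indicator_def)
  then show "ennreal (kappa CARD('n) s / 2) * dom_energy s \<Omega> u \<le> V_energy s \<Omega> u"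
   unfolding V by (rule mult_left_mono) simp
  have "(\<integral>\<^sup>+x y. ?f (x, y)) \<le>
    (\<integral>\<^sup>+x y. gagliardo s u x y * indicator \<Omega> x + gagliardo s u y x * indicator \<Omega> y)"
   by (intro nn_integral_mono) (auto simp: ind indicator_def gagliardo_sym[of s u])
  also have "\<dots> = dom_energy s \<Omega> u + (\<integral>\<^sup>+x y. gagliardo s u y x * indicator \<Omega> y)"
   unfolding dom_energy_def by (simp add: nn_integral_add)
  also have "(\<integral>\<^sup>+x y. gagliardo s u y x * indicator \<Omega> y) = dom_energy s \<Omega> u"
   unfolding dom_energy_def by (rule nn_integral_swap) measurable
  finally show "V_energy s \<Omega> u \<le> ennreal (kappa CARD('n) s / 2) * (2 * dom_energy s \<Omega> u)"
   unfolding V by (intro mult_left_mono) (auto simp: mult_2)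
qed

context lipschitz_domain
begin

text \<open>For some \<open>y\<close> the energy density is integrable in \<open>x\<close> over the domain. Since \<open>dist x y powr (d + 2 * s)\<close> is
bounded there, \<open>u - u y\<close> is square integrable.\<close>

lemma dom_L2_finite:
  assumes s: "0 < s" and u [measurable]: "u \<in> borel_measurable borel" and fin: "dom_energy s \<Omega> u < \<infinity>"
  shows "dom_L2 u < \<infinity>"
proof -
  let ?b = "real DIM('a) + 2 * s"
  let ?J = "\<lambda>y. \<integral>\<^sup>+x. gagliardo s u x y * indicator \<Omega> x"
  have "(\<integral>\<^sup>+y. ?J y) = dom_energy s \<Omega> u"
   unfolding dom_energy_def by (rule nn_integral_swap) measurable
  then have J: "(\<integral>\<^sup>+y. ?J y) < \<infinity>" using fin by simp
  have "\<exists>y. ?J y < \<infinity>"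
  proof (rule ccontr)
   assume "\<not> (\<exists>y. ?J y < \<infinity>)"
   then have "?J y = \<infinity>" for y using less_top[of "?J y"] by auto
   then have "(\<integral>\<^sup>+y. ?J y) = \<infinity>" by simp
   then show False using J by simp
  qed
  then obtain y where y: "?J y < \<infinity>" by blast
  obtain p where p: "p \<in> \<Omega>" using dom_nonempty by blast
  define L where "L = (D + dist p y) powr ?b"
  have pt: "ennreal ((u x)\<^sup>2) * indicator \<Omega> x \<le> ennreal (2 * L) * (gagliardo s u x y * indicator \<Omega> x) + ennreal (2 * (u y)\<^sup>2) * indicator \<Omega> x" for x
  proof (cases "x \<in> \<Omega>")
   case True
   have "ennreal ((u x - u y)\<^sup>2) \<le> ennreal L * gagliardo s u x y"
   proof (cases "x = y")
    case False
    have "dist x p \<le> D" using diam True p closure_subset by blast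
    then have "dist x y \<le> D + dist p y" using dist_triangle[of x y p] by linarith
    then have "dist x y powr ?b \<le> L" unfolding L_def using s by (intro powr_mono2) auto
    then have "1 \<le> L * dist x y powr (- ?b)" using False by (simp only: powr_minus_divide) simp
    then have "(u x - u y)\<^sup>2 * 1 \<le> (u x - u y)\<^sup>2 * (L * dist x y powr (- ?b))" by (rule mult_left_mono) simp
    then have "ennreal ((u x - u y)\<^sup>2) \<le> ennreal (L * ((u x - u y)\<^sup>2 * dist x y powr (- ?b)))"
     by (intro ennreal_leI) (simp add: mult_ac)
    then show ?thesis by (simp add: gagliardo_def ennreal_mult L_def)
   qed simp
   then have "ennreal 2 * ennreal ((u x - u y)\<^sup>2) \<le> ennreal 2 * (ennreal L * gagliardo s u x y)" by (rule mult_left_mono) simp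
   then have "ennreal ((u x)\<^sup>2) \<le> ennreal 2 * (ennreal L * gagliardo s u x y) + ennreal 2 * ennreal ((u y)\<^sup>2)"
    using two_sq_le[of "u x - u y" "u y"] by (auto intro: order_trans add_right_mono)
   then show ?thesis using True by (simp add: ennreal_mult L_def mult_ac)
  qed simp
  have "dom_L2 u \<le> (\<integral>\<^sup>+x. ennreal (2 * L) * (gagliardo s u x y * indicator \<Omega> x) + ennreal (2 * (u y)\<^sup>2) * indicator \<Omega> x)"
   by (intro nn_integral_mono pt)
  also have "\<dots> = ennreal (2 * L) * ?J y + ennreal (2 * (u y)\<^sup>2) * ennreal dom_vol"
   by (simp add: nn_integral_add nn_integral_cmult nn_integral_cmult_indicator dom_vol)
  also have "\<dots> < \<infinity>" using y by (simp add: ennreal_mult_less_top)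
  finally show ?thesis .
qed

lemma extension_linear:
  assumes s: "0 < s" "s < 1" and f: "averageable s f" and g: "averageable s g"
  shows "extension s (\<lambda>y. a * f y + b * g y) x = a * extension s f x + b * extension s g x"
proof (cases "x \<in> \<Omega>")
  case True
  have i: "integrable lborel (\<lambda>y. avg_weight s x y * h y)" if "averageable s h" for h
   using that True s by (intro avg_weight_mult_integrable[where x = x]) (auto simp: averageable_def)
  have "(\<integral>y. avg_weight s x y * (a * f y + b * g y) \<partial>lborel) =
    (\<integral>y. a * (avg_weight s x y * f y) + b * (avg_weight s x y * g y) \<partial>lborel)"
   by (simp add: algebra_simps)
  also have "\<dots> = a * (\<integral>y. avg_weight s x y * f y \<partial>lborel) + b * (\<integral>y. avg_weight s x y * g y \<partial>lborel)"
   using i[OF f] i[OF g] by simp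
  finally show ?thesis using True by (simp add: extension_def ext_avg_def add_divide_distrib)
qed (simp add: extension_def)

lemma extension_cong_AE:
  assumes [measurable]: "f \<in> borel_measurable borel" "g \<in> borel_measurable borel" and eq: "AE x in lborel. f x = g x"
  shows "AE x in lborel. extension s f x = extension s g x"
proof -
  have "ext_avg s f x = ext_avg s g x" for x
   unfolding ext_avg_def using eq
   by (intro arg_cong2[where f = "(/)"] integral_cong_AE refl) auto
  with eq show ?thesis by (auto simp: extension_def)
qed

end

theorem theorem1p2:
  fixes \<Omega> :: "(real^'n) set"
  assumes "CARD('n) \<ge> 2" and "C11_domain \<Omega>" and "bounded \<Omega>"
  shows "(\<forall>s_star\<in>{0<..<1}. \<exists>C>0. \<forall>s\<in>{s_star<..<1}.
            continuous_linear_operator UNIV (V_space s \<Omega>) (V_norm s \<Omega>)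
              (- \<Omega>) (T_space s \<Omega>) (T_norm s \<Omega>) (Tr \<Omega>) \<and>
            (\<forall>u\<in>V_space s \<Omega>. T_norm s \<Omega> (Tr \<Omega> u) \<le> ennreal C * V_norm s \<Omega> u)) \<and>
         (\<exists>Ext :: real \<Rightarrow> (real^'n \<Rightarrow> real) \<Rightarrow> (real^'n \<Rightarrow> real). \<exists>C>0. \<forall>s\<in>{0<..<1}.
            continuous_linear_operator (- \<Omega>) (T_space s \<Omega>) (T_norm s \<Omega>)
              UNIV (V_space s \<Omega>) (V_norm s \<Omega>) (Ext s) \<and>
            (\<forall>g\<in>T_space s \<Omega>. V_norm s \<Omega> (Ext s g) \<le> ennreal C * T_norm s \<Omega> g) \<and>
            (\<forall>g\<in>T_space s \<Omega>. ae_eq_on (- \<Omega>) (Tr \<Omega> (Ext s g)) g))"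
proof -
  obtain M R D where "lipschitz_domain \<Omega> M R D"
   using C11_domain_lipschitz_domain[OF assms(2,3)] by blast
  then interpret lipschitz_domain \<Omega> M R D .
  have \<Omega> [measurable]: "\<Omega> \<in> sets borel" using open_dom by (rule borel_open)
  obtain kc kC where kc: "kc > 0" and kC: "kC > 0"
   and kap: "\<And>s. s \<in> {0<..<1} \<Longrightarrow> kc * (s * (1 - s)) \<le> kappa CARD('n) s \<and> kappa CARD('n) s \<le> kC * (1 - s)"
   using kappa_bounds[of "CARD('n)"] by auto
  (* The energy alone gives square integrability on the domain, hence a finite norm of the trace. *)
  have L2: "dom_L2 u < \<infinity>" "ennreal (1 - s) * dom_energy s \<Omega> u \<le> ennreal (2 / (kc * s)) * V_energy s \<Omega> u"
   if s: "0 < s" "s < 1" and u: "u \<in> V_space s \<Omega>" for s u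
  proof -
   have um: "u \<in> borel_measurable borel" and V: "V_energy s \<Omega> u < \<infinity>" using u by (auto simp: V_space_def)
   have k: "kc * (s * (1 - s)) \<le> kappa CARD('n) s" using kap[of s] s by auto
   have e: "1 - s = 2 / (kc * s) * (kc * (s * (1 - s)) / 2)" using s kc by (simp add: field_simps)
   have "ennreal (1 - s) \<le> ennreal (2 / (kc * s) * (kappa CARD('n) s / 2))"
    by (subst e, intro ennreal_leI mult_left_mono divide_right_mono k) (use s kc in auto)
   also have "\<dots> = ennreal (2 / (kc * s)) * ennreal (kappa CARD('n) s / 2)"
    using s kc by (intro ennreal_mult'') (use k in \<open>auto intro: order_trans[rotated]\<close>)
   finally have "ennreal (1 - s) * dom_energy s \<Omega> u \<le> ennreal (2 / (kc * s)) * (ennreal (kappa CARD('n) s / 2) * dom_energy s \<Omega> u)"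
    unfolding mult.assoc[symmetric] by (rule mult_right_mono) simp
   also have "\<dots> \<le> ennreal (2 / (kc * s)) * V_energy s \<Omega> u"
    by (intro mult_left_mono V_energy_bounds(1) \<Omega> um) simp
   finally show E: "ennreal (1 - s) * dom_energy s \<Omega> u \<le> ennreal (2 / (kc * s)) * V_energy s \<Omega> u" .
   also have "\<dots> < \<infinity>" using V by (simp add: ennreal_mult_less_top)
   finally have "dom_energy s \<Omega> u < \<infinity>" using s by (auto simp: ennreal_mult_less_top less_top)
   then show "dom_L2 u < \<infinity>" by (rule dom_L2_finite[OF s(1) um])
  qed
  have part1: "\<exists>C>0. \<forall>s\<in>{ss<..<1}.
       continuous_linear_operator UNIV (V_space s \<Omega>) (V_norm s \<Omega>)
        (- \<Omega>) (T_space s \<Omega>) (T_norm s \<Omega>) (Tr \<Omega>) \<and>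
       (\<forall>u\<in>V_space s \<Omega>. T_norm s \<Omega> (Tr \<Omega> u) \<le> ennreal C * V_norm s \<Omega> u)"
   if ss: "0 < ss" "ss < 1" for ss
  proof -
   obtain K where K: "K > 0" and tb: "\<And>s u. ss < s \<Longrightarrow> s < 1 \<Longrightarrow> u \<in> borel_measurable borel \<Longrightarrow>
    trace_mass s \<Omega> u + trace_energy s \<Omega> u \<le> ennreal K * (dom_L2 u + ennreal (1 - s) * dom_energy s \<Omega> u)"
    using trace_bound[OF ss] by blast
   define K' where "K' = K * (1 + 2 / (kc * ss))"
   have K': "K' > 0" using K kc ss by (simp add: K'_def add_pos_pos)
   define C where "C = sqrt K'"
   have C: "C > 0" using K' by (simp add: C_def)
   have Tr_eq: "Tr \<Omega> u x = u x" if "x \<notin> \<Omega>" for u x using that by (simp add: Tr_def)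
   have bound: "T_norm s \<Omega> f \<le> ennreal C * V_norm s \<Omega> u"
    if s: "ss < s" "s < 1" and u: "u \<in> V_space s \<Omega>" and f: "\<And>x. x \<notin> \<Omega> \<Longrightarrow> f x = u x" for s u f
   proof -
    have s0: "0 < s" using s ss by simp
    have um: "u \<in> borel_measurable borel" using u by (simp add: V_space_def)
    have "trace_mass s \<Omega> u + trace_energy s \<Omega> u \<le> ennreal K * (dom_L2 u + ennreal (1 - s) * dom_energy s \<Omega> u)"
     by (rule tb[OF s um])
    also have "\<dots> \<le> ennreal K * (ennreal (1 + 2 / (kc * ss)) * dom_L2 u + ennreal (1 + 2 / (kc * ss)) * V_energy s \<Omega> u)"
    proof (intro mult_left_mono add_mono)
     have "1 \<le> ennreal (1 + 2 / (kc * ss))" using kc ss by simp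
     from mult_right_mono[OF this, of "dom_L2 u"] show "dom_L2 u \<le> ennreal (1 + 2 / (kc * ss)) * dom_L2 u" by simp
     have "2 / (kc * s) \<le> 2 / (kc * ss)" using kc s ss by (intro divide_left_mono mult_left_mono) auto
     then have "ennreal (2 / (kc * s)) * V_energy s \<Omega> u \<le> ennreal (1 + 2 / (kc * ss)) * V_energy s \<Omega> u"
      by (intro mult_right_mono ennreal_leI) auto
     then show "ennreal (1 - s) * dom_energy s \<Omega> u \<le> ennreal (1 + 2 / (kc * ss)) * V_energy s \<Omega> u"
      using L2(2)[OF s0 s(2) u] by (rule order_trans[rotated])
    qed auto
    also have "\<dots> = ennreal (C\<^sup>2) * (dom_L2 u + V_energy s \<Omega> u)"
    proof -
     have "C\<^sup>2 = K'" using K' by (simp add: C_def)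
     then have "ennreal (C\<^sup>2) = ennreal K * ennreal (1 + 2 / (kc * ss))"
      unfolding K'_def using K kc ss by (simp add: ennreal_mult)
     then show ?thesis by (simp only: distrib_left mult.assoc)
    qed
    finally have le: "trace_mass s \<Omega> u + trace_energy s \<Omega> u \<le> ennreal (C\<^sup>2) * (dom_L2 u + V_energy s \<Omega> u)" .
    have "T_norm s \<Omega> f = esqrt (trace_mass s \<Omega> u + trace_energy s \<Omega> u)" by (rule T_norm_eq) (rule f)
    then show ?thesis unfolding V_norm_def using esqrt_le[OF C le] by simp
   qed
   have "continuous_linear_operator UNIV (V_space s \<Omega>) (V_norm s \<Omega>)
        (- \<Omega>) (T_space s \<Omega>) (T_norm s \<Omega>) (Tr \<Omega>)" if s: "ss < s" "s < 1" for s
   proof (rule continuous_linear_operator_of_bound[OF C])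
    have s0: "0 < s" using s ss by simp
    fix u assume u: "u \<in> V_space s \<Omega>"
    have [measurable]: "u \<in> borel_measurable borel" using u by (simp add: V_space_def)
    have "V_norm s \<Omega> u < \<infinity>"
     using L2(1)[OF s0 s(2) u] u unfolding V_norm_def esqrt_finite_iff by (simp add: V_space_def)
    then have fin: "T_norm s \<Omega> (Tr \<Omega> u) < \<infinity>"
     by (intro order.strict_trans1[OF bound[where f = "Tr \<Omega> u", OF s u]]) (simp_all add: Tr_eq ennreal_mult_less_top)
    have "u \<in> borel_measurable (restrict_space borel (- \<Omega>))"
     by (intro measurable_restrict_space1) measurable
    then have "Tr \<Omega> u \<in> borel_measurable (restrict_space borel (- \<Omega>))"
     by (rule measurable_cong[THEN iffD1, rotated]) (simp add: space_restrict_space Tr_def)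
    then show "Tr \<Omega> u \<in> T_space s \<Omega>" using fin by (simp add: T_space_def)
    show "ae_eq_on (- \<Omega>) (Tr \<Omega> (\<lambda>x. c * u x)) (\<lambda>x. c * Tr \<Omega> u x)" for c
     by (simp add: ae_eq_on_def Tr_def)
    fix v assume v: "v \<in> V_space s \<Omega>"
    have [measurable]: "v \<in> borel_measurable borel" using v by (simp add: V_space_def)
    show "ae_eq_on (- \<Omega>) (Tr \<Omega> (\<lambda>x. u x + v x)) (\<lambda>x. Tr \<Omega> u x + Tr \<Omega> v x)"
     by (simp add: ae_eq_on_def Tr_def)
    show "ae_eq_on (- \<Omega>) (Tr \<Omega> u) (Tr \<Omega> v)" if "ae_eq_on UNIV u v"
     using that by (auto simp: ae_eq_on_def Tr_def)
    assume "V_norm s \<Omega> (\<lambda>x. v x - u x) < \<infinity>"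
    then have "(\<lambda>x. v x - u x) \<in> V_space s \<Omega>"
     unfolding V_norm_def esqrt_finite_iff by (auto simp: V_space_def)
    then show "T_norm s \<Omega> (\<lambda>x. Tr \<Omega> v x - Tr \<Omega> u x) \<le> ennreal C * V_norm s \<Omega> (\<lambda>x. v x - u x)"
     by (intro bound s) (simp_all add: Tr_def)
   qed
   then show ?thesis using C bound Tr_eq by (intro exI[of _ C] conjI C ballI) auto
  qed
  have part2: "\<exists>Ext :: real \<Rightarrow> (real^'n \<Rightarrow> real) \<Rightarrow> (real^'n \<Rightarrow> real). \<exists>C>0. \<forall>s\<in>{0<..<1}.
       continuous_linear_operator (- \<Omega>) (T_space s \<Omega>) (T_norm s \<Omega>)
        UNIV (V_space s \<Omega>) (V_norm s \<Omega>) (Ext s) \<and>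
       (\<forall>g\<in>T_space s \<Omega>. V_norm s \<Omega> (Ext s g) \<le> ennreal C * T_norm s \<Omega> g) \<and>
       (\<forall>g\<in>T_space s \<Omega>. ae_eq_on (- \<Omega>) (Tr \<Omega> (Ext s g)) g)"
  proof -
   obtain C1 where C1: "C1 > 0" and EL2: "\<And>s g. 0 < s \<Longrightarrow> s < 1 \<Longrightarrow> averageable s g \<Longrightarrow>
    dom_L2 (extension s g) \<le> ennreal C1 * trace_mass s \<Omega> g" using extension_L2 by blast
   obtain C2 where C2: "C2 > 0" and EE: "\<And>s g. 0 < s \<Longrightarrow> s < 1 \<Longrightarrow> averageable s g \<Longrightarrow>
    ennreal (1 - s) * dom_energy s \<Omega> (extension s g) \<le> ennreal C2 * trace_energy s \<Omega> g" using extension_bound by blast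
   define C where "C = sqrt (C1 + kC * C2)"
   have C: "C > 0" using C1 C2 kC by (simp add: C_def add_pos_pos)
   have Csq: "C\<^sup>2 = C1 + kC * C2" using C1 C2 kC by (simp add: C_def)
   (* Continuation by zero turns measurability on the complement into Borel measurability. *)
   define z :: "(real^'n \<Rightarrow> real) \<Rightarrow> real^'n \<Rightarrow> real" where "z g = (\<lambda>y. indicator (- \<Omega>) y * g y)" for g
   have z_out: "z g x = g x" if "x \<notin> \<Omega>" for g x using that by (simp add: z_def)
   have zm: "g \<in> borel_measurable (restrict_space borel (- \<Omega>)) \<longleftrightarrow> z g \<in> borel_measurable borel" for g
    unfolding z_def by (subst borel_measurable_restrict_space_iff) auto
   have Tn: "T_norm s \<Omega> g = esqrt (trace_mass s \<Omega> (z g) + trace_energy s \<Omega> (z g))" for s g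
    by (rule T_norm_eq) (simp add: z_out)
   have av: "averageable s (z g)" if s: "0 < s" "s < 1" and g: "g \<in> T_space s \<Omega>" for s g
   proof (rule averageable_of_trace_mass[OF s])
    show "z g \<in> borel_measurable borel" using g zm by (simp add: T_space_def)
    show "trace_mass s \<Omega> (z g) < \<infinity>" using g unfolding T_space_def Tn esqrt_finite_iff by simp
   qed
   have bound: "V_norm s \<Omega> (extension s (z g)) \<le> ennreal C * T_norm s \<Omega> g"
    if s: "0 < s" "s < 1" and g: "g \<in> T_space s \<Omega>" for s g
   proof -
    note a = av[OF s g]
    have [measurable]: "z g \<in> borel_measurable borel" using a by (simp add: averageable_def)
    have "V_energy s \<Omega> (extension s (z g)) \<le> ennreal (kappa CARD('n) s / 2) * (2 * dom_energy s \<Omega> (extension s (z g)))"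
     by (rule V_energy_bounds(2)[OF \<Omega>]) measurable
    also have "\<dots> \<le> ennreal (kC * (1 - s) / 2) * (2 * dom_energy s \<Omega> (extension s (z g)))"
     using kap[of s] s by (intro mult_right_mono ennreal_leI divide_right_mono) auto
    also have "\<dots> = ennreal kC * (ennreal (1 - s) * dom_energy s \<Omega> (extension s (z g)))"
    proof -
     have "ennreal (kC * (1 - s) / 2) * ennreal 2 = ennreal kC * ennreal (1 - s)"
      using kC s by (subst (1 2) ennreal_mult[symmetric]) auto
     then show ?thesis by (simp add: mult.assoc[symmetric])
    qed
    also have "\<dots> \<le> ennreal kC * (ennreal C2 * trace_energy s \<Omega> (z g))"
     by (intro mult_left_mono EE s a) simp
    finally have "dom_L2 (extension s (z g)) + V_energy s \<Omega> (extension s (z g)) \<le>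
      ennreal C1 * trace_mass s \<Omega> (z g) + ennreal (kC * C2) * trace_energy s \<Omega> (z g)"
     using kC C2 by (intro add_mono EL2 s a) (simp add: ennreal_mult mult.assoc)
    also have "\<dots> \<le> ennreal (C\<^sup>2) * trace_mass s \<Omega> (z g) + ennreal (C\<^sup>2) * trace_energy s \<Omega> (z g)"
     unfolding Csq using C1 C2 kC by (intro add_mono mult_right_mono ennreal_leI) auto
    also have "\<dots> = ennreal (C\<^sup>2) * (trace_mass s \<Omega> (z g) + trace_energy s \<Omega> (z g))" by (simp only: distrib_left)
    finally show ?thesis unfolding V_norm_def Tn by (rule esqrt_le[OF C])
   qed
   have "continuous_linear_operator (- \<Omega>) (T_space s \<Omega>) (T_norm s \<Omega>)
        UNIV (V_space s \<Omega>) (V_norm s \<Omega>) (\<lambda>g. extension s (z g))" if s: "0 < s" "s < 1" for s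
   proof (rule continuous_linear_operator_of_bound[OF C])
    fix u assume u: "u \<in> T_space s \<Omega>"
    note au = av[OF s u]
    have um [measurable]: "z u \<in> borel_measurable borel" using au by (simp add: averageable_def)
    have "T_norm s \<Omega> u < \<infinity>" using u by (simp add: T_space_def)
    then have "V_norm s \<Omega> (extension s (z u)) < \<infinity>"
     by (intro order.strict_trans1[OF bound[OF s u]]) (simp add: ennreal_mult_less_top)
    then show "extension s (z u) \<in> V_space s \<Omega>"
     unfolding V_norm_def esqrt_finite_iff by (auto simp: V_space_def)
    show "ae_eq_on UNIV (extension s (z (\<lambda>x. c * u x))) (\<lambda>x. c * extension s (z u) x)" for c
     using extension_linear[OF s au au, of c 0] by (simp add: ae_eq_on_def z_def mult_ac)
    fix v assume v: "v \<in> T_space s \<Omega>"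
    note a' = av[OF s v]
    have vm [measurable]: "z v \<in> borel_measurable borel" using a' by (simp add: averageable_def)
    show "ae_eq_on UNIV (extension s (z (\<lambda>x. u x + v x))) (\<lambda>x. extension s (z u) x + extension s (z v) x)"
     using extension_linear[OF s au a', of 1 1] by (simp add: ae_eq_on_def z_def distrib_left)
    show "ae_eq_on UNIV (extension s (z u)) (extension s (z v))" if "ae_eq_on (- \<Omega>) u v"
    proof -
     have "AE x in lborel. z u x = z v x"
      using that unfolding ae_eq_on_def by eventually_elim (auto simp: z_def indicator_def)
     from extension_cong_AE[OF um vm this] show ?thesis by (simp add: ae_eq_on_def)
    qed
    assume fin: "T_norm s \<Omega> (\<lambda>x. v x - u x) < \<infinity>"
    have zd: "z (\<lambda>x. v x - u x) = (\<lambda>x. z v x - z u x)" by (simp add: z_def right_diff_distrib)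
    have "(\<lambda>x. v x - u x) \<in> borel_measurable (restrict_space borel (- \<Omega>))"
     unfolding zm zd by measurable
    then have "(\<lambda>x. v x - u x) \<in> T_space s \<Omega>" using fin by (simp add: T_space_def)
    from bound[OF s this] have "V_norm s \<Omega> (extension s (z (\<lambda>x. v x - u x))) \<le> ennreal C * T_norm s \<Omega> (\<lambda>x. v x - u x)" .
    moreover have "extension s (z (\<lambda>x. v x - u x)) = (\<lambda>x. extension s (z v) x - extension s (z u) x)"
     unfolding zd using extension_linear[OF s a' au, of 1 "-1"] by (intro ext) simp
    ultimately show "V_norm s \<Omega> (\<lambda>x. extension s (z v) x - extension s (z u) x) \<le> ennreal C * T_norm s \<Omega> (\<lambda>x. v x - u x)"
     by simp
   qed
   moreover have "ae_eq_on (- \<Omega>) (Tr \<Omega> (extension s (z g))) g" for s g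
    by (simp add: ae_eq_on_def Tr_def extension_def z_def)
   ultimately show ?thesis using bound
    by (intro exI[of _ "\<lambda>s g. extension s (z g)"] exI[of _ C] conjI C ballI) auto
  qed
  show ?thesis using part1 part2 by (intro conjI ballI) auto
qed

end
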